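(* Let $L\ge1$ be an integer, $\boldsymbol{y}\in\mathbb{R}^L$, let $L_T$ be trend-admissible of order $N_T\ge0$ and $L_S$ seasonal-admissible of order $N_S\ge0$, and let $\lambda_T,\lambda_S>0$. Let $\boldsymbol{\Phi}=(\phi_1,\ldots,\phi_L)$ be a family of $(L_T,L_S)$-sensing admissible functionals such that, for any polynomial $p$ with $L_Tp=0$, $\boldsymbol{\Phi}(p)=\boldsymbol{\Phi}(p,0)=\mathbf{0}$ implies $p=0$. Assume in addition that (i) $(L_T,L_S)$ is sampling admissible and (ii) $L_T$ has a locally Lipschitz Green's function and $L_S$ has a Lipschitz periodic Green's function. Set $$J(f_T,f_S)=\|\boldsymbol{y}-\boldsymbol{\Phi}(f_T,f_S)\|_2^2+\lambda_T\|L_Tf_T\|_{\mathcal{M}(\mathbb{R})}+\lambda_S\|L_Sf_S\|_{\mathcal{M}(\mathbb{T})},$$ $\mathcal{V}=\arg\min_{\mathcal{M}(L_T,L_S)}J$ and $\mathcal{V}_{h_T,h_S}=\arg\min_{\mathcal{M}_{h_T,h_S}(L_T,L_S)}J$. Let $(h_{T,n})_{n\ge0},(h_{S,n})_{n\ge0}$ be positive sequences with $1/h_{S,n}\in\mathbb{N}$ and $(h_{T,n},h_{S,n})\to(0,0)$, and let $(\tilde f_{T,n},\tilde f_{S,n})\in\mathcal{V}_{h_{T,n},h_{S,n}}$ for each $n\ge0$. Then, for any accumulation point $(\tilde f_T,\tilde f_S)\in\mathcal{V}$ such that $(\tilde f_{T,\psi(n)},\tilde f_{S,\psi(n)})\to(\tilde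 f_T,\tilde f_S)$ in the weak*-topology of $\mathcal{M}(L_T,L_S)$ along some subsequence $\psi(n)$, we have, for any finite interval $[a,b]\subset\mathbb{R}$, $$\sup_{t\in[a,b]}|\tilde f_{T,\psi(n)}(t)-\tilde f_T(t)|\to0\quad\text{and}\quad\sup_{t\in\mathbb{R}}|\tilde f_{S,\psi(n)}(t)-\tilde f_S(t)|\to0 .$$ If moreover $\mathcal{V}=\{(\tilde f_T,\tilde f_S)\}$ is a singleton, then for any finite interval $[a,b]\subset\mathbb{R}$, $$\sup_{t\in[a,b]}|\tilde f_{T,n}(t)-\tilde f_T(t)|\to0\quad\text{and}\quad\sup_{t\in\mathbb{R}}|\tilde f_{S,n}(t)-\tilde f_S(t)|\to0.$$
   Context: Conventions: all functions and generalized functions are real-valued, and operators map real generalized functions to real ones. $\mathbb{T}=\mathbb{R}/\mathbb{Z}$. $\mathcal{S}(\mathbb{R})$ is the Schwartz space, $\mathcal{S}'(\mathbb{R})$ its dual (weak*-topology); $\mathcal{S}(\mathbb{T})$ is the space of smooth $1$-periodic functions, $\mathcal{S}'(\mathbb{T})$ its dual (weak*-topology). $\mathcal{S}'(\mathbb{T})$ is embedded in $\mathcal{S}'(\mathbb{R})$ through $\langle f,\varphi\rangle=\langle f,\sum_{k\in\mathbb{Z}}\varphi(\cdot-k)\rangle_{\mathcal{S}'(\mathbb{T})\times\mathcal{S}(\mathbb{T})}$. $\mathcal{M}(\mathbb{R})$ is the space of finite Radon measures on $\mathbb{R}$, dual of $\mathcal{C}_0(\mathbb{R})$ (continuous functions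 vanishing at infinity, sup norm); $\mathcal{M}(\mathbb{T})$ is the dual of $\mathcal{C}(\mathbb{T})$; both have the dual (total variation) norm. $\mathrm{III}=\sum_{k\in\mathbb{Z}}\delta(\cdot-k)\in\mathcal{M}(\mathbb{T})$. $\mathrm{D}$ is the derivative. For $f\in\mathcal{S}'(\mathbb{T})$, $\widehat f[0]=\langle f,1\rangle$ is its mean. LSI means linear and shift-invariant. Trend-admissible of order $N_T\ge0$: an LSI continuous operator $L_T:\mathcal{S}'(\mathbb{R})\to\mathcal{S}'(\mathbb{R})$ of the form $L_T=\mathrm{D}^{N_T}L_{\mathrm{inv},T}$, where $L_{\mathrm{inv},T}:\mathcal{S}'(\mathbb{R})\to\mathcal{S}'(\mathbb{R})$ is LSI, continuous, and has an LSI continuous inverse. Seasonal-admissible of order $N_S\ge0$: an LSI continuous operator $L_S:\mathcal{S}'(\mathbb{T})\to\mathcal{S}'(\mathbb{T})$ of the form $L_S=\mathrm{D}^{N_S}L_{\mathrm{inv},S}$ with $L_{\mathrm{inv},S}:\mathcal{S}'(\mathbb{T})\to\mathcal{S}'(\mathbb{T})$ LSI, continuous, with LSI continuous inverse. Adjoints $L_T^*,L_S^*$ are the operators of the same type with $\langle L\varphi_1,\varphi_2\rangle=\langle L^*\varphi_2,\varphi_1\rangle$ for test functions $\varphi_1,\varphi_2$. Green's functions: a Green's function of $L_T$ is $\psi_{L_T}\in\mathcal{S}'(\mathbb{R})$ with $L_T\psi_{L_T}=\delta$. A periodic Green's function of $L_S$ is $\rho_{L_S}\in\mathcal{S}'(\mathbb{T})$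 with $L_S\rho_{L_S}=\mathrm{III}$ if $N_S=0$ and $L_S\rho_{L_S}=\mathrm{III}-1$ if $N_S\ge1$. Native spaces: $\mathcal{M}_{L_T}(\mathbb{R})=\{f\in\mathcal{S}'(\mathbb{R}):L_Tf\in\mathcal{M}(\mathbb{R})\}$, $\mathcal{M}_{L_S}(\mathbb{T})=\{f\in\mathcal{S}'(\mathbb{T}):L_Sf\in\mathcal{M}(\mathbb{T})\}$, $\mathcal{M}_{L_S,0}(\mathbb{T})=\{f\in\mathcal{M}_{L_S}(\mathbb{T}):\widehat f[0]=0\}$. The seasonal-trend native space is $\mathcal{M}(L_T,L_S)=\mathcal{M}_{L_T}(\mathbb{R})\times\mathcal{M}_{L_S}(\mathbb{T})$ if $N_T=0$ and $\mathcal{M}_{L_T}(\mathbb{R})\times\mathcal{M}_{L_S,0}(\mathbb{T})$ if $N_T\ge1$. Measurement spaces (preduals): If $N_T=0$, $\mathcal{C}_{L_T}(\mathbb{R})=L_T^*\{\mathcal{C}_0(\mathbb{R})\}$ with pairing $\langle f,L_T^*h\rangle=\langle L_Tf,h\rangle$. If $N_T\ge1$, fix $\theta_1,\dots,\theta_{N_T}\in\mathcal{S}(\mathbb{R})$ with $\int\theta_n(t)t^{m-1}dt=\delta_{nm}$ (Kronecker) and set $\mathcal{C}_{L_T}(\mathbb{R})=L_T^*\{\mathcal{C}_0(\mathbb{R})\}\oplus\mathrm{Span}\{\theta_n\}$, with pairing $\langle f,L_T^*h+\sum_nc_n\theta_n\rangle=\langle L_Tf,h\rangle+\sum_nc_n\langle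 f,\theta_n\rangle$ (the space does not depend on the choice of the $\theta_n$). If $N_S=0$, $\mathcal{C}_{L_S}(\mathbb{T})=L_S^*\{\mathcal{C}(\mathbb{T})\}$ with pairing $\langle f,L_S^*h\rangle=\langle L_Sf,h\rangle$. If $N_S\ge1$, $\mathcal{C}_{L_S}(\mathbb{T})=L_S^*\{\mathcal{C}(\mathbb{T})\}\oplus\mathrm{Span}\{1\}$ with pairing $\langle f,L_S^*h+\alpha\rangle=\langle L_Sf,h\rangle+\alpha\widehat f[0]$. $\mathcal{C}_{L_S,0}(\mathbb{T})=\{g\in\mathcal{C}_{L_S}(\mathbb{T}):\widehat g[0]=0\}$. $\mathcal{C}(L_T,L_S)=\mathcal{C}_{L_T}(\mathbb{R})\times\mathcal{C}_{L_S}(\mathbb{T})$ if $N_T=0$ and $\mathcal{C}_{L_T}(\mathbb{R})\times\mathcal{C}_{L_S,0}(\mathbb{T})$ if $N_T\ge1$. The weak*-topology on $\mathcal{M}(L_T,L_S)$ is the coarsest one making $(f_T,f_S)\mapsto\langle f_T,g_T\rangle+\langle f_S,g_S\rangle$ continuous for every $(g_T,g_S)\in\mathcal{C}(L_T,L_S)$. Sensing and sampling admissibility: $\phi\in\mathcal{S}'(\mathbb{R})$ is periodizable if $\sum_{|n|\le N}\phi(\cdot-n)$ converges in $\mathcal{S}'(\mathbb{R})$ as $N\to\infty$; the limit $\mathrm{Per}\{\phi\}\in\mathcal{S}'(\mathbb{T})$ is its periodization. $\phi$ is $(L_T,L_S)$-sensing admissible if it is periodizable and $(\phi,\mathrm{Per}\{\phi\})\in\mathcal{C}_{L_T}(\mathbb{R})\times\mathcal{C}_{L_S}(\mathbb{T})$;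 it then acts on $\mathcal{M}(L_T,L_S)$ by $\phi(f_T,f_S)=\langle f_T,\phi\rangle+\langle f_S,\mathrm{Per}\{\phi\}\rangle$, and $\boldsymbol{\Phi}(f_T,f_S)=(\phi_\ell(f_T,f_S))_{1\le\ell\le L}$. The pair $(L_T,L_S)$ is sampling admissible if $\delta(\cdot-t_0)$ is $(L_T,L_S)$-sensing admissible for every $t_0\in\mathbb{R}$; point values are then $f_T(t_0)=\langle f_T,\delta(\cdot-t_0)\rangle$ and $f_S(t_0)=\langle f_S,\mathrm{III}(\cdot-t_0)\rangle$. Discretized spaces: for $h_T>0$, $h_S>0$ with $n_S=1/h_S\in\mathbb{N}$, $\mathcal{M}_{h_T}(\mathbb{R})=\{\sum_{k\in\mathbb{Z}}a_k\delta(\cdot-h_Tk):(a_k)\in\ell_1(\mathbb{Z})\}$, $\mathcal{M}_{h_S}(\mathbb{T})=\{\sum_{k=1}^{n_S}b_k\mathrm{III}(\cdot-h_Sk):b\in\mathbb{R}^{n_S}\}$, and $\mathcal{M}_{h_T,h_S}(L_T,L_S)=\{(f_T,f_S)\in\mathcal{M}(L_T,L_S):L_Tf_T\in\mathcal{M}_{h_T}(\mathbb{R}),\ L_Sf_S\in\mathcal{M}_{h_S}(\mathbb{T})\}$. *)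

theory Defs
  imports "HOL-Analysis.Analysis"
begin

section \<open>Test functions and generalized functions\<close>

text \<open>Functions on the torus are 1-periodic functions on the real line. The constructions
  common to the line and the torus are parametrized by the topological vector space \<open>T\<close> of
  test functions, whose carrier is \<open>topspace T\<close>. A continuous linear functional on it is made
  a unique HOL function by requiring it to be \<open>undefined\<close> outside the carrier.\<close>

type_synonym gfun = "(real \<Rightarrow> real) \<Rightarrow> real"

definition seminorm_topology :: "(real \<Rightarrow> real) set \<Rightarrow> gfun set \<Rightarrow> (real \<Rightarrow> real) topology" where
  "seminorm_topology X P =
     topology_generated_by {{g \<in> X. p (\<lambda>t. g t - f t) < r} | f p r. f \<in> X \<and> p \<in> P \<and> 0 < r}"

definition smooth :: "(real \<Rightarrow> real) \<Rightarrow> bool" where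
  "smooth f \<longleftrightarrow> (\<forall>n t. (deriv ^^ n) f differentiable (at t))"

definition periodic1 :: "(real \<Rightarrow> real) \<Rightarrow> bool" where
  "periodic1 f \<longleftrightarrow> (\<forall>t. f (t + 1) = f t)"

definition schwartz :: "(real \<Rightarrow> real) set" where
  "schwartz = {f. smooth f \<and> (\<forall>m n. bounded (range (\<lambda>t. t ^ m * (deriv ^^ n) f t)))}"

definition SR :: "(real \<Rightarrow> real) topology" where
  "SR = seminorm_topology schwartz {\<lambda>f. SUP t. \<bar>t ^ m * (deriv ^^ n) f t\<bar> | m n. True}"

definition ST :: "(real \<Rightarrow> real) topology" where
  "ST = seminorm_topology {f. smooth f \<and> periodic1 f} {\<lambda>f. SUP t. \<bar>(deriv ^^ n) f t\<bar> | n. True}"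

definition C0R :: "(real \<Rightarrow> real) topology" where
  "C0R = seminorm_topology {f. continuous_on UNIV f \<and> (f \<longlongrightarrow> 0) at_infinity} {\<lambda>f. SUP t. \<bar>f t\<bar>}"

definition CT :: "(real \<Rightarrow> real) topology" where
  "CT = seminorm_topology {f. continuous_on UNIV f \<and> periodic1 f} {\<lambda>f. SUP t. \<bar>f t\<bar>}"

definition dual :: "(real \<Rightarrow> real) topology \<Rightarrow> gfun set" where
  "dual T = {u \<in> extensional (topspace T).
     (\<forall>f\<in>topspace T. \<forall>g\<in>topspace T. u (\<lambda>t. f t + g t) = u f + u g) \<and>
     (\<forall>c. \<forall>f\<in>topspace T. u (\<lambda>t. c * f t) = c * u f) \<and>
     continuous_map T euclideanreal u}"

definition weak_star :: "(real \<Rightarrow> real) topology \<Rightarrow> gfun topology" where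
  "weak_star T = subtopology (product_topology (\<lambda>_. euclideanreal) (topspace T)) (dual T)"

definition dual_norm :: "(real \<Rightarrow> real) topology \<Rightarrow> gfun \<Rightarrow> real" where
  "dual_norm T u = (SUP h\<in>{h \<in> topspace T. \<forall>t. \<bar>h t\<bar> \<le> 1}. \<bar>u h\<bar>)"

lemma topspace_seminorm_topology:
  assumes "p \<in> P" "p (\<lambda>_. 0) = 0"
  shows "topspace (seminorm_topology X P) = X"
proof -
  have "f \<in> \<Union>{{g \<in> X. p (\<lambda>t. g t - f t) < r} | f p r. f \<in> X \<and> p \<in> P \<and> 0 < r}" if "f \<in> X" for f
    by (rule UnionI[of "{g \<in> X. p (\<lambda>t. g t - f t) < 1}"]) (use that assms in fastforce)+
  then show ?thesis
    unfolding seminorm_topology_def topology_generated_by_topspace by blast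
qed

lemma deriv_iter_zero: "(deriv ^^ n) (\<lambda>_. 0 :: real) = (\<lambda>_. 0)"
  by (induction n) auto

lemma topspace_SR [simp]: "topspace SR = schwartz"
  unfolding SR_def
  by (rule topspace_seminorm_topology[of "\<lambda>f. SUP t. \<bar>t ^ 0 * (deriv ^^ 0) f t\<bar>"])
    (blast, simp)

lemma topspace_ST [simp]: "topspace ST = {f. smooth f \<and> periodic1 f}"
  unfolding ST_def
  by (rule topspace_seminorm_topology[of "\<lambda>f. SUP t. \<bar>(deriv ^^ 0) f t\<bar>"]) (blast, simp)

lemma topspace_C0R [simp]:
  "topspace C0R = {f. continuous_on UNIV f \<and> (f \<longlongrightarrow> 0) at_infinity}"
  unfolding C0R_def by (rule topspace_seminorm_topology[OF singletonI]) simp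

lemma topspace_CT [simp]: "topspace CT = {f. continuous_on UNIV f \<and> periodic1 f}"
  unfolding CT_def by (rule topspace_seminorm_topology[OF singletonI]) simp

lemma topspace_weak_star [simp]: "topspace (weak_star T) = dual T"
  by (auto simp: weak_star_def dual_def PiE_def)

text \<open>The generalized function given by integration against \<open>g\<close>; here \<open>A\<close> is \<open>UNIV\<close> for the
  line and the fundamental domain \<open>{0..1}\<close> for the torus.\<close>

definition regular :: "(real \<Rightarrow> real) topology \<Rightarrow> real set \<Rightarrow> (real \<Rightarrow> real) \<Rightarrow> gfun" where
  "regular T A g = (\<lambda>\<phi>\<in>topspace T. LINT t:A|lborel. g t * \<phi> t)"

abbreviation regular_R :: "(real \<Rightarrow> real) \<Rightarrow> gfun" where "regular_R \<equiv> regular SR UNIV"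
abbreviation regular_T :: "(real \<Rightarrow> real) \<Rightarrow> gfun" where "regular_T \<equiv> regular ST {0..1}"

definition mean :: "gfun \<Rightarrow> real" where
  "mean f = f (\<lambda>_. 1)"

text \<open>\<open>dirac SR t0\<close> is \<open>\<delta>(\<cdot> - t0)\<close>, and \<open>dirac ST t0\<close> is the Dirac comb \<open>III(\<cdot> - t0)\<close>.\<close>

definition dirac :: "(real \<Rightarrow> real) topology \<Rightarrow> real \<Rightarrow> gfun" where
  "dirac T t0 = (\<lambda>\<phi>\<in>topspace T. \<phi> t0)"

text \<open>\<open>shift T \<tau> u\<close> is \<open>u(\<cdot> - \<tau>)\<close>.\<close>

definition shift :: "(real \<Rightarrow> real) topology \<Rightarrow> real \<Rightarrow> gfun \<Rightarrow> gfun" where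
  "shift T \<tau> u = (\<lambda>\<phi>\<in>topspace T. u (\<lambda>t. \<phi> (t + \<tau>)))"

definition gderiv :: "(real \<Rightarrow> real) topology \<Rightarrow> gfun \<Rightarrow> gfun" where
  "gderiv T u = (\<lambda>\<phi>\<in>topspace T. - u (deriv \<phi>))"

text \<open>The embedding of periodic generalized functions into the tempered ones.\<close>

definition embed_periodic :: "gfun \<Rightarrow> gfun" where
  "embed_periodic f = (\<lambda>\<phi>\<in>topspace SR. f (\<lambda>t. \<Sum>\<^sub>\<infinity>k::int. \<phi> (t - of_int k)))"


section \<open>Operators\<close>

definition lsi_operator :: "(real \<Rightarrow> real) topology \<Rightarrow> (gfun \<Rightarrow> gfun) \<Rightarrow> bool" where
  "lsi_operator T L \<longleftrightarrow>
     continuous_map (weak_star T) (weak_star T) L \<and>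
     (\<forall>u\<in>dual T. \<forall>v\<in>dual T.
        L (\<lambda>\<phi>\<in>topspace T. u \<phi> + v \<phi>) = (\<lambda>\<phi>\<in>topspace T. L u \<phi> + L v \<phi>)) \<and>
     (\<forall>c. \<forall>u\<in>dual T. L (\<lambda>\<phi>\<in>topspace T. c * u \<phi>) = (\<lambda>\<phi>\<in>topspace T. c * L u \<phi>)) \<and>
     (\<forall>\<tau>. \<forall>u\<in>dual T. L (shift T \<tau> u) = shift T \<tau> (L u))"

definition admissible :: "(real \<Rightarrow> real) topology \<Rightarrow> nat \<Rightarrow> (gfun \<Rightarrow> gfun) \<Rightarrow> bool" where
  "admissible T N L \<longleftrightarrow>
     lsi_operator T L \<and>
     (\<exists>Linv Linv'. lsi_operator T Linv \<and> lsi_operator T Linv' \<and>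
        (\<forall>u\<in>dual T. Linv' (Linv u) = u \<and> Linv (Linv' u) = u) \<and>
        (\<forall>u\<in>dual T. L u = (gderiv T ^^ N) (Linv u)))"

abbreviation trend_admissible :: "nat \<Rightarrow> (gfun \<Rightarrow> gfun) \<Rightarrow> bool" where
  "trend_admissible \<equiv> admissible SR"

abbreviation seasonal_admissible :: "nat \<Rightarrow> (gfun \<Rightarrow> gfun) \<Rightarrow> bool" where
  "seasonal_admissible \<equiv> admissible ST"

text \<open>The adjoint is determined on \<open>dual T\<close>, where alone it is used.\<close>

definition adjoint_op :: "(real \<Rightarrow> real) topology \<Rightarrow> real set \<Rightarrow> (gfun \<Rightarrow> gfun) \<Rightarrow> gfun \<Rightarrow> gfun" where
  "adjoint_op T A L = (SOME L'. lsi_operator T L' \<and>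
     (\<forall>\<phi>1\<in>topspace T. \<forall>\<phi>2\<in>topspace T. L (regular T A \<phi>1) \<phi>2 = L' (regular T A \<phi>2) \<phi>1))"

abbreviation adjoint_R :: "(gfun \<Rightarrow> gfun) \<Rightarrow> gfun \<Rightarrow> gfun" where "adjoint_R \<equiv> adjoint_op SR UNIV"
abbreviation adjoint_T :: "(gfun \<Rightarrow> gfun) \<Rightarrow> gfun \<Rightarrow> gfun" where "adjoint_T \<equiv> adjoint_op ST {0..1}"

definition greens_function :: "(gfun \<Rightarrow> gfun) \<Rightarrow> gfun \<Rightarrow> bool" where
  "greens_function L w \<longleftrightarrow> w \<in> dual SR \<and> L w = dirac SR 0"

definition periodic_greens_function :: "nat \<Rightarrow> (gfun \<Rightarrow> gfun) \<Rightarrow> gfun \<Rightarrow> bool" where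
  "periodic_greens_function N L w \<longleftrightarrow> w \<in> dual ST \<and>
     L w = (if N = 0 then dirac ST 0
            else (\<lambda>\<phi>\<in>topspace ST. dirac ST 0 \<phi> - regular_T (\<lambda>_. 1) \<phi>))"

text \<open>A tempered generalized function coincides with a continuous function \<open>g\<close> when it is
  integration against \<open>g\<close> on compactly supported test functions. Integrability of \<open>g * \<phi>\<close> for
  every Schwartz \<open>\<phi>\<close> is not implied (consider the derivative of \<open>sin (exp t)\<close>).\<close>

definition locally_lipschitz_gfun :: "gfun \<Rightarrow> bool" where
  "locally_lipschitz_gfun w \<longleftrightarrow>
     (\<exists>g. local_lipschitz {0::real} UNIV (\<lambda>_. g) \<and>
        (\<forall>\<phi>\<in>schwartz. (\<exists>r. \<forall>t. r < \<bar>t\<bar> \<longrightarrow> \<phi> t = 0) \<longrightarrow>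
           w \<phi> = (LINT t|lborel. g t * \<phi> t)))"

definition lipschitz_periodic_gfun :: "gfun \<Rightarrow> bool" where
  "lipschitz_periodic_gfun w \<longleftrightarrow>
     (\<exists>g C. periodic1 g \<and> C-lipschitz_on UNIV g \<and> w = regular_T g)"


section \<open>Measures and native spaces\<close>

text \<open>Finite measures on the line (torus) are the elements of \<open>dual C0R\<close> (\<open>dual CT\<close>); a
  generalized function is a measure when it is the restriction of one to the test functions.
  That measure is unique, by density of the test functions.\<close>

definition measures_in :: "(real \<Rightarrow> real) topology \<Rightarrow> (real \<Rightarrow> real) topology \<Rightarrow> gfun set" where
  "measures_in T C = (\<lambda>u. restrict u (topspace T)) ` dual C"

definition measure_of_gfun ::
  "(real \<Rightarrow> real) topology \<Rightarrow> (real \<Rightarrow> real) topology \<Rightarrow> gfun \<Rightarrow> gfun" where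
  "measure_of_gfun T C = inv_into (dual C) (\<lambda>u. restrict u (topspace T))"

abbreviation MR :: "gfun set" where "MR \<equiv> measures_in SR C0R"
abbreviation MT :: "gfun set" where "MT \<equiv> measures_in ST CT"

abbreviation meas_R :: "gfun \<Rightarrow> gfun" where "meas_R \<equiv> measure_of_gfun SR C0R"
abbreviation meas_T :: "gfun \<Rightarrow> gfun" where "meas_T \<equiv> measure_of_gfun ST CT"

definition norm_MR :: "gfun \<Rightarrow> real" where "norm_MR w = dual_norm C0R (meas_R w)"
definition norm_MT :: "gfun \<Rightarrow> real" where "norm_MT w = dual_norm CT (meas_T w)"

definition native_R :: "(gfun \<Rightarrow> gfun) \<Rightarrow> gfun set" where
  "native_R L = {f \<in> dual SR. L f \<in> MR}"

definition native_T :: "(gfun \<Rightarrow> gfun) \<Rightarrow> gfun set" where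
  "native_T L = {f \<in> dual ST. L f \<in> MT}"

definition native_T0 :: "(gfun \<Rightarrow> gfun) \<Rightarrow> gfun set" where
  "native_T0 L = {f \<in> native_T L. mean f = 0}"

definition native :: "nat \<Rightarrow> (gfun \<Rightarrow> gfun) \<Rightarrow> (gfun \<Rightarrow> gfun) \<Rightarrow> (gfun \<times> gfun) set" where
  "native N\<^sub>T L\<^sub>T L\<^sub>S = native_R L\<^sub>T \<times> (if N\<^sub>T = 0 then native_T L\<^sub>S else native_T0 L\<^sub>S)"


section \<open>Measurement spaces and pairings\<close>

text \<open>The functions \<open>\<theta> 1, \<dots>, \<theta> N\<close> span the finite-dimensional summand of the trend measurement
  space; the sums over \<open>{1..N}\<close> are empty for \<open>N = 0\<close>.\<close>

definition biorthogonal_moments :: "nat \<Rightarrow> (nat \<Rightarrow> real \<Rightarrow> real) \<Rightarrow> bool" where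
  "biorthogonal_moments N \<theta> \<longleftrightarrow>
     (\<forall>n\<in>{1..N}. \<theta> n \<in> schwartz) \<and>
     (\<forall>n\<in>{1..N}. \<forall>m\<in>{1..N}. (LINT t|lborel. \<theta> n t * t ^ (m - 1)) = (if n = m then 1 else 0))"

definition meas_elem_R ::
  "nat \<Rightarrow> (nat \<Rightarrow> real \<Rightarrow> real) \<Rightarrow> (gfun \<Rightarrow> gfun) \<Rightarrow> (real \<Rightarrow> real) \<Rightarrow> (nat \<Rightarrow> real) \<Rightarrow> gfun" where
  "meas_elem_R N \<theta> L h c =
     (\<lambda>\<phi>\<in>topspace SR. adjoint_R L (regular_R h) \<phi> + (\<Sum>n=1..N. c n * regular_R (\<theta> n) \<phi>))"

definition predual_R :: "nat \<Rightarrow> (nat \<Rightarrow> real \<Rightarrow> real) \<Rightarrow> (gfun \<Rightarrow> gfun) \<Rightarrow> gfun set" where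
  "predual_R N \<theta> L = {meas_elem_R N \<theta> L h c | h c. h \<in> topspace C0R}"

text \<open>The pairings are given by formulas in terms of a decomposition of \<open>g\<close>; their common value
  over all decompositions is taken.\<close>

definition pairing_R ::
  "nat \<Rightarrow> (nat \<Rightarrow> real \<Rightarrow> real) \<Rightarrow> (gfun \<Rightarrow> gfun) \<Rightarrow> gfun \<Rightarrow> gfun \<Rightarrow> real" where
  "pairing_R N \<theta> L f g = (THE r. \<exists>h\<in>topspace C0R. \<exists>c. g = meas_elem_R N \<theta> L h c \<and>
     r = meas_R (L f) h + (\<Sum>n=1..N. c n * f (\<theta> n)))"

definition meas_elem_T :: "(gfun \<Rightarrow> gfun) \<Rightarrow> (real \<Rightarrow> real) \<Rightarrow> real \<Rightarrow> gfun" where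
  "meas_elem_T L h \<alpha> =
     (\<lambda>\<phi>\<in>topspace ST. adjoint_T L (regular_T h) \<phi> + regular_T (\<lambda>_. \<alpha>) \<phi>)"

definition predual_T :: "nat \<Rightarrow> (gfun \<Rightarrow> gfun) \<Rightarrow> gfun set" where
  "predual_T N L = {meas_elem_T L h \<alpha> | h \<alpha>. h \<in> topspace CT \<and> (N = 0 \<longrightarrow> \<alpha> = 0)}"

definition predual_T0 :: "nat \<Rightarrow> (gfun \<Rightarrow> gfun) \<Rightarrow> gfun set" where
  "predual_T0 N L = {g \<in> predual_T N L. mean g = 0}"

definition pairing_T :: "nat \<Rightarrow> (gfun \<Rightarrow> gfun) \<Rightarrow> gfun \<Rightarrow> gfun \<Rightarrow> real" where
  "pairing_T N L f g = (THE r. \<exists>h\<in>topspace CT. \<exists>\<alpha>. (N = 0 \<longrightarrow> \<alpha> = 0) \<and>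
     g = meas_elem_T L h \<alpha> \<and> r = meas_T (L f) h + \<alpha> * mean f)"

definition predual ::
  "nat \<Rightarrow> (nat \<Rightarrow> real \<Rightarrow> real) \<Rightarrow> (gfun \<Rightarrow> gfun) \<Rightarrow> nat \<Rightarrow> (gfun \<Rightarrow> gfun) \<Rightarrow> (gfun \<times> gfun) set" where
  "predual N\<^sub>T \<theta> L\<^sub>T N\<^sub>S L\<^sub>S =
     predual_R N\<^sub>T \<theta> L\<^sub>T \<times> (if N\<^sub>T = 0 then predual_T N\<^sub>S L\<^sub>S else predual_T0 N\<^sub>S L\<^sub>S)"

definition native_weak_star ::
  "nat \<Rightarrow> (nat \<Rightarrow> real \<Rightarrow> real) \<Rightarrow> (gfun \<Rightarrow> gfun) \<Rightarrow> nat \<Rightarrow> (gfun \<Rightarrow> gfun) \<Rightarrow> (gfun \<times> gfun) topology"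
where
  "native_weak_star N\<^sub>T \<theta> L\<^sub>T N\<^sub>S L\<^sub>S = topology_generated_by
     {{f \<in> native N\<^sub>T L\<^sub>T L\<^sub>S.
         pairing_R N\<^sub>T \<theta> L\<^sub>T (fst f) (fst g) + pairing_T N\<^sub>S L\<^sub>S (snd f) (snd g) \<in> U} | g U.
       g \<in> predual N\<^sub>T \<theta> L\<^sub>T N\<^sub>S L\<^sub>S \<and> open U}"


section \<open>Sensing and sampling\<close>

definition translate_sum :: "gfun \<Rightarrow> nat \<Rightarrow> gfun" where
  "translate_sum \<phi> K = (\<lambda>\<psi>\<in>topspace SR. \<Sum>n=-int K..int K. shift SR (of_int n) \<phi> \<psi>)"

definition periodizable :: "gfun \<Rightarrow> bool" where
  "periodizable \<phi> \<longleftrightarrow> \<phi> \<in> dual SR \<and> (\<exists>w. limitin (weak_star SR) (translate_sum \<phi>) w sequentially)"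

definition periodization :: "gfun \<Rightarrow> gfun" where
  "periodization \<phi> =
     (THE p. p \<in> dual ST \<and> limitin (weak_star SR) (translate_sum \<phi>) (embed_periodic p) sequentially)"

definition sensing_admissible ::
  "nat \<Rightarrow> (nat \<Rightarrow> real \<Rightarrow> real) \<Rightarrow> (gfun \<Rightarrow> gfun) \<Rightarrow> nat \<Rightarrow> (gfun \<Rightarrow> gfun) \<Rightarrow> gfun \<Rightarrow> bool" where
  "sensing_admissible N\<^sub>T \<theta> L\<^sub>T N\<^sub>S L\<^sub>S \<phi> \<longleftrightarrow>
     periodizable \<phi> \<and> \<phi> \<in> predual_R N\<^sub>T \<theta> L\<^sub>T \<and> periodization \<phi> \<in> predual_T N\<^sub>S L\<^sub>S"

definition sense ::
  "nat \<Rightarrow> (nat \<Rightarrow> real \<Rightarrow> real) \<Rightarrow> (gfun \<Rightarrow> gfun) \<Rightarrow> nat \<Rightarrow> (gfun \<Rightarrow> gfun) \<Rightarrow> ('l \<Rightarrow> gfun) \<Rightarrow>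
   gfun \<times> gfun \<Rightarrow> real ^ 'l::finite" where
  "sense N\<^sub>T \<theta> L\<^sub>T N\<^sub>S L\<^sub>S \<Phi> f =
     (\<chi> l. pairing_R N\<^sub>T \<theta> L\<^sub>T (fst f) (\<Phi> l) + pairing_T N\<^sub>S L\<^sub>S (snd f) (periodization (\<Phi> l)))"

definition sampling_admissible ::
  "nat \<Rightarrow> (nat \<Rightarrow> real \<Rightarrow> real) \<Rightarrow> (gfun \<Rightarrow> gfun) \<Rightarrow> nat \<Rightarrow> (gfun \<Rightarrow> gfun) \<Rightarrow> bool" where
  "sampling_admissible N\<^sub>T \<theta> L\<^sub>T N\<^sub>S L\<^sub>S \<longleftrightarrow> (\<forall>t0. sensing_admissible N\<^sub>T \<theta> L\<^sub>T N\<^sub>S L\<^sub>S (dirac SR t0))"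

definition value_R :: "nat \<Rightarrow> (nat \<Rightarrow> real \<Rightarrow> real) \<Rightarrow> (gfun \<Rightarrow> gfun) \<Rightarrow> gfun \<Rightarrow> real \<Rightarrow> real" where
  "value_R N\<^sub>T \<theta> L\<^sub>T f t0 = pairing_R N\<^sub>T \<theta> L\<^sub>T f (dirac SR t0)"

definition value_T :: "nat \<Rightarrow> (gfun \<Rightarrow> gfun) \<Rightarrow> gfun \<Rightarrow> real \<Rightarrow> real" where
  "value_T N\<^sub>S L\<^sub>S f t0 = pairing_T N\<^sub>S L\<^sub>S f (dirac ST t0)"


section \<open>Discretized spaces and the optimization problem\<close>

definition grid_measures_R :: "real \<Rightarrow> gfun set" where
  "grid_measures_R h =
     {(\<lambda>\<phi>\<in>topspace SR. \<Sum>\<^sub>\<infinity>k::int. a k * dirac SR (h * of_int k) \<phi>) | a :: int \<Rightarrow> real.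
        (\<lambda>k. \<bar>a k\<bar>) summable_on UNIV}"

text \<open>Used for \<open>1 / h \<in> \<nat>\<close>, in which case \<open>nat \<lfloor>1 / h\<rfloor>\<close> is \<open>1 / h\<close>.\<close>

definition grid_measures_T :: "real \<Rightarrow> gfun set" where
  "grid_measures_T h =
     {(\<lambda>\<phi>\<in>topspace ST. \<Sum>k=1..nat \<lfloor>1 / h\<rfloor>. b k * dirac ST (h * of_nat k) \<phi>) | b :: nat \<Rightarrow> real. True}"

definition native_grid ::
  "nat \<Rightarrow> (gfun \<Rightarrow> gfun) \<Rightarrow> (gfun \<Rightarrow> gfun) \<Rightarrow> real \<Rightarrow> real \<Rightarrow> (gfun \<times> gfun) set" where
  "native_grid N\<^sub>T L\<^sub>T L\<^sub>S h\<^sub>T h\<^sub>S =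
     {f \<in> native N\<^sub>T L\<^sub>T L\<^sub>S. L\<^sub>T (fst f) \<in> grid_measures_R h\<^sub>T \<and> L\<^sub>S (snd f) \<in> grid_measures_T h\<^sub>S}"

definition objective ::
  "nat \<Rightarrow> (nat \<Rightarrow> real \<Rightarrow> real) \<Rightarrow> (gfun \<Rightarrow> gfun) \<Rightarrow> nat \<Rightarrow> (gfun \<Rightarrow> gfun) \<Rightarrow>
   real ^ 'l::finite \<Rightarrow> ('l \<Rightarrow> gfun) \<Rightarrow> real \<Rightarrow> real \<Rightarrow> gfun \<times> gfun \<Rightarrow> real" where
  "objective N\<^sub>T \<theta> L\<^sub>T N\<^sub>S L\<^sub>S y \<Phi> lam\<^sub>T lam\<^sub>S f =
     (norm (y - sense N\<^sub>T \<theta> L\<^sub>T N\<^sub>S L\<^sub>S \<Phi> f))\<^sup>2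
     + lam\<^sub>T * norm_MR (L\<^sub>T (fst f)) + lam\<^sub>S * norm_MT (L\<^sub>S (snd f))"

definition minimizers :: "('a \<Rightarrow> real) \<Rightarrow> 'a set \<Rightarrow> 'a set" where
  "minimizers J A = {f. is_arg_min J (\<lambda>f. f \<in> A) f}"

end

theory Submission
  imports Defs
begin

text \<open>A pair \<open>(f\<^sub>T, f\<^sub>S)\<close> of the native space is determined by its coordinates: the measures
  \<open>L\<^sub>T f\<^sub>T\<close> and \<open>L\<^sub>S f\<^sub>S\<close>, the numbers \<open>\<langle>f\<^sub>T, \<theta> n\<rangle>\<close> and the mean of \<open>f\<^sub>S\<close>. All coordinates subject to
  the evident compatibility conditions occur, and weak* convergence is convergence of coordinates.

  Shift invariance makes point values coordinates too: \<open>f\<^sub>T(t)\<close> pairs \<open>L\<^sub>T f\<^sub>T\<close> with the translate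
  by \<open>t\<close> of a fixed function of \<open>C\<^sub>0\<close>, up to a term \<open>\<langle>f\<^sub>T, \<phi>(\<cdot> - t)\<rangle>\<close> with \<open>\<phi>\<close> in the span of the \<open>\<theta> n\<close>, and
  \<open>f\<^sub>S(t)\<close> pairs \<open>L\<^sub>S f\<^sub>S\<close> with a translate of the reflected periodic Green's function. Translates of a
  uniformly continuous function over a compact interval form a compact set in the sup norm, so
  for norm-bounded sequences of measures pointwise convergence on this set is uniform. The second
  term is reduced to measures by differentiating in \<open>t\<close>.

  If the minimizer is unique, a nonzero change of the finitely many coordinates other than the
  measures that is invisible to the measurements would produce a second one; hence the minimizers
  of the discretized problems have bounded coordinates. Along any cluster
  filter of these coordinates the limit minimizes \<open>J\<close> as well, by lower semicontinuity of the
  norms and by recovery sequences. The latter come from the transpose of piecewise linear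
  interpolation, which maps measures to measures on the grid without increasing their norm.\<close>

subsection \<open>Seminorm topologies and their duals\<close>

text \<open>The operators are given only as weak* continuous LSI maps on generalized functions. A
  weak* continuous linear functional on a dual is evaluation at a test function, so each operator is
  the transpose of a map of test functions; inverses and adjoints are handled on that level, without
  Fourier analysis.

  The pairings are defined through decompositions of measurements, so their consistency has to be
  proved. On the line the decomposition is unique: polynomials, the kernel of \<open>D^N\<close>,
  are excluded because functionals given by \<open>C_0\<close> functions vanish under translation to
  infinity. On the torus with \<open>N_S > 0\<close> it is not unique, since constants are
  annihilated by the adjoint, but \<open>L_S f\<close> annihilates constants as well.

  Compactness is obtained from Tychonoff's theorem, which yields cluster filters rather than
  subsequences. An eventual property of the whole sequence follows once every nontrivial finer
  filter has a further refinement along which it holds.\<close>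

locale seminorm_space =
  fixes X :: "(real \<Rightarrow> real) set" and P :: "gfun set"
  assumes P_nonempty: "P \<noteq> {}"
    and zero_in: "(\<lambda>_. 0) \<in> X"
    and add_in: "\<And>f g. f \<in> X \<Longrightarrow> g \<in> X \<Longrightarrow> (\<lambda>t. f t + g t) \<in> X"
    and scale_in: "\<And>c f. f \<in> X \<Longrightarrow> (\<lambda>t. c * f t) \<in> X"
    and seminorm_add: "\<And>p f g. p \<in> P \<Longrightarrow> f \<in> X \<Longrightarrow> g \<in> X \<Longrightarrow> p (\<lambda>t. f t + g t) \<le> p f + p g"
    and seminorm_scale: "\<And>p c f. p \<in> P \<Longrightarrow> f \<in> X \<Longrightarrow> p (\<lambda>t. c * f t) = \<bar>c\<bar> * p f"
begin

lemma diff_mem: assumes "f \<in> X" "g \<in> X" shows "(\<lambda>t. f t - g t) \<in> X"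
  using add_in[OF assms(1) scale_in[OF assms(2), of "-1"]] by simp

lemma seminorm_zero: "p \<in> P \<Longrightarrow> p (\<lambda>_. 0) = 0"
  using seminorm_scale[OF _ zero_in, of p 0] by simp

lemma seminorm_minus: "p \<in> P \<Longrightarrow> f \<in> X \<Longrightarrow> p (\<lambda>t. - f t) = p f"
  using seminorm_scale[of p f "-1"] by simp

lemma seminorm_nonneg: assumes "p \<in> P" "f \<in> X" shows "0 \<le> p f"
proof -
  have "p (\<lambda>t. f t + (-1) * f t) \<le> p f + p (\<lambda>t. (-1) * f t)"
    using assms scale_in[OF assms(2), of "-1"] by (intro seminorm_add) auto
  then show ?thesis using assms seminorm_zero[OF assms(1)] seminorm_minus[OF assms] by simp
qed

lemma topspace_eq: "topspace (seminorm_topology X P) = X"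
  using P_nonempty seminorm_zero topspace_seminorm_topology by blast

lemma openin_ball:
  assumes "f \<in> X" "p \<in> P" "0 < r"
  shows "openin (seminorm_topology X P) {g \<in> X. p (\<lambda>t. g t - f t) < r}"
  unfolding seminorm_topology_def using assms
  by (intro topology_generated_by_Basis) blast

text \<open>Only the sub-basic sets need an argument: a ball of radius \<open>r\<close> around
  \<open>f\<close> that contains 0 also contains the ball of radius \<open>r - p f\<close> around
  0.\<close>

lemma nbhd_zero:
  assumes "openin (seminorm_topology X P) U" "(\<lambda>_. 0) \<in> U"
  shows "\<exists>F e. finite F \<and> F \<subseteq> P \<and> 0 < e \<and> {g \<in> X. \<forall>p\<in>F. p g < e} \<subseteq> U"
proof -
  have "generate_topology_on {{g \<in> X. p (\<lambda>t. g t - f t) < r} | f p r. f \<in> X \<and> p \<in> P \<and> 0 < r} U"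
    using assms(1) unfolding seminorm_topology_def openin_topology_generated_by_iff .
  then show ?thesis using assms(2)
  proof (induction rule: generate_topology_on.induct)
    case Empty
    then show ?case by simp
  next
    case (Int U V)
    obtain F e where F: "finite F" "F \<subseteq> P" "0 < e" "{g \<in> X. \<forall>p\<in>F. p g < e} \<subseteq> U"
      using Int by blast
    obtain G d where G: "finite G" "G \<subseteq> P" "0 < d" "{g \<in> X. \<forall>p\<in>G. p g < d} \<subseteq> V"
      using Int by blast
    show ?case using F G
      by (intro exI[of _ "F \<union> G"] exI[of _ "min e d"]) auto
  next
    case (UN K)
    then obtain k where "k \<in> K" "(\<lambda>_. 0) \<in> k" by blast
    then obtain F e where "finite F" "F \<subseteq> P" "0 < e" "{g \<in> X. \<forall>p\<in>F. p g < e} \<subseteq> k"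
      using UN.IH by meson
    then show ?case using \<open>k \<in> K\<close> by (meson Union_upper subset_trans)
  next
    case (Basis U)
    then obtain f p r where U: "U = {g \<in> X. p (\<lambda>t. g t - f t) < r}" "f \<in> X" "p \<in> P" "0 < r"
      by blast
    have "p f < r" using Basis(2) U seminorm_minus[OF U(3,2)] by simp
    have "p (\<lambda>t. g t - f t) < r" if "g \<in> X" "p g < r - p f" for g
    proof -
      have "p (\<lambda>t. g t + (-1) * f t) \<le> p g + p (\<lambda>t. (-1) * f t)"
        using that U scale_in[OF U(2), of "-1"] by (intro seminorm_add) auto
      then show ?thesis using seminorm_minus[OF U(3,2)] that by simp
    qed
    then show ?case using U \<open>p f < r\<close>
      by (intro exI[of _ "{p}"] exI[of _ "r - p f"]) auto
  qed
qed

text \<open>The preimage of \<open>{-1<..<1}\<close> contains a ball for finitely many seminorms;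
  rescaling \<open>f\<close> into that ball turns this into a homogeneous bound.\<close>

lemma continuous_functional_bound:
  assumes scale: "\<And>c f. f \<in> X \<Longrightarrow> u (\<lambda>t. c * f t) = c * u f"
    and cont: "continuous_map (seminorm_topology X P) euclideanreal u"
  shows "\<exists>F C. finite F \<and> F \<subseteq> P \<and> 0 \<le> C \<and> (\<forall>f\<in>X. \<bar>u f\<bar> \<le> C * (\<Sum>p\<in>F. p f))"
proof -
  let ?U = "{f \<in> topspace (seminorm_topology X P). u f \<in> {-1<..<1}}"
  have "openin (seminorm_topology X P) ?U"
    using cont by (rule openin_continuous_map_preimage) simp
  moreover have "u (\<lambda>_. 0) = 0" using scale[OF zero_in, of 0] by simp
  ultimately obtain F e where F: "finite F" "F \<subseteq> P" "0 < e" "{g \<in> X. \<forall>p\<in>F. p g < e} \<subseteq> ?U"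
    using nbhd_zero[of ?U] zero_in topspace_eq by auto
  have "\<bar>u f\<bar> \<le> (1 / e) * (\<Sum>p\<in>F. p f)" if f: "f \<in> X" for f
  proof (rule field_le_epsilon)
    fix d :: real assume "0 < d"
    define s where "s = (\<Sum>p\<in>F. p f)"
    have nn: "p f \<ge> 0" if "p \<in> F" for p using that F f seminorm_nonneg by blast
    have "s \<ge> 0" unfolding s_def using nn by (simp add: sum_nonneg)
    \<comment> \<open>The scale \<open>e / s\<close> would do if \<open>s\<close> were positive. The
      summand \<open>e * d\<close> covers the case that all seminorms of \<open>f\<close> vanish,
      and it costs exactly the slack \<open>d\<close>.\<close>
    define c where "c = e / (s + e * d)"
    have "s + e * d > 0" using \<open>s \<ge> 0\<close> F \<open>0 < d\<close> by (simp add: add_nonneg_pos)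
    then have "c > 0" using F by (simp add: c_def)
    have "p (\<lambda>t. c * f t) < e" if "p \<in> F" for p
    proof -
      have "p f \<le> s" unfolding s_def using member_le_sum[OF that _ F(1), of "\<lambda>p. p f"] nn by blast
      then have "p f < s + e * d" using F \<open>0 < d\<close> by (smt (verit) mult_pos_pos)
      then have "e * p f < e * (s + e * d)" using F by simp
      then have "c * p f < e" using \<open>s + e * d > 0\<close> unfolding c_def by (simp add: pos_divide_less_eq)
      then show ?thesis using seminorm_scale[of p f c] that F f \<open>c > 0\<close> by auto
    qed
    then have "\<bar>u (\<lambda>t. c * f t)\<bar> < 1" using F(4) scale_in[OF f] by force
    then have "c * \<bar>u f\<bar> < 1" using scale[OF f] \<open>c > 0\<close> by (simp add: abs_mult)
    then have "e * \<bar>u f\<bar> < s + e * d" using \<open>s + e * d > 0\<close> unfolding c_def by (simp add: field_simps)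
    then show "\<bar>u f\<bar> \<le> (1 / e) * (\<Sum>p\<in>F. p f) + d" using F by (simp add: s_def field_simps)
  qed
  then show ?thesis using F by (intro exI[of _ F] exI[of _ "1/e"]) auto
qed

lemma continuous_functionalI:
  assumes add: "\<And>f g. f \<in> X \<Longrightarrow> g \<in> X \<Longrightarrow> u (\<lambda>t. f t + g t) = u f + u g"
    and scale: "\<And>c f. f \<in> X \<Longrightarrow> u (\<lambda>t. c * f t) = c * u f"
    and F: "finite F" "F \<subseteq> P" and bound: "\<And>f. f \<in> X \<Longrightarrow> \<bar>u f\<bar> \<le> C * (\<Sum>p\<in>F. p f)"
  shows "continuous_map (seminorm_topology X P) euclideanreal u"
  unfolding continuous_map_def topspace_eq
proof safe
  fix f assume "f \<in> X" then show "u f \<in> topspace euclideanreal" by simp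
next
  fix U :: "real set" assume "openin euclideanreal U"
  then have "open U" by simp
  have diff: "u (\<lambda>t. g t - f t) = u g - u f" if "f \<in> X" "g \<in> X" for f g
    using add[OF that(2) scale_in[OF that(1), of "-1"]] scale[OF that(1), of "-1"] by simp
  show "openin (seminorm_topology X P) {f \<in> X. u f \<in> U}"
  proof (subst openin_subopen, safe)
    fix f assume f: "f \<in> X" "u f \<in> U"
    obtain e where e: "e > 0" "\<And>y. \<bar>y - u f\<bar> < e \<Longrightarrow> y \<in> U"
      using \<open>open U\<close> f by (auto simp: open_dist dist_real_def)
    \<comment> \<open>The two increments by 1 keep the denominator positive for \<open>C = 0\<close>
      and for empty \<open>F\<close>, and make the final estimate strict.\<close>
    define d where "d = e / ((\<bar>C\<bar> + 1) * (card F + 1))"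
    have d: "d > 0" using e by (simp add: d_def)
    \<comment> \<open>The extra seminorm \<open>q\<close> makes the intersection below nonempty as a
      family, so that it is a subset of \<open>X\<close> even for empty \<open>F\<close>.\<close>
    obtain q where q: "q \<in> P" using P_nonempty by blast
    let ?V = "\<Inter>p\<in>insert q F. {g \<in> X. p (\<lambda>t. g t - f t) < d}"
    have "openin (seminorm_topology X P) ?V"
      using F q f d by (intro openin_Inter) (auto intro: openin_ball)
    moreover have "f \<in> ?V"
    proof -
      have "p (\<lambda>t. f t - f t) < d" if "p \<in> insert q F" for p
        using seminorm_zero[of p] that F q d by auto
      then show ?thesis using f by blast
    qed
    moreover have "u g \<in> U" "g \<in> X" if "g \<in> ?V" for g
    proof -
      show g: "g \<in> X" using that by simp
      have "(\<Sum>p\<in>F. p (\<lambda>t. g t - f t)) \<le> (\<Sum>p\<in>F. d)" using that by (intro sum_mono) (auto simp: less_imp_le)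
      then have S: "(\<Sum>p\<in>F. p (\<lambda>t. g t - f t)) \<le> card F * d" by simp
      have S0: "0 \<le> (\<Sum>p\<in>F. p (\<lambda>t. g t - f t))"
        using F diff_mem[OF g f(1)] seminorm_nonneg by (intro sum_nonneg) auto
      have "\<bar>u g - u f\<bar> \<le> C * (\<Sum>p\<in>F. p (\<lambda>t. g t - f t))"
        using bound[OF diff_mem[OF g f(1)]] diff[OF f(1) g] by simp
      also have "\<dots> \<le> (\<bar>C\<bar>) * (card F * d)" using S S0 by (intro mult_mono) auto
      also have "\<dots> < (\<bar>C\<bar> + 1) * ((card F + 1) * d)"
      proof -
        have "0 \<le> \<bar>C\<bar> * d" "0 \<le> card F * d" using d by simp_all
        then show ?thesis using d by (simp add: algebra_simps add_pos_nonneg)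
      qed
      also have "\<dots> = e" by (simp add: d_def)
      finally show "u g \<in> U" by (rule e)
    qed
    ultimately show "\<exists>T. openin (seminorm_topology X P) T \<and> f \<in> T \<and> T \<subseteq> {f \<in> X. u f \<in> U}"
      by (intro exI[of _ ?V]) blast
  qed
qed

end

section \<open>Iterated derivatives of smooth functions\<close>

lemma deriv_iter_has_derivative:
  "smooth f \<Longrightarrow> ((deriv ^^ n) f has_real_derivative (deriv ^^ Suc n) f t) (at t)"
  unfolding smooth_def by (simp add: DERIV_deriv_iff_real_differentiable)

text \<open>The whole sequence of derivatives is guessed at once; smoothness and the formula for
  each derivative then follow from the same first-order statement, as also in
  \<open>smoothI\<close>.\<close>

lemma deriv_iter_eqI:
  assumes "F 0 = f" "\<And>n t. (F n has_real_derivative F (Suc n) t) (at t)"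
  shows "(deriv ^^ n) f = F n"
  using assms by (induction n) (auto intro!: ext DERIV_imp_deriv)

lemma smoothI:
  assumes "F 0 = f" "\<And>n t. (F n has_real_derivative F (Suc n) t) (at t)"
  shows "smooth f"
  unfolding smooth_def deriv_iter_eqI[of F f, OF assms]
  using assms(2) real_differentiable_def by blast

lemma
  assumes "smooth f" "smooth g"
  shows smooth_add: "smooth (\<lambda>t. f t + g t)"
    and deriv_iter_add: "(deriv ^^ n) (\<lambda>t. f t + g t) = (\<lambda>t. (deriv ^^ n) f t + (deriv ^^ n) g t)"
  by (rule smoothI[of "\<lambda>n t. (deriv ^^ n) f t + (deriv ^^ n) g t"]
      deriv_iter_eqI[of "\<lambda>n t. (deriv ^^ n) f t + (deriv ^^ n) g t"];
      force intro!: DERIV_add deriv_iter_has_derivative assms simp del: funpow.simps simp add: funpow.simps(1))+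

lemma
  assumes "smooth f"
  shows smooth_scale: "smooth (\<lambda>t. c * f t)"
    and deriv_iter_scale: "(deriv ^^ n) (\<lambda>t. c * f t) = (\<lambda>t. c * (deriv ^^ n) f t)"
  by (rule smoothI[of "\<lambda>n t. c * (deriv ^^ n) f t"]
      deriv_iter_eqI[of "\<lambda>n t. c * (deriv ^^ n) f t"];
      force intro!: DERIV_cmult deriv_iter_has_derivative assms simp del: funpow.simps simp add: funpow.simps(1))+

lemma deriv_iter_diff:
  assumes "smooth f" "smooth g"
  shows "(deriv ^^ n) (\<lambda>t. f t - g t) = (\<lambda>t. (deriv ^^ n) f t - (deriv ^^ n) g t)"
  using smooth_add[OF assms(1) smooth_scale[OF assms(2), of "-1"]]
    deriv_iter_add[OF assms(1) smooth_scale[OF assms(2), of "-1"], of n]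
    deriv_iter_scale[OF assms(2), of n "-1"] by simp_all

lemma
  assumes "smooth f"
  shows smooth_affine: "smooth (\<lambda>t. f (a * t + b))"
    and deriv_iter_affine: "(deriv ^^ n) (\<lambda>t. f (a * t + b)) = (\<lambda>t. a ^ n * (deriv ^^ n) f (a * t + b))"
proof -
  let ?F = "\<lambda>n t. a ^ n * (deriv ^^ n) f (a * t + b)"
  have 1: "(?F n has_real_derivative ?F (Suc n) t) (at t)" for n t
  proof -
    have "((\<lambda>t. (deriv ^^ n) f (a * t + b)) has_real_derivative (deriv ^^ Suc n) f (a * t + b) * a) (at t)"
      by (rule DERIV_chain2[OF deriv_iter_has_derivative[OF assms]]) (auto intro!: derivative_eq_intros)
    from DERIV_cmult[OF this, of "a ^ n"] show ?thesis by (simp add: mult_ac)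
  qed
  show "smooth (\<lambda>t. f (a * t + b))" by (rule smoothI[of ?F, OF _ 1]) simp
  show "(deriv ^^ n) (\<lambda>t. f (a * t + b)) = (\<lambda>t. a ^ n * (deriv ^^ n) f (a * t + b))"
    by (rule deriv_iter_eqI[of ?F, OF _ 1]) simp
qed

lemma
  assumes "smooth f"
  shows smooth_shift: "smooth (\<lambda>t. f (t + b))"
    and deriv_iter_shift: "(deriv ^^ n) (\<lambda>t. f (t + b)) = (\<lambda>t. (deriv ^^ n) f (t + b))"
  using smooth_affine[OF assms, of 1 b] deriv_iter_affine[OF assms, of n 1 b] by simp_all

lemma
  assumes "smooth f"
  shows smooth_reflect: "smooth (\<lambda>t. f (- t))"
    and deriv_iter_reflect: "(deriv ^^ n) (\<lambda>t. f (- t)) = (\<lambda>t. (-1) ^ n * (deriv ^^ n) f (- t))"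
  using smooth_affine[OF assms, of "-1" 0] deriv_iter_affine[OF assms, of n "-1" 0] by simp_all

lemma deriv_iter_deriv: "(deriv ^^ n) (deriv f) = (deriv ^^ Suc n) f"
  by (simp add: funpow_swap1)

lemma smooth_deriv: "smooth f \<Longrightarrow> smooth (deriv f)"
  unfolding smooth_def deriv_iter_deriv by blast

lemma smooth_const: "smooth (\<lambda>_. c :: real)"
  by (rule smoothI[of "\<lambda>n _. if n = 0 then c else 0"]) auto

lemma smooth_has_derivative: "smooth f \<Longrightarrow> (f has_real_derivative deriv f t) (at t)"
  using deriv_iter_has_derivative[of f 0] by simp

lemma smooth_continuous: "smooth f \<Longrightarrow> continuous_on S f"
  by (meson DERIV_continuous continuous_at_imp_continuous_on smooth_has_derivative)

lemma smooth_iter: "smooth f \<Longrightarrow> smooth ((deriv ^^ n) f)"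
  by (induction n) (auto intro: smooth_deriv)

section \<open>Suprema as seminorms, and first-order expansions with quadratic remainder\<close>

lemma abs_le_SUP:
  fixes f :: "real \<Rightarrow> real"
  assumes "\<And>t. \<bar>f t\<bar> \<le> B"
  shows "\<bar>f t\<bar> \<le> (SUP t. \<bar>f t\<bar>)"
  using assms by (intro cSUP_upper) (auto simp: bdd_above_def)

lemma SUP_abs_le:
  fixes f :: "real \<Rightarrow> real"
  assumes "\<And>t. \<bar>f t\<bar> \<le> B"
  shows "(SUP t. \<bar>f t\<bar>) \<le> B"
  using assms by (intro cSUP_least) auto

lemma SUP_abs_scale:
  fixes f :: "real \<Rightarrow> real"
  assumes bdd: "\<And>t. \<bar>f t\<bar> \<le> B"
  shows "(SUP t. \<bar>c * f t\<bar>) = \<bar>c\<bar> * (SUP t. \<bar>f t\<bar>)"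
proof -
  have le: "(SUP t. \<bar>c * f t\<bar>) \<le> \<bar>c\<bar> * (SUP t. \<bar>f t\<bar>)"
    if "\<And>t. \<bar>f t\<bar> \<le> B" for c B and f :: "real \<Rightarrow> real"
    using abs_le_SUP[of f B, OF that] by (intro SUP_abs_le) (simp add: abs_mult mult_left_mono)
  show ?thesis
  proof (cases "c = 0")
    case False
    have "(SUP t. \<bar>inverse c * (c * f t)\<bar>) \<le> \<bar>inverse c\<bar> * (SUP t. \<bar>c * f t\<bar>)"
      by (rule le[of _ "\<bar>c\<bar> * B"]) (simp add: abs_mult bdd mult_left_mono)
    then have "(SUP t. \<bar>f t\<bar>) \<le> (SUP t. \<bar>c * f t\<bar>) / \<bar>c\<bar>"
      using False by (simp add: mult.assoc[symmetric] divide_inverse mult.commute)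
    then have "\<bar>c\<bar> * (SUP t. \<bar>f t\<bar>) \<le> (SUP t. \<bar>c * f t\<bar>)"
      using False by (simp add: pos_le_divide_eq mult.commute)
    with le[of f B c, OF bdd] show ?thesis by (rule antisym)
  qed simp
qed

lemma SUP_abs_add:
  fixes f g :: "real \<Rightarrow> real"
  assumes "\<And>t. \<bar>f t\<bar> \<le> B" "\<And>t. \<bar>g t\<bar> \<le> C"
  shows "(SUP t. \<bar>f t + g t\<bar>) \<le> (SUP t. \<bar>f t\<bar>) + (SUP t. \<bar>g t\<bar>)"
proof (rule SUP_abs_le)
  fix t
  show "\<bar>f t + g t\<bar> \<le> (SUP t. \<bar>f t\<bar>) + (SUP t. \<bar>g t\<bar>)"
    using abs_le_SUP[of f B t, OF assms(1)] abs_le_SUP[of g C t, OF assms(2)] by linarith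
qed

text \<open>A quadratic remainder is the form of differentiability that passes through a continuous
  functional: it is an inequality, and so can be checked in each seminorm separately.\<close>

lemma has_real_derivative_quadratic:
  fixes F :: "real \<Rightarrow> real"
  assumes "\<And>t. t \<in> S \<Longrightarrow> \<bar>F t - F s - (t - s) * d\<bar> \<le> M * (t - s)\<^sup>2"
  shows "(F has_real_derivative d) (at s within S)"
  unfolding has_field_derivative_iff
proof (rule LIM_zero_cancel, rule Lim_null_comparison)
  show "\<forall>\<^sub>F t in at s within S. norm ((F t - F s) / (t - s) - d) \<le> \<bar>M\<bar> * \<bar>t - s\<bar>"
    unfolding eventually_at_filter
  proof (rule always_eventually, safe)
    fix t assume t: "t \<in> S" "t \<noteq> s"
    have "\<bar>(F t - F s) / (t - s) - d\<bar> = \<bar>F t - F s - (t - s) * d\<bar> / \<bar>t - s\<bar>"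
    proof -
      have "(F t - F s) / (t - s) - d = (F t - F s - (t - s) * d) / (t - s)"
        using t by (simp add: diff_divide_distrib)
      then show ?thesis by (simp only: abs_divide)
    qed
    also have "\<dots> \<le> M * (t - s)\<^sup>2 / \<bar>t - s\<bar>"
      using assms[OF t(1)] by (intro divide_right_mono) auto
    also have "\<dots> = M * \<bar>t - s\<bar>"
    proof -
      have "(t - s)\<^sup>2 = \<bar>t - s\<bar> * \<bar>t - s\<bar>" by (simp add: power2_eq_square)
      then show ?thesis using t by (simp del: abs_mult_self_eq)
    qed
    also have "\<dots> \<le> \<bar>M\<bar> * \<bar>t - s\<bar>" by (intro mult_right_mono) auto
    finally show "norm ((F t - F s) / (t - s) - d) \<le> \<bar>M\<bar> * \<bar>t - s\<bar>" by simp
  qed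
  show "((\<lambda>t. \<bar>M\<bar> * \<bar>t - s\<bar>) \<longlongrightarrow> 0) (at s within S)"
    by (auto intro!: tendsto_eq_intros)
qed

text \<open>The mean value theorem gives an intermediate slope \<open>H' \<xi>\<close> with
  \<open>\<xi>\<close> no farther from \<open>s\<close> than \<open>t\<close>; the Lipschitz bound
  on \<open>H'\<close> supplies the second factor.\<close>

lemma quadratic_remainder:
  fixes H :: "real \<Rightarrow> real"
  assumes der: "\<And>t. t \<in> {a..b} \<Longrightarrow> (H has_real_derivative H' t) (at t within {a..b})"
    and lip: "\<And>s t. s \<in> {a..b} \<Longrightarrow> t \<in> {a..b} \<Longrightarrow> \<bar>H' t - H' s\<bar> \<le> M * \<bar>t - s\<bar>"
    and st: "s \<in> {a..b}" "t \<in> {a..b}"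
  shows "\<bar>H t - H s - (t - s) * H' s\<bar> \<le> M * (t - s)\<^sup>2"
proof -
  have main: "\<exists>\<xi>\<in>{a..b}. \<bar>\<xi> - s\<bar> \<le> \<bar>t - s\<bar> \<and> H t - H s = (t - s) * H' \<xi>"
  proof (cases s t rule: linorder_cases)
    case less
    have "\<And>x. s \<le> x \<Longrightarrow> x \<le> t \<Longrightarrow> (H has_derivative (*) (H' x)) (at x within {s..t})"
      using st by (auto intro!: has_derivative_subset[OF der[unfolded has_field_derivative_def]])
    from mvt_very_simple[OF less_imp_le[OF less] this]
    obtain \<xi> where \<xi>: "\<xi> \<in> {s..t}" "H t - H s = H' \<xi> * (t - s)" by auto
    then have "H t - H s = (t - s) * H' \<xi>" by (simp add: algebra_simps)
    then show ?thesis using st less \<xi>(1) by (intro bexI[of _ \<xi>]) auto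
  next
    case greater
    have "\<And>x. t \<le> x \<Longrightarrow> x \<le> s \<Longrightarrow> (H has_derivative (*) (H' x)) (at x within {t..s})"
      using st by (auto intro!: has_derivative_subset[OF der[unfolded has_field_derivative_def]])
    from mvt_very_simple[OF less_imp_le[OF greater] this]
    obtain \<xi> where \<xi>: "\<xi> \<in> {t..s}" "H s - H t = H' \<xi> * (s - t)" by auto
    then have "H t - H s = (t - s) * H' \<xi>" by (simp add: algebra_simps)
    then show ?thesis using st greater \<xi>(1) by (intro bexI[of _ \<xi>]) auto
  qed (use st in auto)
  then obtain \<xi> where x: "\<xi> \<in> {a..b}" "\<bar>\<xi> - s\<bar> \<le> \<bar>t - s\<bar>" "H t - H s = (t - s) * H' \<xi>" by blast
  have "0 \<le> M * \<bar>t - s\<bar>" using lip[OF st] by linarith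
  then have "M \<ge> 0 \<or> t = s" by (auto simp: zero_le_mult_iff)
  then have "\<bar>H' \<xi> - H' s\<bar> \<le> M * \<bar>t - s\<bar>"
    using lip[OF st(1) x(1)] x(2) by (auto intro: order_trans mult_left_mono)
  then have "\<bar>t - s\<bar> * \<bar>H' \<xi> - H' s\<bar> \<le> \<bar>t - s\<bar> * (M * \<bar>t - s\<bar>)"
    by (rule mult_left_mono) simp
  moreover have "H t - H s - (t - s) * H' s = (t - s) * (H' \<xi> - H' s)"
    using x(3) by (simp add: algebra_simps)
  moreover have "\<bar>t - s\<bar> * (M * \<bar>t - s\<bar>) = M * (t - s)\<^sup>2"
    by (simp add: power2_eq_square mult_ac)
  ultimately show ?thesis by (simp only: abs_mult)
qed

lemma deriv_iter_translate_has_derivative: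
  assumes "smooth \<phi>"
  shows "((\<lambda>t. (deriv ^^ k) \<phi> (y + t)) has_real_derivative (deriv ^^ Suc k) \<phi> (y + t)) (at t within A)"
proof -
  have "((\<lambda>t. (deriv ^^ k) \<phi> (y + t)) has_real_derivative (deriv ^^ Suc k) \<phi> (y + t) * (0 + 1)) (at t)"
    by (rule DERIV_chain2[OF deriv_iter_has_derivative[OF assms]]) (intro DERIV_add DERIV_const DERIV_ident)
  then show ?thesis by (simp only: add_0 mult_1_right has_field_derivative_at_within)
qed

text \<open>Differentiation under an integral over a compact interval. The derivative falls on
  \<open>\<phi>\<close> alone, so \<open>g\<close> need only be continuous.\<close>

lemma
  fixes \<phi> g :: "real \<Rightarrow> real"
  assumes sm: "smooth \<phi>" and g: "continuous_on {a..b} g"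
  shows smooth_interval_correlation: "smooth (\<lambda>y. integral {a..b} (\<lambda>x. g x * \<phi> (y + x)))"
    and deriv_iter_interval_correlation:
      "(deriv ^^ n) (\<lambda>y. integral {a..b} (\<lambda>x. g x * \<phi> (y + x))) =
         (\<lambda>y. integral {a..b} (\<lambda>x. g x * (deriv ^^ n) \<phi> (y + x)))"
proof -
  let ?F = "\<lambda>n y. integral {a..b} (\<lambda>x. g x * (deriv ^^ n) \<phi> (y + x))"
  have cont: "continuous_on UNIV ((deriv ^^ n) \<phi>)" for n
    by (intro smooth_continuous smooth_iter sm)
  have 1: "(?F n has_real_derivative ?F (Suc n) y) (at y)" for n y
  proof -
    have "((\<lambda>y. integral (cbox a b) (\<lambda>x. g x * (deriv ^^ n) \<phi> (y + x))) has_real_derivative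
            integral (cbox a b) (\<lambda>x. g x * (deriv ^^ Suc n) \<phi> (y + x))) (at y within UNIV)"
    proof (rule leibniz_rule_field_derivative)
      fix y x
      have "((\<lambda>y. (deriv ^^ n) \<phi> (y + x)) has_real_derivative (deriv ^^ Suc n) \<phi> (y + x)) (at y)"
        by (rule DERIV_shift[THEN iffD1, OF deriv_iter_has_derivative[OF sm]])
      then show "((\<lambda>y. g x * (deriv ^^ n) \<phi> (y + x)) has_real_derivative g x * (deriv ^^ Suc n) \<phi> (y + x)) (at y within UNIV)"
        by (intro DERIV_cmult) simp
    next
      fix y show "(\<lambda>x. g x * (deriv ^^ n) \<phi> (y + x)) integrable_on cbox a b"
        using g by (intro integrable_continuous continuous_intros continuous_on_compose2[OF cont]) auto
    next
      show "continuous_on (UNIV \<times> cbox a b) (\<lambda>(y, x). g x * (deriv ^^ Suc n) \<phi> (y + x))"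
        unfolding split_beta using g
        by (intro continuous_intros continuous_on_compose2[OF cont] continuous_on_compose2[OF g]) auto
    qed auto
    then show ?thesis by simp
  qed
  show "smooth (\<lambda>y. integral {a..b} (\<lambda>x. g x * \<phi> (y + x)))" by (rule smoothI[of ?F, OF _ 1]) simp
  show "(deriv ^^ n) (\<lambda>y. integral {a..b} (\<lambda>x. g x * \<phi> (y + x))) = ?F n"
    by (rule deriv_iter_eqI[of ?F, OF _ 1]) simp
qed

subsection \<open>Spaces of test functions\<close>

text \<open>A common frame for the line and the torus: \<open>M\<close> is the set of exponents of
  the polynomial weights, all of them for Schwartz functions and only 0 for periodic functions.
  Closure under correlation over an interval makes integrals of translates available as test
  functions.\<close>

locale test_space =
  fixes T :: "(real \<Rightarrow> real) topology" and X :: "(real \<Rightarrow> real) set" and M :: "nat set"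
  assumes T_eq: "T = seminorm_topology X {\<lambda>f. SUP t. \<bar>t ^ m * (deriv ^^ n) f t\<bar> | m n. m \<in> M}"
    and zero_in_M: "0 \<in> M"
    and M_down: "\<And>m k. m \<in> M \<Longrightarrow> k \<le> m \<Longrightarrow> k \<in> M"
    and smooth_mem: "\<And>f. f \<in> X \<Longrightarrow> smooth f"
    and decay: "\<And>f m n. f \<in> X \<Longrightarrow> m \<in> M \<Longrightarrow> \<exists>B. \<forall>t. \<bar>t ^ m * (deriv ^^ n) f t\<bar> \<le> B"
    and zero_mem: "(\<lambda>_. 0) \<in> X"
    and add_mem: "\<And>f g. f \<in> X \<Longrightarrow> g \<in> X \<Longrightarrow> (\<lambda>t. f t + g t) \<in> X"
    and scale_mem: "\<And>c f. f \<in> X \<Longrightarrow> (\<lambda>t. c * f t) \<in> X"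
    and shift_mem: "\<And>f b. f \<in> X \<Longrightarrow> (\<lambda>t. f (t + b)) \<in> X"
    and reflect_mem: "\<And>f. f \<in> X \<Longrightarrow> (\<lambda>t. f (- t)) \<in> X"
    and deriv_mem: "\<And>f. f \<in> X \<Longrightarrow> deriv f \<in> X"
    and correlation_mem: "\<And>f g a b. f \<in> X \<Longrightarrow> continuous_on {a..b} g \<Longrightarrow>
           (\<lambda>y. integral {a..b} (\<lambda>x. g x * f (y + x))) \<in> X"
begin

sublocale seminorm_space X "{\<lambda>f. SUP t. \<bar>t ^ m * (deriv ^^ n) f t\<bar> | m n. m \<in> M}"
proof
  fix p :: gfun and f g assume p: "p \<in> {\<lambda>f. SUP t. \<bar>t ^ m * (deriv ^^ n) f t\<bar> | m n. m \<in> M}" "f \<in> X" "g \<in> X"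
  then obtain m n where mn: "m \<in> M" "p = (\<lambda>f. SUP t. \<bar>t ^ m * (deriv ^^ n) f t\<bar>)" by blast
  obtain B C where "\<And>t. \<bar>t ^ m * (deriv ^^ n) f t\<bar> \<le> B" "\<And>t. \<bar>t ^ m * (deriv ^^ n) g t\<bar> \<le> C"
    using decay p mn by meson
  from SUP_abs_add[OF this] show "p (\<lambda>t. f t + g t) \<le> p f + p g"
    using p by (simp add: mn deriv_iter_add smooth_mem algebra_simps)
next
  fix p :: gfun and c f assume p: "p \<in> {\<lambda>f. SUP t. \<bar>t ^ m * (deriv ^^ n) f t\<bar> | m n. m \<in> M}" "f \<in> X"
  then obtain m n where mn: "m \<in> M" "p = (\<lambda>f. SUP t. \<bar>t ^ m * (deriv ^^ n) f t\<bar>)" by blast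
  obtain B where "\<And>t. \<bar>t ^ m * (deriv ^^ n) f t\<bar> \<le> B"
    using decay p mn by meson
  from SUP_abs_scale[OF this] show "p (\<lambda>t. c * f t) = \<bar>c\<bar> * p f"
    using p by (simp add: mn deriv_iter_scale smooth_mem algebra_simps)
qed (use zero_in_M zero_mem add_mem scale_mem in auto)

lemma topspace_T [simp]: "topspace T = X"
  unfolding T_eq by (rule topspace_eq)

lemma iter_mem: "f \<in> X \<Longrightarrow> (deriv ^^ n) f \<in> X"
  by (induction n) (auto intro: deriv_mem)

lemma shift_mem': "f \<in> X \<Longrightarrow> (\<lambda>t. f (t - b)) \<in> X"
  using shift_mem[of f "- b"] by simp

lemma minus_mem: "f \<in> X \<Longrightarrow> (\<lambda>t. - f t) \<in> X"
  using scale_mem[of f "-1"] by simp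

lemma sum_mem: "finite I \<Longrightarrow> (\<And>i. i \<in> I \<Longrightarrow> f i \<in> X) \<Longrightarrow> (\<lambda>t. \<Sum>i\<in>I. f i t) \<in> X"
  by (induction I rule: finite_induct) (auto intro: zero_mem add_mem)

lemma extensional_dual: "u \<in> dual T \<Longrightarrow> u \<in> extensional X"
  by (simp add: dual_def)

lemma dual_add: "u \<in> dual T \<Longrightarrow> f \<in> X \<Longrightarrow> g \<in> X \<Longrightarrow> u (\<lambda>t. f t + g t) = u f + u g"
  by (simp add: dual_def)

lemma dual_scale: "u \<in> dual T \<Longrightarrow> f \<in> X \<Longrightarrow> u (\<lambda>t. c * f t) = c * u f"
  by (simp add: dual_def)

lemma dual_zero: "u \<in> dual T \<Longrightarrow> u (\<lambda>_. 0) = 0"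
  using dual_scale[of u "\<lambda>_. 0" 0] zero_mem by simp

lemma dual_diff: "u \<in> dual T \<Longrightarrow> f \<in> X \<Longrightarrow> g \<in> X \<Longrightarrow> u (\<lambda>t. f t - g t) = u f - u g"
  using dual_add[of u f "\<lambda>t. (-1) * g t"] dual_scale[of u g "-1"] scale_mem[of g "-1"] by simp

lemma dual_sum:
  assumes "u \<in> dual T" "finite I" "\<And>i. i \<in> I \<Longrightarrow> f i \<in> X"
  shows "u (\<lambda>t. \<Sum>i\<in>I. f i t) = (\<Sum>i\<in>I. u (f i))"
  using assms(2,3)
proof (induction I rule: finite_induct)
  case (insert x F)
  then have "u (\<lambda>t. f x t + (\<Sum>i\<in>F. f i t)) = u (f x) + u (\<lambda>t. \<Sum>i\<in>F. f i t)"
    by (intro dual_add[OF assms(1)] sum_mem) auto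
  then show ?case using insert by simp
qed (simp add: dual_zero assms(1))

text \<open>The unspecified finite family of seminorms is enlarged to all those with both indices at
  most \<open>K\<close>, and their suprema are replaced by an arbitrary common bound
  \<open>B\<close>. Later estimates then concern one number.\<close>

lemma dual_bound:
  assumes "u \<in> dual T"
  shows "\<exists>C K. 0 \<le> C \<and> (\<forall>f\<in>X. \<forall>B. (\<forall>m\<in>M. \<forall>n t. m \<le> K \<longrightarrow> n \<le> K \<longrightarrow> \<bar>t ^ m * (deriv ^^ n) f t\<bar> \<le> B)
            \<longrightarrow> \<bar>u f\<bar> \<le> C * B)"
proof -
  have "continuous_map (seminorm_topology X {\<lambda>f. SUP t. \<bar>t ^ m * (deriv ^^ n) f t\<bar> | m n. m \<in> M}) euclideanreal u"
    using assms T_eq by (simp add: dual_def)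
  from continuous_functional_bound[OF dual_scale[OF assms] this]
  obtain F C where F: "finite F" "F \<subseteq> {\<lambda>f. SUP t. \<bar>t ^ m * (deriv ^^ n) f t\<bar> | m n. m \<in> M}" "0 \<le> C"
      "\<And>f. f \<in> X \<Longrightarrow> \<bar>u f\<bar> \<le> C * (\<Sum>p\<in>F. p f)" by blast
  have "\<forall>p\<in>F. \<exists>mn. fst mn \<in> M \<and> p = (\<lambda>f. SUP t. \<bar>t ^ fst mn * (deriv ^^ snd mn) f t\<bar>)"
    using F(2) by fastforce
  from bchoice[OF this] obtain \<mu> where
    mu: "\<forall>p\<in>F. fst (\<mu> p) \<in> M \<and> p = (\<lambda>f. SUP t. \<bar>t ^ fst (\<mu> p) * (deriv ^^ snd (\<mu> p)) f t\<bar>)"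
    by (rule exE)
  \<comment> \<open>The sum of the two indices bounds each of them; the inserted 0 serves an empty
    \<open>F\<close>.\<close>
  define K where "K = Max (insert 0 ((\<lambda>p. fst (\<mu> p) + snd (\<mu> p)) ` F))"
  have K: "fst (\<mu> p) \<le> K" "snd (\<mu> p) \<le> K" if "p \<in> F" for p
  proof -
    have "fst (\<mu> p) + snd (\<mu> p) \<le> K" unfolding K_def using F(1) that by (intro Max_ge) auto
    then show "fst (\<mu> p) \<le> K" "snd (\<mu> p) \<le> K" by auto
  qed
  have "\<bar>u f\<bar> \<le> (C * card F) * B"
    if f: "f \<in> X" and B: "\<forall>m\<in>M. \<forall>n t. m \<le> K \<longrightarrow> n \<le> K \<longrightarrow> \<bar>t ^ m * (deriv ^^ n) f t\<bar> \<le> B" for f B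
  proof -
    have "p f \<le> B" if p: "p \<in> F" for p
    proof -
      have "(SUP t. \<bar>t ^ fst (\<mu> p) * (deriv ^^ snd (\<mu> p)) f t\<bar>) \<le> B"
        by (rule SUP_abs_le) (use B K[OF p] mu p in blast)
      moreover have "p f = (SUP t. \<bar>t ^ fst (\<mu> p) * (deriv ^^ snd (\<mu> p)) f t\<bar>)"
        using fun_cong[OF conjunct2[OF bspec[OF mu p]], of f] .
      ultimately show ?thesis by (simp only:)
    qed
    then have "(\<Sum>p\<in>F. p f) \<le> (\<Sum>p\<in>F. B)" by (intro sum_mono)
    then have "C * (\<Sum>p\<in>F. p f) \<le> C * (card F * B)" using F(3) by (intro mult_left_mono) auto
    then show ?thesis using F(4)[OF f] by (simp add: mult_ac)
  qed
  then show ?thesis using F(3) by (intro exI[of _ "C * card F"] exI[of _ K]) auto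
qed

lemma dualI:
  assumes ext: "u \<in> extensional X"
    and add: "\<And>f g. f \<in> X \<Longrightarrow> g \<in> X \<Longrightarrow> u (\<lambda>t. f t + g t) = u f + u g"
    and scale: "\<And>c f. f \<in> X \<Longrightarrow> u (\<lambda>t. c * f t) = c * u f"
    and bound: "\<And>f B. f \<in> X \<Longrightarrow> (\<And>m n t. m \<in> M \<Longrightarrow> m \<le> K \<Longrightarrow> n \<le> K \<Longrightarrow> \<bar>t ^ m * (deriv ^^ n) f t\<bar> \<le> B) \<Longrightarrow> \<bar>u f\<bar> \<le> C * B"
  shows "u \<in> dual T"
proof -
  define I where "I = (M \<inter> {..K}) \<times> {..K}"
  define p where "p = (\<lambda>(m :: nat, n) f. SUP t. \<bar>t ^ m * (deriv ^^ n) f t :: real\<bar>)"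
  have fin: "finite (p ` I)" by (simp add: I_def)
  have sub: "p ` I \<subseteq> {\<lambda>f. SUP t. \<bar>t ^ m * (deriv ^^ n) f t\<bar> | m n. m \<in> M}"
    by (auto simp: p_def I_def)
  \<comment> \<open>The sum of all seminorms of order at most \<open>K\<close> dominates each of
    them, hence is an admissible value of \<open>B\<close>.\<close>
  have bd: "\<bar>u f\<bar> \<le> C * (\<Sum>q\<in>p ` I. q f)" if f: "f \<in> X" for f
  proof (rule bound[OF f])
    fix m n t assume mn: "m \<in> M" "m \<le> K" "n \<le> K"
    then have "(m, n) \<in> I" by (simp add: I_def)
    obtain B where "\<And>t. \<bar>t ^ m * (deriv ^^ n) f t\<bar> \<le> B" using decay[OF f mn(1)] by blast
    from abs_le_SUP[of "\<lambda>t. t ^ m * (deriv ^^ n) f t", OF this]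
    have "\<bar>t ^ m * (deriv ^^ n) f t\<bar> \<le> p (m, n) f" unfolding p_def prod.case .
    also have "\<dots> \<le> (\<Sum>q\<in>p ` I. q f)"
    proof (rule member_le_sum[where f = "\<lambda>q. q f"])
      show "p (m, n) \<in> p ` I" using \<open>(m, n) \<in> I\<close> by blast
      show "finite (p ` I)" by (rule fin)
      fix q assume "q \<in> p ` I - {p (m, n)}"
      then have "q \<in> {\<lambda>f. SUP t. \<bar>t ^ m * (deriv ^^ n) f t\<bar> | m n. m \<in> M}" using sub by blast
      then show "0 \<le> q f" using f by (rule seminorm_nonneg)
    qed
    finally show "\<bar>t ^ m * (deriv ^^ n) f t\<bar> \<le> (\<Sum>q\<in>p ` I. q f)" .
  qed
  have "continuous_map T euclideanreal u"
    unfolding T_eq by (rule continuous_functionalI[OF add scale fin sub bd])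
  then show ?thesis using ext add scale by (simp add: dual_def)
qed

lemma dual_eqI:
  assumes "u \<in> extensional X" "v \<in> extensional X" "\<And>\<phi>. \<phi> \<in> X \<Longrightarrow> u \<phi> = v \<phi>"
  shows "u = v"
  by (rule extensionalityI[OF assms])

text \<open>The induction writes one factor \<open>y\<close> as \<open>(y + x) - x\<close>, so that
  the powers move onto the argument of the derivative, where the decay of \<open>f\<close> applies;
  \<open>j\<close> counts the powers already moved.\<close>

lemma shift_decay:
  assumes f: "f \<in> X"
  shows "m + j \<in> M \<Longrightarrow> \<exists>B. \<forall>x y. \<bar>x\<bar> \<le> r \<longrightarrow> \<bar>y ^ m * (y + x) ^ j * (deriv ^^ n) f (y + x)\<bar> \<le> B"
proof (induction m arbitrary: j)
  case 0
  then have "j \<in> M" by simp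
  from decay[OF f this, of n] obtain B where "\<And>t. \<bar>t ^ j * (deriv ^^ n) f t\<bar> \<le> B" by blast
  then show ?case by (intro exI[of _ B]) simp
next
  case (Suc m)
  obtain B where B: "\<And>x y. \<bar>x\<bar> \<le> r \<Longrightarrow> \<bar>y ^ m * (y + x) ^ Suc j * (deriv ^^ n) f (y + x)\<bar> \<le> B"
    using Suc.IH[of "Suc j"] Suc.prems by auto
  obtain C where C: "\<And>x y. \<bar>x\<bar> \<le> r \<Longrightarrow> \<bar>y ^ m * (y + x) ^ j * (deriv ^^ n) f (y + x)\<bar> \<le> C"
    using Suc.IH[of j] M_down[OF Suc.prems, of "m + j"] by auto
  show ?case
  proof (intro exI[of _ "B + r * C"] allI impI)
    fix x y :: real assume x: "\<bar>x\<bar> \<le> r"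
    let ?d = "(deriv ^^ n) f (y + x)"
    have "y ^ Suc m * (y + x) ^ j * ?d = y ^ m * (y + x) ^ Suc j * ?d - x * (y ^ m * (y + x) ^ j * ?d)"
      by (simp add: algebra_simps)
    also have "\<bar>\<dots>\<bar> \<le> \<bar>y ^ m * (y + x) ^ Suc j * ?d\<bar> + \<bar>x\<bar> * \<bar>y ^ m * (y + x) ^ j * ?d\<bar>"
      by (metis abs_mult abs_triangle_ineq4)
    also have "\<dots> \<le> B + r * C" using B[OF x] C[OF x] x
      by (intro add_mono mult_mono) auto
    finally show "\<bar>y ^ Suc m * (y + x) ^ j * ?d\<bar> \<le> B + r * C" .
  qed
qed

lemma shift_bound:
  assumes "f \<in> X" "m \<in> M"
  shows "\<exists>B\<ge>0. \<forall>x y. \<bar>x\<bar> \<le> r \<longrightarrow> \<bar>y ^ m * (deriv ^^ n) f (y + x)\<bar> \<le> B"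
proof -
  obtain B where "\<forall>x y. \<bar>x\<bar> \<le> r \<longrightarrow> \<bar>y ^ m * (deriv ^^ n) f (y + x)\<bar> \<le> B"
    using shift_decay[OF assms(1), where m = m and j = 0 and r = r and n = n] assms(2) by auto
  then have "\<forall>x y. \<bar>x\<bar> \<le> r \<longrightarrow> \<bar>y ^ m * (deriv ^^ n) f (y + x)\<bar> \<le> \<bar>B\<bar>"
    by (meson abs_ge_self order_trans)
  then show ?thesis using abs_ge_zero by blast
qed

text \<open>A curve of test functions with quadratic remainder in every seminorm is differentiable
  after \<open>u\<close>, since \<open>u\<close> is bounded by finitely many seminorms.\<close>

lemma dual_has_derivative:
  assumes u: "u \<in> dual T"
    and Z: "\<And>t. t \<in> S \<Longrightarrow> Z t \<in> X" and Z': "Z' \<in> X" and s: "s \<in> S"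
    and quad: "\<And>m n. m \<in> M \<Longrightarrow> \<exists>B. \<forall>t\<in>S. \<forall>y. \<bar>y ^ m * ((deriv ^^ n) (Z t) y - (deriv ^^ n) (Z s) y - (t - s) * (deriv ^^ n) Z' y)\<bar> \<le> B * (t - s)\<^sup>2"
  shows "((\<lambda>t. u (Z t)) has_real_derivative u Z') (at s within S)"
proof -
  obtain C K where CK: "0 \<le> C" "\<And>f B. f \<in> X \<Longrightarrow> (\<forall>m\<in>M. \<forall>n t. m \<le> K \<longrightarrow> n \<le> K \<longrightarrow> \<bar>t ^ m * (deriv ^^ n) f t\<bar> \<le> B)
            \<Longrightarrow> \<bar>u f\<bar> \<le> C * B" using dual_bound[OF u] by metis
  have "\<forall>m n. \<exists>B. m \<in> M \<longrightarrow> (\<forall>t\<in>S. \<forall>y. \<bar>y ^ m * ((deriv ^^ n) (Z t) y - (deriv ^^ n) (Z s) y - (t - s) * (deriv ^^ n) Z' y)\<bar> \<le> B * (t - s)\<^sup>2)"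
    using quad by blast
  then obtain B where B: "\<And>m n t y. m \<in> M \<Longrightarrow> t \<in> S \<Longrightarrow> \<bar>y ^ m * ((deriv ^^ n) (Z t) y - (deriv ^^ n) (Z s) y - (t - s) * (deriv ^^ n) Z' y)\<bar> \<le> B m n * (t - s)\<^sup>2"
    by metis
  \<comment> \<open>One constant that dominates the remainders in all the seminorms that control
    \<open>u\<close>.\<close>
  define D where "D = (\<Sum>(m, n)\<in>{..K} \<times> {..K}. \<bar>B m n\<bar>)"
  have D: "B m n \<le> D" if "m \<le> K" "n \<le> K" for m n
  proof -
    have "\<bar>B m n\<bar> = (case (m, n) of (m, n) \<Rightarrow> \<bar>B m n\<bar>)" by simp
    also have "\<dots> \<le> D" unfolding D_def using that by (intro member_le_sum) auto
    finally show ?thesis by linarith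
  qed
  show ?thesis
  proof (rule has_real_derivative_quadratic)
    fix t assume t: "t \<in> S"
    let ?e = "\<lambda>y. Z t y - Z s y - (t - s) * Z' y"
    have mem: "(\<lambda>y. Z t y - Z s y) \<in> X" "(\<lambda>y. (t - s) * Z' y) \<in> X"
      using Z[OF t] Z[OF s] Z' by (auto intro: diff_mem scale_mem)
    have eX: "?e \<in> X" using diff_mem[OF mem] .
    have ueq: "u ?e = u (Z t) - u (Z s) - (t - s) * u Z'"
      using dual_diff[OF u mem] dual_diff[OF u Z[OF t] Z[OF s]] dual_scale[OF u Z'] by simp
    have deq: "(deriv ^^ n) ?e y = (deriv ^^ n) (Z t) y - (deriv ^^ n) (Z s) y - (t - s) * (deriv ^^ n) Z' y" for n y
      using Z[OF t] Z[OF s] Z' mem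
      by (simp only: smooth_mem deriv_iter_diff deriv_iter_scale)
    have "\<bar>u ?e\<bar> \<le> C * (D * (t - s)\<^sup>2)"
    proof (rule CK(2)[OF eX], intro ballI allI impI)
      fix m n y assume mn: "m \<in> M" "m \<le> K" "n \<le> K"
      have "\<bar>y ^ m * (deriv ^^ n) ?e y\<bar> \<le> B m n * (t - s)\<^sup>2" unfolding deq by (rule B[OF mn(1) t])
      also have "\<dots> \<le> D * (t - s)\<^sup>2" using D[OF mn(2,3)] by (rule mult_right_mono) simp
      finally show "\<bar>y ^ m * (deriv ^^ n) ?e y\<bar> \<le> D * (t - s)\<^sup>2" .
    qed
    then show "\<bar>u (Z t) - u (Z s) - (t - s) * u Z'\<bar> \<le> (C * D) * (t - s)\<^sup>2"
      using ueq by (simp add: mult_ac)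
  qed
qed

lemma dual_shift_has_derivative:
  assumes u: "u \<in> dual T" and \<phi>: "\<phi> \<in> X"
  shows "((\<lambda>t. u (\<lambda>y. \<phi> (y + t))) has_real_derivative u (\<lambda>y. deriv \<phi> (y + s))) (at s)"
proof -
  \<comment> \<open>Restricting \<open>t\<close> to a bounded window makes the weighted second
    derivatives of all occurring translates uniformly bounded.\<close>
  have "((\<lambda>t. u (\<lambda>y. \<phi> (y + t))) has_real_derivative u (\<lambda>y. deriv \<phi> (y + s))) (at s within {s-1..s+1})"
  proof (rule dual_has_derivative[OF u])
    fix m n assume m: "m \<in> M"
    obtain B where B: "B \<ge> 0" "\<And>x y. \<bar>x\<bar> \<le> \<bar>s\<bar> + 1 \<Longrightarrow> \<bar>y ^ m * (deriv ^^ (Suc (Suc n))) \<phi> (y + x)\<bar> \<le> B"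
      using shift_bound[OF \<phi> m] by blast
    have sm: "smooth \<phi>" using \<phi> smooth_mem by blast
    have "\<bar>y ^ m * ((deriv ^^ n) (\<lambda>y. \<phi> (y + t)) y - (deriv ^^ n) (\<lambda>y. \<phi> (y + s)) y - (t - s) * (deriv ^^ n) (\<lambda>y. deriv \<phi> (y + s)) y)\<bar>
      \<le> B * (t - s)\<^sup>2" if t: "t \<in> {s-1..s+1}" for t y
    proof -
      let ?H = "\<lambda>k t. y ^ m * (deriv ^^ k) \<phi> (y + t)"
      have der: "(?H k has_real_derivative ?H (Suc k) t) (at t within A)" for k t A
        by (intro DERIV_cmult deriv_iter_translate_has_derivative sm)
      have "\<bar>?H n t - ?H n s - (t - s) * ?H (Suc n) s\<bar> \<le> B * (t - s)\<^sup>2"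
      proof (rule quadratic_remainder[where a = "s - 1" and b = "s + 1", OF der])
        fix v w assume vw: "v \<in> {s-1..s+1}" "w \<in> {s-1..s+1}"
        show "\<bar>?H (Suc n) w - ?H (Suc n) v\<bar> \<le> B * \<bar>w - v\<bar>"
          unfolding real_norm_def[symmetric]
        proof (rule field_differentiable_bound[OF _ der])
          fix z assume "z \<in> {s-1..s+1}"
          then show "norm (?H (Suc (Suc n)) z) \<le> B" unfolding real_norm_def by (intro B(2)) auto
        qed (use vw in auto)
      qed (use t in auto)
      then show ?thesis using sm
        by (simp add: deriv_iter_shift smooth_deriv deriv_iter_deriv algebra_simps del: funpow.simps)
    qed
    then show "\<exists>B. \<forall>t\<in>{s-1..s+1}. \<forall>y. \<bar>y ^ m * ((deriv ^^ n) (\<lambda>y. \<phi> (y + t)) y - (deriv ^^ n) (\<lambda>y. \<phi> (y + s)) y - (t - s) * (deriv ^^ n) (\<lambda>y. deriv \<phi> (y + s)) y)\<bar>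
      \<le> B * (t - s)\<^sup>2" by blast
  qed (use \<phi> in \<open>auto intro: shift_mem deriv_mem\<close>)
  moreover have "at s within {s-1..s+1} = at s" by (rule at_within_interior) simp
  ultimately show ?thesis by simp
qed

lemma dual_shift_continuous:
  "u \<in> dual T \<Longrightarrow> \<phi> \<in> X \<Longrightarrow> continuous_on S (\<lambda>t. u (\<lambda>y. \<phi> (y + t)))"
  by (intro continuous_at_imp_continuous_on ballI) (rule DERIV_isCont[OF dual_shift_has_derivative])

text \<open>An exchange of \<open>u\<close> with an integral that avoids vector-valued integration.
  As functions of the upper limit both sides vanish at \<open>a\<close> and have the same
  derivative. Smoothness of \<open>g\<close> makes the integrand Lipschitz, whence the quadratic
  remainder.\<close>

lemma dual_correlation:
  assumes u: "u \<in> dual T" and \<phi>: "\<phi> \<in> X" and g: "smooth g" and ab: "a \<le> b"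
  shows "u (\<lambda>y. integral {a..b} (\<lambda>x. g x * \<phi> (y + x))) = integral {a..b} (\<lambda>x. g x * u (\<lambda>y. \<phi> (y + x)))"
proof -
  let ?Z = "\<lambda>t y. integral {a..t} (\<lambda>x. g x * \<phi> (y + x))"
  have sm: "smooth \<phi>" using \<phi> smooth_mem by blast
  have cont: "continuous_on S ((deriv ^^ n) \<phi>)" for n S by (intro smooth_continuous smooth_iter sm)
  have gc: "continuous_on S g" for S by (rule smooth_continuous[OF g])
  have der: "((\<lambda>t. u (?Z t)) has_real_derivative g s * u (\<lambda>y. \<phi> (y + s))) (at s within {a..b})"
    if s: "s \<in> {a..b}" for s
    unfolding dual_scale[OF u shift_mem[OF \<phi>], symmetric]
  proof (rule dual_has_derivative[OF u])
    fix m n assume m: "m \<in> M"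
    define r where "r = \<bar>a\<bar> + \<bar>b\<bar>"
    obtain B where B: "B \<ge> 0" "\<And>x y. \<bar>x\<bar> \<le> r \<Longrightarrow> \<bar>y ^ m * (deriv ^^ n) \<phi> (y + x)\<bar> \<le> B"
      using shift_bound[OF \<phi> m] by blast
    obtain B' where B': "B' \<ge> 0" "\<And>x y. \<bar>x\<bar> \<le> r \<Longrightarrow> \<bar>y ^ m * (deriv ^^ Suc n) \<phi> (y + x)\<bar> \<le> B'"
      using shift_bound[OF \<phi> m] by blast
    have "bounded (h ` {a..b})" if "smooth h" for h :: "real \<Rightarrow> real"
      by (intro compact_imp_bounded compact_continuous_image smooth_continuous that compact_Icc)
    then have "\<exists>B. \<forall>x\<in>{a..b}. \<bar>h x\<bar> \<le> B" if "smooth h" for h :: "real \<Rightarrow> real"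
      using that by (simp add: bounded_iff)
    from this[OF g] this[OF smooth_deriv[OF g]]
    obtain G G' where G: "\<And>x. x \<in> {a..b} \<Longrightarrow> \<bar>g x\<bar> \<le> G" "\<And>x. x \<in> {a..b} \<Longrightarrow> \<bar>deriv g x\<bar> \<le> G'"
      by blast
    have "\<bar>y ^ m * ((deriv ^^ n) (?Z t) y - (deriv ^^ n) (?Z s) y - (t - s) * (deriv ^^ n) (\<lambda>y. g s * \<phi> (y + s)) y)\<bar>
      \<le> (G' * B + G * B') * (t - s)\<^sup>2" if t: "t \<in> {a..b}" for t y
    proof -
      let ?h = "\<lambda>x. y ^ m * (g x * (deriv ^^ n) \<phi> (y + x))"
      let ?h' = "\<lambda>x. y ^ m * (deriv g x * (deriv ^^ n) \<phi> (y + x) + (deriv ^^ Suc n) \<phi> (y + x) * g x)"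
      have derh: "(?h has_real_derivative ?h' x) (at x within A)" for x A
        by (intro DERIV_cmult DERIV_mult deriv_iter_translate_has_derivative sm
            has_field_derivative_at_within[OF smooth_has_derivative[OF g]])
      have hc: "continuous_on {a..b} ?h"
        using derh by (auto intro!: DERIV_continuous_on)
      let ?H = "\<lambda>t. integral {a..t} ?h"
      have bd: "\<bar>?h' x\<bar> \<le> G' * B + G * B'" if x: "x \<in> {a..b}" for x
      proof -
        have r: "\<bar>x\<bar> \<le> r" using x by (auto simp: r_def)
        have "?h' x = deriv g x * (y ^ m * (deriv ^^ n) \<phi> (y + x)) + g x * (y ^ m * (deriv ^^ Suc n) \<phi> (y + x))"
          by (simp add: algebra_simps del: funpow.simps)
        also have "\<bar>\<dots>\<bar> \<le> \<bar>deriv g x\<bar> * \<bar>y ^ m * (deriv ^^ n) \<phi> (y + x)\<bar> + \<bar>g x\<bar> * \<bar>y ^ m * (deriv ^^ Suc n) \<phi> (y + x)\<bar>"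
          by (metis abs_mult abs_triangle_ineq)
        also have "\<dots> \<le> G' * B + G * B'"
          using G(1)[OF x] G(2)[OF x] B(2)[OF r] B'(2)[OF r] abs_ge_zero order_trans
          by (intro add_mono mult_mono) (auto intro: order_trans[OF abs_ge_zero] simp del: funpow.simps)
        finally show ?thesis .
      qed
      have "\<bar>?H t - ?H s - (t - s) * ?h s\<bar> \<le> (G' * B + G * B') * (t - s)\<^sup>2"
      proof (rule quadratic_remainder[where a = a and b = b])
        fix t assume "t \<in> {a..b}"
        then show "(?H has_real_derivative ?h t) (at t within {a..b})"
          by (rule integral_has_real_derivative[OF hc])
      next
        fix v w assume vw: "v \<in> {a..b}" "w \<in> {a..b}"
        show "\<bar>?h w - ?h v\<bar> \<le> (G' * B + G * B') * \<bar>w - v\<bar>"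
          unfolding real_norm_def[symmetric]
        proof (rule field_differentiable_bound[OF _ derh])
          fix z assume "z \<in> {a..b}"
          then show "norm (?h' z) \<le> G' * B + G * B'" unfolding real_norm_def by (rule bd)
        qed (use vw in auto)
      qed (use s t in auto)
      moreover have "?H v = y ^ m * integral {a..v} (\<lambda>x. g x * (deriv ^^ n) \<phi> (y + x))" for v
        by (rule integral_mult_right)
      moreover have "(deriv ^^ n) (\<lambda>y. g s * \<phi> (y + s)) = (\<lambda>y. g s * (deriv ^^ n) \<phi> (y + s))"
        using sm by (simp add: deriv_iter_scale deriv_iter_shift smooth_shift)
      ultimately show ?thesis
        unfolding deriv_iter_interval_correlation[OF sm gc]
        by (simp add: right_diff_distrib mult_ac del: funpow.simps)
    qed
    then show "\<exists>B. \<forall>t\<in>{a..b}. \<forall>y. \<bar>y ^ m * ((deriv ^^ n) (?Z t) y - (deriv ^^ n) (?Z s) y - (t - s) * (deriv ^^ n) (\<lambda>y. g s * \<phi> (y + s)) y)\<bar>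
      \<le> B * (t - s)\<^sup>2" by blast
  qed (use \<phi> s in \<open>auto intro!: shift_mem scale_mem correlation_mem gc\<close>)
  have "((\<lambda>x. g x * u (\<lambda>y. \<phi> (y + x))) has_integral (u (?Z b) - u (?Z a))) {a..b}"
    by (rule fundamental_theorem_of_calculus[OF ab])
      (use der in \<open>simp add: has_real_derivative_iff_has_vector_derivative\<close>)
  moreover have "u (?Z a) = 0" using dual_zero[OF u] by simp
  ultimately show ?thesis by (simp add: integral_unique)
qed

lemma dirac_mem [simp]: "dirac T t0 \<in> dual T"
proof (rule dualI[where K = 0 and C = 1])
  fix f B assume "f \<in> X" "\<And>m n t. m \<in> M \<Longrightarrow> m \<le> 0 \<Longrightarrow> n \<le> 0 \<Longrightarrow> \<bar>t ^ m * (deriv ^^ n) f t\<bar> \<le> B"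
  from this(1) this(2)[OF zero_in_M, of 0 t0] show "\<bar>dirac T t0 f\<bar> \<le> 1 * B"
    by (simp add: dirac_def)
qed (auto simp: dirac_def add_mem scale_mem)

lemma dirac_apply [simp]: "\<phi> \<in> X \<Longrightarrow> dirac T t0 \<phi> = \<phi> t0"
  by (simp add: dirac_def)

lemma zero_dual: "(\<lambda>\<phi>\<in>X. 0) \<in> dual T"
  by (rule dualI[where C = 0]) (auto simp: add_mem scale_mem)

lemma add_dual:
  assumes "u \<in> dual T" "v \<in> dual T"
  shows "(\<lambda>\<phi>\<in>X. u \<phi> + v \<phi>) \<in> dual T"
proof -
  have "continuous_map T euclideanreal (\<lambda>\<phi>. u \<phi> + v \<phi>)"
    using assms by (intro continuous_map_add) (auto simp: dual_def)
  then have "continuous_map T euclideanreal (\<lambda>\<phi>\<in>X. u \<phi> + v \<phi>)"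
    by (rule continuous_map_eq) simp
  then show ?thesis
    by (simp add: dual_def add_mem scale_mem dual_add[OF assms(1)] dual_add[OF assms(2)]
      dual_scale[OF assms(1)] dual_scale[OF assms(2)] distrib_left)
qed

lemma scale_dual:
  assumes "u \<in> dual T"
  shows "(\<lambda>\<phi>\<in>X. c * u \<phi>) \<in> dual T"
proof -
  have "continuous_map T euclideanreal (\<lambda>\<phi>. c * u \<phi>)"
    using assms by (intro continuous_map_real_mult) (auto simp: dual_def)
  then have "continuous_map T euclideanreal (\<lambda>\<phi>\<in>X. c * u \<phi>)"
    by (rule continuous_map_eq) simp
  then show ?thesis
    by (simp add: dual_def add_mem scale_mem dual_add[OF assms] dual_scale[OF assms] distrib_left)
qed

end

section \<open>Operators on generalized functions as transposes of maps of test functions\<close>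

definition reflect :: "(real \<Rightarrow> real) \<Rightarrow> real \<Rightarrow> real" where
  "reflect f t = f (- t)"

lemma reflect_reflect [simp]: "reflect (reflect f) = f"
  by (simp add: reflect_def fun_eq_iff)

lemma reflect_eq: "reflect f = (\<lambda>t. f (- t))"
  by (simp add: reflect_def fun_eq_iff)

context test_space
begin

lemma reflect_in: "f \<in> X \<Longrightarrow> reflect f \<in> X"
  unfolding reflect_eq by (rule reflect_mem)

text \<open>Each coordinate of the transpose of \<open>G\<close> is again a coordinate, namely the
  one at \<open>G \<phi>\<close>.\<close>

lemma weak_star_continuous:
  assumes G: "\<And>\<phi>. \<phi> \<in> X \<Longrightarrow> G \<phi> \<in> X"
    and H: "\<And>u. u \<in> dual T \<Longrightarrow> H u \<in> dual T"
    and HG: "\<And>u \<phi>. u \<in> dual T \<Longrightarrow> \<phi> \<in> X \<Longrightarrow> H u \<phi> = u (G \<phi>)"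
  shows "continuous_map (weak_star T) (weak_star T) H"
proof -
  have "continuous_map (weak_star T) euclideanreal (\<lambda>u. H u \<phi>)" if \<phi>: "\<phi> \<in> X" for \<phi>
  proof (rule continuous_map_eq)
    show "continuous_map (weak_star T) euclideanreal (\<lambda>u. u (G \<phi>))"
      unfolding weak_star_def using G[OF \<phi>]
      by (intro continuous_map_from_subtopology continuous_map_product_projection) simp
    fix u assume "u \<in> topspace (weak_star T)"
    then show "u (G \<phi>) = H u \<phi>" using HG \<phi> by simp
  qed
  then have "continuous_map (weak_star T) (product_topology (\<lambda>_. euclideanreal) (topspace T)) H"
    unfolding continuous_map_componentwise topspace_weak_star
    using H extensional_dual by (auto simp: image_subset_iff)
  then show ?thesis
    unfolding weak_star_def[of T] continuous_map_in_subtopology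
    using H by (auto simp flip: weak_star_def)
qed

definition linear_functional :: "(gfun \<Rightarrow> real) \<Rightarrow> bool" where
  "linear_functional l \<longleftrightarrow> (\<forall>u\<in>dual T. \<forall>v\<in>dual T. l (\<lambda>\<phi>\<in>X. u \<phi> + v \<phi>) = l u + l v) \<and>
     (\<forall>c. \<forall>u\<in>dual T. l (\<lambda>\<phi>\<in>X. c * u \<phi>) = c * l u)"

text \<open>A functional that vanishes on the common kernel of finitely many evaluations is a linear
  combination of them. The induction splits off one evaluation unless the others already force it to
  vanish.\<close>

lemma linear_functional_evaluation:
  assumes "finite F" "F \<subseteq> X" "linear_functional l"
    and "\<And>u. u \<in> dual T \<Longrightarrow> \<forall>\<phi>\<in>F. u \<phi> = 0 \<Longrightarrow> l u = 0"
  shows "\<exists>\<phi>\<in>X. \<forall>u\<in>dual T. l u = u \<phi>"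
  using assms
proof (induction F arbitrary: l rule: finite_induct)
  case empty
  then show ?case using zero_mem dual_zero by (intro bexI[of _ "\<lambda>_. 0"]) auto
next
  case (insert i F)
  have i: "i \<in> X" and F: "F \<subseteq> X" using insert.prems by auto
  show ?case
  proof (cases "\<forall>u\<in>dual T. (\<forall>\<phi>\<in>F. u \<phi> = 0) \<longrightarrow> u i = 0")
    case True
    then show ?thesis using insert.prems by (intro insert.IH F) auto
  next
    case False
    then obtain u0 where u0: "u0 \<in> dual T" "\<forall>\<phi>\<in>F. u0 \<phi> = 0" "u0 i \<noteq> 0" by blast
    define c where "c = l u0 / u0 i"
    have lin: "linear_functional (\<lambda>u. l u - c * u i)"
      using insert.prems(2) i by (simp add: linear_functional_def algebra_simps)
    have "l u - c * u i = 0" if u: "u \<in> dual T" "\<forall>\<phi>\<in>F. u \<phi> = 0" for u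
    proof -
      \<comment> \<open>Adding \<open>d * u0\<close> to \<open>u\<close> cancels the value at
        \<open>i\<close> without disturbing the zeros on \<open>F\<close>.\<close>
      define d where "d = - (u i / u0 i)"
      let ?v = "\<lambda>\<phi>\<in>X. d * u0 \<phi>"
      let ?w = "\<lambda>\<phi>\<in>X. u \<phi> + ?v \<phi>"
      have v: "?v \<in> dual T" by (rule scale_dual[OF u0(1)])
      have "?w \<in> dual T" by (rule add_dual[OF u(1) v])
      moreover have "\<forall>\<phi>\<in>insert i F. ?w \<phi> = 0"
        using u u0 i F by (auto simp: d_def)
      ultimately have "l ?w = 0" by (rule insert.prems(3))
      moreover have "l ?w = l u + d * l u0"
        using insert.prems(2) u(1) u0(1) v unfolding linear_functional_def by metis
      ultimately show ?thesis using u0(3) by (simp add: c_def d_def field_simps)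
    qed
    from insert.IH[OF F lin this] obtain \<phi> where \<phi>: "\<phi> \<in> X" "\<forall>u\<in>dual T. l u - c * u i = u \<phi>" by blast
    have "l u = u (\<lambda>t. \<phi> t + c * i t)" if u: "u \<in> dual T" for u
      using \<phi>(2) u dual_add[OF u \<phi>(1) scale_mem[OF i]] dual_scale[OF u i] by force
    then show ?thesis using add_mem[OF \<phi>(1) scale_mem[OF i]] by blast
  qed
qed

text \<open>The dual of a dual space under its weak* topology is the original space: a basic
  neighbourhood of 0 constrains only finitely many coordinates.\<close>

lemma weak_star_functional_evaluation:
  assumes lin: "linear_functional l" and cont: "continuous_map (weak_star T) euclideanreal l"
  shows "\<exists>\<phi>\<in>X. \<forall>u\<in>dual T. l u = u \<phi>"
proof -
  let ?z = "\<lambda>\<phi>\<in>X. 0 :: real"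
  have "openin (weak_star T) {u \<in> topspace (weak_star T). l u \<in> {-1<..<1}}"
    using cont by (rule openin_continuous_map_preimage) simp
  then obtain W where W: "openin (product_topology (\<lambda>_. euclideanreal) X) W"
      "{u \<in> dual T. l u \<in> {-1<..<1}} = W \<inter> dual T"
    unfolding topspace_weak_star unfolding weak_star_def openin_subtopology topspace_T by blast
  have lz: "l ?z = 0"
  proof -
    have "l (\<lambda>\<phi>\<in>X. 0 * ?z \<phi>) = 0 * l ?z" using lin zero_dual unfolding linear_functional_def by blast
    then show ?thesis by (simp cong: restrict_cong)
  qed
  have "?z \<in> {u \<in> dual T. l u \<in> {-1<..<1}}" using lz zero_dual by simp
  then have "?z \<in> W" using W(2) by blast
  from bspec[OF W(1)[unfolded openin_product_topology_alt] this]
  obtain U where U: "finite {i \<in> X. U i \<noteq> UNIV}" "?z \<in> Pi\<^sub>E X U" "Pi\<^sub>E X U \<subseteq> W"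
    by (auto simp only: topspace_euclidean)
  let ?F = "{i \<in> X. U i \<noteq> UNIV}"
  show ?thesis
  proof (rule linear_functional_evaluation[OF U(1) _ lin])
    fix u assume u: "u \<in> dual T" "\<forall>\<phi>\<in>?F. u \<phi> = 0"
    \<comment> \<open>All multiples of \<open>u\<close> stay in the neighbourhood, because the
      constrained coordinates of \<open>u\<close> are zero; a linear functional bounded on a line
      vanishes there.\<close>
    have small: "\<bar>c * l u\<bar> < 1" for c
    proof -
      let ?v = "\<lambda>\<phi>\<in>X. c * u \<phi>"
      have v: "?v \<in> dual T" by (rule scale_dual[OF u(1)])
      have "?v \<phi> \<in> U \<phi>" if "\<phi> \<in> X" for \<phi>
      proof (cases "\<phi> \<in> ?F")
        case True
        have "?z \<phi> \<in> U \<phi>" using U(2) that by (rule PiE_mem)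
        then show ?thesis using True u(2) that by simp
      qed (use that in auto)
      then have "?v \<in> Pi\<^sub>E X U" by auto
      then have "?v \<in> W \<inter> dual T" using U(3) v by blast
      then have "?v \<in> {u \<in> dual T. l u \<in> {-1<..<1}}" by (simp only: W(2))
      then have "\<bar>l ?v\<bar> < 1" by (simp add: abs_less_iff)
      then show ?thesis using lin u(1) unfolding linear_functional_def by metis
    qed
    show "l u = 0"
    proof (rule ccontr)
      assume "l u \<noteq> 0"
      then show False using small[of "1 / l u"] by simp
    qed
  qed auto
qed

text \<open>Continuity of \<open>A\<close> is expressed through its transpose: composition with
  \<open>A\<close> must preserve the dual. This is the form in which it is obtained and
  applied.\<close>

definition lsi_map :: "((real \<Rightarrow> real) \<Rightarrow> real \<Rightarrow> real) \<Rightarrow> bool" where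
  "lsi_map A \<longleftrightarrow> (\<forall>\<phi>\<in>X. A \<phi> \<in> X) \<and>
     (\<forall>\<phi>\<in>X. \<forall>\<psi>\<in>X. A (\<lambda>t. \<phi> t + \<psi> t) = (\<lambda>t. A \<phi> t + A \<psi> t)) \<and>
     (\<forall>c. \<forall>\<phi>\<in>X. A (\<lambda>t. c * \<phi> t) = (\<lambda>t. c * A \<phi> t)) \<and>
     (\<forall>\<tau>. \<forall>\<phi>\<in>X. A (\<lambda>t. \<phi> (t + \<tau>)) = (\<lambda>t. A \<phi> (t + \<tau>))) \<and>
     (\<forall>\<phi>\<in>X. A (deriv \<phi>) = deriv (A \<phi>)) \<and>
     (\<forall>u\<in>dual T. (\<lambda>\<phi>\<in>X. u (A \<phi>)) \<in> dual T)"

lemma lsi_mapD: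
  assumes "lsi_map A"
  shows "\<phi> \<in> X \<Longrightarrow> A \<phi> \<in> X"
    and "\<phi> \<in> X \<Longrightarrow> \<psi> \<in> X \<Longrightarrow> A (\<lambda>t. \<phi> t + \<psi> t) = (\<lambda>t. A \<phi> t + A \<psi> t)"
    and "\<phi> \<in> X \<Longrightarrow> A (\<lambda>t. c * \<phi> t) = (\<lambda>t. c * A \<phi> t)"
    and "\<phi> \<in> X \<Longrightarrow> A (\<lambda>t. \<phi> (t + \<tau>)) = (\<lambda>t. A \<phi> (t + \<tau>))"
    and "\<phi> \<in> X \<Longrightarrow> A (deriv \<phi>) = deriv (A \<phi>)"
    and "u \<in> dual T \<Longrightarrow> (\<lambda>\<phi>\<in>X. u (A \<phi>)) \<in> dual T"
  using assms unfolding lsi_map_def by simp_all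

lemma lsi_map_iter:
  assumes "lsi_map A" "\<phi> \<in> X"
  shows "A ((deriv ^^ n) \<phi>) = (deriv ^^ n) (A \<phi>)"
  by (induction n) (use assms iter_mem in \<open>auto simp: lsi_mapD(5)\<close>)

lemma lsi_operator_dual: "lsi_operator T L \<Longrightarrow> u \<in> dual T \<Longrightarrow> L u \<in> dual T"
  unfolding lsi_operator_def using continuous_map_image_subset_topspace[of "weak_star T" "weak_star T" L] by auto

text \<open>For fixed \<open>\<phi>\<close> the functional \<open>u \<mapsto> L u \<phi>\<close> is
  weak* continuous, hence evaluation at some \<open>A \<phi>\<close>. Testing against Dirac
  functionals recovers the values of \<open>A \<phi>\<close>, and through them its linearity and
  shift invariance.\<close>

lemma lsi_operator_transpose:
  assumes L: "lsi_operator T L"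
  obtains A where "lsi_map A" "\<And>u \<phi>. u \<in> dual T \<Longrightarrow> \<phi> \<in> X \<Longrightarrow> L u \<phi> = u (A \<phi>)"
proof -
  have "\<exists>\<psi>. \<psi> \<in> X \<and> (\<forall>u\<in>dual T. L u \<phi> = u \<psi>)" if \<phi>: "\<phi> \<in> X" for \<phi>
  proof -
    have "continuous_map (weak_star T) euclideanreal ((\<lambda>u. u \<phi>) \<circ> L)"
    proof (rule continuous_map_compose)
      show "continuous_map (weak_star T) (weak_star T) L" using L by (simp add: lsi_operator_def)
      show "continuous_map (weak_star T) euclideanreal (\<lambda>u. u \<phi>)"
        unfolding weak_star_def using \<phi>
        by (intro continuous_map_from_subtopology continuous_map_product_projection) simp
    qed
    moreover have "linear_functional ((\<lambda>u. u \<phi>) \<circ> L)"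
      using L \<phi> by (auto simp: linear_functional_def lsi_operator_def)
    ultimately have "\<exists>\<psi>\<in>X. \<forall>u\<in>dual T. ((\<lambda>u. u \<phi>) \<circ> L) u = u \<psi>"
      by (intro weak_star_functional_evaluation)
    then show ?thesis by auto
  qed
  then obtain A where A: "\<And>\<phi>. \<phi> \<in> X \<Longrightarrow> A \<phi> \<in> X"
      "\<And>\<phi> u. \<phi> \<in> X \<Longrightarrow> u \<in> dual T \<Longrightarrow> L u \<phi> = u (A \<phi>)" by metis
  have ev: "A \<phi> x = L (dirac T x) \<phi>" if "\<phi> \<in> X" for \<phi> x
    using A(2)[OF that dirac_mem, of x] A(1)[OF that] by simp
  have Ld: "L (dirac T x) \<in> dual T" for x by (rule lsi_operator_dual[OF L dirac_mem])
  have shift: "A \<phi> (x + \<tau>) = A (\<lambda>t. \<phi> (t + \<tau>)) x" if \<phi>: "\<phi> \<in> X" for \<phi> x \<tau>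
  proof -
    have "shift T \<tau> (dirac T x) = dirac T (x + \<tau>)"
      unfolding shift_def dirac_def topspace_T
      by (rule restrict_ext) (simp add: shift_mem)
    moreover have "L (shift T \<tau> (dirac T x)) = shift T \<tau> (L (dirac T x))"
      using L dirac_mem[of x] unfolding lsi_operator_def by blast
    ultimately show ?thesis using \<phi> by (simp add: ev shift_mem shift_def)
  qed
  \<comment> \<open>By shift invariance \<open>A \<phi>\<close> is the correlation of
    \<open>\<phi>\<close> with the impulse response \<open>L (dirac T 0)\<close>, so differentiation
    passes onto \<open>\<phi>\<close>.\<close>
  have der: "(A \<phi> has_real_derivative A (deriv \<phi>) s) (at s)" if \<phi>: "\<phi> \<in> X" for \<phi> s
  proof -
    have eq: "A \<psi> t = L (dirac T 0) (\<lambda>y. \<psi> (y + t))" if "\<psi> \<in> X" for \<psi> t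
      using shift[OF that, of 0 t] ev[OF shift_mem[OF that]] by simp
    have "A \<phi> = (\<lambda>t. L (dirac T 0) (\<lambda>y. \<phi> (y + t)))" using eq[OF \<phi>] by blast
    then show ?thesis
      using dual_shift_has_derivative[OF Ld[of 0] \<phi>, of s] eq[OF deriv_mem[OF \<phi>], of s] by simp
  qed
  have "lsi_map A"
    unfolding lsi_map_def
  proof (intro conjI allI ballI)
    fix \<phi> \<psi> assume "\<phi> \<in> X" "\<psi> \<in> X"
    then show "A (\<lambda>t. \<phi> t + \<psi> t) = (\<lambda>t. A \<phi> t + A \<psi> t)"
      by (simp add: fun_eq_iff ev add_mem dual_add[OF Ld])
  next
    fix c \<phi> assume "\<phi> \<in> X"
    then show "A (\<lambda>t. c * \<phi> t) = (\<lambda>t. c * A \<phi> t)"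
      by (simp add: fun_eq_iff ev scale_mem dual_scale[OF Ld])
  next
    fix \<tau> \<phi> assume "\<phi> \<in> X"
    then show "A (\<lambda>t. \<phi> (t + \<tau>)) = (\<lambda>t. A \<phi> (t + \<tau>))" using shift by presburger
  next
    fix \<phi> assume "\<phi> \<in> X"
    from DERIV_imp_deriv[OF der[OF this]] show "A (deriv \<phi>) = deriv (A \<phi>)" by (simp add: fun_eq_iff)
  next
    fix u assume u: "u \<in> dual T"
    have "(\<lambda>\<phi>\<in>X. u (A \<phi>)) = L u"
      using A(2) u extensional_dual[OF lsi_operator_dual[OF L u]]
      by (intro dual_eqI) auto
    then show "(\<lambda>\<phi>\<in>X. u (A \<phi>)) \<in> dual T" using lsi_operator_dual[OF L u] by simp
  qed (rule A)
  then show thesis using A(2) that by blast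
qed

lemma lsi_map_operator:
  assumes A: "lsi_map A"
  shows "lsi_operator T (\<lambda>u. \<lambda>\<phi>\<in>X. u (A \<phi>))"
  unfolding lsi_operator_def
proof (intro conjI ballI allI)
  show "continuous_map (weak_star T) (weak_star T) (\<lambda>u. \<lambda>\<phi>\<in>X. u (A \<phi>))"
    by (rule weak_star_continuous[of A]) (simp_all add: lsi_mapD[OF A])
next
  fix \<tau> u assume "u \<in> dual T"
  show "(\<lambda>\<phi>\<in>X. shift T \<tau> u (A \<phi>)) = shift T \<tau> (\<lambda>\<phi>\<in>X. u (A \<phi>))"
    unfolding shift_def topspace_T
    by (rule restrict_ext) (simp add: shift_mem lsi_mapD[OF A])
qed (simp_all add: lsi_mapD[OF A] cong: restrict_cong)

lemma reflect_dual:
  assumes u: "u \<in> dual T"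
  shows "(\<lambda>\<phi>\<in>X. u (reflect \<phi>)) \<in> dual T"
proof -
  obtain C K where CK: "0 \<le> C" "\<And>f B. f \<in> X \<Longrightarrow> (\<forall>m\<in>M. \<forall>n t. m \<le> K \<longrightarrow> n \<le> K \<longrightarrow> \<bar>t ^ m * (deriv ^^ n) f t\<bar> \<le> B)
            \<Longrightarrow> \<bar>u f\<bar> \<le> C * B" using dual_bound[OF u] by metis
  show ?thesis
  proof (rule dualI[where K = K and C = C])
    fix f B assume f: "f \<in> X" and B: "\<And>m n t. m \<in> M \<Longrightarrow> m \<le> K \<Longrightarrow> n \<le> K \<Longrightarrow> \<bar>t ^ m * (deriv ^^ n) f t\<bar> \<le> B"
    have "\<bar>u (reflect f)\<bar> \<le> C * B"
    proof (rule CK(2)[OF reflect_in[OF f]], intro ballI allI impI)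
      fix m n t assume mn: "m \<in> M" "m \<le> K" "n \<le> K"
      have "\<bar>t ^ m * (deriv ^^ n) (reflect f) t\<bar> = \<bar>(- t) ^ m * (deriv ^^ n) f (- t)\<bar>"
        unfolding reflect_eq deriv_iter_reflect[OF smooth_mem[OF f]] by (simp add: abs_mult power_abs)
      then show "\<bar>t ^ m * (deriv ^^ n) (reflect f) t\<bar> \<le> B" using B[OF mn] by simp
    qed
    then show "\<bar>(\<lambda>\<phi>\<in>X. u (reflect \<phi>)) f\<bar> \<le> C * B" using f by simp
  qed (simp_all add: reflect_eq add_mem scale_mem reflect_mem dual_add[OF u] dual_scale[OF u])
qed

lemma deriv_reflect: "\<phi> \<in> X \<Longrightarrow> deriv (reflect \<phi>) = (\<lambda>t. - reflect (deriv \<phi>) t)"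
  using deriv_iter_reflect[OF smooth_mem, of \<phi> 1] by (simp add: reflect_eq)

lemma lsi_map_minus:
  assumes "lsi_map A" "\<phi> \<in> X" shows "A (\<lambda>t. - \<phi> t) = (\<lambda>t. - A \<phi> t)"
  using lsi_mapD(3)[OF assms, of "-1"] by simp

lemma lsi_map_zero:
  assumes "lsi_map A" shows "A (\<lambda>t. 0) = (\<lambda>t. 0)"
  using lsi_mapD(3)[OF assms zero_mem, of 0] by simp

lemma lsi_map_diff:
  assumes "lsi_map A" "\<phi> \<in> X" "\<psi> \<in> X" shows "A (\<lambda>t. \<phi> t - \<psi> t) = (\<lambda>t. A \<phi> t - A \<psi> t)"
  using lsi_mapD(2)[OF assms(1,2) minus_mem[OF assms(3)]] lsi_map_minus[OF assms(1,3)] by simp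

text \<open>Conjugation by the reflection reverses the sign of shifts and of derivatives twice. It
  reflects the impulse response, which is what passing to the adjoint amounts to.\<close>

lemma lsi_map_reflect:
  assumes A: "lsi_map A"
  shows "lsi_map (\<lambda>\<phi>. reflect (A (reflect \<phi>)))"
  unfolding lsi_map_def
proof (intro conjI ballI allI)
  fix \<tau> \<phi> assume \<phi>: "\<phi> \<in> X"
  have "reflect (\<lambda>t. \<phi> (t + \<tau>)) = (\<lambda>t. reflect \<phi> (t + - \<tau>))" by (simp add: reflect_eq)
  then have "A (reflect (\<lambda>t. \<phi> (t + \<tau>))) = (\<lambda>t. A (reflect \<phi>) (t + - \<tau>))"
    using lsi_mapD(4)[OF A reflect_in[OF \<phi>], of "- \<tau>"] by simp
  then show "reflect (A (reflect (\<lambda>t. \<phi> (t + \<tau>)))) = (\<lambda>t. reflect (A (reflect \<phi>)) (t + \<tau>))"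
    by (simp add: reflect_eq)
next
  fix \<phi> assume \<phi>: "\<phi> \<in> X"
  have "reflect (deriv \<phi>) = (\<lambda>t. - deriv (reflect \<phi>) t)" by (simp add: deriv_reflect[OF \<phi>])
  then have "A (reflect (deriv \<phi>)) = (\<lambda>t. - deriv (A (reflect \<phi>)) t)"
    using \<phi> by (simp add: lsi_map_minus[OF A] reflect_in deriv_mem lsi_mapD(5)[OF A])
  then show "reflect (A (reflect (deriv \<phi>))) = deriv (reflect (A (reflect \<phi>)))"
    using \<phi> by (simp add: deriv_reflect lsi_mapD[OF A] reflect_in) (simp add: reflect_eq)
next
  fix u assume u: "u \<in> dual T"
  have "(\<lambda>\<phi>\<in>X. u (reflect (A (reflect \<phi>)))) =
      (\<lambda>\<phi>\<in>X. (\<lambda>\<phi>\<in>X. (\<lambda>\<phi>\<in>X. u (reflect \<phi>)) (A \<phi>)) (reflect \<phi>))"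
    by (rule restrict_ext) (simp add: reflect_in lsi_mapD[OF A])
  also have "\<dots> \<in> dual T" by (intro reflect_dual lsi_mapD(6)[OF A] u)
  finally show "(\<lambda>\<phi>\<in>X. u (reflect (A (reflect \<phi>)))) \<in> dual T" .
next
  fix \<phi> \<psi> assume "\<phi> \<in> X" "\<psi> \<in> X"
  then show "reflect (A (reflect (\<lambda>t. \<phi> t + \<psi> t))) = (\<lambda>t. reflect (A (reflect \<phi>)) t + reflect (A (reflect \<psi>)) t)"
    using lsi_mapD(2)[OF A reflect_in reflect_in, of \<phi> \<psi>] by (simp add: reflect_eq)
next
  fix c \<phi> assume "\<phi> \<in> X"
  then show "reflect (A (reflect (\<lambda>t. c * \<phi> t))) = (\<lambda>t. c * reflect (A (reflect \<phi>)) t)"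
    using lsi_mapD(3)[OF A reflect_in, of \<phi> c] by (simp add: reflect_eq)
qed (simp add: reflect_in lsi_mapD[OF A])

lemma gderiv_iter:
  assumes "u \<in> dual T" "\<phi> \<in> X"
  shows "(gderiv T ^^ n) u \<phi> = (-1) ^ n * u ((deriv ^^ n) \<phi>)"
  using assms(2)
proof (induction n arbitrary: \<phi>)
  case (Suc n)
  then show ?case by (simp add: gderiv_def deriv_mem deriv_iter_deriv)
qed simp

lemma deriv_iter_reflect_in:
  "\<phi> \<in> X \<Longrightarrow> (deriv ^^ n) (reflect \<phi>) = (\<lambda>t. (-1) ^ n * reflect ((deriv ^^ n) \<phi>) t)"
  unfolding reflect_eq using deriv_iter_reflect[OF smooth_mem] by simp

end

text \<open>In \<open>convolution_swap\<close> both sides are formally the double integral of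
  \<open>w y * \<phi> x * \<psi> (x + y)\<close>. The property identifies adjoints, while
  \<open>definite\<close> makes them unique.\<close>

locale test_pairing = test_space +
  fixes A :: "real set"
  assumes regular_mem: "\<And>\<phi>. \<phi> \<in> X \<Longrightarrow> regular T A \<phi> \<in> dual T"
    and integrable_mult: "\<And>\<phi> \<psi>. \<phi> \<in> X \<Longrightarrow> \<psi> \<in> X \<Longrightarrow> set_integrable lborel A (\<lambda>t. \<phi> t * \<psi> t)"
    and definite: "\<And>\<phi>. \<phi> \<in> X \<Longrightarrow> (LINT t:A|lborel. \<phi> t * \<phi> t) = 0 \<Longrightarrow> \<phi> = (\<lambda>_. 0)"
    and convolution_swap: "\<And>w \<phi> \<psi>. w \<in> dual T \<Longrightarrow> \<phi> \<in> X \<Longrightarrow> \<psi> \<in> X \<Longrightarrow>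
      (LINT x:A|lborel. \<phi> x * w (\<lambda>y. \<psi> (y + x))) = (LINT x:A|lborel. \<psi> x * w (\<lambda>y. \<phi> (x - y)))"
begin

lemma regular_apply: "\<phi> \<in> X \<Longrightarrow> regular T A g \<phi> = (LINT t:A|lborel. g t * \<phi> t)"
  by (simp add: regular_def)

lemma pairing_nondegenerate:
  assumes "\<phi> \<in> X" "\<psi> \<in> X" "\<And>g. g \<in> X \<Longrightarrow> (LINT t:A|lborel. g t * \<phi> t) = (LINT t:A|lborel. g t * \<psi> t)"
  shows "\<phi> = \<psi>"
proof -
  let ?d = "\<lambda>t. \<phi> t - \<psi> t"
  have d: "?d \<in> X" using assms by (intro diff_mem)
  have "(LINT t:A|lborel. ?d t * ?d t) = (LINT t:A|lborel. ?d t * \<phi> t) - (LINT t:A|lborel. ?d t * \<psi> t)"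
    using integrable_mult[OF d assms(1)] integrable_mult[OF d assms(2)]
    by (subst set_integral_diff(2)[symmetric]) (simp_all add: right_diff_distrib)
  also have "\<dots> = 0" using assms(3)[OF d] by simp
  finally have "?d = (\<lambda>_. 0)" by (rule definite[OF d])
  then show ?thesis by (simp add: fun_eq_iff)
qed

text \<open>The adjoint is a \<open>SOME\<close>, so a candidate and its uniqueness are both needed.
  The candidate is the transpose of the reflected map; uniqueness on the whole dual follows because
  any competitor is itself a transpose.\<close>

lemma adjoint_op_apply:
  assumes L: "lsi_operator T L"
    and G: "lsi_map G" "\<And>u \<phi>. u \<in> dual T \<Longrightarrow> \<phi> \<in> X \<Longrightarrow> L u \<phi> = u (G \<phi>)"
  shows "u \<in> dual T \<Longrightarrow> \<phi> \<in> X \<Longrightarrow> adjoint_op T A L u \<phi> = u (reflect (G (reflect \<phi>)))"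
proof -
  let ?P = "\<lambda>L'. lsi_operator T L' \<and>
     (\<forall>\<phi>1\<in>topspace T. \<forall>\<phi>2\<in>topspace T. L (regular T A \<phi>1) \<phi>2 = L' (regular T A \<phi>2) \<phi>1)"
  let ?G' = "\<lambda>\<phi>. reflect (G (reflect \<phi>))"
  have G': "lsi_map ?G'" by (rule lsi_map_reflect[OF G(1)])
  let ?w = "L (dirac T 0)"
  have w: "?w \<in> dual T" by (rule lsi_operator_dual[OF L dirac_mem])
  have Gx: "G \<phi> x = ?w (\<lambda>y. \<phi> (y + x))" if "\<phi> \<in> X" for \<phi> x
  proof -
    have "?w (\<lambda>y. \<phi> (y + x)) = G (\<lambda>y. \<phi> (y + x)) 0"
      using G(2)[OF dirac_mem shift_mem[OF that]] lsi_mapD(1)[OF G(1) shift_mem[OF that]] by simp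
    then show ?thesis using lsi_mapD(4)[OF G(1) that, of x] by simp
  qed
  have swap: "(LINT x:A|lborel. \<phi> x * G \<psi> x) = (LINT x:A|lborel. \<psi> x * ?G' \<phi> x)"
    if "\<phi> \<in> X" "\<psi> \<in> X" for \<phi> \<psi>
  proof -
    have "?G' \<phi> x = ?w (\<lambda>y. \<phi> (x - y))" for x
      using Gx[OF reflect_in[OF that(1)], of "- x"] by (simp add: reflect_eq)
    then show ?thesis using convolution_swap[OF w that] Gx[OF that(2)] by simp
  qed
  have P0: "?P (\<lambda>u. \<lambda>\<phi>\<in>X. u (?G' \<phi>))"
  proof (intro conjI ballI)
    show "lsi_operator T (\<lambda>u. \<lambda>\<phi>\<in>X. u (?G' \<phi>))" by (rule lsi_map_operator[OF G'])
    fix \<phi>1 \<phi>2 assume "\<phi>1 \<in> topspace T" "\<phi>2 \<in> topspace T"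
    then have \<phi>: "\<phi>1 \<in> X" "\<phi>2 \<in> X" by simp_all
    then show "L (regular T A \<phi>1) \<phi>2 = (\<lambda>\<phi>\<in>X. regular T A \<phi>2 (?G' \<phi>)) \<phi>1"
      using swap[OF \<phi>] by (simp add: G(2) regular_mem regular_apply lsi_mapD[OF G(1)] lsi_mapD(1)[OF G'])
  qed
  have P: "?P (adjoint_op T A L)" unfolding adjoint_op_def by (rule someI[of ?P, OF P0])
  then obtain G'' where G'': "lsi_map G''" "\<And>u \<phi>. u \<in> dual T \<Longrightarrow> \<phi> \<in> X \<Longrightarrow> adjoint_op T A L u \<phi> = u (G'' \<phi>)"
    using lsi_operator_transpose by blast
  \<comment> \<open>The defining identity is known only for regular functionals of test functions,
    but it determines the map of test functions and with it the operator everywhere.\<close>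
  have "G'' \<phi> = ?G' \<phi>" if \<phi>: "\<phi> \<in> X" for \<phi>
  proof (rule pairing_nondegenerate)
    fix g assume g: "g \<in> X"
    have "L (regular T A \<phi>) g = adjoint_op T A L (regular T A g) \<phi>" using P \<phi> g by simp
    then show "(LINT t:A|lborel. g t * G'' \<phi> t) = (LINT t:A|lborel. g t * ?G' \<phi> t)"
      using swap[OF \<phi> g] g \<phi> by (simp add: G(2) G''(2) regular_mem regular_apply lsi_mapD[OF G(1)] lsi_mapD(1)[OF G''(1)])
  qed (use \<phi> lsi_mapD(1)[OF G'] lsi_mapD(1)[OF G''(1)] in auto)
  then show "u \<in> dual T \<Longrightarrow> \<phi> \<in> X \<Longrightarrow> adjoint_op T A L u \<phi> = u (?G' \<phi>)" using G''(2) by simp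
qed

end

text \<open>On test functions, an admissible operator is transpose to \<open>\<phi> \<mapsto> (-1)\<^sup>N B D\<^sup>N \<phi>\<close>
  and its adjoint to \<open>\<phi> \<mapsto> B' D\<^sup>N \<phi>\<close>, where \<open>B\<close> is the transpose of the invertible factor
  and \<open>B'\<close> its conjugate by the reflection.\<close>

locale admissible_op = test_pairing +
  fixes N :: nat and L :: "gfun \<Rightarrow> gfun" and B Binv :: "(real \<Rightarrow> real) \<Rightarrow> real \<Rightarrow> real"
  assumes B: "lsi_map B" and Binv: "lsi_map Binv"
    and B_Binv: "\<And>\<phi>. \<phi> \<in> X \<Longrightarrow> B (Binv \<phi>) = \<phi>" and Binv_B: "\<And>\<phi>. \<phi> \<in> X \<Longrightarrow> Binv (B \<phi>) = \<phi>"
    and L_lsi: "lsi_operator T L"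
    and L_apply: "\<And>u \<phi>. u \<in> dual T \<Longrightarrow> \<phi> \<in> X \<Longrightarrow> L u \<phi> = (-1) ^ N * u (B ((deriv ^^ N) \<phi>))"
begin

definition B' where "B' \<phi> = reflect (B (reflect \<phi>))"
definition B'inv where "B'inv \<phi> = reflect (Binv (reflect \<phi>))"

lemma B': "lsi_map B'" and B'inv: "lsi_map B'inv"
  unfolding B'_def B'inv_def by (intro lsi_map_reflect B Binv)+

lemma B'_B'inv: "\<phi> \<in> X \<Longrightarrow> B' (B'inv \<phi>) = \<phi>" and B'inv_B': "\<phi> \<in> X \<Longrightarrow> B'inv (B' \<phi>) = \<phi>"
  by (simp_all add: B'_def B'inv_def reflect_in B_Binv Binv_B)

lemma L_dual: "u \<in> dual T \<Longrightarrow> L u \<in> dual T"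
  by (rule lsi_operator_dual[OF L_lsi])

lemma L_transpose:
  "\<exists>G. lsi_map G \<and> (\<forall>u\<in>dual T. \<forall>\<phi>\<in>X. L u \<phi> = u (G \<phi>)) \<and>
     (\<forall>\<phi>\<in>X. G \<phi> = (\<lambda>t. (-1) ^ N * B ((deriv ^^ N) \<phi>) t))"
proof -
  obtain G where G: "lsi_map G" "\<And>u \<phi>. u \<in> dual T \<Longrightarrow> \<phi> \<in> X \<Longrightarrow> L u \<phi> = u (G \<phi>)"
    using lsi_operator_transpose[OF L_lsi] by blast
  have "G \<phi> t = (-1) ^ N * B ((deriv ^^ N) \<phi>) t" if "\<phi> \<in> X" for \<phi> t
    using G(2)[OF dirac_mem that, of t] L_apply[OF dirac_mem that, of t]
      lsi_mapD(1)[OF G(1) that] lsi_mapD(1)[OF B iter_mem[OF that]] by simp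
  then show ?thesis using G by blast
qed

lemma adjoint_apply:
  assumes "u \<in> dual T" "\<phi> \<in> X"
  shows "adjoint_op T A L u \<phi> = u (B' ((deriv ^^ N) \<phi>))"
proof -
  obtain G where G: "lsi_map G" "\<And>u \<phi>. u \<in> dual T \<Longrightarrow> \<phi> \<in> X \<Longrightarrow> L u \<phi> = u (G \<phi>)"
    "\<And>\<phi>. \<phi> \<in> X \<Longrightarrow> G \<phi> = (\<lambda>t. (-1) ^ N * B ((deriv ^^ N) \<phi>) t)"
    using L_transpose by blast
  have mem: "reflect ((deriv ^^ N) \<phi>) \<in> X" by (intro reflect_in iter_mem assms)
  have "B ((deriv ^^ N) (reflect \<phi>)) = (\<lambda>t. (-1) ^ N * B (reflect ((deriv ^^ N) \<phi>)) t)"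
    unfolding deriv_iter_reflect_in[OF assms(2)] by (rule lsi_mapD(3)[OF B mem])
  then have "G (reflect \<phi>) = B (reflect ((deriv ^^ N) \<phi>))"
    using assms by (simp add: G(3) reflect_in flip: mult.assoc power_mult_distrib)
  then show ?thesis
    using adjoint_op_apply[OF L_lsi G(1,2) assms] by (simp add: B'_def)
qed

end

text \<open>The inverse relations between operators become inverse relations between their
  transposes when applied to Dirac functionals; transposition reverses the order of
  composition.\<close>

lemma (in test_pairing) admissible_imp_admissible_op:
  assumes "admissible T N L"
  shows "\<exists>B Binv. admissible_op T X M A N L B Binv"
proof -
  obtain L1 L2 where L: "lsi_operator T L" and L1: "lsi_operator T L1" and L2: "lsi_operator T L2"
    and inv: "\<forall>u\<in>dual T. L2 (L1 u) = u \<and> L1 (L2 u) = u"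
    and LD: "\<forall>u\<in>dual T. L u = (gderiv T ^^ N) (L1 u)"
    using assms unfolding admissible_def by blast
  obtain B where B: "lsi_map B" "\<And>u \<phi>. u \<in> dual T \<Longrightarrow> \<phi> \<in> X \<Longrightarrow> L1 u \<phi> = u (B \<phi>)"
    using lsi_operator_transpose[OF L1] by blast
  obtain Bi where Bi: "lsi_map Bi" "\<And>u \<phi>. u \<in> dual T \<Longrightarrow> \<phi> \<in> X \<Longrightarrow> L2 u \<phi> = u (Bi \<phi>)"
    using lsi_operator_transpose[OF L2] by blast
  have 1: "B (Bi \<phi>) = \<phi>" "Bi (B \<phi>) = \<phi>" if \<phi>: "\<phi> \<in> X" for \<phi>
  proof -
    have "B (Bi \<phi>) x = \<phi> x \<and> Bi (B \<phi>) x = \<phi> x" for x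
    proof -
      let ?d = "dirac T x"
      have d: "?d \<in> dual T" "L1 ?d \<in> dual T" "L2 ?d \<in> dual T"
        using lsi_operator_dual[OF L1] lsi_operator_dual[OF L2] by simp_all
      have "L2 (L1 ?d) \<phi> = B (Bi \<phi>) x"
        using d \<phi> by (simp add: B(2) Bi(2) lsi_mapD(1)[OF B(1)] lsi_mapD(1)[OF Bi(1)])
      moreover have "L1 (L2 ?d) \<phi> = Bi (B \<phi>) x"
        using d \<phi> by (simp add: B(2) Bi(2) lsi_mapD(1)[OF B(1)] lsi_mapD(1)[OF Bi(1)])
      ultimately show ?thesis using inv d(1) \<phi> by simp
    qed
    then show "B (Bi \<phi>) = \<phi>" "Bi (B \<phi>) = \<phi>" by auto
  qed
  have "L u \<phi> = (-1) ^ N * u (B ((deriv ^^ N) \<phi>))" if "u \<in> dual T" "\<phi> \<in> X" for u \<phi>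
    using LD that by (simp add: gderiv_iter lsi_operator_dual[OF L1] B(2) iter_mem)
  then have "admissible_op T X M A N L B Bi"
    by unfold_locales (use B(1) Bi(1) 1 L in auto)
  then show ?thesis by blast
qed

subsection \<open>The Schwartz space\<close>

text \<open>Dominated convergence for the difference quotients, which the mean value theorem turns
  into values of \<open>\<phi>'\<close> at points displaced by at most 1.\<close>

lemma correlation_has_derivative:
  fixes g \<phi> \<phi>' :: "real \<Rightarrow> real"
  assumes der: "\<And>t. (\<phi> has_real_derivative \<phi>' t) (at t)" and cont: "continuous_on UNIV \<phi>'"
    and g[measurable]: "g \<in> borel_measurable borel"
    and int: "\<And>y. integrable lborel (\<lambda>x. g x * \<phi> (y + x))"
    and G: "integrable lborel G" "\<And>h x. \<bar>h\<bar> \<le> 1 \<Longrightarrow> \<bar>g x * \<phi>' (y + h + x)\<bar> \<le> G x"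
  shows "((\<lambda>y. LINT x|lborel. g x * \<phi> (y + x)) has_real_derivative (LINT x|lborel. g x * \<phi>' (y + x))) (at y)"
proof -
  let ?C = "\<lambda>y. LINT x|lborel. g x * \<phi> (y + x)"
  have [measurable]: "\<phi> \<in> borel_measurable borel" "\<phi>' \<in> borel_measurable borel"
    using cont der by (auto intro!: borel_measurable_continuous_onI DERIV_continuous_on)
  \<comment> \<open>Increments are confined to \<open>{-1<..<1}\<close> so that the majorant
    \<open>G\<close> applies to every term of the sequence and not only eventually.\<close>
  have "((\<lambda>h. (?C (y + h) - ?C y) / h) \<longlongrightarrow> (LINT x|lborel. g x * \<phi>' (y + x))) (at 0 within {-1<..<1})"
    unfolding tendsto_at_iff_sequentially
  proof (intro allI impI)
    fix Z :: "nat \<Rightarrow> real" assume Z: "\<forall>i. Z i \<in> {-1<..<1} - {0}" "Z \<longlonglongrightarrow> 0"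
    let ?q = "\<lambda>i x. g x * ((\<phi> (y + Z i + x) - \<phi> (y + x)) / Z i)"
    have "(\<lambda>i. LINT x|lborel. ?q i x) \<longlonglongrightarrow> (LINT x|lborel. g x * \<phi>' (y + x))"
    proof (rule integral_dominated_convergence[where w = G])
      show "AE x in lborel. (\<lambda>i. ?q i x) \<longlonglongrightarrow> g x * \<phi>' (y + x)"
      proof (rule AE_I2, rule tendsto_mult_left)
        fix x
        have "((\<lambda>h. (\<phi> (y + x + h) - \<phi> (y + x)) / h) \<longlongrightarrow> \<phi>' (y + x)) (at 0)"
          using der[of "y + x"] by (simp add: DERIV_def)
        then have "((\<lambda>h. (\<phi> (y + x + h) - \<phi> (y + x)) / h) \<circ> Z) \<longlonglongrightarrow> \<phi>' (y + x)"
          unfolding tendsto_at_iff_sequentially using Z by blast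
        then show "(\<lambda>i. (\<phi> (y + Z i + x) - \<phi> (y + x)) / Z i) \<longlonglongrightarrow> \<phi>' (y + x)"
          by (simp add: o_def add_ac)
      qed
      fix i
      show "AE x in lborel. norm (?q i x) \<le> G x"
      proof (rule AE_I2)
        fix x
        have Zi: "Z i \<noteq> 0" "\<bar>Z i\<bar> \<le> 1" using Z(1)[rule_format, of i] by auto
        have "\<exists>h. \<bar>h\<bar> \<le> 1 \<and> \<phi> (y + Z i + x) - \<phi> (y + x) = Z i * \<phi>' (y + h + x)"
        proof (cases "Z i > 0")
          case True
          then have "y + x < y + Z i + x" by simp
          from MVT2[OF this, of \<phi> \<phi>'] der obtain z where
            "y + x < z" "z < y + Z i + x" "\<phi> (y + Z i + x) - \<phi> (y + x) = (y + Z i + x - (y + x)) * \<phi>' z"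
            by blast
          then show ?thesis using Zi by (intro exI[of _ "z - y - x"]) auto
        next
          case False
          then have "y + Z i + x < y + x" using Zi by simp
          from MVT2[OF this, of \<phi> \<phi>'] der obtain z where
            "y + Z i + x < z" "z < y + x" "\<phi> (y + x) - \<phi> (y + Z i + x) = (y + x - (y + Z i + x)) * \<phi>' z"
            by blast
          then show ?thesis using Zi by (intro exI[of _ "z - y - x"]) (auto simp: algebra_simps)
        qed
        then obtain h where h: "\<bar>h\<bar> \<le> 1" "\<phi> (y + Z i + x) - \<phi> (y + x) = Z i * \<phi>' (y + h + x)" by blast
        show "norm (?q i x) \<le> G x" unfolding h(2) using G(2)[OF h(1), of x] Zi by simp
      qed
    qed (use G in auto)
    moreover have "(?C (y + Z i) - ?C y) / Z i = (LINT x|lborel. ?q i x)" for i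
    proof -
      have "?C (y + Z i) - ?C y = (LINT x|lborel. g x * \<phi> (y + Z i + x) - g x * \<phi> (y + x))"
        by (rule Bochner_Integration.integral_diff[symmetric]; rule int)
      also have "\<dots> = (LINT x|lborel. g x * (\<phi> (y + Z i + x) - \<phi> (y + x)))"
        by (simp add: right_diff_distrib)
      finally show ?thesis by simp
    qed
    ultimately show "((\<lambda>h. (?C (y + h) - ?C y) / h) \<circ> Z) \<longlonglongrightarrow> (LINT x|lborel. g x * \<phi>' (y + x))"
      unfolding o_def by (simp only:)
  qed
  moreover have "at 0 within {-1<..<1} = at (0::real)" by (rule at_within_open) auto
  ultimately show ?thesis by (simp add: DERIV_def)
qed

lemma
  fixes g \<phi> :: "real \<Rightarrow> real"
  assumes sm: "smooth \<phi>" and g[measurable]: "g \<in> borel_measurable borel"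
    and dom: "\<And>n y. \<exists>G. integrable lborel G \<and> (\<forall>h x. \<bar>h\<bar> \<le> 1 \<longrightarrow> \<bar>g x * (deriv ^^ n) \<phi> (y + h + x)\<bar> \<le> G x)"
  shows smooth_correlation: "smooth (\<lambda>y. LINT x|lborel. g x * \<phi> (y + x))"
    and deriv_iter_correlation: "(deriv ^^ n) (\<lambda>y. LINT x|lborel. g x * \<phi> (y + x)) =
         (\<lambda>y. LINT x|lborel. g x * (deriv ^^ n) \<phi> (y + x))"
proof -
  let ?F = "\<lambda>n y. LINT x|lborel. g x * (deriv ^^ n) \<phi> (y + x)"
  have cont: "continuous_on UNIV ((deriv ^^ n) \<phi>)" for n by (intro smooth_continuous smooth_iter sm)
  have [measurable]: "(deriv ^^ n) \<phi> \<in> borel_measurable borel" for n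
    using cont by (rule borel_measurable_continuous_onI)
  have int: "integrable lborel (\<lambda>x. g x * (deriv ^^ n) \<phi> (y + x))" for n y
  proof -
    obtain G where G: "integrable lborel G" "\<And>h x. \<bar>h\<bar> \<le> 1 \<Longrightarrow> \<bar>g x * (deriv ^^ n) \<phi> (y + h + x)\<bar> \<le> G x"
      using dom[of n y] by blast
    show ?thesis
    proof (rule Bochner_Integration.integrable_bound[OF G(1)])
      show "AE x in lborel. norm (g x * (deriv ^^ n) \<phi> (y + x)) \<le> norm (G x)"
        using G(2)[of 0] by (intro AE_I2) (auto intro: order_trans[OF _ abs_ge_self])
    qed simp
  qed
  have 1: "(?F n has_real_derivative ?F (Suc n) y) (at y)" for n y
  proof -
    obtain G where G: "integrable lborel G" "\<And>h x. \<bar>h\<bar> \<le> 1 \<Longrightarrow> \<bar>g x * (deriv ^^ Suc n) \<phi> (y + h + x)\<bar> \<le> G x"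
      using dom[of "Suc n" y] by blast
    show ?thesis
      by (rule correlation_has_derivative[OF deriv_iter_has_derivative[OF sm] cont g int G])
  qed
  show "smooth (\<lambda>y. LINT x|lborel. g x * \<phi> (y + x))" by (rule smoothI[of ?F, OF _ 1]) simp
  show "(deriv ^^ n) (\<lambda>y. LINT x|lborel. g x * \<phi> (y + x)) = ?F n"
    by (rule deriv_iter_eqI[of ?F, OF _ 1]) simp
qed

section \<open>Decay, growth and integrability on the line\<close>

lemma integrable_inverse_square: "integrable lborel (\<lambda>t::real. 1 / (1 + t\<^sup>2))"
proof -
  have nz: "1 + t\<^sup>2 \<noteq> 0" for t :: real by (metis add_pos_nonneg less_irrefl zero_le_power2 zero_less_one)
  have "set_integrable lborel (einterval (-\<infinity>) \<infinity>) (\<lambda>t::real. 1 / (1 + t\<^sup>2))"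
  proof (rule interval_integral_FTC_nonneg[where F = arctan and A = "-(pi/2)" and B = "pi/2"])
    show "(arctan has_real_derivative 1 / (1 + x\<^sup>2)) (at x)" for x
      using DERIV_arctan[of x] by (simp add: inverse_eq_divide)
    show "isCont (\<lambda>t. 1 / (1 + t\<^sup>2)) x" for x :: real
      using nz[of x] by (intro continuous_intros) auto
    show "((arctan \<circ> real_of_ereal) \<longlongrightarrow> - (pi / 2)) (at_right (- \<infinity>))"
      unfolding ereal_tendsto_simps by (rule tendsto_arctan_at_bot)
    show "((arctan \<circ> real_of_ereal) \<longlongrightarrow> pi / 2) (at_left \<infinity>)"
      unfolding ereal_tendsto_simps by (rule tendsto_arctan_at_top)
  qed (auto simp: add_nonneg_nonneg)
  then show ?thesis by (simp add: set_integrable_def)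
qed

text \<open>The number pi, in its role as the constant that converts a pointwise bound with weight
  \<open>1 + t^2\<close> into a bound on the integral.\<close>

definition cauchy_mass :: real where "cauchy_mass = (LINT t|lborel. 1 / (1 + t\<^sup>2))"

lemma cauchy_mass_nonneg: "0 \<le> cauchy_mass"
  unfolding cauchy_mass_def by (rule integral_nonneg_AE) simp

lemma
  fixes f :: "real \<Rightarrow> real"
  assumes f[measurable]: "f \<in> borel_measurable borel" and B: "\<And>t. (1 + t\<^sup>2) * \<bar>f t\<bar> \<le> B"
  shows decay_integrable: "integrable lborel f"
    and decay_integral_bound: "\<bar>LINT t|lborel. f t\<bar> \<le> B * cauchy_mass"
proof -
  have le: "\<bar>f t\<bar> \<le> B * (1 / (1 + t\<^sup>2))" for t
  proof -
    have "0 < 1 + t\<^sup>2" by (simp add: add_pos_nonneg)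
    then show ?thesis using B[of t] by (simp add: pos_le_divide_eq mult.commute)
  qed
  have int: "integrable lborel (\<lambda>t. B * (1 / (1 + t\<^sup>2)))"
    using integrable_inverse_square by (rule integrable_mult_right)
  show f': "integrable lborel f"
  proof (rule Bochner_Integration.integrable_bound[OF int])
    show "AE t in lborel. norm (f t) \<le> norm (B * (1 / (1 + t\<^sup>2)))"
      unfolding real_norm_def by (intro AE_I2 order_trans[OF le abs_ge_self])
  qed simp
  have "norm (LINT t|lborel. f t) \<le> (LINT t|lborel. B * (1 / (1 + t\<^sup>2)))"
    by (rule Bochner_Integration.integral_norm_bound_integral[OF f' int]) (use le in simp)
  then show "\<bar>LINT t|lborel. f t\<bar> \<le> B * cauchy_mass"
    by (simp only: cauchy_mass_def integral_mult_right_zero real_norm_def)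
qed

lemma schwartz_iff:
  "f \<in> schwartz \<longleftrightarrow> smooth f \<and> (\<forall>m n. \<exists>B. \<forall>t. \<bar>t ^ m * (deriv ^^ n) f t\<bar> \<le> B)"
  by (auto simp: schwartz_def bounded_iff)

lemma schwartz_smooth: "f \<in> schwartz \<Longrightarrow> smooth f"
  by (simp add: schwartz_iff)

lemma power_one_add_le:
  fixes s :: real
  assumes "0 \<le> s"
  shows "(1 + s) ^ m \<le> 2 ^ m * (1 + s ^ m)"
proof -
  have "(1 + s) ^ m \<le> (2 * max 1 s) ^ m" using assms by (intro power_mono) auto
  also have "\<dots> = 2 ^ m * max 1 s ^ m" by (simp add: power_mult_distrib)
  also have "max 1 s ^ m \<le> 1 + s ^ m" using assms by (cases "1 \<le> s") (auto simp: max_def)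
  finally show ?thesis by simp
qed

lemma schwartz_weight_bound:
  assumes "\<phi> \<in> schwartz"
  shows "\<exists>B\<ge>0. \<forall>t. (1 + \<bar>t\<bar>) ^ m * \<bar>(deriv ^^ n) \<phi> t\<bar> \<le> B"
proof -
  obtain B C where B: "\<And>t. \<bar>t ^ m * (deriv ^^ n) \<phi> t\<bar> \<le> B" and C: "\<And>t. \<bar>t ^ 0 * (deriv ^^ n) \<phi> t\<bar> \<le> C"
    using assms unfolding schwartz_iff by meson
  have le: "(1 + \<bar>t\<bar>) ^ m * \<bar>(deriv ^^ n) \<phi> t\<bar> \<le> 2 ^ m * (C + B)" for t
  proof -
    have "(1 + \<bar>t\<bar>) ^ m * \<bar>(deriv ^^ n) \<phi> t\<bar> \<le> (2 ^ m * (1 + \<bar>t\<bar> ^ m)) * \<bar>(deriv ^^ n) \<phi> t\<bar>"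
      by (intro mult_right_mono power_one_add_le) auto
    also have "\<dots> = 2 ^ m * (\<bar>(deriv ^^ n) \<phi> t\<bar> + \<bar>t ^ m * (deriv ^^ n) \<phi> t\<bar>)"
      by (simp add: abs_mult power_abs algebra_simps)
    also have "\<dots> \<le> 2 ^ m * (C + B)" using B[of t] C[of t] by (intro mult_left_mono add_mono) auto
    finally show ?thesis .
  qed
  have "0 \<le> 2 ^ m * (C + B)" by (rule order_trans[OF _ le[of 0]]) simp
  then show ?thesis using le by blast
qed

text \<open>A Peetre-type inequality, \<open>\<bar>y\<bar> \<le> (1 + \<bar>y + x\<bar>) * (1 +
  \<bar>x\<bar>)\<close>: translating by \<open>x\<close> costs only a polynomial factor in
  \<open>x\<close>.\<close>

lemma schwartz_translate_bound:
  assumes "\<phi> \<in> schwartz"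
  shows "\<exists>B\<ge>0. \<forall>x y. \<bar>y ^ m * (deriv ^^ n) \<phi> (y + x)\<bar> \<le> B * (1 + \<bar>x\<bar>) ^ m"
proof -
  obtain B where B: "B \<ge> 0" "\<And>t. (1 + \<bar>t\<bar>) ^ m * \<bar>(deriv ^^ n) \<phi> t\<bar> \<le> B"
    using schwartz_weight_bound[OF assms] by blast
  have "\<bar>y ^ m * (deriv ^^ n) \<phi> (y + x)\<bar> \<le> B * (1 + \<bar>x\<bar>) ^ m" for x y
  proof -
    have "\<bar>y\<bar> \<le> \<bar>y + x\<bar> + \<bar>x\<bar>" by simp
    also have "\<dots> \<le> (1 + \<bar>y + x\<bar>) * (1 + \<bar>x\<bar>)" by (simp add: algebra_simps)
    finally have "\<bar>y\<bar> ^ m \<le> ((1 + \<bar>y + x\<bar>) * (1 + \<bar>x\<bar>)) ^ m" by (intro power_mono) auto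
    then have "\<bar>y\<bar> ^ m * \<bar>(deriv ^^ n) \<phi> (y + x)\<bar> \<le> ((1 + \<bar>y + x\<bar>) * (1 + \<bar>x\<bar>)) ^ m * \<bar>(deriv ^^ n) \<phi> (y + x)\<bar>"
      by (rule mult_right_mono) simp
    also have "\<dots> = (1 + \<bar>y + x\<bar>) ^ m * \<bar>(deriv ^^ n) \<phi> (y + x)\<bar> * (1 + \<bar>x\<bar>) ^ m"
      by (simp add: power_mult_distrib)
    also have "\<dots> \<le> B * (1 + \<bar>x\<bar>) ^ m" using B(2) by (intro mult_right_mono) auto
    finally show ?thesis by (simp add: abs_mult power_abs)
  qed
  then show ?thesis using B(1) by blast
qed

lemma schwartz_reflect: assumes "f \<in> schwartz" shows "(\<lambda>t. f (- t)) \<in> schwartz"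
  unfolding schwartz_iff
proof (intro conjI allI)
  have sm: "smooth f" by (rule schwartz_smooth[OF assms])
  show "smooth (\<lambda>t. f (- t))" by (rule smooth_reflect[OF sm])
  fix m n
  obtain B where B: "\<And>t. \<bar>t ^ m * (deriv ^^ n) f t\<bar> \<le> B" using assms unfolding schwartz_iff by blast
  have "\<bar>t ^ m * (deriv ^^ n) (\<lambda>t. f (- t)) t\<bar> \<le> B" for t
    using B[of "- t"] by (simp add: deriv_iter_reflect[OF sm] abs_mult power_abs)
  then show "\<exists>B. \<forall>t. \<bar>t ^ m * (deriv ^^ n) (\<lambda>t. f (- t)) t\<bar> \<le> B" by blast
qed

lemma schwartz_interval_correlation:
  assumes f: "f \<in> schwartz" and g: "continuous_on {a..b} g"
  shows "(\<lambda>y. integral {a..b} (\<lambda>x. g x * f (y + x))) \<in> schwartz"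
  unfolding schwartz_iff
proof (intro conjI allI)
  have sm: "smooth f" by (rule schwartz_smooth[OF f])
  show "smooth (\<lambda>y. integral {a..b} (\<lambda>x. g x * f (y + x)))" by (rule smooth_interval_correlation[OF sm g])
  fix m n
  obtain B where B: "B \<ge> 0" "\<And>x y. \<bar>y ^ m * (deriv ^^ n) f (y + x)\<bar> \<le> B * (1 + \<bar>x\<bar>) ^ m"
    using schwartz_translate_bound[OF f] by blast
  have "continuous_on {a..b} (\<lambda>x. g x * (B * (1 + \<bar>x\<bar>) ^ m))" using g by (intro continuous_intros)
  then have "bounded ((\<lambda>x. g x * (B * (1 + \<bar>x\<bar>) ^ m)) ` {a..b})"
    by (intro compact_imp_bounded compact_continuous_image compact_Icc)
  then obtain Q where Q': "\<forall>z\<in>(\<lambda>x. g x * (B * (1 + \<bar>x\<bar>) ^ m)) ` {a..b}. norm z \<le> Q"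
    unfolding bounded_iff by blast
  have Q: "\<bar>g x * (B * (1 + \<bar>x\<bar>) ^ m)\<bar> \<le> Q" if "x \<in> {a..b}" for x
    using bspec[OF Q' imageI[OF that]] by (simp only: real_norm_def)
  have "\<bar>y ^ m * integral {a..b} (\<lambda>x. g x * (deriv ^^ n) f (y + x))\<bar> \<le> \<bar>Q\<bar> * \<bar>b - a\<bar>" for y
  proof (cases "a \<le> b")
    case True
    have c: "continuous_on {a..b} (\<lambda>x. y ^ m * (g x * (deriv ^^ n) f (y + x)))"
      by (intro continuous_intros g continuous_on_compose2[OF smooth_continuous[OF smooth_iter[OF sm], of UNIV]]) auto
    have "norm (integral {a..b} (\<lambda>x. y ^ m * (g x * (deriv ^^ n) f (y + x)))) \<le> \<bar>Q\<bar> * (b - a)"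
    proof (rule integral_bound[OF True c])
      fix x assume x: "x \<in> {a..b}"
      have "norm (y ^ m * (g x * (deriv ^^ n) f (y + x))) = \<bar>g x\<bar> * \<bar>y ^ m * (deriv ^^ n) f (y + x)\<bar>"
        by (simp add: abs_mult)
      also have "\<dots> \<le> \<bar>g x\<bar> * (B * (1 + \<bar>x\<bar>) ^ m)" using B(2) by (intro mult_left_mono) auto
      also have "\<dots> = \<bar>g x * (B * (1 + \<bar>x\<bar>) ^ m)\<bar>" using B(1) by (simp add: abs_mult)
      finally show "norm (y ^ m * (g x * (deriv ^^ n) f (y + x))) \<le> \<bar>Q\<bar>" using Q[OF x] by linarith
    qed
    then show ?thesis using True by simp
  qed simp
  then show "\<exists>B. \<forall>y. \<bar>y ^ m * (deriv ^^ n) (\<lambda>y. integral {a..b} (\<lambda>x. g x * f (y + x))) y\<bar> \<le> B"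
    unfolding deriv_iter_interval_correlation[OF sm g] by blast
qed

interpretation SR: test_space SR schwartz UNIV
proof
  show "SR = seminorm_topology schwartz {\<lambda>f. SUP t. \<bar>t ^ m * (deriv ^^ n) f t\<bar> | m n. m \<in> UNIV}"
    unfolding SR_def by simp
  show "(\<lambda>_. 0) \<in> schwartz" by (auto simp: schwartz_iff smooth_const deriv_iter_zero)
next
  fix f g assume fg: "f \<in> schwartz" "g \<in> schwartz"
  show "(\<lambda>t. f t + g t) \<in> schwartz"
    unfolding schwartz_iff
  proof (intro conjI allI)
    show "smooth (\<lambda>t. f t + g t)" using fg by (intro smooth_add schwartz_smooth)
    fix m n
    obtain B C where B: "\<And>t. \<bar>t ^ m * (deriv ^^ n) f t\<bar> \<le> B" and C: "\<And>t. \<bar>t ^ m * (deriv ^^ n) g t\<bar> \<le> C"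
      using fg unfolding schwartz_iff by meson
    have "\<bar>t ^ m * (deriv ^^ n) (\<lambda>t. f t + g t) t\<bar> \<le> B + C" for t
      using B[of t] C[of t] abs_triangle_ineq[of "t ^ m * (deriv ^^ n) f t" "t ^ m * (deriv ^^ n) g t"] fg
      by (simp add: deriv_iter_add schwartz_smooth distrib_left)
    then show "\<exists>B. \<forall>t. \<bar>t ^ m * (deriv ^^ n) (\<lambda>t. f t + g t) t\<bar> \<le> B" by blast
  qed
next
  fix c f assume f: "f \<in> schwartz"
  show "(\<lambda>t. c * f t) \<in> schwartz"
    unfolding schwartz_iff
  proof (intro conjI allI)
    show "smooth (\<lambda>t. c * f t)" using f by (intro smooth_scale schwartz_smooth)
    fix m n
    obtain B where B: "\<And>t. \<bar>t ^ m * (deriv ^^ n) f t\<bar> \<le> B" using f unfolding schwartz_iff by meson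
    have "\<bar>t ^ m * (deriv ^^ n) (\<lambda>t. c * f t) t\<bar> \<le> \<bar>c\<bar> * B" for t
      using mult_left_mono[OF B[of t], of "\<bar>c\<bar>"] f
      by (simp add: deriv_iter_scale schwartz_smooth abs_mult mult_ac)
    then show "\<exists>B. \<forall>t. \<bar>t ^ m * (deriv ^^ n) (\<lambda>t. c * f t) t\<bar> \<le> B" by blast
  qed
next
  fix f b assume f: "f \<in> schwartz"
  show "(\<lambda>t. f (t + b)) \<in> schwartz"
    unfolding schwartz_iff
  proof (intro conjI allI)
    show "smooth (\<lambda>t. f (t + b))" using f by (intro smooth_shift schwartz_smooth)
    fix m n
    obtain B where "\<And>x y. \<bar>y ^ m * (deriv ^^ n) f (y + x)\<bar> \<le> B * (1 + \<bar>x\<bar>) ^ m"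
      using schwartz_translate_bound[OF f] by blast
    then show "\<exists>B. \<forall>t. \<bar>t ^ m * (deriv ^^ n) (\<lambda>t. f (t + b)) t\<bar> \<le> B"
      using f by (auto simp: deriv_iter_shift schwartz_smooth)
  qed
next
  fix f assume f: "f \<in> schwartz"
  show "(\<lambda>t. f (- t)) \<in> schwartz" by (rule schwartz_reflect[OF f])
  show "deriv f \<in> schwartz" using f unfolding schwartz_iff by (auto simp: smooth_deriv deriv_iter_deriv simp del: funpow.simps)
next
  fix f g :: "real \<Rightarrow> real" and a b :: real assume "f \<in> schwartz" "continuous_on {a..b} g"
  then show "(\<lambda>y. integral {a..b} (\<lambda>x. g x * f (y + x))) \<in> schwartz"
    by (rule schwartz_interval_correlation)
qed (auto simp: schwartz_iff)

lemma schwartz_measurable [measurable_dest]: "\<phi> \<in> schwartz \<Longrightarrow> \<phi> \<in> borel_measurable borel"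
  by (intro borel_measurable_continuous_onI smooth_continuous schwartz_smooth)

lemma one_add_square_le: "1 + t\<^sup>2 \<le> (1 + \<bar>t\<bar>)\<^sup>2" for t :: real
  by (simp add: power2_eq_square algebra_simps)

text \<open>Growth of order \<open>k\<close> is compensated by decay of order \<open>k + 2\<close>;
  the two spare powers leave an integrable weight.\<close>

lemma
  fixes h :: "real \<Rightarrow> real"
  assumes [measurable]: "h \<in> borel_measurable borel" and h: "\<And>t. \<bar>h t\<bar> \<le> C * (1 + \<bar>t\<bar>) ^ k"
    and [measurable]: "\<phi> \<in> borel_measurable borel" and B: "\<And>t. (1 + \<bar>t\<bar>) ^ (k + 2) * \<bar>\<phi> t\<bar> \<le> B"
  shows moderate_integrable: "integrable lborel (\<lambda>t. h t * \<phi> t)"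
    and moderate_integral_bound: "\<bar>LINT t|lborel. h t * \<phi> t\<bar> \<le> C * B * cauchy_mass"
proof -
  have C: "C \<ge> 0" using h[of 0] abs_ge_zero[of "h 0"] by simp
  have le: "(1 + t\<^sup>2) * \<bar>h t * \<phi> t\<bar> \<le> C * B" for t
  proof -
    have "(1 + t\<^sup>2) * \<bar>h t * \<phi> t\<bar> \<le> (1 + \<bar>t\<bar>)\<^sup>2 * ((C * (1 + \<bar>t\<bar>) ^ k) * \<bar>\<phi> t\<bar>)"
      unfolding abs_mult by (intro mult_mono one_add_square_le h) (use C in auto)
    also have "\<dots> = C * ((1 + \<bar>t\<bar>) ^ (k + 2) * \<bar>\<phi> t\<bar>)" by (simp only: power_add mult_ac)
    also have "\<dots> \<le> C * B" using B C by (intro mult_left_mono)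
    finally show ?thesis .
  qed
  show "integrable lborel (\<lambda>t. h t * \<phi> t)" by (rule decay_integrable[OF _ le]) simp
  show "\<bar>LINT t|lborel. h t * \<phi> t\<bar> \<le> C * B * cauchy_mass" by (rule decay_integral_bound[OF _ le]) simp
qed

lemma moderate_integrable':
  fixes h :: "real \<Rightarrow> real"
  assumes "h \<in> borel_measurable borel" "\<And>t. \<bar>h t\<bar> \<le> C * (1 + \<bar>t\<bar>) ^ k" "\<phi> \<in> schwartz"
  shows "integrable lborel (\<lambda>t. h t * \<phi> t)"
  using moderate_integrable[OF assms(1,2) schwartz_measurable[OF assms(3)]]
    schwartz_weight_bound[OF assms(3), of "k + 2" 0] by auto

lemma regular_R_dual:
  fixes h :: "real \<Rightarrow> real"
  assumes h: "h \<in> borel_measurable borel" "\<And>t. \<bar>h t\<bar> \<le> C * (1 + \<bar>t\<bar>) ^ k"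
  shows "regular_R h \<in> dual SR"
proof (rule SR.dualI[where K = "k + 2" and C = "C * (2 ^ (k + 2) * 2) * cauchy_mass"])
  have ap: "regular_R h f = (LINT t|lborel. h t * f t)" if "f \<in> schwartz" for f
    using that by (simp add: regular_def set_lebesgue_integral_def)
  fix f g assume fg: "f \<in> schwartz" "g \<in> schwartz"
  then show "regular_R h (\<lambda>t. f t + g t) = regular_R h f + regular_R h g"
    using moderate_integrable'[OF h] by (simp add: ap SR.add_mem distrib_left)
next
  fix c f assume "f \<in> schwartz"
  then show "regular_R h (\<lambda>t. c * f t) = c * regular_R h f"
    by (simp add: regular_def set_lebesgue_integral_def SR.scale_mem mult.left_commute)
next
  fix f B assume f: "f \<in> schwartz" and B: "\<And>m n t. m \<in> UNIV \<Longrightarrow> m \<le> k + 2 \<Longrightarrow> n \<le> k + 2 \<Longrightarrow> \<bar>t ^ m * (deriv ^^ n) f t\<bar> \<le> B"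
  have "(1 + \<bar>t\<bar>) ^ (k + 2) * \<bar>f t\<bar> \<le> 2 ^ (k + 2) * 2 * B" for t
  proof -
    have "(1 + \<bar>t\<bar>) ^ (k + 2) * \<bar>f t\<bar> \<le> (2 ^ (k + 2) * (1 + \<bar>t\<bar> ^ (k + 2))) * \<bar>f t\<bar>"
      by (intro mult_right_mono power_one_add_le) auto
    also have "\<dots> = 2 ^ (k + 2) * (\<bar>t ^ 0 * (deriv ^^ 0) f t\<bar> + \<bar>t ^ (k + 2) * (deriv ^^ 0) f t\<bar>)"
      by (simp only: abs_mult power_abs funpow_0 power_0) (simp only: algebra_simps abs_one)
    also have "\<dots> \<le> 2 ^ (k + 2) * (B + B)" by (intro mult_left_mono add_mono B) auto
    finally show ?thesis by (simp only: mult_2 distrib_left mult.assoc)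
  qed
  from moderate_integral_bound[OF h schwartz_measurable[OF f] this]
  show "\<bar>regular_R h f\<bar> \<le> C * (2 ^ (k + 2) * 2) * cauchy_mass * B"
    using f by (simp add: regular_def set_lebesgue_integral_def mult_ac)
qed (simp add: regular_def)

lemma schwartz_bounded: "\<phi> \<in> schwartz \<Longrightarrow> \<exists>C\<ge>0. \<forall>t. \<bar>\<phi> t\<bar> \<le> C * (1 + \<bar>t\<bar>) ^ 0"
  using schwartz_weight_bound[of \<phi> 0 0] by auto

text \<open>Smoothness of the correlation comes from \<open>\<phi>\<close> and its decay from both
  factors, so \<open>g\<close> may be discontinuous. The density proof for \<open>C_0\<close>
  applies this to a truncated function.\<close>

lemma rapidly_decreasing_correlation:
  assumes gm[measurable]: "g \<in> borel_measurable borel" and g: "\<And>k. \<exists>Q\<ge>0. \<forall>t. (1 + \<bar>t\<bar>) ^ k * \<bar>g t\<bar> \<le> Q"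
    and \<phi>: "\<phi> \<in> schwartz"
  shows "(\<lambda>y. LINT x|lborel. g x * \<phi> (y + x)) \<in> schwartz"
    and "(deriv ^^ n) (\<lambda>y. LINT x|lborel. g x * \<phi> (y + x)) = (\<lambda>y. LINT x|lborel. g x * (deriv ^^ n) \<phi> (y + x))"
proof -
  have sm: "smooth \<phi>" by (rule schwartz_smooth[OF \<phi>])
  have [measurable]: "(deriv ^^ n) \<phi> \<in> borel_measurable borel" for n
    using schwartz_measurable[OF SR.iter_mem[OF \<phi>]] .
  have dom: "\<exists>G. integrable lborel G \<and> (\<forall>h x. \<bar>h\<bar> \<le> 1 \<longrightarrow> \<bar>g x * (deriv ^^ n) \<phi> (y + h + x)\<bar> \<le> G x)" for n y
  proof -
    obtain B where B: "B \<ge> 0" "\<And>t. (1 + \<bar>t\<bar>) ^ 0 * \<bar>(deriv ^^ n) \<phi> t\<bar> \<le> B"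
      using schwartz_weight_bound[OF \<phi>] by blast
    obtain Q where "\<And>t. (1 + \<bar>t\<bar>) ^ (0 + 2) * \<bar>g t\<bar> \<le> Q" using g[of "0 + 2"] by blast
    from moderate_integrable[of "\<lambda>_. 1" 1 0, OF _ _ gm this]
    have "integrable lborel (\<lambda>x. B * \<bar>g x\<bar>)" by simp
    moreover have "\<bar>g x * (deriv ^^ n) \<phi> (y + h + x)\<bar> \<le> B * \<bar>g x\<bar>" for h x
      using mult_left_mono[OF B(2)[of "y + h + x"], of "\<bar>g x\<bar>"] by (simp add: abs_mult mult.commute)
    ultimately show ?thesis by blast
  qed
  have D: "(deriv ^^ n) (\<lambda>y. LINT x|lborel. g x * \<phi> (y + x)) = (\<lambda>y. LINT x|lborel. g x * (deriv ^^ n) \<phi> (y + x))" for n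
    by (rule deriv_iter_correlation[OF sm _ dom]) simp
  then show "(deriv ^^ n) (\<lambda>y. LINT x|lborel. g x * \<phi> (y + x)) = (\<lambda>y. LINT x|lborel. g x * (deriv ^^ n) \<phi> (y + x))" .
  show "(\<lambda>y. LINT x|lborel. g x * \<phi> (y + x)) \<in> schwartz"
    unfolding schwartz_iff
  proof (intro conjI allI)
    show "smooth (\<lambda>y. LINT x|lborel. g x * \<phi> (y + x))" by (rule smooth_correlation[OF sm _ dom]) simp
    fix m n
    obtain B where B: "B \<ge> 0" "\<And>x y. \<bar>y ^ m * (deriv ^^ n) \<phi> (y + x)\<bar> \<le> B * (1 + \<bar>x\<bar>) ^ m"
      using schwartz_translate_bound[OF \<phi>] by blast
    obtain Q where Q: "Q \<ge> 0" "\<And>t. (1 + \<bar>t\<bar>) ^ (m + 2) * \<bar>g t\<bar> \<le> Q"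
      using g[of "m + 2"] by blast
    have "\<bar>y ^ m * (LINT x|lborel. g x * (deriv ^^ n) \<phi> (y + x))\<bar> \<le> B * Q * cauchy_mass" for y
    proof -
      have "\<bar>LINT x|lborel. (y ^ m * (deriv ^^ n) \<phi> (y + x)) * g x\<bar> \<le> B * Q * cauchy_mass"
        by (rule moderate_integral_bound[OF _ B(2) gm Q(2)]) simp
      moreover have "(\<lambda>x. (y ^ m * (deriv ^^ n) \<phi> (y + x)) * g x) = (\<lambda>x. y ^ m * (g x * (deriv ^^ n) \<phi> (y + x)))"
        by (simp only: mult_ac)
      ultimately show ?thesis by (simp only: integral_mult_right_zero)
    qed
    then show "\<exists>B. \<forall>y. \<bar>y ^ m * (deriv ^^ n) (\<lambda>y. LINT x|lborel. g x * \<phi> (y + x)) y\<bar> \<le> B"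
      unfolding D by blast
  qed
qed

lemma
  assumes g: "g \<in> schwartz" and \<phi>: "\<phi> \<in> schwartz"
  shows schwartz_correlation: "(\<lambda>y. LINT x|lborel. g x * \<phi> (y + x)) \<in> schwartz"
    and deriv_iter_schwartz_correlation:
      "(deriv ^^ n) (\<lambda>y. LINT x|lborel. g x * \<phi> (y + x)) = (\<lambda>y. LINT x|lborel. g x * (deriv ^^ n) \<phi> (y + x))"
proof -
  have "\<exists>Q\<ge>0. \<forall>t. (1 + \<bar>t\<bar>) ^ k * \<bar>g t\<bar> \<le> Q" for k using schwartz_weight_bound[OF g, of k 0] by simp
  from rapidly_decreasing_correlation[OF schwartz_measurable[OF g] this \<phi>]
  show "(\<lambda>y. LINT x|lborel. g x * \<phi> (y + x)) \<in> schwartz"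
    "(deriv ^^ n) (\<lambda>y. LINT x|lborel. g x * \<phi> (y + x)) = (\<lambda>y. LINT x|lborel. g x * (deriv ^^ n) \<phi> (y + x))" .
qed

lemma tendsto_integral_interval:
  fixes f :: "real \<Rightarrow> real"
  assumes f: "integrable lborel f"
  shows "(\<lambda>k. LINT x|lborel. indicator {- real k..real k} x * f x) \<longlonglongrightarrow> (LINT x|lborel. f x)"
proof (rule integral_dominated_convergence[where w = "\<lambda>x. \<bar>f x\<bar>"])
  have [measurable]: "f \<in> borel_measurable lborel" using f by auto
  show "f \<in> borel_measurable lborel" by simp
  show "(\<lambda>x. indicator {- real i..real i} x * f x) \<in> borel_measurable lborel" for i by simp
  show "AE x in lborel. (\<lambda>k. indicator {- real k..real k} x * f x) \<longlonglongrightarrow> f x"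
  proof (rule AE_I2, rule tendsto_eventually)
    fix x :: real
    obtain n where "\<bar>x\<bar> \<le> real n" using real_arch_simple by blast
    then have "indicator {- real k..real k} x * f x = f x" if "n \<le> k" for k
      using that by (auto simp: indicator_def abs_le_iff)
    then show "\<forall>\<^sub>F k in sequentially. indicator {- real k..real k} x * f x = f x"
      by (rule eventually_sequentiallyI)
  qed
qed (use f in \<open>auto simp: indicator_def\<close>)

text \<open>The exchange over bounded intervals is extended to the line: the truncated correlations
  converge to the full one in the finitely many seminorms that control \<open>w\<close>.\<close>

lemma dual_schwartz_correlation:
  assumes w: "w \<in> dual SR" and g: "g \<in> schwartz" and \<phi>: "\<phi> \<in> schwartz"
  shows "w (\<lambda>y. LINT x|lborel. g x * \<phi> (y + x)) = (LINT x|lborel. g x * w (\<lambda>y. \<phi> (y + x)))"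
proof -
  obtain C K where CK: "0 \<le> C" "\<And>f B. f \<in> schwartz \<Longrightarrow> (\<forall>m\<in>UNIV. \<forall>n t. m \<le> K \<longrightarrow> n \<le> K \<longrightarrow> \<bar>t ^ m * (deriv ^^ n) f t\<bar> \<le> B)
            \<Longrightarrow> \<bar>w f\<bar> \<le> C * B" using SR.dual_bound[OF w] by metis
  have gm[measurable]: "g \<in> borel_measurable borel" using g by measurable
  have \<phi>m[measurable]: "(deriv ^^ n) \<phi> \<in> borel_measurable borel" for n
    using schwartz_measurable[OF SR.iter_mem[OF \<phi>]] .
  have sm: "smooth \<phi>" "smooth g" using \<phi> g schwartz_smooth by auto
  have "\<forall>m n. \<exists>B\<ge>0. \<forall>x y. \<bar>y ^ m * (deriv ^^ n) \<phi> (y + x)\<bar> \<le> B * (1 + \<bar>x\<bar>) ^ m"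
    using schwartz_translate_bound[OF \<phi>] by blast
  then obtain b where b: "\<And>m n. b m n \<ge> 0" "\<And>m n x y. \<bar>y ^ m * (deriv ^^ n) \<phi> (y + x)\<bar> \<le> b m n * (1 + \<bar>x\<bar>) ^ m"
    by metis
  define D where "D = (\<Sum>m\<le>K. \<Sum>n\<le>K. b m n)"
  have D: "\<bar>y ^ m * (deriv ^^ n) \<phi> (y + x)\<bar> \<le> D * (1 + \<bar>x\<bar>) ^ K" if "m \<le> K" "n \<le> K" for m n x y
  proof -
    have "b m n \<le> (\<Sum>n\<le>K. b m n)" using that b(1) by (intro member_le_sum) auto
    also have "\<dots> \<le> D" unfolding D_def using that b(1)
      by (intro member_le_sum[where f = "\<lambda>m. \<Sum>n\<le>K. b m n"]) (auto intro: sum_nonneg)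
    finally have "b m n \<le> D" .
    moreover have "(1 + \<bar>x\<bar>) ^ m \<le> (1 + \<bar>x\<bar>) ^ K" using that by (intro power_increasing) auto
    ultimately have "b m n * (1 + \<bar>x\<bar>) ^ m \<le> D * (1 + \<bar>x\<bar>) ^ K" using b(1)[of m n] by (intro mult_mono) auto
    then show ?thesis using b(2)[where m = m and n = n and x = x and y = y] by linarith
  qed
  let ?U = "\<lambda>x. w (\<lambda>y. \<phi> (y + x))"
  have Uc: "continuous_on S ?U" for S by (rule SR.dual_shift_continuous[OF w \<phi>])
  have [measurable]: "?U \<in> borel_measurable borel" using Uc by (rule borel_measurable_continuous_onI)
  have U: "\<bar>?U x\<bar> \<le> (C * D) * (1 + \<bar>x\<bar>) ^ K" for x
  proof -
    have "\<bar>?U x\<bar> \<le> C * (D * (1 + \<bar>x\<bar>) ^ K)"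
    proof (rule CK(2)[OF SR.shift_mem[OF \<phi>]], intro ballI allI impI)
      fix m n y assume "m \<le> K" "n \<le> K"
      then show "\<bar>y ^ m * (deriv ^^ n) (\<lambda>y. \<phi> (y + x)) y\<bar> \<le> D * (1 + \<bar>x\<bar>) ^ K"
        using D by (simp add: deriv_iter_shift[OF sm(1)])
    qed
    then show ?thesis by (simp add: mult.assoc)
  qed
  have intgU: "integrable lborel (\<lambda>x. g x * ?U x)"
    using moderate_integrable'[OF _ U g] by (simp add: mult.commute)
  let ?c = "\<lambda>y. LINT x|lborel. g x * \<phi> (y + x)"
  let ?ck = "\<lambda>k y. integral {- real k..real k} (\<lambda>x. g x * \<phi> (y + x))"
  have gc: "continuous_on S g" for S by (rule smooth_continuous[OF sm(2)])
  have ck_mem: "?ck k \<in> schwartz" for k by (rule schwartz_interval_correlation[OF \<phi> gc])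
  have to_leb: "integral {- real k..real k} f = (LINT x|lborel. indicator {- real k..real k} x * f x)"
    if "continuous_on UNIV f" for f :: "real \<Rightarrow> real" and k
  proof -
    have "set_integrable lborel {- real k..real k} f"
      by (rule borel_integrable_atLeastAtMost'[OF continuous_on_subset[OF that subset_UNIV]])
    from set_borel_integral_eq_integral(2)[OF this] show ?thesis
      by (simp add: set_lebesgue_integral_def)
  qed
  have "w (?ck k) = (LINT x|lborel. indicator {- real k..real k} x * (g x * ?U x))" for k
  proof -
    have "w (?ck k) = integral {- real k..real k} (\<lambda>x. g x * ?U x)"
      by (rule SR.dual_correlation[OF w \<phi> sm(2)]) simp
    also have "\<dots> = (LINT x|lborel. indicator {- real k..real k} x * (g x * ?U x))"
      by (rule to_leb) (intro continuous_intros gc Uc)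
    finally show ?thesis .
  qed
  then have lim1: "(\<lambda>k. w (?ck k)) \<longlonglongrightarrow> (LINT x|lborel. g x * ?U x)"
    using tendsto_integral_interval[OF intgU] by simp
  have c_mem: "?c \<in> schwartz" by (rule schwartz_correlation[OF g \<phi>])
  \<comment> \<open>The tail of a weighted integral of \<open>g\<close>. It bounds the truncation
    error in all relevant seminorms at once, since translating by \<open>x\<close> costs at most a
    factor \<open>(1 + \<bar>x\<bar>) ^ K\<close>.\<close>
  define \<tau> where "\<tau> k = (LINT x|lborel. \<bar>g x\<bar> * (1 + \<bar>x\<bar>) ^ K)
      - (LINT x|lborel. indicator {- real k..real k} x * (\<bar>g x\<bar> * (1 + \<bar>x\<bar>) ^ K))" for k
  have intg: "integrable lborel (\<lambda>x. \<bar>g x\<bar> * (1 + \<bar>x\<bar>) ^ K)"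
  proof -
    have "integrable lborel (\<lambda>x. (1 + \<bar>x\<bar>) ^ K * g x)"
      by (rule moderate_integrable'[where C = 1 and k = K, OF _ _ g]) auto
    from integrable_abs[OF this] show ?thesis by (simp add: abs_mult mult.commute)
  qed
  have \<tau>0: "\<tau> \<longlonglongrightarrow> 0"
    unfolding \<tau>_def by (rule tendsto_eq_intros tendsto_integral_interval intg refl | simp)+
  have bound: "\<bar>w ?c - w (?ck k)\<bar> \<le> C * (D * \<tau> k)" for k
  proof -
    have d_mem: "(\<lambda>y. ?c y - ?ck k y) \<in> schwartz" by (rule SR.diff_mem[OF c_mem ck_mem])
    have "\<bar>w (\<lambda>y. ?c y - ?ck k y)\<bar> \<le> C * (D * \<tau> k)"
    proof (rule CK(2)[OF d_mem], intro ballI allI impI)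
      fix m n y assume mn: "m \<le> K" "n \<le> K"
      let ?p = "\<lambda>x. g x * (deriv ^^ n) \<phi> (y + x)"
      let ?I = "indicator {- real k..real k} :: real \<Rightarrow> real"
      have pc: "continuous_on UNIV ?p"
        by (intro continuous_intros gc continuous_on_compose2[OF smooth_continuous[OF smooth_iter[OF sm(1)], of UNIV]]) auto
      have D0: "\<bar>(deriv ^^ n) \<phi> (y + x)\<bar> \<le> D * (1 + \<bar>x\<bar>) ^ K" for x
        using D[of 0 n y x] mn by simp
      have intp: "integrable lborel ?p"
        using moderate_integrable'[OF _ D0 g] by (simp add: mult.commute)
      have intIp: "integrable lborel (\<lambda>x. ?I x * ?p x)"
        by (rule Bochner_Integration.integrable_bound[OF intp]) (auto simp: indicator_def)
      have intIg: "integrable lborel (\<lambda>x. ?I x * (\<bar>g x\<bar> * (1 + \<bar>x\<bar>) ^ K))"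
        by (rule Bochner_Integration.integrable_bound[OF intg]) (auto simp: indicator_def)
      have "(deriv ^^ n) (\<lambda>y. ?c y - ?ck k y) y = (LINT x|lborel. ?p x) - (LINT x|lborel. ?I x * ?p x)"
        unfolding deriv_iter_diff[OF schwartz_smooth[OF c_mem] schwartz_smooth[OF ck_mem]]
          deriv_iter_schwartz_correlation[OF g \<phi>] deriv_iter_interval_correlation[OF sm(1) gc] to_leb[OF pc] ..
      also have "\<dots> = (LINT x|lborel. ?p x - ?I x * ?p x)"
        by (rule Bochner_Integration.integral_diff[symmetric, OF intp intIp])
      finally have eq: "y ^ m * (deriv ^^ n) (\<lambda>y. ?c y - ?ck k y) y = (LINT x|lborel. y ^ m * (?p x - ?I x * ?p x))"
        by simp
      have "norm (LINT x|lborel. y ^ m * (?p x - ?I x * ?p x)) \<le>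
          (LINT x|lborel. D * (\<bar>g x\<bar> * (1 + \<bar>x\<bar>) ^ K - ?I x * (\<bar>g x\<bar> * (1 + \<bar>x\<bar>) ^ K)))"
      proof (rule Bochner_Integration.integral_norm_bound_integral)
        show "integrable lborel (\<lambda>x. y ^ m * (?p x - ?I x * ?p x))"
          by (intro integrable_mult_right Bochner_Integration.integrable_diff intp intIp)
        show "integrable lborel (\<lambda>x. D * (\<bar>g x\<bar> * (1 + \<bar>x\<bar>) ^ K - ?I x * (\<bar>g x\<bar> * (1 + \<bar>x\<bar>) ^ K)))"
          by (intro integrable_mult_right Bochner_Integration.integrable_diff intg intIg)
        fix x
        have "norm (y ^ m * (?p x - ?I x * ?p x)) = (1 - ?I x) * (\<bar>g x\<bar> * \<bar>y ^ m * (deriv ^^ n) \<phi> (y + x)\<bar>)"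
          by (simp add: indicator_def abs_mult)
        also have "\<dots> \<le> (1 - ?I x) * (\<bar>g x\<bar> * (D * (1 + \<bar>x\<bar>) ^ K))"
          by (intro mult_left_mono D mn) (auto simp: indicator_def)
        finally show "norm (y ^ m * (?p x - ?I x * ?p x)) \<le> D * (\<bar>g x\<bar> * (1 + \<bar>x\<bar>) ^ K - ?I x * (\<bar>g x\<bar> * (1 + \<bar>x\<bar>) ^ K))"
          by (simp add: algebra_simps)
      qed
      also have "\<dots> = D * \<tau> k"
        unfolding \<tau>_def integral_mult_right_zero by (subst Bochner_Integration.integral_diff[OF intg intIg]) simp
      finally show "\<bar>y ^ m * (deriv ^^ n) (\<lambda>y. ?c y - ?ck k y) y\<bar> \<le> D * \<tau> k" unfolding eq real_norm_def .
    qed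
    then show ?thesis using SR.dual_diff[OF w c_mem ck_mem] by simp
  qed
  have "(\<lambda>k. w ?c - w (?ck k)) \<longlonglongrightarrow> 0"
  proof (rule Lim_null_comparison)
    show "\<forall>\<^sub>F k in sequentially. norm (w ?c - w (?ck k)) \<le> C * (D * \<tau> k)" using bound by simp
    show "(\<lambda>k. C * (D * \<tau> k)) \<longlonglongrightarrow> 0" using \<tau>0 by (auto intro!: tendsto_eq_intros)
  qed
  from tendsto_diff[OF tendsto_const[of "w ?c"] this] have "(\<lambda>k. w (?ck k)) \<longlonglongrightarrow> w ?c" by simp
  with lim1 show ?thesis by (rule LIMSEQ_unique[symmetric])
qed

lemma continuous_square_integral_zero:
  fixes f :: "real \<Rightarrow> real"
  assumes c: "continuous_on {a..b} f" and ab: "a < b" and int: "integral {a..b} (\<lambda>t. f t * f t) = 0"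
    and t: "t \<in> {a..b}"
  shows "f t = 0"
proof -
  have "(\<lambda>t. f t * f t) integrable_on {a..b}"
    using c by (intro integrable_continuous_interval continuous_intros)
  then have "((\<lambda>t. f t * f t) has_integral 0) (cbox a b)"
    using int by (metis cbox_interval integrable_integral)
  then have "f t * f t = 0"
    by (rule has_integral_0_cbox_imp_0[rotated 2]) (use c ab t in \<open>auto intro!: continuous_intros\<close>)
  then show ?thesis by simp
qed

interpretation SR: test_pairing SR schwartz UNIV UNIV
proof
  fix \<phi> assume \<phi>: "\<phi> \<in> schwartz"
  show "regular_R \<phi> \<in> dual SR"
    using regular_R_dual[OF schwartz_measurable[OF \<phi>]] schwartz_bounded[OF \<phi>] by meson
  obtain C where C: "\<And>t. \<bar>\<phi> t\<bar> \<le> C * (1 + \<bar>t\<bar>) ^ 0" using schwartz_bounded[OF \<phi>] by blast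
  show "set_integrable lborel UNIV (\<lambda>t. \<phi> t * \<psi> t)" if \<psi>: "\<psi> \<in> schwartz" for \<psi>
    using moderate_integrable'[OF schwartz_measurable[OF \<phi>] C \<psi>] by (simp add: set_integrable_def)
  assume zero: "(LINT t:UNIV|lborel. \<phi> t * \<phi> t) = 0"
  have int: "integrable lborel (\<lambda>t. \<phi> t * \<phi> t)"
    by (rule moderate_integrable'[OF schwartz_measurable[OF \<phi>] C \<phi>])
  have c: "continuous_on S \<phi>" for S by (rule smooth_continuous[OF schwartz_smooth[OF \<phi>]])
  show "\<phi> = (\<lambda>_. 0)"
  proof
    fix t
    have si: "set_integrable lborel {t - 1..t + 1} (\<lambda>t. \<phi> t * \<phi> t)"
      by (intro borel_integrable_atLeastAtMost' continuous_intros c)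
    have "(LINT s:{t - 1..t + 1}|lborel. \<phi> s * \<phi> s) \<le> (LINT s|lborel. \<phi> s * \<phi> s)"
      unfolding set_lebesgue_integral_def
      by (rule integral_mono[OF si[unfolded set_integrable_def] int]) (auto simp: indicator_def)
    moreover have "0 \<le> (LINT s:{t - 1..t + 1}|lborel. \<phi> s * \<phi> s)"
      unfolding set_lebesgue_integral_def by (rule integral_nonneg_AE) auto
    moreover have "(LINT s|lborel. \<phi> s * \<phi> s) = 0"
      using zero by (simp add: set_lebesgue_integral_def)
    ultimately have "(LINT s:{t - 1..t + 1}|lborel. \<phi> s * \<phi> s) = 0" by linarith
    then have "integral {t - 1..t + 1} (\<lambda>t. \<phi> t * \<phi> t) = 0"
      using set_borel_integral_eq_integral(2)[OF si] by simp
    from continuous_square_integral_zero[OF c _ this, of t] show "\<phi> t = 0" by simp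
  qed
next
  fix w \<phi> \<psi> assume w: "w \<in> dual SR" and \<phi>: "\<phi> \<in> schwartz" and \<psi>: "\<psi> \<in> schwartz"
  have "(LINT x|lborel. \<phi> x * w (\<lambda>y. \<psi> (y + x))) = w (\<lambda>y. LINT x|lborel. \<phi> x * \<psi> (y + x))"
    by (rule dual_schwartz_correlation[OF w \<phi> \<psi>, symmetric])
  \<comment> \<open>Replacing \<open>x\<close> by \<open>- (y + x)\<close> moves the dependence on
    \<open>y\<close> from \<open>\<psi>\<close> to \<open>\<phi>\<close>, so that \<open>w\<close>
    can be taken back under the integral on the other factor.\<close>
  also have "(\<lambda>y. LINT x|lborel. \<phi> x * \<psi> (y + x)) = (\<lambda>y. LINT x|lborel. \<psi> (- x) * \<phi> (- (y + x)))"
  proof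
    fix y :: real
    show "(LINT x|lborel. \<phi> x * \<psi> (y + x)) = (LINT x|lborel. \<psi> (- x) * \<phi> (- (y + x)))"
      using lborel_integral_real_affine[of "-1" "\<lambda>x. \<phi> x * \<psi> (y + x)" "- y"] by (simp add: mult.commute)
  qed
  also have "w \<dots> = (LINT x|lborel. \<psi> (- x) * w (\<lambda>y. \<phi> (- (y + x))))"
    by (rule dual_schwartz_correlation[OF w schwartz_reflect[OF \<psi>] schwartz_reflect[OF \<phi>]])
  also have "\<dots> = (LINT x|lborel. \<psi> x * w (\<lambda>y. \<phi> (x - y)))"
    using lborel_integral_real_affine[of "-1" "\<lambda>x. \<psi> x * w (\<lambda>y. \<phi> (x - y))" 0] by (simp add: add.commute)
  finally show "(LINT x:UNIV|lborel. \<phi> x * w (\<lambda>y. \<psi> (y + x))) = (LINT x:UNIV|lborel. \<psi> x * w (\<lambda>y. \<phi> (x - y)))"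
    by (simp add: set_lebesgue_integral_def)
qed

subsection \<open>Periodic test functions\<close>

lemma periodic1_int:
  assumes "periodic1 f" shows "f (t + of_int k) = f t"
proof -
  have nat: "f (t + real n) = f t" for t n
  proof (induction n)
    case (Suc n)
    have "f (t + real (Suc n)) = f ((t + real n) + 1)" by (simp add: add_ac)
    also have "\<dots> = f (t + real n)" using assms unfolding periodic1_def by blast
    finally show ?case using Suc by simp
  qed simp
  show ?thesis
  proof (cases "k \<ge> 0")
    case True
    then show ?thesis using nat[of t "nat k"] by simp
  next
    case False
    then show ?thesis using nat[of "t + of_int k" "nat (- k)"] by simp
  qed
qed

lemma periodic1_frac: "periodic1 f \<Longrightarrow> f (frac t) = f t"
  using periodic1_int[of f t "- \<lfloor>t\<rfloor>"] by (simp add: frac_def)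

lemma periodic1_frac_mem: "frac t \<in> {0..1::real}"
  using frac_ge_0[of t] frac_lt_1[of t] by (simp add: less_imp_le)

lemma periodic1_bounded:
  assumes "periodic1 f" "continuous_on {0..1} f"
  shows "\<exists>B\<ge>0. \<forall>t. \<bar>f t\<bar> \<le> B"
proof -
  have "bounded (f ` {0..1})"
    using assms(2) by (intro compact_imp_bounded compact_continuous_image) auto
  then obtain B where B: "\<forall>z\<in>f ` {0..1}. norm z \<le> B" unfolding bounded_iff by blast
  have le: "\<bar>f t\<bar> \<le> B" for t
    using bspec[OF B imageI[OF periodic1_frac_mem[of t]]] periodic1_frac[OF assms(1), of t] by simp
  have "0 \<le> B" using le[of 0] by linarith
  then show ?thesis using le by blast
qed

lemma periodic1_shift_integral:
  fixes p :: "real \<Rightarrow> real"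
  assumes p: "periodic1 p" and c: "continuous_on UNIV p"
  shows "integral {0..1} (\<lambda>x. p (x + d)) = integral {0..1} p"
proof -
  have main: "integral {0..1} (\<lambda>x. p (x + d)) = integral {0..1} p" if d: "0 \<le> d" "d \<le> 1" for d
  proof -
    have int: "p integrable_on {a..b}" for a b
      by (intro integrable_continuous_interval continuous_on_subset[OF c]) auto
    have "integral {0..1} (\<lambda>x. p (x + d)) = integral {d..1 + d} p"
      using integral_shift_real_ivl[of d d "1 + d" p] by simp
    also have "\<dots> = integral {d..1} p + integral {1..1 + d} p"
      using d by (intro Henstock_Kurzweil_Integration.integral_combine[symmetric] int) auto
    also have "integral {1..1 + d} p = integral {0..d} (\<lambda>x. p (x + 1))"
      using integral_shift_real_ivl[of 1 1 "1 + d" p] by simp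
    also have "(\<lambda>x. p (x + 1)) = p" using p by (simp add: periodic1_def fun_eq_iff)
    also have "integral {d..1} p + integral {0..d} p = integral {0..1} p"
      using d Henstock_Kurzweil_Integration.integral_combine[of 0 d 1 p] int by simp
    finally show ?thesis .
  qed
  have "p (x + d) = p (x + frac d)" for x
    using periodic1_int[OF p, of "x + frac d" "\<lfloor>d\<rfloor>"] by (simp add: frac_def)
  then show ?thesis using main[of "frac d"] periodic1_frac_mem[of d] by simp
qed

lemma periodic1_reflect_integral:
  fixes p :: "real \<Rightarrow> real"
  assumes p: "periodic1 p" and c: "continuous_on UNIV p"
  shows "integral {0..1} (\<lambda>x. p (d - x)) = integral {0..1} p"
proof -
  let ?q = "\<lambda>x. p (x + d)"
  have q: "?q (x + 1) = ?q x" for x using p unfolding periodic1_def by (metis add.commute add.left_commute)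
  have "integral {- 0..- (- 1)} (\<lambda>x. ?q (- x)) = integral {- 1..0} ?q"
    by (rule Henstock_Kurzweil_Integration.integral_reflect_real)
  then have "integral {0..1} (\<lambda>x. p (d - x)) = integral {- 1..0} ?q" by simp
  also have "\<dots> = integral {- 1..0} (\<lambda>x. ?q (x + 1))" by (simp only: q)
  also have "\<dots> = integral {0..1} ?q" using integral_shift_real_ivl[of 0 1 1 ?q] by simp
  also have "\<dots> = integral {0..1} p" by (rule periodic1_shift_integral[OF p c])
  finally show ?thesis .
qed

lemma periodic1_deriv_iter:
  assumes "smooth f" "periodic1 f" shows "periodic1 ((deriv ^^ n) f)"
  using deriv_iter_shift[OF assms(1), of n 1] assms(2) unfolding periodic1_def
  by (metis (no_types, lifting) ext)

lemma set_integral_continuous: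
  fixes f :: "real \<Rightarrow> real"
  assumes "continuous_on {a..b} f"
  shows "(LINT x:{a..b}|lborel. f x) = integral {a..b} f"
  by (rule set_borel_integral_eq_integral(2)[OF borel_integrable_atLeastAtMost'[OF assms]])

lemma regular_T_apply:
  assumes "continuous_on {0..1} g" "smooth f" "periodic1 f"
  shows "regular_T g f = integral {0..1} (\<lambda>x. g x * f x)"
  using assms by (simp add: regular_def set_integral_continuous continuous_on_mult smooth_continuous)

interpretation ST: test_space ST "{f. smooth f \<and> periodic1 f}" "{0}"
proof
  show "ST = seminorm_topology {f. smooth f \<and> periodic1 f} {\<lambda>f. SUP t. \<bar>t ^ m * (deriv ^^ n) f t\<bar> | m n. m \<in> {0}}"
    unfolding ST_def by simp
  fix f m n assume f: "f \<in> {f. smooth f \<and> periodic1 f}" "m \<in> {0::nat}"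
  then have "\<exists>B\<ge>0. \<forall>t. \<bar>(deriv ^^ n) f t\<bar> \<le> B"
    by (intro periodic1_bounded periodic1_deriv_iter smooth_continuous smooth_iter) auto
  then show "\<exists>B. \<forall>t. \<bar>t ^ m * (deriv ^^ n) f t\<bar> \<le> B" using f(2) by auto
next
  fix f assume f: "f \<in> {f. smooth f \<and> periodic1 f}"
  then have per: "f (t + of_int k) = f t" for t k by (intro periodic1_int) simp
  show "(\<lambda>t. f (- t)) \<in> {f. smooth f \<and> periodic1 f}"
    using f per[of _ "-1"] by (simp add: smooth_reflect periodic1_def)
  show "deriv f \<in> {f. smooth f \<and> periodic1 f}"
    using f periodic1_deriv_iter[of f 1] by (simp add: smooth_deriv)
  fix b show "(\<lambda>t. f (t + b)) \<in> {f. smooth f \<and> periodic1 f}"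
    using f per[of _ 1] by (simp add: smooth_shift periodic1_def) (metis add.commute add.left_commute)
next
  fix f g :: "real \<Rightarrow> real" and a b :: real
  assume f: "f \<in> {f. smooth f \<and> periodic1 f}" and g: "continuous_on {a..b} g"
  have "f (y + 1 + x) = f (y + x)" for x y
    using f unfolding periodic1_def mem_Collect_eq by (metis add.commute add.left_commute)
  then show "(\<lambda>y. integral {a..b} (\<lambda>x. g x * f (y + x))) \<in> {f. smooth f \<and> periodic1 f}"
    using f smooth_interval_correlation[OF _ g] by (simp add: periodic1_def)
qed (auto simp: smooth_const smooth_add smooth_scale periodic1_def)

lemma regular_T_dual:
  assumes g: "continuous_on {0..1} g"
  shows "regular_T g \<in> dual ST"
proof -
  have "bounded (g ` {0..1})" using g by (intro compact_imp_bounded compact_continuous_image) auto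
  then obtain G where G: "\<forall>z\<in>g ` {0..1}. norm z \<le> G" unfolding bounded_iff by blast
  have c: "continuous_on {0..1} (\<lambda>x. g x * f x)" if "smooth f" for f
    using that by (intro continuous_on_mult g smooth_continuous)
  show ?thesis
  proof (rule ST.dualI[where K = 0 and C = G])
    fix f B assume f: "f \<in> {f. smooth f \<and> periodic1 f}"
      and B: "\<And>m n t. m \<in> {0} \<Longrightarrow> m \<le> 0 \<Longrightarrow> n \<le> 0 \<Longrightarrow> \<bar>t ^ m * (deriv ^^ n) f t\<bar> \<le> B"
    have "norm (integral {0..1} (\<lambda>x. g x * f x)) \<le> (G * B) * (1 - 0)"
    proof (rule integral_bound)
      fix x :: real assume x: "x \<in> {0..1}"
      have "\<bar>g x\<bar> * \<bar>f x\<bar> \<le> G * B"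
        using bspec[OF G imageI[OF x]] B[of 0 0 x] by (intro mult_mono) auto
      then show "norm (g x * f x) \<le> G * B" by (simp add: abs_mult)
    qed (use f c in auto)
    then show "\<bar>regular_T g f\<bar> \<le> G * B" using f by (simp add: regular_T_apply[OF g])
  next
    fix f h assume f: "f \<in> {f. smooth f \<and> periodic1 f}" "h \<in> {f. smooth f \<and> periodic1 f}"
    then have fh: "(\<lambda>t. f t + h t) \<in> {f. smooth f \<and> periodic1 f}" by (rule ST.add_mem)
    have "integral {0..1} (\<lambda>x. g x * f x + g x * h x) = integral {0..1} (\<lambda>x. g x * f x) + integral {0..1} (\<lambda>x. g x * h x)"
      using f by (intro Henstock_Kurzweil_Integration.integral_add integrable_continuous_interval c) auto
    then show "regular_T g (\<lambda>t. f t + h t) = regular_T g f + regular_T g h"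
      using f fh by (simp add: regular_T_apply[OF g] distrib_left)
  next
    fix k f assume f: "f \<in> {f. smooth f \<and> periodic1 f}"
    then have "(\<lambda>t. k * f t) \<in> {f. smooth f \<and> periodic1 f}" by (rule ST.scale_mem)
    then show "regular_T g (\<lambda>t. k * f t) = k * regular_T g f"
      using f by (simp add: regular_T_apply[OF g] mult.left_commute)
  qed (simp add: regular_def)
qed

interpretation ST: test_pairing ST "{f. smooth f \<and> periodic1 f}" "{0}" "{0..1}"
proof
  fix \<phi> assume \<phi>: "\<phi> \<in> {f. smooth f \<and> periodic1 f}"
  then have c: "continuous_on S \<phi>" for S by (auto intro: smooth_continuous)
  show "regular_T \<phi> \<in> dual ST" by (rule regular_T_dual[OF c])
  show "set_integrable lborel {0..1} (\<lambda>t. \<phi> t * \<psi> t)" if "\<psi> \<in> {f. smooth f \<and> periodic1 f}" for \<psi>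
    using that by (intro borel_integrable_atLeastAtMost' continuous_on_mult c) (auto intro: smooth_continuous)
  assume "(LINT t:{0..1}|lborel. \<phi> t * \<phi> t) = 0"
  then have int: "integral {0..1} (\<lambda>t. \<phi> t * \<phi> t) = 0"
    by (simp add: set_integral_continuous continuous_on_mult c)
  have "\<phi> t = 0" for t
    using continuous_square_integral_zero[OF c _ int periodic1_frac_mem[of t]] \<phi> by (simp add: periodic1_frac)
  then show "\<phi> = (\<lambda>_. 0)" by blast
next
  fix w \<phi> \<psi> assume w: "w \<in> dual ST" and \<phi>: "\<phi> \<in> {f. smooth f \<and> periodic1 f}" and \<psi>: "\<psi> \<in> {f. smooth f \<and> periodic1 f}"
  have sm: "smooth \<phi>" "smooth \<psi>" "periodic1 \<phi>" "periodic1 \<psi>" using \<phi> \<psi> by auto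
  have R\<phi>: "(\<lambda>t. \<phi> (- t)) \<in> {f. smooth f \<and> periodic1 f}" by (rule ST.reflect_mem[OF \<phi>])
  have Uc: "continuous_on S (\<lambda>x. w (\<lambda>y. \<psi> (y + x)))" "continuous_on S (\<lambda>x. w (\<lambda>y. \<phi> (- (y + x))))" for S
    using ST.dual_shift_continuous[OF w \<psi>] ST.dual_shift_continuous[OF w R\<phi>] by auto
  have cc: "continuous_on S \<phi>" "continuous_on S \<psi>" for S using sm by (auto intro: smooth_continuous)
  have per: "\<psi> (x + 1) = \<psi> x" "\<phi> (x + 1) = \<phi> x" for x using sm by (auto simp: periodic1_def)
  let ?V = "\<lambda>x. \<psi> x * w (\<lambda>y. \<phi> (x - y))"
  have Vc: "continuous_on UNIV ?V"
  proof -
    have "continuous_on UNIV (\<lambda>x. w (\<lambda>y. \<phi> (- (y + - x))))"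
      by (rule continuous_on_compose2[OF Uc(2)[of UNIV]]) (auto intro!: continuous_intros)
    then show ?thesis by (intro continuous_on_mult cc) simp
  qed
  have Vp: "periodic1 ?V"
    unfolding periodic1_def
  proof
    fix x
    have "\<phi> (x + 1 - y) = \<phi> (x - y)" for y using per(2)[of "x - y"] by (simp add: algebra_simps)
    then show "?V (x + 1) = ?V x" by (simp add: per)
  qed
  have "(LINT x:{0..1}|lborel. \<phi> x * w (\<lambda>y. \<psi> (y + x))) = integral {0..1} (\<lambda>x. \<phi> x * w (\<lambda>y. \<psi> (y + x)))"
    by (intro set_integral_continuous continuous_on_mult cc Uc)
  also have "\<dots> = w (\<lambda>y. integral {0..1} (\<lambda>x. \<phi> x * \<psi> (y + x)))"
    by (rule ST.dual_correlation[OF w \<psi> sm(1), symmetric]) simp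
  \<comment> \<open>The same substitution as on the line; periodicity brings the reflected and
    translated interval back to \<open>{0..1}\<close>.\<close>
  also have "(\<lambda>y. integral {0..1} (\<lambda>x. \<phi> x * \<psi> (y + x))) = (\<lambda>y. integral {0..1} (\<lambda>x. \<psi> (- x) * \<phi> (- (y + x))))"
  proof
    fix y
    have p: "periodic1 (\<lambda>x. \<phi> x * \<psi> (y + x))"
      unfolding periodic1_def using per by (simp flip: add.assoc)
    have c: "continuous_on UNIV (\<lambda>x. \<phi> x * \<psi> (y + x))"
      by (intro continuous_on_mult cc continuous_on_compose2[OF cc(2)[of UNIV]] continuous_intros) auto
    from periodic1_reflect_integral[OF p c, of "- y"]
    show "integral {0..1} (\<lambda>x. \<phi> x * \<psi> (y + x)) = integral {0..1} (\<lambda>x. \<psi> (- x) * \<phi> (- (y + x)))"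
      by (simp add: mult.commute)
  qed
  also have "w \<dots> = integral {0..1} (\<lambda>x. \<psi> (- x) * w (\<lambda>y. \<phi> (- (y + x))))"
    by (rule ST.dual_correlation[OF w R\<phi> smooth_reflect[OF sm(2)]]) simp
  also have "\<dots> = integral {0..1} ?V"
    using periodic1_reflect_integral[OF Vp Vc, of 0] by (simp add: add.commute)
  also have "\<dots> = (LINT x:{0..1}|lborel. ?V x)"
    by (rule set_integral_continuous[symmetric, OF continuous_on_subset[OF Vc]]) simp
  finally show "(LINT x:{0..1}|lborel. \<phi> x * w (\<lambda>y. \<psi> (y + x))) = (LINT x:{0..1}|lborel. \<psi> x * w (\<lambda>y. \<phi> (x - y)))" .
qed

subsection \<open>Moments and antiderivatives of Schwartz functions\<close>

definition moment :: "nat \<Rightarrow> (real \<Rightarrow> real) \<Rightarrow> real" where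
  "moment m \<phi> = (LINT t|lborel. t ^ m * \<phi> t)"

lemma power_moderate: "\<bar>t ^ m\<bar> \<le> 1 * (1 + \<bar>t\<bar>) ^ m" for t :: real
  by (simp add: power_abs power_mono)

lemma moment_integrable: "\<phi> \<in> schwartz \<Longrightarrow> integrable lborel (\<lambda>t. t ^ m * \<phi> t)"
  by (rule moderate_integrable'[OF _ power_moderate]) simp

lemma schwartz_integrable: "\<phi> \<in> schwartz \<Longrightarrow> integrable lborel \<phi>"
  using moment_integrable[of \<phi> 0] by simp

lemma moment_add: "\<phi> \<in> schwartz \<Longrightarrow> \<psi> \<in> schwartz \<Longrightarrow> moment m (\<lambda>t. \<phi> t + \<psi> t) = moment m \<phi> + moment m \<psi>"
  by (simp add: moment_def distrib_left moment_integrable)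

lemma moment_scale: "moment m (\<lambda>t. c * \<phi> t) = c * moment m \<phi>"
  by (simp add: moment_def mult.left_commute)

lemma moment_diff: "\<phi> \<in> schwartz \<Longrightarrow> \<psi> \<in> schwartz \<Longrightarrow> moment m (\<lambda>t. \<phi> t - \<psi> t) = moment m \<phi> - moment m \<psi>"
  by (simp add: moment_def right_diff_distrib moment_integrable)

lemma integral_derivative_zero:
  fixes f f' :: "real \<Rightarrow> real"
  assumes der: "\<And>t. (f has_real_derivative f' t) (at t)" and c: "continuous_on UNIV f'"
    and int: "integrable lborel f'" and bd: "\<And>t. (1 + \<bar>t\<bar>) * \<bar>f t\<bar> \<le> B"
  shows "(LINT t|lborel. f' t) = 0"
proof -
  have bd': "\<bar>f t\<bar> \<le> B / (1 + \<bar>t\<bar>)" for t using bd[of t] by (simp add: pos_le_divide_eq mult.commute add_pos_nonneg)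
  have eq: "(LINT x|lborel. indicator {- real k..real k} x * f' x) = f (real k) - f (- real k)" for k
  proof -
    have "(f' has_integral (f (real k) - f (- real k))) {- real k..real k}"
      by (rule fundamental_theorem_of_calculus)
        (auto simp flip: has_real_derivative_iff_has_vector_derivative intro!: has_field_derivative_at_within der)
    then have "integral {- real k..real k} f' = f (real k) - f (- real k)" by (rule integral_unique)
    then show ?thesis
      using set_integral_continuous[of "- real k" "real k" f'] continuous_on_subset[OF c]
      by (simp add: set_lebesgue_integral_def)
  qed
  have "(\<lambda>k. f (real k) - f (- real k)) \<longlonglongrightarrow> (LINT t|lborel. f' t)"
    using tendsto_integral_interval[OF int] by (simp only: eq)
  moreover have "(\<lambda>k. f (real k) - f (- real k)) \<longlonglongrightarrow> 0"
  proof (rule Lim_null_comparison)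
    have "\<bar>f (real k) - f (- real k)\<bar> \<le> 2 * B / (1 + real k)" for k
      using bd'[of "real k"] bd'[of "- real k"] by simp
    then show "\<forall>\<^sub>F k in sequentially. norm (f (real k) - f (- real k)) \<le> 2 * B / (1 + real k)" by simp
    show "(\<lambda>k. 2 * B / (1 + real k)) \<longlonglongrightarrow> 0"
      by (rule real_tendsto_divide_at_top[OF tendsto_const]) (rule filterlim_tendsto_add_at_top[OF tendsto_const filterlim_real_sequentially])
  qed
  ultimately show ?thesis by (rule LIMSEQ_unique)
qed

text \<open>Integration by parts against a monomial; the boundary terms vanish by decay.
  Differentiation thus moves every moment up by one order.\<close>

lemma
  assumes \<phi>: "\<phi> \<in> schwartz"
  shows moment_0_deriv: "moment 0 (deriv \<phi>) = 0"
    and moment_Suc_deriv: "moment (Suc m) (deriv \<phi>) = - (real (Suc m) * moment m \<phi>)"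
proof -
  have sm: "smooth \<phi>" by (rule schwartz_smooth[OF \<phi>])
  have d: "deriv \<phi> \<in> schwartz" by (rule SR.deriv_mem[OF \<phi>])
  have bd: "\<exists>B. \<forall>t. (1 + \<bar>t\<bar>) * \<bar>t ^ m * \<phi> t\<bar> \<le> B" for m
  proof -
    obtain B where B: "\<And>t. (1 + \<bar>t\<bar>) ^ Suc m * \<bar>(deriv ^^ 0) \<phi> t\<bar> \<le> B" using schwartz_weight_bound[OF \<phi>] by blast
    have "(1 + \<bar>t\<bar>) * \<bar>t ^ m * \<phi> t\<bar> \<le> B" for t
    proof -
      have "(1 + \<bar>t\<bar>) * \<bar>t ^ m * \<phi> t\<bar> \<le> (1 + \<bar>t\<bar>) * ((1 * (1 + \<bar>t\<bar>) ^ m) * \<bar>\<phi> t\<bar>)"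
        unfolding abs_mult by (intro mult_left_mono mult_right_mono power_moderate) auto
      then show ?thesis using B[of t] by (simp add: mult.assoc)
    qed
    then show ?thesis by blast
  qed
  obtain B0 where "\<And>t. (1 + \<bar>t\<bar>) * \<bar>t ^ 0 * \<phi> t\<bar> \<le> B0" using bd by blast
  then have "(LINT t|lborel. deriv \<phi> t) = 0"
    by (intro integral_derivative_zero[OF smooth_has_derivative[OF sm]] smooth_continuous smooth_deriv sm schwartz_integrable d) auto
  then show "moment 0 (deriv \<phi>) = 0" by (simp add: moment_def)
  obtain B where B: "\<And>t. (1 + \<bar>t\<bar>) * \<bar>t ^ Suc m * \<phi> t\<bar> \<le> B" using bd by blast
  let ?f' = "\<lambda>t. real (Suc m) * (t ^ m * \<phi> t) + t ^ Suc m * deriv \<phi> t"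
  have "(LINT t|lborel. ?f' t) = 0"
  proof (rule integral_derivative_zero[OF _ _ _ B])
    fix t show "((\<lambda>t. t ^ Suc m * \<phi> t) has_real_derivative ?f' t) (at t)"
      by (rule derivative_eq_intros smooth_has_derivative[OF sm] refl)+ (simp add: algebra_simps)
    show "continuous_on UNIV ?f'"
      by (intro continuous_intros smooth_continuous smooth_deriv sm)
    show "integrable lborel ?f'"
      by (intro Bochner_Integration.integrable_add integrable_mult_right moment_integrable \<phi> d)
  qed
  also have "(LINT t|lborel. ?f' t) = real (Suc m) * moment m \<phi> + moment (Suc m) (deriv \<phi>)"
    unfolding moment_def
    by (subst Bochner_Integration.integral_add) (intro integrable_mult_right moment_integrable \<phi> d integral_mult_right_zero | simp only: integral_mult_right_zero)+
  finally show "moment (Suc m) (deriv \<phi>) = - (real (Suc m) * moment m \<phi>)" by linarith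
qed

lemma moment_deriv_iter:
  assumes "\<phi> \<in> schwartz"
  shows "m < N \<Longrightarrow> moment m ((deriv ^^ N) \<phi>) = 0"
proof (induction N arbitrary: m)
  case (Suc N)
  have mem: "(deriv ^^ N) \<phi> \<in> schwartz" by (rule SR.iter_mem[OF assms])
  show ?case
  proof (cases m)
    case 0
    then show ?thesis using moment_0_deriv[OF mem] by simp
  next
    case (Suc k)
    then show ?thesis using moment_Suc_deriv[OF mem, of k] Suc.IH[of k] Suc.prems by simp
  qed
qed simp

definition antideriv :: "(real \<Rightarrow> real) \<Rightarrow> real \<Rightarrow> real" where
  "antideriv \<phi> x = (LINT t|lborel. indicator {..x} t * \<phi> t)"

lemma integrable_indicator_mult: 
  fixes \<phi> :: "real \<Rightarrow> real"
  assumes "integrable lborel \<phi>" "S \<in> sets borel"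
  shows "integrable lborel (\<lambda>t. indicator S t * \<phi> t)"
  using integrable_mult_indicator[of S lborel \<phi>] assms by simp

lemma antideriv_has_derivative:
  assumes \<phi>: "\<phi> \<in> schwartz"
  shows "(antideriv \<phi> has_real_derivative \<phi> x) (at x)"
proof -
  have int: "integrable lborel \<phi>" by (rule schwartz_integrable[OF \<phi>])
  have c: "continuous_on S \<phi>" for S by (rule smooth_continuous[OF schwartz_smooth[OF \<phi>]])
  have split: "antideriv \<phi> y = antideriv \<phi> (x - 1) + integral {x - 1..y} \<phi>" if y: "y \<in> {x - 1..x + 1}" for y
  proof -
    have i: "integrable lborel (\<lambda>t. indicator {..<x - 1} t * \<phi> t)" "integrable lborel (\<lambda>t. indicator {x - 1..y} t * \<phi> t)"
      by (auto intro!: integrable_indicator_mult int)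
    have "antideriv \<phi> y = (LINT t|lborel. indicator {..<x - 1} t * \<phi> t + indicator {x - 1..y} t * \<phi> t)"
      unfolding antideriv_def using y by (intro Bochner_Integration.integral_cong refl) (auto simp: indicator_def)
    also have "\<dots> = (LINT t|lborel. indicator {..<x - 1} t * \<phi> t) + (LINT t|lborel. indicator {x - 1..y} t * \<phi> t)"
      by (rule Bochner_Integration.integral_add[OF i])
    also have "(LINT t|lborel. indicator {..<x - 1} t * \<phi> t) = antideriv \<phi> (x - 1)"
      unfolding antideriv_def
    proof (rule integral_cong_AE)
      show "AE t in lborel. indicator {..<x - 1} t * \<phi> t = indicator {..x - 1} t * \<phi> t"
        using AE_lborel_singleton[of "x - 1"] by eventually_elim (auto simp: indicator_def)
    qed (use schwartz_measurable[OF \<phi>] in measurable)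
    also have "(LINT t|lborel. indicator {x - 1..y} t * \<phi> t) = integral {x - 1..y} \<phi>"
      using set_integral_continuous[OF c, of "x - 1" y] by (simp add: set_lebesgue_integral_def)
    finally show ?thesis .
  qed
  have "((\<lambda>y. antideriv \<phi> (x - 1) + integral {x - 1..y} \<phi>) has_real_derivative 0 + \<phi> x) (at x within {x - 1..x + 1})"
    by (intro DERIV_add DERIV_const integral_has_real_derivative c) simp
  then have "((\<lambda>y. antideriv \<phi> (x - 1) + integral {x - 1..y} \<phi>) has_real_derivative \<phi> x) (at x within {x - 1..x + 1})"
    by simp
  then have "(antideriv \<phi> has_real_derivative \<phi> x) (at x within {x - 1..x + 1})"
  proof (rule has_field_derivative_transform_within[OF _ zero_less_one])
    show "x \<in> {x - 1..x + 1}" by simp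
    fix y assume "y \<in> {x - 1..x + 1}"
    then show "antideriv \<phi> (x - 1) + integral {x - 1..y} \<phi> = antideriv \<phi> y" by (rule split[symmetric])
  qed
  moreover have "at x within {x - 1..x + 1} = at x" by (rule at_within_interior) simp
  ultimately show ?thesis by simp
qed

lemma deriv_iter_antideriv:
  assumes \<phi>: "\<phi> \<in> schwartz"
  shows "(deriv ^^ n) (antideriv \<phi>) = (case n of 0 \<Rightarrow> antideriv \<phi> | Suc k \<Rightarrow> (deriv ^^ k) \<phi>)"
    and "smooth (antideriv \<phi>)"
proof -
  let ?F = "\<lambda>n. case n of 0 \<Rightarrow> antideriv \<phi> | Suc k \<Rightarrow> (deriv ^^ k) \<phi>"
  have 1: "(?F n has_real_derivative ?F (Suc n) t) (at t)" for n t
    using antideriv_has_derivative[OF \<phi>] deriv_iter_has_derivative[OF schwartz_smooth[OF \<phi>]]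
    by (cases n) simp_all
  show "(deriv ^^ n) (antideriv \<phi>) = ?F n" by (rule deriv_iter_eqI[of ?F, OF _ 1]) simp
  show "smooth (antideriv \<phi>)" by (rule smoothI[of ?F, OF _ 1]) simp
qed

text \<open>For positive \<open>x\<close> the integral up to \<open>x\<close> need not be small term
  by term. Since the total integral vanishes it is minus the integral beyond \<open>x\<close>, so in
  either case only points with \<open>\<bar>t\<bar> \<ge> \<bar>x\<bar>\<close> contribute.\<close>

lemma antideriv_bound:
  assumes \<phi>: "\<phi> \<in> schwartz" and m0: "moment 0 \<phi> = 0" and Q: "\<And>t. (1 + \<bar>t\<bar>) ^ (m + 2) * \<bar>\<phi> t\<bar> \<le> Q"
  shows "\<bar>x ^ m * antideriv \<phi> x\<bar> \<le> Q * cauchy_mass"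
proof -
  have int: "integrable lborel \<phi>" by (rule schwartz_integrable[OF \<phi>])
  have [measurable]: "\<phi> \<in> borel_measurable borel" by (rule schwartz_measurable[OF \<phi>])
  have bound: "\<bar>LINT t|lborel. (indicator S t * x ^ m) * \<phi> t\<bar> \<le> 1 * Q * cauchy_mass"
    if S: "S \<in> sets borel" "\<And>t. t \<in> S \<Longrightarrow> \<bar>x\<bar> \<le> \<bar>t\<bar>" for S :: "real set"
  proof (rule moderate_integral_bound[OF _ _ _ Q])
    show "(\<lambda>t. indicator S t * x ^ m) \<in> borel_measurable borel" using S(1) by measurable
    fix t show "\<bar>indicator S t * x ^ m\<bar> \<le> 1 * (1 + \<bar>t\<bar>) ^ m"
      using S(2)[of t] by (auto simp: indicator_def power_abs intro!: power_mono)
  qed simp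
  show ?thesis
  proof (cases "x \<le> 0")
    case True
    have "x ^ m * antideriv \<phi> x = (LINT t|lborel. (indicator {..x} t * x ^ m) * \<phi> t)"
      unfolding antideriv_def integral_mult_right_zero[symmetric] by (simp only: mult_ac)
    then show ?thesis using bound[of "{..x}"] True by auto
  next
    case False
    have "moment 0 \<phi> = (LINT t|lborel. indicator {..x} t * \<phi> t + indicator {x<..} t * \<phi> t)"
      unfolding moment_def by (intro Bochner_Integration.integral_cong refl) (auto simp: indicator_def)
    also have "\<dots> = antideriv \<phi> x + (LINT t|lborel. indicator {x<..} t * \<phi> t)"
      unfolding antideriv_def by (intro Bochner_Integration.integral_add integrable_indicator_mult int) auto
    finally have "antideriv \<phi> x = - (LINT t|lborel. indicator {x<..} t * \<phi> t)" using m0 by linarith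
    then have "x ^ m * antideriv \<phi> x = - (x ^ m * (LINT t|lborel. indicator {x<..} t * \<phi> t))" by simp
    also have "x ^ m * (LINT t|lborel. indicator {x<..} t * \<phi> t) = (LINT t|lborel. (indicator {x<..} t * x ^ m) * \<phi> t)"
      unfolding integral_mult_right_zero[symmetric] by (simp only: mult_ac)
    finally show ?thesis using bound[of "{x<..}"] False by auto
  qed
qed

lemma antideriv_schwartz:
  assumes \<phi>: "\<phi> \<in> schwartz" and m0: "moment 0 \<phi> = 0"
  shows "antideriv \<phi> \<in> schwartz" and "deriv (antideriv \<phi>) = \<phi>"
proof -
  show "deriv (antideriv \<phi>) = \<phi>" using deriv_iter_antideriv(1)[OF \<phi>, of 1] by simp
  show "antideriv \<phi> \<in> schwartz"
    unfolding schwartz_iff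
  proof (intro conjI allI deriv_iter_antideriv(2)[OF \<phi>])
    fix m n
    show "\<exists>B. \<forall>t. \<bar>t ^ m * (deriv ^^ n) (antideriv \<phi>) t\<bar> \<le> B"
    proof (cases n)
      case 0
      obtain Q where "\<And>t. (1 + \<bar>t\<bar>) ^ (m + 2) * \<bar>(deriv ^^ 0) \<phi> t\<bar> \<le> Q"
        using schwartz_weight_bound[OF \<phi>] by blast
      then show ?thesis using antideriv_bound[OF \<phi> m0] 0 by (metis funpow_0)
    next
      case (Suc k)
      then show ?thesis using \<phi> unfolding deriv_iter_antideriv(1)[OF \<phi>] by (simp add: schwartz_iff)
    qed
  qed
qed

text \<open>Up to a nonzero factor, the moment of order \<open>m\<close> of a primitive is the
  moment of order \<open>m + 1\<close> of the function. Each integration therefore uses up one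
  vanishing moment.\<close>

lemma vanishing_moments_antideriv:
  "\<phi> \<in> schwartz \<Longrightarrow> (\<And>m. m < N \<Longrightarrow> moment m \<phi> = 0) \<Longrightarrow> \<exists>\<eta>\<in>schwartz. (deriv ^^ N) \<eta> = \<phi>"
proof (induction N arbitrary: \<phi>)
  case (Suc N)
  let ?\<eta> = "antideriv \<phi>"
  have \<eta>: "?\<eta> \<in> schwartz" "deriv ?\<eta> = \<phi>" using Suc.prems by (auto intro: antideriv_schwartz)
  have "moment m ?\<eta> = 0" if "m < N" for m
    using moment_Suc_deriv[OF \<eta>(1), of m] Suc.prems(2)[of "Suc m"] that \<eta>(2) by simp
  then obtain \<zeta> where \<zeta>: "\<zeta> \<in> schwartz" "(deriv ^^ N) \<zeta> = ?\<eta>" using Suc.IH[OF \<eta>(1)] by blast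
  then have "(deriv ^^ Suc N) \<zeta> = \<phi>" using \<eta>(2) by simp
  then show ?case using \<zeta>(1) by blast
qed auto

text \<open>A constant that decays at infinity is zero. Hence no polynomial part can be hidden in a
  Schwartz function.\<close>

lemma schwartz_deriv_zero:
  assumes "\<eta> \<in> schwartz" "(deriv ^^ N) \<eta> = (\<lambda>_. 0)"
  shows "\<eta> = (\<lambda>_. 0)"
  using assms
proof (induction N arbitrary: \<eta>)
  case (Suc N)
  have "deriv \<eta> = (\<lambda>_. 0)"
  proof (rule Suc.IH)
    show "deriv \<eta> \<in> schwartz" by (rule SR.deriv_mem[OF Suc.prems(1)])
    show "(deriv ^^ N) (deriv \<eta>) = (\<lambda>_. 0)" unfolding deriv_iter_deriv by (rule Suc.prems(2))
  qed
  then have "\<And>t. (\<eta> has_real_derivative 0) (at t)"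
    using smooth_has_derivative[OF schwartz_smooth[OF Suc.prems(1)]] by simp
  then have const: "\<eta> t = \<eta> 0" for t using DERIV_isconst_all by blast
  obtain B where B: "B \<ge> 0" "\<And>t. (1 + \<bar>t\<bar>) ^ 1 * \<bar>(deriv ^^ 0) \<eta> t\<bar> \<le> B"
    using schwartz_weight_bound[OF Suc.prems(1)] by blast
  have "\<eta> 0 = 0"
  proof (rule ccontr)
    assume nz: "\<eta> 0 \<noteq> 0"
    have "(1 + \<bar>B / \<bar>\<eta> 0\<bar>\<bar>) * \<bar>\<eta> 0\<bar> \<le> B" using B(2)[of "B / \<bar>\<eta> 0\<bar>"] const[of "B / \<bar>\<eta> 0\<bar>"] by simp
    then have "\<bar>\<eta> 0\<bar> + B \<le> B" using nz B(1) by (simp add: distrib_right)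
    then show False using nz by simp
  qed
  then show ?case using const by auto
qed simp

text \<open>Every derivative is a polynomial times the Gaussian; \<open>p n\<close> is the resulting
  sequence of polynomials, the Hermite polynomials up to sign.\<close>

lemma gaussian_schwartz: "(\<lambda>t. exp (- t\<^sup>2)) \<in> schwartz"
proof -
  define p where "p n = ((\<lambda>q. pderiv q - [:0, 2:] * q) ^^ n) (1 :: real poly)" for n
  have "((\<lambda>t. poly q t * exp (- t\<^sup>2)) has_real_derivative poly (pderiv q - [:0, 2:] * q) t * exp (- t\<^sup>2)) (at t)"
    for q :: "real poly" and t
    by (auto intro!: derivative_eq_intros poly_DERIV simp: algebra_simps)
  then have 1: "((\<lambda>t. poly (p n) t * exp (- t\<^sup>2)) has_real_derivative poly (p (Suc n)) t * exp (- t\<^sup>2)) (at t)" for n t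
    by (simp add: p_def)
  have p0: "(\<lambda>t. poly (p 0) t * exp (- t\<^sup>2)) = (\<lambda>t. exp (- t\<^sup>2))" by (simp add: p_def)
  have pow: "\<bar>t ^ k * exp (- t\<^sup>2)\<bar> \<le> 1 + fact k" for k and t :: real
  proof -
    have "\<bar>t\<bar> ^ k \<le> 1 + (t\<^sup>2) ^ k"
    proof (cases "\<bar>t\<bar> \<le> 1")
      case True
      then have "\<bar>t\<bar> ^ k \<le> 1" by (simp add: power_le_one)
      then show ?thesis by (smt (verit) zero_le_power zero_le_power2)
    next
      case False
      then have "\<bar>t\<bar> ^ k \<le> \<bar>t\<bar> ^ (2 * k)" by (intro power_increasing) auto
      then show ?thesis by (simp add: power_mult)
    qed
    \<comment> \<open>A single term of the exponential series is at most the whole sum.\<close>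
    also have "(t\<^sup>2) ^ k \<le> fact k * exp (t\<^sup>2)"
    proof -
      have s: "summable (\<lambda>n. (t\<^sup>2) ^ n /\<^sub>R fact n)" using exp_converges by (rule sums_summable)
      have "(t\<^sup>2) ^ k /\<^sub>R fact k = (\<Sum>n\<in>{k}. (t\<^sup>2) ^ n /\<^sub>R fact n)" by simp
      also have "\<dots> \<le> (\<Sum>n. (t\<^sup>2) ^ n /\<^sub>R fact n)" by (rule sum_le_suminf[OF s]) auto
      also have "\<dots> = exp (t\<^sup>2)" using exp_converges sums_unique by metis
      finally show ?thesis by (simp add: field_simps)
    qed
    finally have "\<bar>t\<bar> ^ k * exp (- t\<^sup>2) \<le> (1 + fact k * exp (t\<^sup>2)) * exp (- t\<^sup>2)"
      by (intro mult_right_mono) auto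
    also have "\<dots> = exp (- t\<^sup>2) + fact k" by (simp add: distrib_right exp_minus)
    also have "\<dots> \<le> 1 + fact k" by simp
    finally show ?thesis by (simp add: abs_mult power_abs)
  qed
  have bd: "\<exists>B. \<forall>t. \<bar>t ^ m * (poly q t * exp (- t\<^sup>2))\<bar> \<le> B" for m and q :: "real poly"
  proof (induction q arbitrary: m)
    case 0
    then show ?case by auto
  next
    case (pCons a q)
    obtain B where B: "\<And>t. \<bar>t ^ Suc m * (poly q t * exp (- t\<^sup>2))\<bar> \<le> B" using pCons.IH by blast
    have "\<bar>t ^ m * (poly (pCons a q) t * exp (- t\<^sup>2))\<bar> \<le> \<bar>a\<bar> * (1 + fact m) + B" for t
    proof -
      have "t ^ m * (poly (pCons a q) t * exp (- t\<^sup>2)) = a * (t ^ m * exp (- t\<^sup>2)) + t ^ Suc m * (poly q t * exp (- t\<^sup>2))"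
        by (simp add: algebra_simps)
      also have "\<bar>\<dots>\<bar> \<le> \<bar>a\<bar> * \<bar>t ^ m * exp (- t\<^sup>2)\<bar> + \<bar>t ^ Suc m * (poly q t * exp (- t\<^sup>2))\<bar>"
        by (metis abs_mult abs_triangle_ineq)
      also have "\<dots> \<le> \<bar>a\<bar> * (1 + fact m) + B"
        using B[of t] pow[of t m] by (intro add_mono mult_left_mono) auto
      finally show ?thesis .
    qed
    then show ?case by blast
  qed
  show ?thesis
    unfolding schwartz_iff deriv_iter_eqI[of "\<lambda>n t. poly (p n) t * exp (- t\<^sup>2)", OF p0 1]
    using smoothI[of "\<lambda>n t. poly (p n) t * exp (- t\<^sup>2)", OF p0 1] bd by blast
qed

lemma mollifier_exists: "\<exists>\<kappa>\<in>schwartz. (\<forall>t. 0 \<le> \<kappa> t) \<and> (LINT t|lborel. \<kappa> t) = 1"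
proof -
  let ?g = "\<lambda>t::real. exp (- t\<^sup>2)"
  have int: "integrable lborel ?g" by (rule schwartz_integrable[OF gaussian_schwartz])
  have le: "indicator {0..1} t * exp (- 1) \<le> ?g t" for t :: real
    by (auto simp: indicator_def power_le_one)
  have "(LINT t|lborel. indicator {0..1::real} t * exp (- 1)) \<le> (LINT t|lborel. ?g t)"
    by (rule integral_mono[OF _ int le]) auto
  then have pos: "0 < (LINT t|lborel. ?g t)"
    by (simp add: order.strict_trans2[of 0 "exp (-1)"])
  show ?thesis
    using SR.scale_mem[OF gaussian_schwartz, of "1 / (LINT t|lborel. ?g t)"] pos
    by (intro bexI[of _ "\<lambda>t. 1 / (LINT t|lborel. ?g t) * ?g t"]) auto
qed

subsection \<open>Solving \<open>D\<^sup>N v = u\<close>\<close>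

context test_space
begin

lemma uniform_decay:
  assumes f: "f \<in> X"
  shows "\<exists>B\<ge>0. \<forall>m\<in>M. \<forall>n t. m \<le> K \<longrightarrow> n \<le> K \<longrightarrow> \<bar>t ^ m * (deriv ^^ n) f t\<bar> \<le> B"
proof -
  have "\<forall>m n. \<exists>B. m \<in> M \<longrightarrow> (\<forall>t. \<bar>t ^ m * (deriv ^^ n) f t\<bar> \<le> B)" using decay[OF f] by blast
  then obtain b where b: "\<And>m n t. m \<in> M \<Longrightarrow> \<bar>t ^ m * (deriv ^^ n) f t\<bar> \<le> b m n" by metis
  define D where "D = (\<Sum>(m, n)\<in>{..K} \<times> {..K}. \<bar>b m n\<bar>)"
  have "\<bar>t ^ m * (deriv ^^ n) f t\<bar> \<le> D" if "m \<in> M" "m \<le> K" "n \<le> K" for m n t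
  proof -
    have "\<bar>b m n\<bar> = (case (m, n) of (m, n) \<Rightarrow> \<bar>b m n\<bar>)" by simp
    also have "\<dots> \<le> D" unfolding D_def using that by (intro member_le_sum) auto
    finally show ?thesis using b[OF that(1), of t n] by linarith
  qed
  moreover have "0 \<le> D" unfolding D_def by (rule sum_nonneg) auto
  ultimately show ?thesis by blast
qed

end

section \<open>Primitives of tempered generalized functions\<close>

lemma weight_from_seminorms:
  fixes f :: "real \<Rightarrow> real"
  assumes B: "\<And>m n t. m \<le> K \<Longrightarrow> n \<le> K \<Longrightarrow> \<bar>t ^ m * (deriv ^^ n) f t\<bar> \<le> B" and mn: "m \<le> K" "n \<le> K"
  shows "(1 + \<bar>t\<bar>) ^ m * \<bar>(deriv ^^ n) f t\<bar> \<le> 2 ^ m * (2 * B)"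
proof -
  have "(1 + \<bar>t\<bar>) ^ m * \<bar>(deriv ^^ n) f t\<bar> \<le> (2 ^ m * (1 + \<bar>t\<bar> ^ m)) * \<bar>(deriv ^^ n) f t\<bar>"
    by (intro mult_right_mono power_one_add_le) auto
  also have "\<dots> = 2 ^ m * (\<bar>t ^ 0 * (deriv ^^ n) f t\<bar> + \<bar>t ^ m * (deriv ^^ n) f t\<bar>)"
    by (simp add: abs_mult power_abs algebra_simps)
  also have "\<dots> \<le> 2 ^ m * (B + B)" by (intro mult_left_mono add_mono B) (use mn in auto)
  finally show ?thesis by simp
qed

lemma schwartz_eqI_deriv:
  assumes "\<phi> \<in> schwartz" "\<psi> \<in> schwartz" "deriv \<phi> = deriv \<psi>"
  shows "\<phi> = \<psi>"
proof -
  have "(deriv ^^ 1) (\<lambda>t. \<phi> t - \<psi> t) = (\<lambda>_. 0)"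
    using assms by (simp only: deriv_iter_diff schwartz_smooth) simp
  from schwartz_deriv_zero[OF SR.diff_mem[OF assms(1,2)] this] show ?thesis
    by (simp add: fun_eq_iff)
qed

text \<open>A primitive must be prescribed on derivatives, that is on test functions of integral
  zero. The map \<open>P\<close> projects onto these by subtracting a multiple of a fixed
  \<open>\<kappa>\<close>, \<open>J\<close> integrates, and \<open>- u (J \<phi>)\<close> is the
  primitive; the rest is continuity of \<open>J\<close>.\<close>

lemma dual_SR_antiderivative:
  assumes u: "u \<in> dual SR"
  shows "\<exists>v\<in>dual SR. \<forall>\<phi>\<in>schwartz. v (deriv \<phi>) = - u \<phi>"
proof -
  obtain \<kappa> where \<kappa>: "\<kappa> \<in> schwartz" "(LINT t|lborel. \<kappa> t) = 1" using mollifier_exists by blast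
  then have \<kappa>1: "moment 0 \<kappa> = 1" by (simp add: moment_def)
  define P where "P \<phi> = (\<lambda>t. \<phi> t - moment 0 \<phi> * \<kappa> t)" for \<phi>
  have P: "P \<phi> \<in> schwartz" "moment 0 (P \<phi>) = 0" if "\<phi> \<in> schwartz" for \<phi>
    unfolding P_def using that \<kappa>
    by (auto simp: moment_diff moment_scale \<kappa>1 SR.scale_mem intro!: SR.diff_mem)
  define J where "J \<phi> = antideriv (P \<phi>)" for \<phi>
  have J: "J \<phi> \<in> schwartz" "deriv (J \<phi>) = P \<phi>" if "\<phi> \<in> schwartz" for \<phi>
    unfolding J_def using antideriv_schwartz[OF P[OF that]] by auto
  have J_add: "J (\<lambda>t. \<phi> t + \<psi> t) = (\<lambda>t. J \<phi> t + J \<psi> t)" if \<phi>: "\<phi> \<in> schwartz" and \<psi>: "\<psi> \<in> schwartz" for \<phi> \<psi>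
  proof (rule schwartz_eqI_deriv)
    have mem: "(\<lambda>t. \<phi> t + \<psi> t) \<in> schwartz" by (rule SR.add_mem[OF \<phi> \<psi>])
    show "J (\<lambda>t. \<phi> t + \<psi> t) \<in> schwartz" by (rule J[OF mem])
    show "(\<lambda>t. J \<phi> t + J \<psi> t) \<in> schwartz" by (intro SR.add_mem J \<phi> \<psi>)
    have "deriv (\<lambda>t. J \<phi> t + J \<psi> t) = (\<lambda>t. P \<phi> t + P \<psi> t)"
      using deriv_iter_add[OF schwartz_smooth schwartz_smooth, of "J \<phi>" "J \<psi>" 1] J \<phi> \<psi> by simp
    then show "deriv (J (\<lambda>t. \<phi> t + \<psi> t)) = deriv (\<lambda>t. J \<phi> t + J \<psi> t)"
      unfolding J(2)[OF mem] by (simp add: P_def moment_add \<phi> \<psi> fun_eq_iff algebra_simps)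
  qed
  have J_scale: "J (\<lambda>t. c * \<phi> t) = (\<lambda>t. c * J \<phi> t)" if \<phi>: "\<phi> \<in> schwartz" for c \<phi>
  proof (rule schwartz_eqI_deriv)
    have mem: "(\<lambda>t. c * \<phi> t) \<in> schwartz" by (rule SR.scale_mem[OF \<phi>])
    show "J (\<lambda>t. c * \<phi> t) \<in> schwartz" by (rule J[OF mem])
    show "(\<lambda>t. c * J \<phi> t) \<in> schwartz" by (intro SR.scale_mem J \<phi>)
    have "deriv (\<lambda>t. c * J \<phi> t) = (\<lambda>t. c * P \<phi> t)"
      using deriv_iter_scale[OF schwartz_smooth, of "J \<phi>" 1 c] J \<phi> by simp
    then show "deriv (J (\<lambda>t. c * \<phi> t)) = deriv (\<lambda>t. c * J \<phi> t)"
      unfolding J(2)[OF mem] by (simp add: P_def moment_scale fun_eq_iff algebra_simps)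
  qed
  have J_deriv: "J (deriv \<phi>) = \<phi>" if \<phi>: "\<phi> \<in> schwartz" for \<phi>
  proof (rule schwartz_eqI_deriv[OF J(1)[OF SR.deriv_mem[OF \<phi>]] \<phi>])
    show "deriv (J (deriv \<phi>)) = deriv \<phi>"
      unfolding J(2)[OF SR.deriv_mem[OF \<phi>]] P_def moment_0_deriv[OF \<phi>] by simp
  qed
  obtain C K where CK: "0 \<le> C" "\<And>f B. f \<in> schwartz \<Longrightarrow> (\<forall>m\<in>UNIV. \<forall>n t. m \<le> K \<longrightarrow> n \<le> K \<longrightarrow> \<bar>t ^ m * (deriv ^^ n) f t\<bar> \<le> B)
            \<Longrightarrow> \<bar>u f\<bar> \<le> C * B" using SR.dual_bound[OF u] by metis
  obtain b where b: "b \<ge> 0" "\<And>m n t. m \<le> K + 2 \<Longrightarrow> n \<le> K + 2 \<Longrightarrow> \<bar>t ^ m * (deriv ^^ n) \<kappa> t\<bar> \<le> b"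
    using SR.uniform_decay[OF \<kappa>(1), of "K + 2"] by blast
  \<comment> \<open>\<open>c1\<close> bounds \<open>P\<close> on seminorms: 8 comes from bounding
    the weight \<open>(1 + \<bar>t\<bar>)^2\<close> by seminorms, and \<open>b\<close> bounds those
    of \<open>\<kappa>\<close>. \<open>c2\<close> bounds the integration; its summand 1 accounts for
    derivatives of positive order, which only shift the index.\<close>
  define c1 where "c1 = 1 + 8 * cauchy_mass * b"
  define c2 where "c2 = 2 ^ (K + 2) * 2 * cauchy_mass + 1"
  have "(\<lambda>\<phi>\<in>schwartz. - u (J \<phi>)) \<in> dual SR"
  proof (rule SR.dualI[where K = "K + 2" and C = "C * (c2 * c1)"])
    fix f B assume f: "f \<in> schwartz"
      and "\<And>m n t. m \<in> UNIV \<Longrightarrow> m \<le> K + 2 \<Longrightarrow> n \<le> K + 2 \<Longrightarrow> \<bar>t ^ m * (deriv ^^ n) f t\<bar> \<le> B"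
    then have B: "\<And>m n t. m \<le> K + 2 \<Longrightarrow> n \<le> K + 2 \<Longrightarrow> \<bar>t ^ m * (deriv ^^ n) f t\<bar> \<le> B" by simp
    have "\<bar>t ^ 0 * (deriv ^^ 0) f t\<bar> \<le> B" for t by (rule B) auto
    then have B0: "B \<ge> 0" using abs_ge_zero order_trans by blast
    have "(1 + \<bar>t\<bar>) ^ (0 + 2) * \<bar>f t\<bar> \<le> 8 * B" for t
    proof -
      have "(1 + \<bar>t\<bar>) ^ (0 + 2) * \<bar>f t\<bar> = (1 + \<bar>t\<bar>) ^ 2 * \<bar>(deriv ^^ 0) f t\<bar>"
        by (simp only: add_0 funpow_0)
      also have "\<dots> \<le> 2 ^ 2 * (2 * B)" by (rule weight_from_seminorms[OF B]) auto
      also have "\<dots> = 8 * B" by simp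
      finally show ?thesis .
    qed
    from moderate_integral_bound[of "\<lambda>_. 1" 1 0, OF _ _ schwartz_measurable[OF f] this]
    have mom: "\<bar>moment 0 f\<bar> \<le> 8 * B * cauchy_mass" by (simp add: moment_def)
    have PB: "\<bar>t ^ m * (deriv ^^ n) (P f) t\<bar> \<le> c1 * B" if mn: "m \<le> K + 2" "n \<le> K + 2" for m n t
    proof -
      have "(deriv ^^ n) (P f) = (\<lambda>t. (deriv ^^ n) f t - moment 0 f * (deriv ^^ n) \<kappa> t)"
        unfolding P_def using f \<kappa>(1) by (simp only: deriv_iter_diff deriv_iter_scale schwartz_smooth SR.scale_mem)
      then have "t ^ m * (deriv ^^ n) (P f) t = t ^ m * (deriv ^^ n) f t - moment 0 f * (t ^ m * (deriv ^^ n) \<kappa> t)"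
        by (simp add: algebra_simps)
      also have "\<bar>\<dots>\<bar> \<le> \<bar>t ^ m * (deriv ^^ n) f t\<bar> + \<bar>moment 0 f\<bar> * \<bar>t ^ m * (deriv ^^ n) \<kappa> t\<bar>"
        by (metis abs_mult abs_triangle_ineq4)
      also have "\<dots> \<le> B + (8 * B * cauchy_mass) * b"
        using B0 cauchy_mass_nonneg by (intro add_mono mult_mono mom B b(2) mn) auto
      finally show ?thesis by (simp add: c1_def algebra_simps)
    qed
    have nn: "0 \<le> c1 * B" using b(1) cauchy_mass_nonneg B0 by (simp add: c1_def)
    have "\<bar>u (J f)\<bar> \<le> C * (c2 * (c1 * B))"
    proof (rule CK(2)[OF J(1)[OF f]], intro ballI allI impI)
      fix m n t assume mn: "m \<le> K" "n \<le> K"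
      show "\<bar>t ^ m * (deriv ^^ n) (J f) t\<bar> \<le> c2 * (c1 * B)"
      proof (cases n)
        case 0
        have "(1 + \<bar>t\<bar>) ^ (m + 2) * \<bar>P f t\<bar> \<le> 2 ^ (K + 2) * (2 * (c1 * B))" for t
        proof -
          have "(1 + \<bar>t\<bar>) ^ (m + 2) * \<bar>(deriv ^^ 0) (P f) t\<bar> \<le> 2 ^ (m + 2) * (2 * (c1 * B))"
            by (rule weight_from_seminorms[OF PB]) (use mn in auto)
          also have "\<dots> \<le> 2 ^ (K + 2) * (2 * (c1 * B))"
            using nn mn by (intro mult_right_mono power_increasing) auto
          finally show ?thesis by simp
        qed
        from antideriv_bound[OF P[OF f] this, of t]
        have "\<bar>t ^ m * J f t\<bar> \<le> 2 ^ (K + 2) * (2 * (c1 * B)) * cauchy_mass" unfolding J_def .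
        also have "\<dots> \<le> c2 * (c1 * B)" using nn by (simp add: c2_def algebra_simps)
        finally show ?thesis using 0 by simp
      next
        case (Suc k)
        then have "\<bar>t ^ m * (deriv ^^ n) (J f) t\<bar> = \<bar>t ^ m * (deriv ^^ k) (P f) t\<bar>"
          using J(2)[OF f] deriv_iter_deriv[of k "J f"] by simp
        also have "\<dots> \<le> 1 * (c1 * B)" using PB[of m k t] mn Suc by simp
        also have "\<dots> \<le> c2 * (c1 * B)" using nn cauchy_mass_nonneg by (intro mult_right_mono) (auto simp: c2_def)
        finally show ?thesis .
      qed
    qed
    then show "\<bar>(\<lambda>\<phi>\<in>schwartz. - u (J \<phi>)) f\<bar> \<le> C * (c2 * c1) * B" using f by (simp add: mult.assoc)
  qed (auto simp: J_add J_scale J SR.add_mem SR.scale_mem SR.dual_add[OF u] SR.dual_scale[OF u])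
  then show ?thesis
    by (rule bexI[rotated]) (simp add: J_deriv SR.deriv_mem)
qed

lemma dual_SR_iterated_antiderivative:
  "u \<in> dual SR \<Longrightarrow> \<exists>v\<in>dual SR. \<forall>\<phi>\<in>schwartz. v ((deriv ^^ N) \<phi>) = (-1) ^ N * u \<phi>"
proof (induction N)
  case (Suc N)
  then obtain v where v: "v \<in> dual SR" "\<And>\<phi>. \<phi> \<in> schwartz \<Longrightarrow> v ((deriv ^^ N) \<phi>) = (-1) ^ N * u \<phi>" by blast
  obtain v' where v': "v' \<in> dual SR" "\<And>\<phi>. \<phi> \<in> schwartz \<Longrightarrow> v' (deriv \<phi>) = - v \<phi>"
    using dual_SR_antiderivative[OF v(1)] by blast
  have "v' ((deriv ^^ Suc N) \<phi>) = (-1) ^ Suc N * u \<phi>" if "\<phi> \<in> schwartz" for \<phi>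
    using v'(2)[OF SR.iter_mem[OF that]] v(2)[OF that] by simp
  then show ?case using v'(1) by blast
qed auto

section \<open>Primitives on the torus\<close>

abbreviation XT :: "(real \<Rightarrow> real) set" where "XT \<equiv> {f. smooth f \<and> periodic1 f}"

lemma XT_const: "(\<lambda>_. c) \<in> XT"
  by (simp add: smooth_const periodic1_def)

text \<open>Integration by parts shows that this is a periodic primitive of \<open>\<phi>\<close>
  minus its mean. Written as a correlation with a sawtooth kernel, it inherits periodicity and
  smoothness from the correlation lemmas.\<close>

definition antideriv_T :: "(real \<Rightarrow> real) \<Rightarrow> real \<Rightarrow> real" where
  "antideriv_T \<phi> = (\<lambda>y. integral {0..1} (\<lambda>s. s * \<phi> (y + s)))"

lemma continuous_on_translate:
  "smooth \<phi> \<Longrightarrow> continuous_on S (\<lambda>s. \<phi> (y + s))"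
  by (rule continuous_on_compose2[OF smooth_continuous[of \<phi> UNIV]]) (auto intro!: continuous_intros)

lemma antideriv_T:
  assumes \<phi>: "\<phi> \<in> XT"
  shows "antideriv_T \<phi> \<in> XT"
    and "(deriv ^^ n) (antideriv_T \<phi>) = antideriv_T ((deriv ^^ n) \<phi>)"
    and "deriv (antideriv_T \<phi>) = (\<lambda>y. \<phi> y - integral {0..1} \<phi>)"
proof -
  have sm: "smooth \<phi>" and per: "periodic1 \<phi>" using \<phi> by auto
  show "antideriv_T \<phi> \<in> XT" unfolding antideriv_T_def by (rule ST.correlation_mem[OF \<phi>]) (rule continuous_on_id)
  show it: "(deriv ^^ n) (antideriv_T \<phi>) = antideriv_T ((deriv ^^ n) \<phi>)" for n
    unfolding antideriv_T_def by (rule deriv_iter_interval_correlation[OF sm continuous_on_id])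
  show "deriv (antideriv_T \<phi>) = (\<lambda>y. \<phi> y - integral {0..1} \<phi>)"
  proof
    fix y
    have c: "continuous_on S (\<lambda>s. \<phi> (y + s))" "continuous_on S (\<lambda>s. deriv \<phi> (y + s))" for S
      by (intro continuous_on_translate sm smooth_deriv)+
    have "((\<lambda>s. \<phi> (y + s) + s * deriv \<phi> (y + s)) has_integral (1 * \<phi> (y + 1) - 0 * \<phi> (y + 0))) {0..1}"
    proof (rule fundamental_theorem_of_calculus)
      fix s :: real
      have "((\<lambda>s. \<phi> (y + s)) has_real_derivative deriv \<phi> (y + s)) (at s within {0..1})"
        using deriv_iter_translate_has_derivative[OF sm, of 0 y s] by simp
      from DERIV_mult[OF DERIV_ident this]
      show "((\<lambda>s. s * \<phi> (y + s)) has_vector_derivative \<phi> (y + s) + s * deriv \<phi> (y + s)) (at s within {0..1})"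
        by (simp add: has_real_derivative_iff_has_vector_derivative mult.commute)
    qed simp
    then have "integral {0..1} (\<lambda>s. \<phi> (y + s) + s * deriv \<phi> (y + s)) = \<phi> y"
      using per by (simp add: integral_unique periodic1_def)
    moreover have "integral {0..1} (\<lambda>s. \<phi> (y + s) + s * deriv \<phi> (y + s)) =
       integral {0..1} (\<lambda>s. \<phi> (y + s)) + integral {0..1} (\<lambda>s. s * deriv \<phi> (y + s))"
      by (intro Henstock_Kurzweil_Integration.integral_add integrable_continuous_interval continuous_intros c)
    moreover have "integral {0..1} (\<lambda>s. \<phi> (y + s)) = integral {0..1} \<phi>"
      using periodic1_shift_integral[OF per smooth_continuous[OF sm], of y] by (simp add: add.commute)
    ultimately show "deriv (antideriv_T \<phi>) y = \<phi> y - integral {0..1} \<phi>"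
      using it[of 1] by (simp add: antideriv_T_def)
  qed
qed

text \<open>On the torus \<open>v (deriv \<phi>) = - u \<phi>\<close> forces \<open>u\<close> to
  vanish on constants. The solution is normalized to vanish on constants too, so the construction
  can be iterated.\<close>

lemma dual_ST_antiderivative:
  assumes u: "u \<in> dual ST" and u1: "u (\<lambda>_. 1) = 0"
  shows "\<exists>v\<in>dual ST. v (\<lambda>_. 1) = 0 \<and> (\<forall>\<phi>\<in>XT. v (deriv \<phi>) = - u \<phi>)"
proof -
  have uc: "u (\<lambda>_. c) = 0" for c using ST.dual_scale[OF u XT_const, of c 1] u1 by simp
  have rep: "u (antideriv_T \<phi>) = integral {0..1} (\<lambda>s. s * u (\<lambda>y. \<phi> (y + s)))" if "\<phi> \<in> XT" for \<phi>
    unfolding antideriv_T_def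
    by (rule ST.dual_correlation[OF u that smoothI[of "\<lambda>n t. if n = 0 then t else if n = 1 then 1 else 0"]]) auto
  let ?v = "\<lambda>\<phi>\<in>XT. - u (antideriv_T \<phi>)"
  obtain C K where CK: "0 \<le> C" "\<And>f B. f \<in> XT \<Longrightarrow> (\<forall>m\<in>{0}. \<forall>n t. m \<le> K \<longrightarrow> n \<le> K \<longrightarrow> \<bar>t ^ m * (deriv ^^ n) f t\<bar> \<le> B)
            \<Longrightarrow> \<bar>u f\<bar> \<le> C * B" using ST.dual_bound[OF u] by blast
  have add: "antideriv_T (\<lambda>t. \<phi> t + \<psi> t) = (\<lambda>t. antideriv_T \<phi> t + antideriv_T \<psi> t)" if "\<phi> \<in> XT" "\<psi> \<in> XT" for \<phi> \<psi>
  proof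
    fix y
    have "continuous_on {0..1} (\<lambda>s. s * f (y + s))" if "f \<in> XT" for f
      using that by (intro continuous_intros continuous_on_translate) auto
    then show "antideriv_T (\<lambda>t. \<phi> t + \<psi> t) y = antideriv_T \<phi> y + antideriv_T \<psi> y"
      unfolding antideriv_T_def distrib_left using that
      by (intro Henstock_Kurzweil_Integration.integral_add integrable_continuous_interval) auto
  qed
  have scale: "antideriv_T (\<lambda>t. c * \<phi> t) = (\<lambda>t. c * antideriv_T \<phi> t)" for c \<phi>
    unfolding antideriv_T_def by (simp only: mult.left_commute[of _ c] integral_mult_right)
  have "?v \<in> dual ST"
  proof (rule ST.dualI[where K = K and C = C])
    fix f B assume f: "f \<in> XT" and B: "\<And>m n t. m \<in> {0} \<Longrightarrow> m \<le> K \<Longrightarrow> n \<le> K \<Longrightarrow> \<bar>t ^ m * (deriv ^^ n) f t\<bar> \<le> B"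
    have "\<bar>u (antideriv_T f)\<bar> \<le> C * B"
    proof (rule CK(2)[OF antideriv_T(1)[OF f]], intro ballI allI impI)
      fix m n y assume mn: "m \<in> {0::nat}" "m \<le> K" "n \<le> K"
      have "norm (integral {0..1} (\<lambda>s. s * (deriv ^^ n) f (y + s))) \<le> B * (1 - 0)"
      proof (rule integral_bound)
        show "continuous_on {0..1} (\<lambda>s. s * (deriv ^^ n) f (y + s))"
          using f by (intro continuous_intros continuous_on_translate smooth_iter) auto
        fix s :: real assume "s \<in> {0..1}"
        then have "\<bar>s\<bar> * \<bar>(deriv ^^ n) f (y + s)\<bar> \<le> 1 * B"
          using B[of 0 n "y + s"] mn by (intro mult_mono) auto
        then show "norm (s * (deriv ^^ n) f (y + s)) \<le> B" by (simp add: abs_mult)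
      qed simp
      then show "\<bar>y ^ m * (deriv ^^ n) (antideriv_T f) y\<bar> \<le> B"
        using mn unfolding antideriv_T(2)[OF f] by (simp add: antideriv_T_def)
    qed
    then show "\<bar>?v f\<bar> \<le> C * B" using f by simp
  next
    fix f g assume fg: "f \<in> XT" "g \<in> XT"
    then show "?v (\<lambda>t. f t + g t) = ?v f + ?v g"
      using ST.add_mem[OF fg] ST.dual_add[OF u antideriv_T(1)[OF fg(1)] antideriv_T(1)[OF fg(2)]] add[OF fg] by simp
  next
    fix c f assume f: "f \<in> XT"
    then show "?v (\<lambda>t. c * f t) = c * ?v f"
      using ST.scale_mem[OF f, of c] ST.dual_scale[OF u antideriv_T(1)[OF f]] scale by simp
  qed simp
  moreover have "?v (\<lambda>_. 1) = 0"
  proof -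
    have "antideriv_T (\<lambda>_. 1) = (\<lambda>_. integral {0..1} (\<lambda>s::real. s))" by (simp add: antideriv_T_def)
    then show ?thesis using XT_const[of 1] uc by simp
  qed
  moreover have "?v (deriv \<phi>) = - u \<phi>" if \<phi>: "\<phi> \<in> XT" for \<phi>
  proof -
    have "antideriv_T (deriv \<phi>) = deriv (antideriv_T \<phi>)" using antideriv_T(2)[OF \<phi>, of 1] by simp
    also have "\<dots> = (\<lambda>y. \<phi> y - integral {0..1} \<phi>)" by (rule antideriv_T(3)[OF \<phi>])
    finally show ?thesis
      using ST.deriv_mem[OF \<phi>] ST.dual_diff[OF u \<phi> XT_const[of "integral {0..1} \<phi>"]] uc by simp
  qed
  ultimately show ?thesis by blast
qed

lemma dual_ST_iterated_antiderivative:
  "u \<in> dual ST \<Longrightarrow> u (\<lambda>_. 1) = 0 \<Longrightarrow>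
     \<exists>v\<in>dual ST. v (\<lambda>_. 1) = 0 \<and> (\<forall>\<phi>\<in>XT. v ((deriv ^^ N) \<phi>) = (-1) ^ N * u \<phi>)"
proof (induction N)
  case (Suc N)
  then obtain v where v: "v \<in> dual ST" "v (\<lambda>_. 1) = 0" "\<And>\<phi>. \<phi> \<in> XT \<Longrightarrow> v ((deriv ^^ N) \<phi>) = (-1) ^ N * u \<phi>" by blast
  obtain v' where v': "v' \<in> dual ST" "v' (\<lambda>_. 1) = 0" "\<And>\<phi>. \<phi> \<in> XT \<Longrightarrow> v' (deriv \<phi>) = - v \<phi>"
    using dual_ST_antiderivative[OF v(1,2)] by blast
  have "v' ((deriv ^^ Suc N) \<phi>) = (-1) ^ Suc N * u \<phi>" if "\<phi> \<in> XT" for \<phi>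
    using v'(3)[OF ST.iter_mem[OF that]] v(3)[OF that] by simp
  then show ?case using v'(1,2) by blast
qed auto

text \<open>The primitive again has mean zero, so a single vanishing mean suffices for all
  \<open>N\<close> integrations, in contrast to the line.\<close>

lemma mean_zero_antideriv_T:
  "\<phi> \<in> XT \<Longrightarrow> integral {0..1} \<phi> = 0 \<Longrightarrow> \<exists>\<eta>\<in>XT. (deriv ^^ N) \<eta> = \<phi>"
proof (induction N arbitrary: \<phi>)
  case (Suc N)
  let ?\<eta> = "antideriv_T \<phi>"
  have \<eta>: "?\<eta> \<in> XT" "deriv ?\<eta> = \<phi>" using antideriv_T[OF Suc.prems(1)] Suc.prems(2) by auto
  have one: "regular_T (\<lambda>_. 1) \<in> dual ST" by (rule regular_T_dual) (rule continuous_on_const)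
  have ap: "regular_T (\<lambda>_. 1) f = integral {0..1} f" if "f \<in> XT" for f
    using that regular_T_apply[of "\<lambda>_. 1" f] by simp
  \<comment> \<open>Fubini's theorem in the form of \<open>dual_correlation\<close> for the
    functional that integrates over one period.\<close>
  have "integral {0..1} ?\<eta> = integral {0..1} (\<lambda>s. s * regular_T (\<lambda>_. 1) (\<lambda>y. \<phi> (y + s)))"
    using ap[OF \<eta>(1)] unfolding antideriv_T_def
    by (subst ST.dual_correlation[OF one Suc.prems(1) smoothI[of "\<lambda>n t. if n = 0 then t else if n = 1 then 1 else 0"], symmetric]) auto
  also have "\<dots> = 0"
  proof -
    have "regular_T (\<lambda>_. 1) (\<lambda>y. \<phi> (y + s)) = 0" for s
      using ap[OF ST.shift_mem[OF Suc.prems(1)]] Suc.prems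
        periodic1_shift_integral[of \<phi> s, OF _ smooth_continuous] by simp
    then show ?thesis by simp
  qed
  finally obtain \<zeta> where \<zeta>: "\<zeta> \<in> XT" "(deriv ^^ N) \<zeta> = ?\<eta>" using Suc.IH[OF \<eta>(1)] by blast
  then have "(deriv ^^ Suc N) \<zeta> = \<phi>" using \<eta>(2) by simp
  then show ?case using \<zeta>(1) by blast
qed auto

subsection \<open>Measures as functionals\<close>

text \<open>A common frame for \<open>C_0\<close> on the line and \<open>C\<close> on the torus.
  Uniform continuity of the elements carries both arguments made later: uniformity over translates
  and convergence of interpolants.\<close>

locale sup_space =
  fixes C :: "(real \<Rightarrow> real) topology" and Y :: "(real \<Rightarrow> real) set"
  assumes C_eq: "C = seminorm_topology Y {\<lambda>f. SUP t. \<bar>f t\<bar>}"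
    and zero_mem: "(\<lambda>_. 0) \<in> Y"
    and add_mem: "\<And>f g. f \<in> Y \<Longrightarrow> g \<in> Y \<Longrightarrow> (\<lambda>t. f t + g t) \<in> Y"
    and scale_mem: "\<And>c f. f \<in> Y \<Longrightarrow> (\<lambda>t. c * f t) \<in> Y"
    and shift_mem: "\<And>b f. f \<in> Y \<Longrightarrow> (\<lambda>t. f (t - b)) \<in> Y"
    and bounded_mem: "\<And>f. f \<in> Y \<Longrightarrow> \<exists>B. \<forall>t. \<bar>f t\<bar> \<le> B"
    and uniformly_continuous_mem: "\<And>f. f \<in> Y \<Longrightarrow> uniformly_continuous_on UNIV f"
begin

sublocale seminorm_space Y "{\<lambda>f. SUP t. \<bar>f t\<bar>}"
proof
  fix p :: gfun and f g assume p: "p \<in> {\<lambda>f. SUP t. \<bar>f t\<bar>}" "f \<in> Y" "g \<in> Y"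
  obtain B1 B2 where "\<And>t. \<bar>f t\<bar> \<le> B1" "\<And>t. \<bar>g t\<bar> \<le> B2" using bounded_mem p by meson
  from SUP_abs_add[OF this] show "p (\<lambda>t. f t + g t) \<le> p f + p g" using p(1) by simp
next
  fix p :: gfun and c f assume p: "p \<in> {\<lambda>f. SUP t. \<bar>f t\<bar>}" "f \<in> Y"
  obtain B where "\<And>t. \<bar>f t\<bar> \<le> B" using bounded_mem p by meson
  from SUP_abs_scale[OF this] show "p (\<lambda>t. c * f t) = \<bar>c\<bar> * p f" using p(1) by simp
qed (auto simp: zero_mem add_mem scale_mem)

lemma topspace_C [simp]: "topspace C = Y"
  unfolding C_eq by (rule topspace_eq)

lemma extensional_dual: "u \<in> dual C \<Longrightarrow> u \<in> extensional Y"
  by (simp add: dual_def)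

lemma dual_add: "u \<in> dual C \<Longrightarrow> f \<in> Y \<Longrightarrow> g \<in> Y \<Longrightarrow> u (\<lambda>t. f t + g t) = u f + u g"
  by (simp add: dual_def)

lemma dual_scale: "u \<in> dual C \<Longrightarrow> f \<in> Y \<Longrightarrow> u (\<lambda>t. c * f t) = c * u f"
  by (simp add: dual_def)

lemma dual_zero: "u \<in> dual C \<Longrightarrow> u (\<lambda>_. 0) = 0"
  using dual_scale[of u "\<lambda>_. 0" 0] zero_mem by simp

lemma dual_diff: "u \<in> dual C \<Longrightarrow> f \<in> Y \<Longrightarrow> g \<in> Y \<Longrightarrow> u (\<lambda>t. f t - g t) = u f - u g"
  using dual_add[of u f "\<lambda>t. (-1) * g t"] dual_scale[of u g "-1"] scale_mem[of g "-1"] by simp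

lemma dual_sum:
  assumes "u \<in> dual C" "finite I" "\<And>i. i \<in> I \<Longrightarrow> f i \<in> Y"
  shows "(\<lambda>t. \<Sum>i\<in>I. f i t) \<in> Y" "u (\<lambda>t. \<Sum>i\<in>I. f i t) = (\<Sum>i\<in>I. u (f i))"
proof -
  have "(\<lambda>t. \<Sum>i\<in>I. f i t) \<in> Y \<and> u (\<lambda>t. \<Sum>i\<in>I. f i t) = (\<Sum>i\<in>I. u (f i))"
    using assms(2,3)
  proof (induction I rule: finite_induct)
    case (insert x F)
    then have F: "(\<lambda>t. \<Sum>i\<in>F. f i t) \<in> Y" "u (\<lambda>t. \<Sum>i\<in>F. f i t) = (\<Sum>i\<in>F. u (f i))" "f x \<in> Y" by auto
    have "u (\<lambda>t. f x t + (\<Sum>i\<in>F. f i t)) = u (f x) + u (\<lambda>t. \<Sum>i\<in>F. f i t)"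
      by (rule dual_add[OF assms(1) F(3,1)])
    then show ?case using insert(1,2) F add_mem[OF F(3,1)] by simp
  qed (simp add: dual_zero zero_mem assms(1))
  then show "(\<lambda>t. \<Sum>i\<in>I. f i t) \<in> Y" "u (\<lambda>t. \<Sum>i\<in>I. f i t) = (\<Sum>i\<in>I. u (f i))" by auto
qed

lemma dual_bound:
  assumes "u \<in> dual C"
  shows "\<exists>K\<ge>0. \<forall>f\<in>Y. \<forall>B. (\<forall>t. \<bar>f t\<bar> \<le> B) \<longrightarrow> \<bar>u f\<bar> \<le> K * B"
proof -
  have "continuous_map (seminorm_topology Y {\<lambda>f. SUP t. \<bar>f t\<bar>}) euclideanreal u"
    using assms C_eq by (simp add: dual_def)
  from continuous_functional_bound[OF dual_scale[OF assms] this]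
  obtain F K where F: "finite F" "F \<subseteq> {\<lambda>f. SUP t. \<bar>f t\<bar>}" "0 \<le> K"
      "\<And>f. f \<in> Y \<Longrightarrow> \<bar>u f\<bar> \<le> K * (\<Sum>p\<in>F. p f)" by blast
  have "\<bar>u f\<bar> \<le> K * B" if f: "f \<in> Y" and B: "\<forall>t. \<bar>f t\<bar> \<le> B" for f B
  proof -
    have B0: "0 \<le> B" using B abs_ge_zero order_trans by blast
    have "(\<Sum>p\<in>F. p f) \<le> B"
    \<comment> \<open>There is just one seminorm, so a finite family is either empty or this
      singleton; \<open>0 \<le> B\<close> settles the empty case.\<close>
    proof (cases "F = {}")
      case False
      then have "F = {\<lambda>f. SUP t. \<bar>f t\<bar>}" using F(2) by blast
      then show ?thesis using SUP_abs_le[of f B] B by simp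
    qed (use B0 in simp)
    then have "K * (\<Sum>p\<in>F. p f) \<le> K * B" using F(3) by (rule mult_left_mono)
    then show ?thesis using F(4)[OF f] by linarith
  qed
  then show ?thesis using F(3) by blast
qed

lemma dualI:
  assumes ext: "u \<in> extensional Y"
    and add: "\<And>f g. f \<in> Y \<Longrightarrow> g \<in> Y \<Longrightarrow> u (\<lambda>t. f t + g t) = u f + u g"
    and scale: "\<And>c f. f \<in> Y \<Longrightarrow> u (\<lambda>t. c * f t) = c * u f"
    and bound: "\<And>f B. f \<in> Y \<Longrightarrow> (\<And>t. \<bar>f t\<bar> \<le> B) \<Longrightarrow> \<bar>u f\<bar> \<le> K * B"
  shows "u \<in> dual C"
proof -
  have fin: "finite {\<lambda>f :: real \<Rightarrow> real. SUP t. \<bar>f t\<bar>}" by simp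
  have "\<bar>u f\<bar> \<le> K * (\<Sum>p\<in>{\<lambda>f. SUP t. \<bar>f t\<bar>}. p f)" if f: "f \<in> Y" for f
  proof -
    obtain B where "\<And>t. \<bar>f t\<bar> \<le> B" using bounded_mem[OF f] by blast
    then have "\<bar>u f\<bar> \<le> K * (SUP t. \<bar>f t\<bar>)" by (intro bound[OF f] abs_le_SUP)
    then show ?thesis by simp
  qed
  from continuous_functionalI[OF add scale fin subset_refl this] have "continuous_map C euclideanreal u"
    unfolding C_eq .
  then show ?thesis using ext add scale by (simp add: dual_def)
qed

lemma dual_norm_bdd:
  assumes "u \<in> dual C"
  shows "bdd_above ((\<lambda>h. \<bar>u h\<bar>) ` {h \<in> topspace C. \<forall>t. \<bar>h t\<bar> \<le> 1})"
proof -
  obtain K where "\<And>f B. f \<in> Y \<Longrightarrow> \<forall>t. \<bar>f t\<bar> \<le> B \<Longrightarrow> \<bar>u f\<bar> \<le> K * B" using dual_bound[OF assms] by blast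
  then show ?thesis by (intro bdd_aboveI[of _ "K * 1"]) fastforce
qed

lemma dual_norm_upper:
  assumes u: "u \<in> dual C" and h: "h \<in> Y" "\<And>t. \<bar>h t\<bar> \<le> B"
  shows "\<bar>u h\<bar> \<le> dual_norm C u * B"
proof (cases "B > 0")
  case True
  have "\<bar>u (\<lambda>t. (1 / B) * h t)\<bar> \<le> dual_norm C u"
    unfolding dual_norm_def
    using h True scale_mem[OF h(1), of "1 / B"] by (intro cSUP_upper dual_norm_bdd[OF u]) (simp add: abs_mult pos_divide_le_eq)
  then have "\<bar>u h\<bar> / B \<le> dual_norm C u" using dual_scale[OF u h(1), of "1 / B"] True by (simp add: abs_mult)
  then show ?thesis using True by (simp add: pos_divide_le_eq)
next
  case False
  have "h = (\<lambda>_. 0)"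
  proof
    fix t show "h t = 0" using h(2)[of t] False by linarith
  qed
  moreover have "B = 0" using h(2)[of 0] False by linarith
  ultimately show ?thesis using dual_zero[OF u] by simp
qed

lemma dual_norm_nonneg: "u \<in> dual C \<Longrightarrow> 0 \<le> dual_norm C u"
  using dual_norm_upper[of u "\<lambda>_. 0" 1] zero_mem by (simp add: dual_zero)

lemma dual_norm_leI:
  assumes "\<And>h. h \<in> Y \<Longrightarrow> (\<And>t. \<bar>h t\<bar> \<le> 1) \<Longrightarrow> \<bar>u h\<bar> \<le> K"
  shows "dual_norm C u \<le> K"
  unfolding dual_norm_def using assms zero_mem by (intro cSUP_least) auto

end

lemma vanishing_uniformly_continuous:
  fixes f :: "real \<Rightarrow> real"
  assumes c: "continuous_on UNIV f" and lim: "(f \<longlongrightarrow> 0) at_infinity"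
  shows "uniformly_continuous_on UNIV f"
  unfolding uniformly_continuous_on_def
proof (intro allI impI)
  fix e :: real assume e: "0 < e"
  have "\<forall>\<^sub>F x in at_infinity. dist (f x) 0 < e / 2" using lim e by (intro tendstoD) auto
  then obtain R where R: "\<And>x. R \<le> norm x \<Longrightarrow> \<bar>f x\<bar> < e / 2"
    unfolding eventually_at_infinity by auto
  \<comment> \<open>The interval is enlarged by 1: two points at distance below 1 then lie both in
    the interval or both in the region where \<open>f\<close> is small.\<close>
  have "uniformly_continuous_on {- \<bar>R\<bar> - 1..\<bar>R\<bar> + 1} f"
    by (rule compact_uniformly_continuous[OF continuous_on_subset[OF c]]) auto
  then obtain d where d: "d > 0" "\<And>x x'. x \<in> {- \<bar>R\<bar> - 1..\<bar>R\<bar> + 1} \<Longrightarrow> x' \<in> {- \<bar>R\<bar> - 1..\<bar>R\<bar> + 1} \<Longrightarrow> dist x' x < d \<Longrightarrow> dist (f x') (f x) < e"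
    unfolding uniformly_continuous_on_def using e by metis
  show "\<exists>d>0. \<forall>x\<in>UNIV. \<forall>x'\<in>UNIV. dist x' x < d \<longrightarrow> dist (f x') (f x) < e"
  proof (intro exI[of _ "min d 1"] conjI ballI impI)
    fix x x' :: real assume D: "dist x' x < min d 1"
    show "dist (f x') (f x) < e"
    proof (cases "x \<in> {- \<bar>R\<bar> - 1..\<bar>R\<bar> + 1} \<and> x' \<in> {- \<bar>R\<bar> - 1..\<bar>R\<bar> + 1}")
      case True
      then show ?thesis using d(2)[of x x'] D by simp
    next
      case False
      then have "R \<le> norm x" "R \<le> norm x'" using D by (auto simp: dist_real_def)
      then have "\<bar>f x\<bar> < e / 2" "\<bar>f x'\<bar> < e / 2" using R by auto
      then show ?thesis by (simp add: dist_real_def)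
    qed
  qed (use d in auto)
qed

lemma periodic1_uniformly_continuous:
  fixes f :: "real \<Rightarrow> real"
  assumes c: "continuous_on UNIV f" and per: "periodic1 f"
  shows "uniformly_continuous_on UNIV f"
  unfolding uniformly_continuous_on_def
proof (intro allI impI)
  fix e :: real assume e: "0 < e"
  have "uniformly_continuous_on {- 1..2} f"
    by (rule compact_uniformly_continuous[OF continuous_on_subset[OF c]]) auto
  then obtain d where d: "d > 0" "\<And>x x'. x \<in> {- 1..2} \<Longrightarrow> x' \<in> {- 1..2} \<Longrightarrow> dist x' x < d \<Longrightarrow> dist (f x') (f x) < e"
    unfolding uniformly_continuous_on_def using e by metis
  show "\<exists>d>0. \<forall>x\<in>UNIV. \<forall>x'\<in>UNIV. dist x' x < d \<longrightarrow> dist (f x') (f x) < e"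
  proof (intro exI[of _ "min d 1"] conjI ballI impI)
    fix x x' :: real assume D: "dist x' x < min d 1"
    let ?y = "x - of_int \<lfloor>x\<rfloor>" and ?y' = "x' - of_int \<lfloor>x\<rfloor>"
    have "?y \<in> {0..1}" using periodic1_frac_mem[of x] by (simp add: frac_def)
    moreover have "\<bar>x' - x\<bar> < 1" using D by (simp add: dist_real_def)
    ultimately have y: "?y \<in> {-1..2}" and y': "?y' \<in> {-1..2}"
      unfolding atLeastAtMost_iff by (intro conjI, linarith, linarith)+
    have "dist ?y' ?y < d" using D by (simp add: dist_real_def)
    moreover have "f ?y = f x" "f ?y' = f x'"
      using periodic1_int[OF per, of x "- \<lfloor>x\<rfloor>"] periodic1_int[OF per, of x' "- \<lfloor>x\<rfloor>"] by simp_all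
    ultimately show "dist (f x') (f x) < e" using d(2)[OF y y'] by simp
  qed (use d in auto)
qed

abbreviation Y0 :: "(real \<Rightarrow> real) set" where "Y0 \<equiv> {f. continuous_on UNIV f \<and> (f \<longlongrightarrow> 0) at_infinity}"
abbreviation YT :: "(real \<Rightarrow> real) set" where "YT \<equiv> {f. continuous_on UNIV f \<and> periodic1 f}"

interpretation C0R: sup_space C0R Y0
proof
  show "C0R = seminorm_topology Y0 {\<lambda>f. SUP t. \<bar>f t\<bar>}" by (simp add: C0R_def)
  fix f assume f: "f \<in> Y0"
  show "uniformly_continuous_on UNIV f" using f by (intro vanishing_uniformly_continuous) auto
  have "\<forall>\<^sub>F x in at_infinity. dist (f x) 0 < 1" using f by (intro tendstoD) auto
  then obtain R where R: "\<And>x. R \<le> norm x \<Longrightarrow> \<bar>f x\<bar> < 1"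
    unfolding eventually_at_infinity by auto
  have "bounded (f ` {- R..R})"
    using f by (intro compact_imp_bounded compact_continuous_image compact_Icc) (auto intro: continuous_on_subset)
  then obtain B where B: "\<forall>z\<in>f ` {- R..R}. norm z \<le> B" unfolding bounded_iff by blast
  have "\<bar>f t\<bar> \<le> max 1 B" for t
  proof (cases "t \<in> {- R..R}")
    case True
    then show ?thesis using bspec[OF B imageI[OF True]] by simp
  next
    case False
    then have "R \<le> norm t" by auto
    then show ?thesis using R[of t] by simp
  qed
  then show "\<exists>B. \<forall>t. \<bar>f t\<bar> \<le> B" by blast
  fix b
  have "filterlim (\<lambda>t. t - b) at_infinity (at_infinity :: real filter)"
    using tendsto_add_filterlim_at_infinity[OF tendsto_const[of "- b"] filterlim_ident] by simp
  then have "((\<lambda>t. f (t - b)) \<longlongrightarrow> 0) at_infinity" using f by (auto intro: filterlim_compose)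
  moreover have "continuous_on UNIV (\<lambda>t. f (t - b))"
    using f by (auto intro!: continuous_on_compose2[of UNIV f] continuous_intros)
  ultimately show "(\<lambda>t. f (t - b)) \<in> Y0" by simp
next
  fix f g assume "f \<in> Y0" "g \<in> Y0"
  then show "(\<lambda>t. f t + g t) \<in> Y0" using tendsto_add[of f 0 at_infinity g 0] by (auto intro: continuous_on_add)
next
  fix c :: real and f assume "f \<in> Y0"
  then show "(\<lambda>t. c * f t) \<in> Y0" using tendsto_mult_left[of f 0 at_infinity c] by (auto intro: continuous_on_mult_left)
qed auto

interpretation CT: sup_space CT YT
proof
  show "CT = seminorm_topology YT {\<lambda>f. SUP t. \<bar>f t\<bar>}" by (simp add: CT_def)
  fix f assume f: "f \<in> YT"
  show "uniformly_continuous_on UNIV f" using f by (intro periodic1_uniformly_continuous) auto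
  show "\<exists>B. \<forall>t. \<bar>f t\<bar> \<le> B" using f periodic1_bounded[of f] continuous_on_subset[of UNIV f "{0..1}"] by auto
  fix b
  have "f (t + 1 - b) = f (t - b)" for t using f by (simp add: periodic1_def) (metis add_diff_eq diff_add_eq)
  then show "(\<lambda>t. f (t - b)) \<in> YT"
    using f by (auto simp: periodic1_def intro!: continuous_on_compose2[of UNIV f] continuous_intros)
qed (auto simp: periodic1_def intro!: continuous_intros)

subsection \<open>Density of the test functions\<close>

lemma schwartz_dilate:
  assumes "f \<in> schwartz" "c > 0" shows "(\<lambda>t. f (c * t)) \<in> schwartz"
  unfolding schwartz_iff
proof (intro conjI allI)
  have sm: "smooth f" by (rule schwartz_smooth[OF assms(1)])
  show "smooth (\<lambda>t. f (c * t))" using smooth_affine[OF sm, of c 0] by simp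
  fix m n
  obtain B where B: "\<And>t. \<bar>t ^ m * (deriv ^^ n) f t\<bar> \<le> B" using assms unfolding schwartz_iff by blast
  have "\<bar>t ^ m * (deriv ^^ n) (\<lambda>t. f (c * t)) t\<bar> \<le> c ^ n / c ^ m * B" for t
  proof -
    have "t ^ m * (deriv ^^ n) (\<lambda>t. f (c * t)) t = c ^ n / c ^ m * ((c * t) ^ m * (deriv ^^ n) f (c * t))"
      using deriv_iter_affine[OF sm, of n c 0] assms(2) by (simp add: power_mult_distrib)
    also have "\<bar>\<dots>\<bar> = c ^ n / c ^ m * \<bar>(c * t) ^ m * (deriv ^^ n) f (c * t)\<bar>"
      using assms(2) by (simp add: abs_mult)
    also have "\<dots> \<le> c ^ n / c ^ m * B" using assms(2) by (intro mult_left_mono B) auto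
    finally show ?thesis .
  qed
  then show "\<exists>B. \<forall>t. \<bar>t ^ m * (deriv ^^ n) (\<lambda>t. f (c * t)) t\<bar> \<le> B" by blast
qed

text \<open>Near the centre uniform continuity gives \<open>e / 2\<close>; away from it the trivial
  bound \<open>2 * H\<close> is majorized linearly in \<open>\<bar>s\<bar>\<close>, so the first
  absolute moment of a mollifier with unbounded support is enough. The sign in
  \<open>h (- x)\<close> makes the correlation a convolution.\<close>

lemma mollification_close:
  fixes h :: "real \<Rightarrow> real"
  assumes uc: "uniformly_continuous_on UNIV h" and H: "\<And>t. \<bar>h t\<bar> \<le> H" and e: "e > 0"
  shows "\<exists>\<kappa>\<in>schwartz. (\<forall>t. 0 \<le> \<kappa> t) \<and> (LINT t|lborel. \<kappa> t) = 1 \<and>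
           (\<forall>y. \<bar>(LINT x|lborel. h (- x) * \<kappa> (y + x)) - h y\<bar> \<le> e)"
proof -
  have hc: "continuous_on UNIV h" by (rule uniformly_continuous_imp_continuous[OF uc])
  then have [measurable]: "h \<in> borel_measurable borel" by (rule borel_measurable_continuous_onI)
  obtain k where k: "k \<in> schwartz" "\<And>t. 0 \<le> k t" "(LINT t|lborel. k t) = 1" using mollifier_exists by blast
  have [measurable]: "k \<in> borel_measurable borel" by (rule schwartz_measurable[OF k(1)])
  have intk: "integrable lborel k" by (rule schwartz_integrable[OF k(1)])
  have intk1: "integrable lborel (\<lambda>s. \<bar>s\<bar> * k s)"
    using integrable_abs[OF moment_integrable[OF k(1), of 1]] k(2) by (simp add: abs_mult)
  define m1 where "m1 = (LINT s|lborel. \<bar>s\<bar> * k s)"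
  have m1: "m1 \<ge> 0" unfolding m1_def using k(2) by (intro integral_nonneg_AE) auto
  have H0: "H \<ge> 0" using H[of 0] by linarith
  obtain d where d: "d > 0" "\<And>x x'. \<bar>x' - x\<bar> < d \<Longrightarrow> \<bar>h x' - h x\<bar> < e / 2"
    using uc[unfolded uniformly_continuous_on_def, rule_format, of "e / 2"] e by (auto simp: dist_real_def)
  \<comment> \<open>Chosen so that the far contribution \<open>2 * H * \<delta> / d * m1\<close> is
    at most \<open>e / 2\<close>; the summand 1 avoids a zero denominator.\<close>
  define \<delta> where "\<delta> = e * d / (4 * H * m1 + 1)"
  have den: "4 * H * m1 + 1 > 0" using H0 m1 by (simp add: add_nonneg_pos)
  have \<delta>: "\<delta> > 0" using e d den by (simp add: \<delta>_def)
  define \<kappa> where "\<kappa> t = (1 / \<delta>) * k ((1 / \<delta>) * t)" for t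
  have "\<kappa> \<in> schwartz" unfolding \<kappa>_def using \<delta> by (intro SR.scale_mem schwartz_dilate k) auto
  moreover have "0 \<le> \<kappa> t" for t using k(2) \<delta> by (simp add: \<kappa>_def)
  moreover have "(LINT t|lborel. \<kappa> t) = 1"
    using lborel_integral_real_affine[of \<delta> \<kappa> 0] \<delta> k(3) by (simp add: \<kappa>_def)
  moreover have "\<bar>(LINT x|lborel. h (- x) * \<kappa> (y + x)) - h y\<bar> \<le> e" for y
  proof -
    have "(LINT x|lborel. h (- x) * \<kappa> (y + x)) = (LINT s|lborel. h (y - \<delta> * s) * k s)"
      using lborel_integral_real_affine[of \<delta> "\<lambda>x. h (- x) * \<kappa> (y + x)" "- y"] \<delta> by (simp add: \<kappa>_def)
    moreover have "integrable lborel (\<lambda>s. h (y - \<delta> * s) * k s)"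
      by (rule moderate_integrable'[where C = H and k = 0, OF _ _ k(1)]) (use H in auto)
    moreover have "integrable lborel (\<lambda>s. h y * k s)" using intk by simp
    ultimately have eq: "(LINT x|lborel. h (- x) * \<kappa> (y + x)) - h y = (LINT s|lborel. h (y - \<delta> * s) * k s - h y * k s)"
      using k(3) by (simp add: Bochner_Integration.integral_diff)
    have "norm (LINT s|lborel. h (y - \<delta> * s) * k s - h y * k s) \<le> (LINT s|lborel. e / 2 * k s + 2 * H * \<delta> / d * (\<bar>s\<bar> * k s))"
    proof (rule Bochner_Integration.integral_norm_bound_integral)
      show "integrable lborel (\<lambda>s. h (y - \<delta> * s) * k s - h y * k s)"
        by (intro Bochner_Integration.integrable_diff integrable_mult_right intk
              moderate_integrable'[where C = H and k = 0, OF _ _ k(1)]) (use H in auto)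
      show "integrable lborel (\<lambda>s. e / 2 * k s + 2 * H * \<delta> / d * (\<bar>s\<bar> * k s))"
        by (intro Bochner_Integration.integrable_add integrable_mult_right intk intk1)
      fix s
      have "\<bar>h (y - \<delta> * s) - h y\<bar> \<le> e / 2 + 2 * H * \<delta> / d * \<bar>s\<bar>"
      proof (cases "\<delta> * \<bar>s\<bar> < d")
        case True
        then have "\<bar>(y - \<delta> * s) - y\<bar> < d" using \<delta> by (simp add: abs_mult)
        then have "\<bar>h (y - \<delta> * s) - h y\<bar> < e / 2" by (rule d(2))
        moreover have "0 \<le> 2 * H * \<delta> / d * \<bar>s\<bar>" using H0 \<delta> d by simp
        ultimately show ?thesis by linarith
      next
        case False
        then have "1 \<le> \<delta> * \<bar>s\<bar> / d" using d by (simp add: pos_le_divide_eq)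
        then have "2 * H * 1 \<le> 2 * H * (\<delta> * \<bar>s\<bar> / d)" using H0 by (intro mult_left_mono) auto
        moreover have "\<bar>h (y - \<delta> * s) - h y\<bar> \<le> 2 * H" using H[of "y - \<delta> * s"] H[of y] by linarith
        ultimately show ?thesis using e by simp
      qed
      then have "\<bar>h (y - \<delta> * s) - h y\<bar> * k s \<le> (e / 2 + 2 * H * \<delta> / d * \<bar>s\<bar>) * k s"
        using k(2) by (rule mult_right_mono)
      moreover have "norm (h (y - \<delta> * s) * k s - h y * k s) = \<bar>h (y - \<delta> * s) - h y\<bar> * k s"
        using k(2)[of s] by (simp add: abs_mult flip: left_diff_distrib)
      ultimately show "norm (h (y - \<delta> * s) * k s - h y * k s) \<le> e / 2 * k s + 2 * H * \<delta> / d * (\<bar>s\<bar> * k s)"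
        by (simp only: distrib_right mult.assoc)
    qed
    also have "\<dots> = e / 2 * 1 + 2 * H * \<delta> / d * m1"
      unfolding m1_def k(3)[symmetric] integral_mult_right_zero[symmetric]
      by (rule Bochner_Integration.integral_add) (intro integrable_mult_right intk intk1)+
    also have "\<dots> \<le> e"
    proof -
      have "2 * H * \<delta> / d * m1 = e / 2 * ((4 * H * m1) / (4 * H * m1 + 1))"
      proof -
        have "\<delta> / d = e / (4 * H * m1 + 1)" using d by (simp add: \<delta>_def)
        moreover have "2 * H * \<delta> / d * m1 = 2 * H * (\<delta> / d) * m1" by simp
        ultimately show ?thesis by simp
      qed
      also have "\<dots> \<le> e / 2 * 1" using e den by (intro mult_left_mono) (auto simp: pos_divide_le_eq)
      finally show ?thesis by simp
    qed
    finally show ?thesis unfolding eq real_norm_def .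
  qed
  ultimately show ?thesis by blast
qed

lemma schwartz_subset_Y0: "schwartz \<subseteq> Y0"
proof
  fix \<phi> assume \<phi>: "\<phi> \<in> schwartz"
  obtain B where B: "B \<ge> 0" "\<And>t. (1 + \<bar>t\<bar>) ^ 1 * \<bar>(deriv ^^ 0) \<phi> t\<bar> \<le> B" using schwartz_weight_bound[OF \<phi>] by blast
  have "(\<phi> \<longlongrightarrow> 0) at_infinity"
  proof (rule Lim_null_comparison)
    have "\<bar>\<phi> t\<bar> \<le> B / \<bar>t\<bar>" if "1 \<le> norm t" for t
    proof -
      have "\<bar>t\<bar> * \<bar>\<phi> t\<bar> \<le> (1 + \<bar>t\<bar>) * \<bar>\<phi> t\<bar>" by (intro mult_right_mono) auto
      also have "\<dots> \<le> B" using B(2)[of t] by simp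
      finally show ?thesis using that by (simp add: pos_le_divide_eq mult.commute)
    qed
    then show "\<forall>\<^sub>F t in at_infinity. norm (\<phi> t) \<le> B / \<bar>t\<bar>" unfolding eventually_at_infinity by auto
    have "((\<lambda>t. B / t) \<longlongrightarrow> 0) (at_infinity :: real filter)"
      by (rule tendsto_divide_0[OF tendsto_const filterlim_ident])
    from tendsto_rabs[OF this] show "((\<lambda>t. B / \<bar>t\<bar>) \<longlongrightarrow> 0) (at_infinity :: real filter)"
      using B(1) by simp
  qed
  then show "\<phi> \<in> Y0" using smooth_continuous[OF schwartz_smooth[OF \<phi>]] by simp
qed

text \<open>Mollification alone would give smoothness without Schwartz decay. The function is
  therefore cut off first, where it is below \<open>e / 2\<close>, and the jumps of the cutoff are
  harmless under mollification.\<close>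

lemma schwartz_dense:
  assumes h: "h \<in> Y0" and e: "e > 0"
  shows "\<exists>\<phi>\<in>schwartz. \<forall>t. \<bar>h t - \<phi> t\<bar> \<le> e"
proof -
  have hc: "continuous_on UNIV h" using h by simp
  then have [measurable]: "h \<in> borel_measurable borel" by (rule borel_measurable_continuous_onI)
  obtain H where H: "\<And>t. \<bar>h t\<bar> \<le> H" using C0R.bounded_mem[OF h] by blast
  have H0: "H \<ge> 0" using H[of 0] by linarith
  have e2: "e / 2 > 0" using e by simp
  obtain \<kappa> where \<kappa>: "\<kappa> \<in> schwartz" "\<And>t. 0 \<le> \<kappa> t" "(LINT t|lborel. \<kappa> t) = 1"
      "\<And>y. \<bar>(LINT x|lborel. h (- x) * \<kappa> (y + x)) - h y\<bar> \<le> e / 2"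
    using mollification_close[OF C0R.uniformly_continuous_mem[OF h] H e2] by blast
  have "\<forall>\<^sub>F x in at_infinity. dist (h x) 0 < e / 2" using h e by (intro tendstoD) auto
  then obtain R where R: "\<And>x. R \<le> norm x \<Longrightarrow> \<bar>h x\<bar> < e / 2"
    unfolding eventually_at_infinity by auto
  \<comment> \<open>The reflected function is truncated because it is the kernel of the correlation;
    the interval is symmetric.\<close>
  define g where "g x = indicator {- \<bar>R\<bar>..\<bar>R\<bar>} x * h (- x)" for x
  have [measurable]: "g \<in> borel_measurable borel" unfolding g_def by measurable
  have "\<exists>Q\<ge>0. \<forall>t. (1 + \<bar>t\<bar>) ^ k * \<bar>g t\<bar> \<le> Q" for k
  proof (intro exI[of _ "(1 + \<bar>R\<bar>) ^ k * H"] conjI allI)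
    fix t show "(1 + \<bar>t\<bar>) ^ k * \<bar>g t\<bar> \<le> (1 + \<bar>R\<bar>) ^ k * H"
    proof (cases "t \<in> {- \<bar>R\<bar>..\<bar>R\<bar>}")
      case True
      then have "\<bar>t\<bar> \<le> \<bar>R\<bar>" by auto
      then show ?thesis using H[of "- t"] True H0 by (intro mult_mono power_mono) (auto simp: g_def)
    qed (use H0 in \<open>simp add: g_def\<close>)
  qed (use H0 in simp)
  then have c: "(\<lambda>y. LINT x|lborel. g x * \<kappa> (y + x)) \<in> schwartz"
    by (intro rapidly_decreasing_correlation(1) \<kappa>) auto
  have "\<bar>h y - (LINT x|lborel. g x * \<kappa> (y + x))\<bar> \<le> e" for y
  proof -
    have sh: "(\<lambda>x. \<kappa> (y + x)) \<in> schwartz" using SR.shift_mem[OF \<kappa>(1), of y] by (simp add: add.commute)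
    have i1: "integrable lborel (\<lambda>x. h (- x) * \<kappa> (y + x))"
      by (rule moderate_integrable'[where C = H and k = 0, OF _ _ sh]) (use H in auto)
    have i2: "integrable lborel (\<lambda>x. g x * \<kappa> (y + x))"
      by (rule moderate_integrable'[where C = H and k = 0, OF _ _ sh]) (use H H0 in \<open>auto simp: g_def indicator_def\<close>)
    have i3: "integrable lborel (\<lambda>x. \<kappa> (y + x))" by (rule schwartz_integrable[OF sh])
    have "norm (LINT x|lborel. h (- x) * \<kappa> (y + x) - g x * \<kappa> (y + x)) \<le> (LINT x|lborel. e / 2 * \<kappa> (y + x))"
    proof (rule Bochner_Integration.integral_norm_bound_integral[OF Bochner_Integration.integrable_diff[OF i1 i2] integrable_mult_right[OF i3]])
      fix x
      have "\<bar>h (- x) - g x\<bar> \<le> e / 2"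
      proof (cases "x \<in> {- \<bar>R\<bar>..\<bar>R\<bar>}")
        case False
        then have "R \<le> norm (- x)" by auto
        then show ?thesis using R[of "- x"] False by (simp add: g_def)
      qed (use e in \<open>simp add: g_def\<close>)
      then have "\<bar>h (- x) - g x\<bar> * \<kappa> (y + x) \<le> e / 2 * \<kappa> (y + x)" using \<kappa>(2) by (rule mult_right_mono)
      moreover have "norm (h (- x) * \<kappa> (y + x) - g x * \<kappa> (y + x)) = \<bar>h (- x) - g x\<bar> * \<kappa> (y + x)"
        using \<kappa>(2)[of "y + x"] by (simp add: abs_mult flip: left_diff_distrib)
      ultimately show "norm (h (- x) * \<kappa> (y + x) - g x * \<kappa> (y + x)) \<le> e / 2 * \<kappa> (y + x)" by linarith
    qed
    also have "(LINT x|lborel. e / 2 * \<kappa> (y + x)) = e / 2"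
      using lborel_integral_real_affine[of 1 \<kappa> y] \<kappa>(3) by simp
    finally have "\<bar>(LINT x|lborel. h (- x) * \<kappa> (y + x)) - (LINT x|lborel. g x * \<kappa> (y + x))\<bar> \<le> e / 2"
      by (simp only: Bochner_Integration.integral_diff[OF i1 i2] real_norm_def)
    then show ?thesis using \<kappa>(4)[of y] by linarith
  qed
  then show ?thesis by (intro bexI[OF _ c]) auto
qed

text \<open>Convolution over the whole line with a Schwartz mollifier keeps the period. The periodic
  factor does not decay, so integrability of the derivatives rests on the mollifier alone.\<close>

lemma XT_dense:
  assumes h: "h \<in> YT" and e: "e > 0"
  shows "\<exists>\<phi>\<in>XT. \<forall>t. \<bar>h t - \<phi> t\<bar> \<le> e"
proof -
  have hc: "continuous_on UNIV h" and per: "periodic1 h" using h by auto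
  then have hm[measurable]: "h \<in> borel_measurable borel" by (intro borel_measurable_continuous_onI)
  obtain H where H: "\<And>t. \<bar>h t\<bar> \<le> H" using CT.bounded_mem[OF h] by blast
  have H0: "H \<ge> 0" using H[of 0] by linarith
  obtain \<kappa> where \<kappa>: "\<kappa> \<in> schwartz" "\<And>y. \<bar>(LINT x|lborel. h (- x) * \<kappa> (y + x)) - h y\<bar> \<le> e"
    using mollification_close[OF CT.uniformly_continuous_mem[OF h] H e] by blast
  let ?c = "\<lambda>y. LINT x|lborel. h (- x) * \<kappa> (y + x)"
  have dom: "\<exists>G. integrable lborel G \<and> (\<forall>z x. \<bar>z\<bar> \<le> 1 \<longrightarrow> \<bar>h (- x) * (deriv ^^ n) \<kappa> (y + z + x)\<bar> \<le> G x)" for n y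
  proof -
    obtain B where B: "B \<ge> 0" "\<And>t. (1 + \<bar>t\<bar>) ^ 2 * \<bar>(deriv ^^ n) \<kappa> t\<bar> \<le> B" using schwartz_weight_bound[OF \<kappa>(1)] by blast
    \<comment> \<open>The factor \<open>(2 + \<bar>y\<bar>)^2\<close> compares the weight at
      \<open>x\<close> with the weight at \<open>y + z + x\<close> uniformly for
      \<open>\<bar>z\<bar> \<le> 1\<close>.\<close>
    let ?Q = "H * (B * (2 + \<bar>y\<bar>)\<^sup>2)"
    have "\<bar>h (- x) * (deriv ^^ n) \<kappa> (y + z + x)\<bar> \<le> ?Q * (1 / (1 + x\<^sup>2))" if z: "\<bar>z\<bar> \<le> 1" for z x
    proof -
      let ?w = "y + z + x" and ?d = "\<bar>(deriv ^^ n) \<kappa> (y + z + x)\<bar>"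
      have "1 + \<bar>x\<bar> \<le> (1 + \<bar>?w\<bar>) + (1 + \<bar>y\<bar>)" using z by linarith
      also have "\<dots> \<le> (1 + \<bar>?w\<bar>) * (2 + \<bar>y\<bar>)" by (simp add: algebra_simps)
      finally have "(1 + \<bar>x\<bar>)\<^sup>2 \<le> ((1 + \<bar>?w\<bar>) * (2 + \<bar>y\<bar>))\<^sup>2" by (rule power_mono) simp
      then have "1 + x\<^sup>2 \<le> ((1 + \<bar>?w\<bar>) * (2 + \<bar>y\<bar>))\<^sup>2" using one_add_square_le[of x] by linarith
      from mult_right_mono[OF this abs_ge_zero]
      have "(1 + x\<^sup>2) * ?d \<le> ((1 + \<bar>?w\<bar>) * (2 + \<bar>y\<bar>))\<^sup>2 * ?d" .
      also have "\<dots> = ((1 + \<bar>?w\<bar>)\<^sup>2 * ?d) * (2 + \<bar>y\<bar>)\<^sup>2" by (simp only: power_mult_distrib mult_ac)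
      also have "\<dots> \<le> B * (2 + \<bar>y\<bar>)\<^sup>2" by (rule mult_right_mono[OF B(2)]) simp
      finally have d: "(1 + x\<^sup>2) * ?d \<le> B * (2 + \<bar>y\<bar>)\<^sup>2" .
      have "(1 + x\<^sup>2) * \<bar>h (- x) * (deriv ^^ n) \<kappa> ?w\<bar> = \<bar>h (- x)\<bar> * ((1 + x\<^sup>2) * ?d)" by (simp only: abs_mult mult_ac)
      also have "\<dots> \<le> ?Q" by (rule mult_mono[OF H[of "- x"] d H0]) simp
      finally have "(1 + x\<^sup>2) * \<bar>h (- x) * (deriv ^^ n) \<kappa> ?w\<bar> \<le> ?Q" .
      moreover have "0 < 1 + x\<^sup>2" by (simp add: add_pos_nonneg)
      ultimately show ?thesis by (simp add: pos_le_divide_eq mult.commute)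
    qed
    moreover have "integrable lborel (\<lambda>x. ?Q * (1 / (1 + x\<^sup>2)))" using integrable_inverse_square by (rule integrable_mult_right)
    ultimately show ?thesis by blast
  qed
  have "smooth ?c" by (rule smooth_correlation[OF schwartz_smooth[OF \<kappa>(1)] _ dom]) measurable
  moreover have "periodic1 ?c"
    unfolding periodic1_def
  proof
    fix y
    have "h (1 - x) = h (- x)" for x using per[unfolded periodic1_def, rule_format, of "- x"] by (simp add: add.commute)
    then show "?c (y + 1) = ?c y"
      using lborel_integral_real_affine[of 1 "\<lambda>x. h (- x) * \<kappa> (y + 1 + x)" "-1"] by (simp add: algebra_simps)
  qed
  moreover have "\<bar>h y - ?c y\<bar> \<le> e" for y using \<kappa>(2)[of y] by (simp add: abs_minus_commute)
  ultimately show ?thesis by (intro bexI[of _ ?c]) auto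
qed

locale test_measure = T: test_space T X M + C: sup_space C Y
  for T X M C Y +
  assumes subset: "X \<subseteq> Y" and dense: "\<And>h e. h \<in> Y \<Longrightarrow> e > 0 \<Longrightarrow> \<exists>\<phi>\<in>X. \<forall>t. \<bar>h t - \<phi> t\<bar> \<le> e"
begin

text \<open>By density and norm boundedness a measure is determined by its values on test functions.
  Hence restriction is injective and \<open>measure_of_gfun\<close> inverts it.\<close>

lemma measure_eqI:
  assumes u: "u \<in> dual C" and v: "v \<in> dual C" and eq: "\<And>\<phi>. \<phi> \<in> X \<Longrightarrow> u \<phi> = v \<phi>"
  shows "u = v"
proof (rule extensionalityI[OF C.extensional_dual[OF u] C.extensional_dual[OF v]])
  fix h assume h: "h \<in> Y"
  let ?N = "dual_norm C u + dual_norm C v"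
  have N: "0 \<le> ?N" using C.dual_norm_nonneg[OF u] C.dual_norm_nonneg[OF v] by simp
  have "\<bar>u h - v h\<bar> \<le> 0"
  proof (rule field_le_epsilon)
    fix e :: real assume e: "0 < e"
    define d where "d = e / (?N + 1)"
    have d: "d > 0" using e N by (simp add: d_def)
    obtain \<phi> where \<phi>: "\<phi> \<in> X" "\<And>t. \<bar>h t - \<phi> t\<bar> \<le> d" using dense[OF h d] by blast
    have \<phi>Y: "\<phi> \<in> Y" using \<phi>(1) subset by blast
    have "u h - v h = u (\<lambda>t. h t - \<phi> t) - v (\<lambda>t. h t - \<phi> t)"
      using eq[OF \<phi>(1)] C.dual_diff[OF u h \<phi>Y] C.dual_diff[OF v h \<phi>Y] by simp
    also have "\<bar>\<dots>\<bar> \<le> dual_norm C u * d + dual_norm C v * d"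
      using C.dual_norm_upper[OF u C.diff_mem[OF h \<phi>Y] \<phi>(2)] C.dual_norm_upper[OF v C.diff_mem[OF h \<phi>Y] \<phi>(2)] by linarith
    also have "\<dots> = ?N * d" by (simp add: distrib_right)
    also have "\<dots> \<le> (?N + 1) * d" using d by (intro mult_right_mono) auto
    also have "\<dots> = e" using N by (simp add: d_def)
    finally show "\<bar>u h - v h\<bar> \<le> 0 + e" by simp
  qed
  then show "u h = v h" by simp
qed

lemma measure_of_gfun_restrict: "\<mu> \<in> dual C \<Longrightarrow> measure_of_gfun T C (restrict \<mu> X) = \<mu>"
  unfolding measure_of_gfun_def T.topspace_T
proof (rule inv_into_f_f)
  show "inj_on (\<lambda>u. restrict u X) (dual C)"
    by (rule inj_onI, rule measure_eqI) (auto dest: fun_cong[of "restrict _ X" "restrict _ X"] simp: restrict_def split: if_splits, metis)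
qed

lemma measure_of_gfun_mem: "w \<in> measures_in T C \<Longrightarrow> measure_of_gfun T C w \<in> dual C"
  unfolding measures_in_def measure_of_gfun_def by (rule inv_into_into)

lemma measure_of_gfun_apply:
  assumes "w \<in> measures_in T C" "\<phi> \<in> X" shows "measure_of_gfun T C w \<phi> = w \<phi>"
proof -
  have "restrict (measure_of_gfun T C w) X = w"
    using assms(1) unfolding measures_in_def measure_of_gfun_def T.topspace_T by (rule f_inv_into_f)
  then show ?thesis using assms(2) by (metis restrict_apply')
qed

lemma restrict_measures_in: "\<mu> \<in> dual C \<Longrightarrow> restrict \<mu> X \<in> measures_in T C"
  unfolding measures_in_def T.topspace_T by blast

lemma restrict_dual:
  assumes \<mu>: "\<mu> \<in> dual C" shows "restrict \<mu> X \<in> dual T"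
proof (rule T.dualI[where K = 0 and C = "dual_norm C \<mu>"])
  fix f B assume f: "f \<in> X" and "\<And>m n t. m \<in> M \<Longrightarrow> m \<le> 0 \<Longrightarrow> n \<le> 0 \<Longrightarrow> \<bar>t ^ m * (deriv ^^ n) f t\<bar> \<le> B"
  from this(2)[OF T.zero_in_M, of 0] have "\<bar>f t\<bar> \<le> B" for t by simp
  from C.dual_norm_upper[OF \<mu> _ this] show "\<bar>restrict \<mu> X f\<bar> \<le> dual_norm C \<mu> * B" using f subset by auto
qed (use subset in \<open>auto simp: T.add_mem T.scale_mem C.dual_add[OF \<mu>] C.dual_scale[OF \<mu>] subset_iff\<close>)

end

interpretation MR: test_measure SR schwartz UNIV C0R Y0
  by unfold_locales (use schwartz_subset_Y0 schwartz_dense in auto)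

interpretation MT: test_measure ST XT "{0}" CT YT
proof unfold_locales
  show "XT \<subseteq> YT" by (auto intro: smooth_continuous)
  fix h and e :: real assume "h \<in> YT" "e > 0"
  then show "\<exists>\<phi>\<in>XT. \<forall>t. \<bar>h t - \<phi> t\<bar> \<le> e" by (rule XT_dense)
qed

subsection \<open>The trend measurement space\<close>

context test_pairing
begin

text \<open>Every such map is the correlation with the functional
  \<open>\<phi> \<mapsto> G \<phi> 0\<close>, and \<open>convolution_swap\<close> applies to that
  functional.\<close>

lemma lsi_map_swap:
  assumes G: "lsi_map G" and \<phi>: "\<phi> \<in> X" and \<psi>: "\<psi> \<in> X"
  shows "(LINT x:A|lborel. \<phi> x * G \<psi> x) = (LINT x:A|lborel. \<psi> x * reflect (G (reflect \<phi>)) x)"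
proof -
  let ?w = "\<lambda>\<phi>\<in>X. dirac T 0 (G \<phi>)"
  have w: "?w \<in> dual T" by (rule lsi_mapD(6)[OF G dirac_mem])
  have Gx: "G \<xi> x = ?w (\<lambda>y. \<xi> (y + x))" if "\<xi> \<in> X" for \<xi> x
    using that by (simp add: shift_mem lsi_mapD(1,4)[OF G])
  have "reflect (G (reflect \<phi>)) x = ?w (\<lambda>y. \<phi> (x - y))" for x
    using Gx[OF reflect_in[OF \<phi>], of "- x"] by (simp add: reflect_eq)
  then show ?thesis using convolution_swap[OF w \<phi> \<psi>] Gx[OF \<psi>] by simp
qed

end

lemma (in admissible_op) transpose_swap:
  assumes \<phi>: "\<phi> \<in> X" and \<zeta>: "\<zeta> \<in> X"
  shows "(LINT x:A|lborel. \<zeta> x * B' ((deriv ^^ N) \<phi>) x) = (LINT x:A|lborel. \<phi> x * ((-1) ^ N * B ((deriv ^^ N) \<zeta>) x))"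
proof -
  obtain G where G: "lsi_map G" "\<And>u \<phi>. u \<in> dual T \<Longrightarrow> \<phi> \<in> X \<Longrightarrow> L u \<phi> = u (G \<phi>)"
    "\<And>\<phi>. \<phi> \<in> X \<Longrightarrow> G \<phi> = (\<lambda>t. (-1) ^ N * B ((deriv ^^ N) \<phi>) t)"
    using L_transpose by blast
  have "B' ((deriv ^^ N) \<phi>) x = reflect (G (reflect \<phi>)) x" for x
    using adjoint_apply[OF dirac_mem \<phi>, of x] adjoint_op_apply[OF L_lsi G(1,2) dirac_mem \<phi>, of x]
      lsi_mapD(1)[OF B' iter_mem[OF \<phi>]] lsi_mapD(1)[OF G(1) reflect_in[OF \<phi>]] by (simp add: reflect_in)
  then show ?thesis using lsi_map_swap[OF G(1) \<phi> \<zeta>] G(3)[OF \<zeta>] by simp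
qed

lemma regular_R_apply: "\<phi> \<in> schwartz \<Longrightarrow> regular_R h \<phi> = (LINT t|lborel. h t * \<phi> t)"
  by (simp add: regular_def set_lebesgue_integral_def)

lemma Y0_measurable: "h \<in> Y0 \<Longrightarrow> h \<in> borel_measurable borel"
  by (intro borel_measurable_continuous_onI) simp

lemma Y0_moderate:
  assumes "h \<in> Y0" shows "\<exists>C. \<forall>t. \<bar>h t\<bar> \<le> C * (1 + \<bar>t\<bar>) ^ 0"
  using C0R.bounded_mem[OF assms] by simp

lemma Y0_integrable: "h \<in> Y0 \<Longrightarrow> \<phi> \<in> schwartz \<Longrightarrow> integrable lborel (\<lambda>t. h t * \<phi> t)"
  using Y0_moderate moderate_integrable'[OF Y0_measurable] by blast

lemma regular_R_Y0: "h \<in> Y0 \<Longrightarrow> regular_R h \<in> dual SR"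
  using Y0_moderate regular_R_dual[OF Y0_measurable] by blast

lemma schwartz_in_Y0: "\<phi> \<in> schwartz \<Longrightarrow> \<phi> \<in> Y0"
  using schwartz_subset_Y0 by blast

text \<open>Translates of a reflected mollifier are test functions, so mollified values of
  \<open>h\<close> vanish while approximating \<open>h\<close>.\<close>

lemma Y0_pairing_zero:
  assumes h: "h \<in> Y0" and z: "\<And>\<psi>. \<psi> \<in> schwartz \<Longrightarrow> (LINT t|lborel. h t * \<psi> t) = 0"
  shows "h = (\<lambda>_. 0)"
proof
  fix y
  obtain H where H: "\<And>t. \<bar>h t\<bar> \<le> H" using C0R.bounded_mem[OF h] by blast
  have "\<bar>h y\<bar> \<le> 0"
  proof (rule field_le_epsilon)
    fix e :: real assume e: "0 < e"
    obtain \<kappa> where \<kappa>: "\<kappa> \<in> schwartz" "\<And>y. \<bar>(LINT x|lborel. h (- x) * \<kappa> (y + x)) - h y\<bar> \<le> e"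
      using mollification_close[OF C0R.uniformly_continuous_mem[OF h] H e] by blast
    have "(\<lambda>x. \<kappa> (- x + y)) \<in> schwartz" by (rule schwartz_reflect[OF SR.shift_mem[OF \<kappa>(1), of y]])
    from z[OF this] have "(LINT x|lborel. h (- x) * \<kappa> (y + x)) = 0"
      using lborel_integral_real_affine[of "-1" "\<lambda>x. h x * \<kappa> (- x + y)" 0] by (simp add: add.commute)
    then show "\<bar>h y\<bar> \<le> 0 + e" using \<kappa>(2)[of y] by simp
  qed
  then show "h y = 0" by simp
qed

text \<open>After a change of variables \<open>h\<close> itself is translated to infinity, where it
  tends to 0; dominated convergence applies with a multiple of
  \<open>\<bar>\<phi>\<bar>\<close>.\<close>

lemma Y0_pairing_translate:
  assumes h: "h \<in> Y0" and \<phi>: "\<phi> \<in> schwartz" and a: "filterlim a at_infinity sequentially"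
  shows "(\<lambda>n. LINT t|lborel. h t * \<phi> (t - a n)) \<longlonglongrightarrow> 0"
proof -
  obtain H where H: "\<And>t. \<bar>h t\<bar> \<le> H" using C0R.bounded_mem[OF h] by blast
  have [measurable]: "h \<in> borel_measurable borel" "\<phi> \<in> borel_measurable borel"
    using Y0_measurable[OF h] schwartz_measurable[OF \<phi>] by auto
  have "(\<lambda>n. LINT t|lborel. h (a n + t) * \<phi> t) \<longlonglongrightarrow> (LINT t|(lborel :: real measure). 0)"
  proof (rule integral_dominated_convergence[where f = "\<lambda>_. 0" and w = "\<lambda>t. H * \<bar>\<phi> t\<bar>"])
    show "integrable lborel (\<lambda>t. H * \<bar>\<phi> t\<bar>)"
      by (intro integrable_mult_right integrable_abs schwartz_integrable \<phi>)
    show "AE t in lborel. (\<lambda>n. h (a n + t) * \<phi> t) \<longlonglongrightarrow> 0"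
    proof (rule AE_I2)
      fix t
      have "filterlim (\<lambda>n. t + a n) at_infinity sequentially"
        by (rule tendsto_add_filterlim_at_infinity[OF tendsto_const a])
      then have "(\<lambda>n. h (t + a n)) \<longlonglongrightarrow> 0" using h by (auto intro: filterlim_compose)
      then show "(\<lambda>n. h (a n + t) * \<phi> t) \<longlonglongrightarrow> 0" by (auto intro: tendsto_mult_left_zero simp: add.commute)
    qed
    show "AE t in lborel. norm (h (a n + t) * \<phi> t) \<le> H * \<bar>\<phi> t\<bar>" for n
      using H by (intro AE_I2) (simp add: abs_mult mult_right_mono)
  qed auto
  moreover have "(LINT t|lborel. h t * \<phi> (t - a n)) = (LINT t|lborel. h (a n + t) * \<phi> t)" for n
    using lborel_integral_real_affine[of 1 "\<lambda>t. h t * \<phi> (t - a n)" "a n"] by simp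
  ultimately show ?thesis by simp
qed

lemma schwartz_by_parts:
  assumes \<eta>: "\<eta> \<in> schwartz" and \<phi>: "\<phi> \<in> schwartz"
  shows "(LINT t|lborel. \<eta> t * deriv \<phi> t) = - (LINT t|lborel. deriv \<eta> t * \<phi> t)"
proof -
  have sm: "smooth \<eta>" "smooth \<phi>" using assms schwartz_smooth by auto
  have d: "deriv \<eta> \<in> schwartz" "deriv \<phi> \<in> schwartz" using assms SR.deriv_mem by auto
  obtain P where P: "P \<ge> 0" "\<And>t. (1 + \<bar>t\<bar>) ^ 1 * \<bar>(deriv ^^ 0) \<eta> t\<bar> \<le> P" using schwartz_weight_bound[OF \<eta>] by blast
  obtain Q where Q: "Q \<ge> 0" "\<And>t. (1 + \<bar>t\<bar>) ^ 0 * \<bar>(deriv ^^ 0) \<phi> t\<bar> \<le> Q" using schwartz_weight_bound[OF \<phi>] by blast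
  have i: "integrable lborel (\<lambda>t. deriv \<eta> t * \<phi> t)" "integrable lborel (\<lambda>t. \<eta> t * deriv \<phi> t)"
    using Y0_integrable[OF schwartz_in_Y0] d assms by auto
  have "(LINT t|lborel. deriv \<eta> t * \<phi> t + \<eta> t * deriv \<phi> t) = 0"
  proof (rule integral_derivative_zero)
    fix t show "((\<lambda>t. \<eta> t * \<phi> t) has_real_derivative deriv \<eta> t * \<phi> t + \<eta> t * deriv \<phi> t) (at t)"
      using DERIV_mult[OF smooth_has_derivative[OF sm(1)] smooth_has_derivative[OF sm(2)], of t] by (simp add: mult.commute)
    have "((1 + \<bar>t\<bar>) * \<bar>\<eta> t\<bar>) * \<bar>\<phi> t\<bar> \<le> P * Q" using P(2)[of t] Q(2)[of t] P(1) by (intro mult_mono) auto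
    then show "(1 + \<bar>t\<bar>) * \<bar>\<eta> t * \<phi> t\<bar> \<le> P * Q" by (simp add: abs_mult mult.assoc)
  qed (intro continuous_intros smooth_continuous smooth_deriv sm Bochner_Integration.integrable_add i)+
  then show ?thesis using i by simp
qed

text \<open>Functionals whose translates tend to zero: on these the only solution of \<open>D v = 0\<close> is zero.\<close>

definition vanishing :: "gfun \<Rightarrow> bool" where
  "vanishing v \<longleftrightarrow> (\<forall>\<phi>\<in>schwartz. \<forall>\<psi>\<in>schwartz. v (\<lambda>t. \<phi> t - \<psi> t) = v \<phi> - v \<psi>) \<and>
     (\<forall>\<phi>\<in>schwartz. \<forall>a. filterlim a at_infinity sequentially \<longrightarrow> (\<lambda>n. v (\<lambda>t. \<phi> (t - a n))) \<longlonglongrightarrow> 0)"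

lemma filterlim_real_at_infinity: "filterlim real at_infinity sequentially"
  by (rule filterlim_at_top_imp_at_infinity[OF filterlim_real_sequentially])

lemma filterlim_minus_real_at_infinity: "filterlim (\<lambda>n. - real n) at_infinity sequentially"
  using filterlim_real_at_infinity by (simp add: filterlim_at_infinity[of 0])

text \<open>A test function minus its translate has integral zero and so is a derivative. Thus
  \<open>v\<close> is invariant under translations, yet tends to 0 along them.\<close>

lemma vanishing_deriv_zero:
  assumes v: "vanishing v" and D: "\<And>\<phi>. \<phi> \<in> schwartz \<Longrightarrow> v (deriv \<phi>) = 0" and \<phi>: "\<phi> \<in> schwartz"
  shows "v \<phi> = 0"
proof -
  have "v \<phi> = v (\<lambda>t. \<phi> (t - real n))" for n
  proof -
    have s: "(\<lambda>t. \<phi> (t - real n)) \<in> schwartz" by (rule SR.shift_mem'[OF \<phi>])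
    have "moment 0 (\<lambda>t. \<phi> t - \<phi> (t - real n)) = 0"
      unfolding moment_diff[OF \<phi> s] using lborel_integral_real_affine[of 1 \<phi> "- real n"] by (simp add: moment_def)
    from antideriv_schwartz[OF SR.diff_mem[OF \<phi> s] this] D
    have "v (\<lambda>t. \<phi> t - \<phi> (t - real n)) = 0" by metis
    then show ?thesis using v \<phi> s unfolding vanishing_def by simp
  qed
  moreover have "(\<lambda>n. v (\<lambda>t. \<phi> (t - real n))) \<longlonglongrightarrow> 0"
    using v \<phi> filterlim_real_at_infinity unfolding vanishing_def by blast
  ultimately have "(\<lambda>n::nat. v \<phi>) \<longlonglongrightarrow> 0" by simp
  then show ?thesis by (simp add: LIMSEQ_const_iff)
qed

lemma antideriv_limit:
  assumes \<phi>: "\<phi> \<in> schwartz"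
  shows "(\<lambda>n. antideriv \<phi> (x + real n)) \<longlonglongrightarrow> moment 0 \<phi>" and "(\<lambda>n. antideriv \<phi> (x - real n)) \<longlonglongrightarrow> 0"
proof -
  have [measurable]: "\<phi> \<in> borel_measurable borel" by (rule schwartz_measurable[OF \<phi>])
  have i: "integrable lborel (\<lambda>t. \<bar>\<phi> t\<bar>)" by (intro integrable_abs schwartz_integrable \<phi>)
  have "(\<lambda>n. antideriv \<phi> (x + real n)) \<longlonglongrightarrow> (LINT t|lborel. \<phi> t)"
    unfolding antideriv_def
  proof (rule integral_dominated_convergence[OF _ _ i])
    show "AE t in lborel. (\<lambda>n. indicator {..x + real n} t * \<phi> t) \<longlonglongrightarrow> \<phi> t"
    proof (rule AE_I2, rule tendsto_eventually)
      fix t :: real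
      obtain k where "t - x \<le> real k" using real_arch_simple by blast
      then have "indicator {..x + real n} t * \<phi> t = \<phi> t" if "k \<le> n" for n using that by (auto simp: indicator_def)
      then show "\<forall>\<^sub>F n in sequentially. indicator {..x + real n} t * \<phi> t = \<phi> t" by (rule eventually_sequentiallyI)
    qed
  qed (auto simp: indicator_def)
  then show "(\<lambda>n. antideriv \<phi> (x + real n)) \<longlonglongrightarrow> moment 0 \<phi>" by (simp add: moment_def)
  have "(\<lambda>n. antideriv \<phi> (x - real n)) \<longlonglongrightarrow> (LINT t|(lborel :: real measure). 0)"
    unfolding antideriv_def
  proof (rule integral_dominated_convergence[where f = "\<lambda>_. 0", OF _ _ i])
    show "AE t in lborel. (\<lambda>n. indicator {..x - real n} t * \<phi> t) \<longlonglongrightarrow> 0"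
    proof (rule AE_I2, rule tendsto_eventually)
      fix t :: real
      obtain k where "x - t < real k" using reals_Archimedean2 by blast
      then have "indicator {..x - real n} t * \<phi> t = 0" if "k \<le> n" for n using that by (auto simp: indicator_def)
      then show "\<forall>\<^sub>F n in sequentially. indicator {..x - real n} t * \<phi> t = 0" by (rule eventually_sequentiallyI)
    qed
  qed (auto simp: indicator_def)
  then show "(\<lambda>n. antideriv \<phi> (x - real n)) \<longlonglongrightarrow> 0" by simp
qed

lemma antideriv_translate: "antideriv (\<lambda>t. \<phi> (t + b)) x = antideriv \<phi> (x + b)"
proof -
  have "indicator {..x + b} (b + t) = (indicator {..x} t :: real)" for t by (auto simp: indicator_def)
  then show ?thesis
    using lborel_integral_real_affine[of 1 "\<lambda>t. indicator {..x + b} t * \<phi> t" b]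
    by (simp add: antideriv_def add.commute)
qed

text \<open>If a vanishing functional has a Schwartz function as derivative, it is itself one. First
  the integral of \<open>\<kappa>\<close> must be shown to vanish; then the primitive of
  \<open>\<kappa>\<close> is a Schwartz function that differs from \<open>v\<close> by a vanishing
  functional with derivative 0.\<close>

lemma vanishing_antiderivative:
  assumes v: "vanishing v" and \<kappa>: "\<kappa> \<in> schwartz"
    and D: "\<And>\<phi>. \<phi> \<in> schwartz \<Longrightarrow> v (deriv \<phi>) = - (LINT t|lborel. \<kappa> t * \<phi> t)"
  shows "\<exists>\<eta>\<in>schwartz. deriv \<eta> = \<kappa> \<and> (\<forall>\<phi>\<in>schwartz. v \<phi> = (LINT t|lborel. \<eta> t * \<phi> t))"
proof -
  obtain \<gamma> where \<gamma>: "\<gamma> \<in> schwartz" "\<And>t. 0 \<le> \<gamma> t" "(LINT t|lborel. \<gamma> t) = 1" using mollifier_exists by blast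
  have \<gamma>i: "integrable lborel \<gamma>" by (rule schwartz_integrable[OF \<gamma>(1)])
  \<comment> \<open>Smooth plateaus increasing to the constant 1. Their derivatives are bumps
    escaping to both ends, on which \<open>v\<close> tends to 0; against \<open>\<kappa>\<close>
    they tend to its integral.\<close>
  let ?H = "\<lambda>n x. antideriv \<gamma> (x + real n) - antideriv \<gamma> (x - real n)"
  have \<gamma>s: "(\<lambda>t. \<gamma> (t + b)) \<in> schwartz" for b by (rule SR.shift_mem[OF \<gamma>(1)])
  have H: "?H n \<in> schwartz" "deriv (?H n) = (\<lambda>t. \<gamma> (t + real n) - \<gamma> (t - real n))" for n
  proof -
    let ?g = "\<lambda>t. \<gamma> (t + real n) - \<gamma> (t + - real n)"
    have "moment 0 (\<lambda>t. \<gamma> (t + b)) = 1" for b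
      using lborel_integral_real_affine[of 1 \<gamma> b] \<gamma>(3) by (simp add: moment_def add.commute)
    then have m0: "moment 0 ?g = 0" by (simp only: moment_diff[OF \<gamma>s \<gamma>s])
    have mem: "?g \<in> schwartz" by (intro SR.diff_mem \<gamma>s)
    have "antideriv ?g = ?H n"
    proof
      fix x
      have "antideriv ?g x = antideriv (\<lambda>t. \<gamma> (t + real n)) x - antideriv (\<lambda>t. \<gamma> (t + - real n)) x"
        unfolding antideriv_def right_diff_distrib
        by (intro Bochner_Integration.integral_diff integrable_indicator_mult schwartz_integrable \<gamma>s) auto
      then show "antideriv ?g x = ?H n x" unfolding antideriv_translate by simp
    qed
    then show "?H n \<in> schwartz" "deriv (?H n) = (\<lambda>t. \<gamma> (t + real n) - \<gamma> (t - real n))"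
      using antideriv_schwartz[OF mem m0] by simp_all
  qed
  have E: "0 \<le> antideriv \<gamma> x" "antideriv \<gamma> x \<le> 1" for x
  proof -
    show "0 \<le> antideriv \<gamma> x" unfolding antideriv_def using \<gamma>(2) by (intro integral_nonneg_AE AE_I2) auto
    have "antideriv \<gamma> x \<le> (LINT t|lborel. \<gamma> t)"
      unfolding antideriv_def
      by (intro integral_mono integrable_indicator_mult \<gamma>i) (use \<gamma>(2) in \<open>auto simp: indicator_def\<close>)
    then show "antideriv \<gamma> x \<le> 1" using \<gamma>(3) by simp
  qed
  have [measurable]: "?H n \<in> borel_measurable borel" for n using schwartz_measurable[OF H(1)] .
  have [measurable]: "\<kappa> \<in> borel_measurable borel" by (rule schwartz_measurable[OF \<kappa>])
  have lim: "(\<lambda>n. LINT x|lborel. \<kappa> x * ?H n x) \<longlonglongrightarrow> (LINT x|lborel. \<kappa> x * (1 - 0))"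
  proof (rule integral_dominated_convergence[where w = "\<lambda>x. \<bar>\<kappa> x\<bar>"])
    show "integrable lborel (\<lambda>x. \<bar>\<kappa> x\<bar>)" by (intro integrable_abs schwartz_integrable \<kappa>)
    have m1: "moment 0 \<gamma> = 1" using \<gamma>(3) by (simp add: moment_def)
    show "AE x in lborel. (\<lambda>n. \<kappa> x * ?H n x) \<longlonglongrightarrow> \<kappa> x * (1 - 0)"
      using antideriv_limit[OF \<gamma>(1)] unfolding m1 by (intro AE_I2 tendsto_mult_left tendsto_diff)
    show "AE x in lborel. norm (\<kappa> x * ?H n x) \<le> \<bar>\<kappa> x\<bar>" for n
    proof (rule AE_I2)
      fix x
      have "\<bar>?H n x\<bar> \<le> 1" using E[of "x + real n"] E[of "x - real n"] by linarith
      then show "norm (\<kappa> x * ?H n x) \<le> \<bar>\<kappa> x\<bar>" by (simp add: abs_mult mult_left_le)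
    qed
  qed measurable
  have eq: "(LINT x|lborel. \<kappa> x * ?H n x) = v (\<lambda>t. \<gamma> (t - real n)) - v (\<lambda>t. \<gamma> (t - (- real n)))" for n
  proof -
    have "v (\<lambda>t. \<gamma> (t + real n) - \<gamma> (t - real n)) = v (\<lambda>t. \<gamma> (t + real n)) - v (\<lambda>t. \<gamma> (t - real n))"
      using v \<gamma>s[of "real n"] \<gamma>s[of "- real n"] unfolding vanishing_def by simp
    then show ?thesis using D[OF H(1)[of n]] unfolding H(2) by simp
  qed
  have "(\<lambda>n. v (\<lambda>t. \<gamma> (t - real n)) - v (\<lambda>t. \<gamma> (t - (- real n)))) \<longlonglongrightarrow> 0 - 0"
    using v \<gamma>(1) filterlim_real_at_infinity filterlim_minus_real_at_infinity unfolding vanishing_def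
    by (intro tendsto_diff) blast+
  from LIMSEQ_unique[OF lim[unfolded eq] this] have "(LINT x|lborel. \<kappa> x * (1 - 0)) = 0 - 0" .
  then have m0: "moment 0 \<kappa> = 0" by (simp add: moment_def)
  let ?\<eta> = "antideriv \<kappa>"
  have \<eta>: "?\<eta> \<in> schwartz" "deriv ?\<eta> = \<kappa>" by (rule antideriv_schwartz[OF \<kappa> m0])+
  \<comment> \<open>The difference is again vanishing, because a Schwartz function lies in
    \<open>C_0\<close>.\<close>
  let ?v' = "\<lambda>\<phi>. v \<phi> - (LINT t|lborel. ?\<eta> t * \<phi> t)"
  have \<eta>0: "?\<eta> \<in> Y0" by (rule schwartz_in_Y0[OF \<eta>(1)])
  have "vanishing ?v'"
    unfolding vanishing_def
  proof (intro conjI ballI allI impI)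
    fix \<phi> \<psi> assume "\<phi> \<in> schwartz" "\<psi> \<in> schwartz"
    then show "?v' (\<lambda>t. \<phi> t - \<psi> t) = ?v' \<phi> - ?v' \<psi>"
      using v Y0_integrable[OF \<eta>0] by (simp add: vanishing_def right_diff_distrib)
  next
    fix \<phi> and a :: "nat \<Rightarrow> real" assume "\<phi> \<in> schwartz" "filterlim a at_infinity sequentially"
    then show "(\<lambda>n. ?v' (\<lambda>t. \<phi> (t - a n))) \<longlonglongrightarrow> 0"
      using tendsto_diff[of "\<lambda>n. v (\<lambda>t. \<phi> (t - a n))" 0 sequentially _ 0] v Y0_pairing_translate[OF \<eta>0]
      by (simp add: vanishing_def)
  qed
  moreover have "?v' (deriv \<phi>) = 0" if "\<phi> \<in> schwartz" for \<phi>
    using D[OF that] schwartz_by_parts[OF \<eta>(1) that] \<eta>(2) by simp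
  ultimately have "?v' \<phi> = 0" if "\<phi> \<in> schwartz" for \<phi> using vanishing_deriv_zero that by blast
  then show ?thesis using \<eta> by (intro bexI[of _ ?\<eta>]) auto
qed

lemma vanishing_iterated_antiderivative:
  "vanishing v \<Longrightarrow> \<theta> \<in> schwartz \<Longrightarrow> (\<And>\<phi>. \<phi> \<in> schwartz \<Longrightarrow> v ((deriv ^^ N) \<phi>) = (-1) ^ N * (LINT t|lborel. \<theta> t * \<phi> t)) \<Longrightarrow>
   \<exists>\<eta>\<in>schwartz. (deriv ^^ N) \<eta> = \<theta> \<and> (\<forall>\<phi>\<in>schwartz. v \<phi> = (LINT t|lborel. \<eta> t * \<phi> t))"
proof (induction N arbitrary: v)
  case 0
  then show ?case by auto
next
  case (Suc N)
  let ?v1 = "\<lambda>\<phi>. - v (deriv \<phi>)"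
  have "vanishing ?v1"
    unfolding vanishing_def
  proof (intro conjI ballI allI impI)
    fix \<phi> \<psi> assume \<phi>: "\<phi> \<in> schwartz" "\<psi> \<in> schwartz"
    then have "deriv (\<lambda>t. \<phi> t - \<psi> t) = (\<lambda>t. deriv \<phi> t - deriv \<psi> t)"
      using deriv_iter_diff[OF schwartz_smooth schwartz_smooth, of \<phi> \<psi> 1] by simp
    then show "?v1 (\<lambda>t. \<phi> t - \<psi> t) = ?v1 \<phi> - ?v1 \<psi>"
      using Suc.prems(1) SR.deriv_mem[OF \<phi>(1)] SR.deriv_mem[OF \<phi>(2)] by (simp add: vanishing_def)
  next
    fix \<phi> and a :: "nat \<Rightarrow> real" assume \<phi>: "\<phi> \<in> schwartz" and a: "filterlim a at_infinity sequentially"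
    have "deriv (\<lambda>t. \<phi> (t - b)) = (\<lambda>t. deriv \<phi> (t - b))" for b
      using deriv_iter_shift[OF schwartz_smooth[OF \<phi>], of 1 "- b"] by simp
    then show "(\<lambda>n. ?v1 (\<lambda>t. \<phi> (t - a n))) \<longlonglongrightarrow> 0"
      using Suc.prems(1) SR.deriv_mem[OF \<phi>] a tendsto_minus[of "\<lambda>n. v (\<lambda>t. deriv \<phi> (t - a n))" 0]
      by (simp add: vanishing_def)
  qed
  moreover have "?v1 ((deriv ^^ N) \<phi>) = (-1) ^ N * (LINT t|lborel. \<theta> t * \<phi> t)" if "\<phi> \<in> schwartz" for \<phi>
    using Suc.prems(3)[OF that] by simp
  ultimately obtain \<eta>1 where \<eta>1: "\<eta>1 \<in> schwartz" "(deriv ^^ N) \<eta>1 = \<theta>"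
      "\<And>\<phi>. \<phi> \<in> schwartz \<Longrightarrow> ?v1 \<phi> = (LINT t|lborel. \<eta>1 t * \<phi> t)"
    using Suc.IH[of ?v1] Suc.prems(2) by blast
  have "v (deriv \<phi>) = - (LINT t|lborel. \<eta>1 t * \<phi> t)" if "\<phi> \<in> schwartz" for \<phi>
    using \<eta>1(3)[OF that] by simp
  from vanishing_antiderivative[OF Suc.prems(1) \<eta>1(1) this] obtain \<eta> where
    \<eta>: "\<eta> \<in> schwartz" "deriv \<eta> = \<eta>1" "\<forall>\<phi>\<in>schwartz. v \<phi> = (LINT t|lborel. \<eta> t * \<phi> t)" by blast
  have "(deriv ^^ Suc N) \<eta> = \<theta>" using \<eta>(2) \<eta>1(2) deriv_iter_deriv[of N \<eta>] by simp
  then show ?case using \<eta>(1,3) by blast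
qed

section \<open>Decomposition, pairing and realization for a trend operator\<close>

locale trend_op = admissible_op SR schwartz UNIV UNIV N L B Binv for N L B Binv +
  fixes \<theta> :: "nat \<Rightarrow> real \<Rightarrow> real"
  assumes biorthogonal: "biorthogonal_moments N \<theta>"
begin

lemma \<theta>_mem: "n \<in> {1..N} \<Longrightarrow> \<theta> n \<in> schwartz"
  using biorthogonal unfolding biorthogonal_moments_def by blast

lemma moment_\<theta>: "n \<in> {1..N} \<Longrightarrow> m < N \<Longrightarrow> moment m (\<theta> n) = (if n = Suc m then 1 else 0)"
proof -
  assume n: "n \<in> {1..N}" and m: "m < N"
  then have "Suc m \<in> {1..N}" by auto
  then have "(LINT t|lborel. \<theta> n t * t ^ (Suc m - 1)) = (if n = Suc m then 1 else 0)"
    using biorthogonal n unfolding biorthogonal_moments_def by blast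
  then show "moment m (\<theta> n) = (if n = Suc m then 1 else 0)" by (simp add: moment_def mult.commute)
qed

lemma \<theta>_sum_mem: "(\<lambda>t. \<Sum>n=1..N. c n * \<theta> n t) \<in> schwartz"
  by (intro SR.sum_mem SR.scale_mem \<theta>_mem) auto

lemma moment_\<theta>_sum:
  assumes "m < N" shows "moment m (\<lambda>t. \<Sum>n=1..N. c n * \<theta> n t) = c (Suc m)"
proof -
  have "moment m (\<lambda>t. \<Sum>n=1..N. c n * \<theta> n t) = (LINT t|lborel. (\<Sum>n=1..N. c n * (t ^ m * \<theta> n t)))"
    by (simp add: moment_def sum_distrib_left mult.left_commute)
  also have "\<dots> = (\<Sum>n=1..N. LINT t|lborel. c n * (t ^ m * \<theta> n t))"
    by (intro Bochner_Integration.integral_sum integrable_mult_right moment_integrable \<theta>_mem)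
  also have "\<dots> = (\<Sum>n=1..N. c n * (if n = Suc m then 1 else 0))"
    using moment_\<theta>[OF _ assms] by (intro sum.cong) (auto simp: moment_def)
  also have "\<dots> = c (Suc m)" using assms by (simp add: sum.delta' if_distrib[of "\<lambda>x. c _ * x"] cong: if_cong)
  finally show ?thesis .
qed

lemma meas_elem_R_apply:
  assumes h: "h \<in> Y0" and \<phi>: "\<phi> \<in> schwartz"
  shows "meas_elem_R N \<theta> L h c \<phi> =
    (LINT t|lborel. h t * B' ((deriv ^^ N) \<phi>) t) + (LINT t|lborel. (\<Sum>n=1..N. c n * \<theta> n t) * \<phi> t)"
proof -
  have "(LINT t|lborel. (\<Sum>n=1..N. c n * \<theta> n t) * \<phi> t) = (LINT t|lborel. (\<Sum>n=1..N. c n * (\<theta> n t * \<phi> t)))"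
    by (simp add: sum_distrib_right mult.assoc)
  also have "\<dots> = (\<Sum>n=1..N. LINT t|lborel. c n * (\<theta> n t * \<phi> t))"
    by (intro Bochner_Integration.integral_sum integrable_mult_right Y0_integrable schwartz_in_Y0 \<theta>_mem \<phi>)
  also have "\<dots> = (\<Sum>n=1..N. c n * regular_R (\<theta> n) \<phi>)"
    using \<phi> by (simp add: regular_R_apply)
  finally show ?thesis
    using adjoint_apply[OF regular_R_Y0[OF h] \<phi>] \<phi> lsi_mapD(1)[OF B' SR.iter_mem[OF \<phi>, of N]]
    by (simp add: meas_elem_R_def regular_R_apply)
qed

text \<open>The functional \<open>\<phi> \<mapsto> \<integral> h * B' \<phi>\<close> is vanishing
  and its \<open>N\<close>-th derivative is a combination of the \<open>\<theta> n\<close>, so it is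
  a Schwartz function \<open>\<eta>\<close>. The moments below \<open>N\<close> of
  \<open>(deriv ^^ N) \<eta>\<close> vanish, and by biorthogonality they are the coefficients up to
  sign; then \<open>\<eta> = 0\<close> and finally \<open>h = 0\<close>.\<close>

lemma meas_elem_R_inject:
  assumes h: "h \<in> Y0" and zero: "\<And>\<phi>. \<phi> \<in> schwartz \<Longrightarrow> (LINT t|lborel. h t * B' ((deriv ^^ N) \<phi>) t) + (LINT t|lborel. (\<Sum>n=1..N. c n * \<theta> n t) * \<phi> t) = 0"
  shows "h = (\<lambda>_. 0)" and "n \<in> {1..N} \<Longrightarrow> c n = 0"
proof -
  let ?v = "\<lambda>\<phi>. LINT t|lborel. h t * B' \<phi> t"
  \<comment> \<open>The sign \<open>(-1) ^ N\<close> belongs to the weak derivative, the minus to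
    moving the \<open>\<theta>\<close> term across the equation.\<close>
  let ?c = "\<lambda>n. - ((-1) ^ N * c n)"
  let ?\<Theta> = "\<lambda>t. \<Sum>n=1..N. ?c n * \<theta> n t"
  have van: "vanishing ?v"
    unfolding vanishing_def
  proof (intro conjI ballI allI impI)
    fix \<phi> \<psi> assume "\<phi> \<in> schwartz" "\<psi> \<in> schwartz"
    then show "?v (\<lambda>t. \<phi> t - \<psi> t) = ?v \<phi> - ?v \<psi>"
      using Y0_integrable[OF h lsi_mapD(1)[OF B']] by (simp add: lsi_map_diff[OF B'] right_diff_distrib)
  next
    fix \<phi> and a :: "nat \<Rightarrow> real" assume \<phi>: "\<phi> \<in> schwartz" and a: "filterlim a at_infinity sequentially"
    have "B' (\<lambda>t. \<phi> (t - b)) = (\<lambda>t. B' \<phi> (t - b))" for b using lsi_mapD(4)[OF B' \<phi>, of "- b"] by simp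
    then show "(\<lambda>n. ?v (\<lambda>t. \<phi> (t - a n))) \<longlonglongrightarrow> 0"
      using Y0_pairing_translate[OF h lsi_mapD(1)[OF B' \<phi>] a] by simp
  qed
  have "?v ((deriv ^^ N) \<phi>) = (-1) ^ N * (LINT t|lborel. ?\<Theta> t * \<phi> t)" if \<phi>: "\<phi> \<in> schwartz" for \<phi>
  proof -
    have "?\<Theta> t = - ((-1) ^ N) * (\<Sum>n=1..N. c n * \<theta> n t)" for t by (simp add: sum_distrib_left sum_negf mult.assoc)
    then have "(LINT t|lborel. ?\<Theta> t * \<phi> t) = (LINT t|lborel. - ((-1) ^ N) * ((\<Sum>n=1..N. c n * \<theta> n t) * \<phi> t))"
      by (simp only: mult.assoc)
    also have "\<dots> = - ((-1) ^ N) * (LINT t|lborel. (\<Sum>n=1..N. c n * \<theta> n t) * \<phi> t)"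
      by (rule integral_mult_right_zero)
    also have "(-1) ^ N * \<dots> = - (LINT t|lborel. (\<Sum>n=1..N. c n * \<theta> n t) * \<phi> t)"
      by (simp flip: mult.assoc power_mult_distrib)
    finally show ?thesis using zero[OF \<phi>] by linarith
  qed
  from vanishing_iterated_antiderivative[OF van \<theta>_sum_mem this] obtain \<eta> where
    \<eta>: "\<eta> \<in> schwartz" "(deriv ^^ N) \<eta> = ?\<Theta>" "\<And>\<phi>. \<phi> \<in> schwartz \<Longrightarrow> ?v \<phi> = (LINT t|lborel. \<eta> t * \<phi> t)" by blast
  have c0: "?c (Suc m) = 0" if "m < N" for m
    using moment_\<theta>_sum[OF that, of ?c] moment_deriv_iter[OF \<eta>(1) that] \<eta>(2) by simp
  have c0': "c n = 0" if "n \<in> {1..N}" for n using c0[of "n - 1"] that by auto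
  then show "n \<in> {1..N} \<Longrightarrow> c n = 0" .
  have "?\<Theta> = (\<lambda>_. 0)" using c0' by (auto intro!: ext sum.neutral)
  then have "\<eta> = (\<lambda>_. 0)" using schwartz_deriv_zero[OF \<eta>(1)] \<eta>(2) by simp
  then have v0: "?v \<phi> = 0" if "\<phi> \<in> schwartz" for \<phi> using \<eta>(3)[OF that] by simp
  show "h = (\<lambda>_. 0)"
  proof (rule Y0_pairing_zero[OF h])
    fix \<psi> assume \<psi>: "\<psi> \<in> schwartz"
    show "(LINT t|lborel. h t * \<psi> t) = 0"
      using v0[OF lsi_mapD(1)[OF B'inv \<psi>]] B'_B'inv[OF \<psi>] by simp
  qed
qed

lemma meas_elem_R_eqD:
  assumes h: "h \<in> Y0" "h' \<in> Y0" and eq: "meas_elem_R N \<theta> L h c = meas_elem_R N \<theta> L h' c'"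
  shows "h = h'" and "n \<in> {1..N} \<Longrightarrow> c n = c' n"
proof -
  have mem: "(\<lambda>t. h t - h' t) \<in> Y0" by (rule C0R.diff_mem[OF h])
  have zero: "(LINT t|lborel. (h t - h' t) * B' ((deriv ^^ N) \<phi>) t) + (LINT t|lborel. (\<Sum>n=1..N. (c n - c' n) * \<theta> n t) * \<phi> t) = 0"
    if \<phi>: "\<phi> \<in> schwartz" for \<phi>
  proof -
    have B\<phi>: "B' ((deriv ^^ N) \<phi>) \<in> schwartz" by (intro lsi_mapD(1)[OF B'] SR.iter_mem \<phi>)
    have "(LINT t|lborel. (h t - h' t) * B' ((deriv ^^ N) \<phi>) t) =
        (LINT t|lborel. h t * B' ((deriv ^^ N) \<phi>) t) - (LINT t|lborel. h' t * B' ((deriv ^^ N) \<phi>) t)"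
      unfolding left_diff_distrib by (intro Bochner_Integration.integral_diff Y0_integrable h B\<phi>)
    moreover have "(LINT t|lborel. (\<Sum>n=1..N. (c n - c' n) * \<theta> n t) * \<phi> t) =
        (LINT t|lborel. (\<Sum>n=1..N. c n * \<theta> n t) * \<phi> t) - (LINT t|lborel. (\<Sum>n=1..N. c' n * \<theta> n t) * \<phi> t)"
      unfolding left_diff_distrib sum_subtractf
      by (intro Bochner_Integration.integral_diff Y0_integrable schwartz_in_Y0 \<theta>_sum_mem \<phi>)
    ultimately show ?thesis
      using meas_elem_R_apply[OF h(1) \<phi>, of c] meas_elem_R_apply[OF h(2) \<phi>, of c'] eq by simp
  qed
  show "h = h'" using meas_elem_R_inject(1)[OF mem zero] by (simp add: fun_eq_iff)
  show "n \<in> {1..N} \<Longrightarrow> c n = c' n" using meas_elem_R_inject(2)[OF mem zero] by simp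
qed

text \<open>Both \<open>h\<close> and the relevant coefficients are determined by the measurement,
  so the description in \<open>pairing_R\<close> has exactly one value.\<close>

lemma pairing_R_eq:
  assumes h: "h \<in> Y0"
  shows "pairing_R N \<theta> L f (meas_elem_R N \<theta> L h c) = meas_R (L f) h + (\<Sum>n=1..N. c n * f (\<theta> n))"
  unfolding pairing_R_def topspace_C0R
proof (rule the_equality)
  fix r assume "\<exists>h'\<in>Y0. \<exists>c'. meas_elem_R N \<theta> L h c = meas_elem_R N \<theta> L h' c' \<and> r = meas_R (L f) h' + (\<Sum>n=1..N. c' n * f (\<theta> n))"
  then obtain h' c' where h': "h' \<in> Y0" "meas_elem_R N \<theta> L h c = meas_elem_R N \<theta> L h' c'"
      "r = meas_R (L f) h' + (\<Sum>n=1..N. c' n * f (\<theta> n))" by blast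
  then show "r = meas_R (L f) h + (\<Sum>n=1..N. c n * f (\<theta> n))"
    using meas_elem_R_eqD[OF h h'(1,2)] by simp
qed (use h in blast)

text \<open>Subtracting the combination of the \<open>\<theta> n\<close> with the same moments
  leaves a function with \<open>N\<close> vanishing moments, hence an \<open>N\<close>-th
  derivative; \<open>Binv\<close> then absorbs the invertible factor. The first summand is the
  transpose of \<open>L\<close> at \<open>\<zeta>\<close>.\<close>

lemma schwartz_decomposition:
  assumes \<phi>: "\<phi> \<in> schwartz"
  shows "\<exists>\<zeta>\<in>schwartz. \<phi> = (\<lambda>t. (-1) ^ N * B ((deriv ^^ N) \<zeta>) t + (\<Sum>n=1..N. moment (n - 1) \<phi> * \<theta> n t))"
proof -
  let ?s = "\<lambda>t. \<Sum>n=1..N. moment (n - 1) \<phi> * \<theta> n t"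
  have "moment m (\<lambda>t. \<phi> t - ?s t) = 0" if "m < N" for m
    using moment_\<theta>_sum[OF that, of "\<lambda>n. moment (n - 1) \<phi>"] unfolding moment_diff[OF \<phi> \<theta>_sum_mem] by simp
  from vanishing_moments_antideriv[OF SR.diff_mem[OF \<phi> \<theta>_sum_mem] this]
  obtain \<eta> where \<eta>: "\<eta> \<in> schwartz" "(deriv ^^ N) \<eta> = (\<lambda>t. \<phi> t - ?s t)" by blast
  let ?z = "Binv \<eta>"
  have z: "?z \<in> schwartz" by (rule lsi_mapD(1)[OF Binv \<eta>(1)])
  have "B ((deriv ^^ N) (\<lambda>t. (-1) ^ N * ?z t)) = (\<lambda>t. (-1) ^ N * B ((deriv ^^ N) ?z) t)"
    unfolding deriv_iter_scale[OF schwartz_smooth[OF z]] by (rule lsi_mapD(3)[OF B SR.iter_mem[OF z]])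
  moreover have "B ((deriv ^^ N) ?z) = (deriv ^^ N) \<eta>"
    using lsi_map_iter[OF B z, of N] B_Binv[OF \<eta>(1)] by simp
  ultimately have "\<phi> = (\<lambda>t. (-1) ^ N * B ((deriv ^^ N) (\<lambda>t. (-1) ^ N * ?z t)) t + ?s t)"
    using \<eta>(2) by (simp flip: mult.assoc power_mult_distrib)
  then show ?thesis using SR.scale_mem[OF z] by blast
qed

lemma meas_elem_R_regular:
  assumes \<zeta>: "\<zeta> \<in> schwartz" and \<phi>: "\<phi> \<in> schwartz"
  shows "(LINT t|lborel. \<zeta> t * B' ((deriv ^^ N) \<phi>) t) = (LINT t|lborel. ((-1) ^ N * B ((deriv ^^ N) \<zeta>) t) * \<phi> t)"
  using transpose_swap[OF \<phi> \<zeta>] by (simp add: set_lebesgue_integral_def mult.commute)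

lemma dual_decomposition:
  assumes f: "f \<in> native_R L" and \<zeta>: "\<zeta> \<in> schwartz"
  shows "f (\<lambda>t. (-1) ^ N * B ((deriv ^^ N) \<zeta>) t + (\<Sum>n=1..N. c n * \<theta> n t)) = meas_R (L f) \<zeta> + (\<Sum>n=1..N. c n * f (\<theta> n))"
proof -
  have fd: "f \<in> dual SR" "L f \<in> MR" using f by (auto simp: native_R_def)
  have m: "B ((deriv ^^ N) \<zeta>) \<in> schwartz" by (intro lsi_mapD(1)[OF B] SR.iter_mem \<zeta>)
  have "meas_R (L f) \<zeta> = (-1) ^ N * f (B ((deriv ^^ N) \<zeta>))"
    using MR.measure_of_gfun_apply[OF fd(2) \<zeta>] L_apply[OF fd(1) \<zeta>] by simp
  moreover have "f (\<lambda>t. \<Sum>n=1..N. c n * \<theta> n t) = (\<Sum>n=1..N. c n * f (\<theta> n))"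
    using SR.dual_sum[OF fd(1), of "{1..N}" "\<lambda>n t. c n * \<theta> n t"] SR.dual_scale[OF fd(1) \<theta>_mem]
    by (simp add: SR.scale_mem \<theta>_mem)
  ultimately show ?thesis
    using SR.dual_add[OF fd(1) SR.scale_mem[OF m] \<theta>_sum_mem] SR.dual_scale[OF fd(1) m] by simp
qed

text \<open>Translation does not preserve the span of the \<open>\<theta> n\<close>. A measurement
  whose second part is an arbitrary test function is therefore brought to standard form, the part
  \<open>\<zeta>\<close> of its decomposition being added to \<open>h\<close>.\<close>

lemma schwartz_measurement:
  assumes h: "h \<in> Y0" and \<phi>: "\<phi> \<in> schwartz" and g: "g \<in> extensional schwartz"
    and eq: "\<And>\<psi>. \<psi> \<in> schwartz \<Longrightarrow> g \<psi> = (LINT t|lborel. h t * B' ((deriv ^^ N) \<psi>) t) + (LINT t|lborel. \<phi> t * \<psi> t)"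
  shows "g \<in> predual_R N \<theta> L" and "f \<in> native_R L \<Longrightarrow> pairing_R N \<theta> L f g = meas_R (L f) h + f \<phi>"
proof -
  obtain \<zeta> where \<zeta>: "\<zeta> \<in> schwartz"
      "\<phi> = (\<lambda>t. (-1) ^ N * B ((deriv ^^ N) \<zeta>) t + (\<Sum>n=1..N. moment (n - 1) \<phi> * \<theta> n t))"
    using schwartz_decomposition[OF \<phi>] by blast
  let ?c = "\<lambda>n. moment (n - 1) \<phi>"
  have \<zeta>0: "\<zeta> \<in> Y0" by (rule schwartz_in_Y0[OF \<zeta>(1)])
  have mem: "(\<lambda>t. h t + \<zeta> t) \<in> Y0" by (rule C0R.add_mem[OF h \<zeta>0])
  have A\<zeta>: "(\<lambda>t. (-1) ^ N * B ((deriv ^^ N) \<zeta>) t) \<in> schwartz"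
    by (intro SR.scale_mem lsi_mapD(1)[OF B] SR.iter_mem \<zeta>)
  have geq: "g = meas_elem_R N \<theta> L (\<lambda>t. h t + \<zeta> t) ?c"
  proof (rule SR.dual_eqI[OF g])
    fix \<psi> assume \<psi>: "\<psi> \<in> schwartz"
    have B\<psi>: "B' ((deriv ^^ N) \<psi>) \<in> schwartz" by (intro lsi_mapD(1)[OF B'] SR.iter_mem \<psi>)
    have "(LINT t|lborel. \<phi> t * \<psi> t) = (LINT t|lborel. ((-1) ^ N * B ((deriv ^^ N) \<zeta>) t) * \<psi> t + (\<Sum>n=1..N. ?c n * \<theta> n t) * \<psi> t)"
      by (subst \<zeta>(2)) (simp only: distrib_right)
    also have "\<dots> = (LINT t|lborel. ((-1) ^ N * B ((deriv ^^ N) \<zeta>) t) * \<psi> t) + (LINT t|lborel. (\<Sum>n=1..N. ?c n * \<theta> n t) * \<psi> t)"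
      by (intro Bochner_Integration.integral_add Y0_integrable schwartz_in_Y0 A\<zeta> \<theta>_sum_mem \<psi>)
    also have "(LINT t|lborel. ((-1) ^ N * B ((deriv ^^ N) \<zeta>) t) * \<psi> t) = (LINT t|lborel. \<zeta> t * B' ((deriv ^^ N) \<psi>) t)"
      by (rule meas_elem_R_regular[symmetric, OF \<zeta>(1) \<psi>])
    finally have "g \<psi> = ((LINT t|lborel. h t * B' ((deriv ^^ N) \<psi>) t) + (LINT t|lborel. \<zeta> t * B' ((deriv ^^ N) \<psi>) t))
        + (LINT t|lborel. (\<Sum>n=1..N. ?c n * \<theta> n t) * \<psi> t)" using eq[OF \<psi>] by simp
    also have "(LINT t|lborel. h t * B' ((deriv ^^ N) \<psi>) t) + (LINT t|lborel. \<zeta> t * B' ((deriv ^^ N) \<psi>) t) =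
        (LINT t|lborel. (h t + \<zeta> t) * B' ((deriv ^^ N) \<psi>) t)"
      unfolding distrib_right by (intro Bochner_Integration.integral_add[symmetric] Y0_integrable h \<zeta>0 B\<psi>)
    finally show "g \<psi> = meas_elem_R N \<theta> L (\<lambda>t. h t + \<zeta> t) ?c \<psi>" using meas_elem_R_apply[OF mem \<psi>] by simp
  qed (simp add: meas_elem_R_def)
  then show "g \<in> predual_R N \<theta> L" using mem unfolding predual_R_def topspace_C0R by blast
  assume f: "f \<in> native_R L"
  then have \<mu>: "meas_R (L f) \<in> dual C0R" unfolding native_R_def by (auto intro: MR.measure_of_gfun_mem)
  show "pairing_R N \<theta> L f g = meas_R (L f) h + f \<phi>"
    unfolding geq pairing_R_eq[OF mem] C0R.dual_add[OF \<mu> h \<zeta>0]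
    using dual_decomposition[OF f \<zeta>(1), of ?c] \<zeta>(2) by simp
qed

text \<open>One decomposition of the Dirac functional at 0 serves all points: since
  \<open>B'\<close> commutes with shifts and derivatives, translating both parts by \<open>t\<close>
  represents the Dirac functional at \<open>t\<close>.\<close>

lemma value_R_eq:
  assumes h0: "h0 \<in> Y0" and d: "dirac SR 0 = meas_elem_R N \<theta> L h0 c0" and f: "f \<in> native_R L"
  shows "value_R N \<theta> L f t = meas_R (L f) (\<lambda>x. h0 (x - t)) + f (\<lambda>x. \<Sum>n=1..N. c0 n * \<theta> n (x - t))"
  unfolding value_R_def
proof (rule schwartz_measurement(2)[OF C0R.shift_mem[OF h0] SR.shift_mem'[OF \<theta>_sum_mem] _ _ f])
  show "dirac SR t \<in> extensional schwartz" by (simp add: dirac_def)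
  fix \<psi> assume \<psi>: "\<psi> \<in> schwartz"
  let ?\<psi> = "\<lambda>x. \<psi> (x + t)"
  have s: "?\<psi> \<in> schwartz" by (rule SR.shift_mem[OF \<psi>])
  have "B' ((deriv ^^ N) ?\<psi>) = (\<lambda>x. B' ((deriv ^^ N) \<psi>) (x + t))"
    unfolding deriv_iter_shift[OF schwartz_smooth[OF \<psi>]] by (rule lsi_mapD(4)[OF B' SR.iter_mem[OF \<psi>]])
  moreover have "\<psi> t = meas_elem_R N \<theta> L h0 c0 ?\<psi>" unfolding d[symmetric] using s by simp
  ultimately have "\<psi> t = (LINT x|lborel. h0 x * B' ((deriv ^^ N) \<psi>) (x + t)) + (LINT x|lborel. (\<Sum>n=1..N. c0 n * \<theta> n x) * \<psi> (x + t))"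
    using meas_elem_R_apply[OF h0 s] by simp
  then show "dirac SR t \<psi> = (LINT x|lborel. h0 (x - t) * B' ((deriv ^^ N) \<psi>) x) + (LINT x|lborel. (\<Sum>n=1..N. c0 n * \<theta> n (x - t)) * \<psi> x)"
    using lborel_integral_real_affine[of 1 "\<lambda>x. h0 (x - t) * B' ((deriv ^^ N) \<psi>) x" t]
      lborel_integral_real_affine[of 1 "\<lambda>x. (\<Sum>n=1..N. c0 n * \<theta> n (x - t)) * \<psi> x" t] \<psi>
    by (simp add: add.commute)
qed

text \<open>Integrating \<open>\<mu>\<close> in the distributional sense \<open>N\<close> times and
  composing with \<open>Binv\<close> solves the equation. Polynomials of degree below
  \<open>N\<close> are free, and exactly these adjust the values at the
  \<open>\<theta> n\<close>.\<close>

lemma native_R_realization: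
  assumes \<mu>: "\<mu> \<in> dual C0R"
  shows "\<exists>f\<in>native_R L. meas_R (L f) = \<mu> \<and> (\<forall>n\<in>{1..N}. f (\<theta> n) = b n)"
proof -
  obtain v where v: "v \<in> dual SR" "\<And>\<phi>. \<phi> \<in> schwartz \<Longrightarrow> v ((deriv ^^ N) \<phi>) = (-1) ^ N * restrict \<mu> schwartz \<phi>"
    using dual_SR_iterated_antiderivative[OF MR.restrict_dual[OF \<mu>]] by blast
  let ?u = "\<lambda>\<phi>\<in>schwartz. v (Binv \<phi>)"
  have f0: "?u \<in> dual SR" by (rule lsi_mapD(6)[OF Binv v(1)])
  \<comment> \<open>By biorthogonality the polynomial with these coefficients takes the value
    \<open>?a n\<close> at \<open>\<theta> n\<close>, the missing amount.\<close>
  let ?a = "\<lambda>n. b n - ?u (\<theta> n)"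
  let ?p = "\<lambda>t::real. \<Sum>n=1..N. ?a n * t ^ (n - 1)"
  have pm: "?p \<in> borel_measurable borel" by measurable
  have pb: "\<bar>?p t\<bar> \<le> (\<Sum>n=1..N. \<bar>?a n\<bar>) * (1 + \<bar>t\<bar>) ^ N" for t
  proof -
    have "\<bar>?p t\<bar> \<le> (\<Sum>n=1..N. \<bar>?a n * t ^ (n - 1)\<bar>)" by (rule sum_abs)
    also have "\<dots> \<le> (\<Sum>n=1..N. \<bar>?a n\<bar> * (1 + \<bar>t\<bar>) ^ N)"
    proof (rule sum_mono)
      fix n assume n: "n \<in> {1..N}"
      have "\<bar>t\<bar> ^ (n - 1) \<le> (1 + \<bar>t\<bar>) ^ (n - 1)" by (rule power_mono) auto
      also have "\<dots> \<le> (1 + \<bar>t\<bar>) ^ N" using n by (intro power_increasing) auto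
      finally show "\<bar>?a n * t ^ (n - 1)\<bar> \<le> \<bar>?a n\<bar> * (1 + \<bar>t\<bar>) ^ N"
        unfolding abs_mult power_abs by (rule mult_left_mono) simp
    qed
    finally show ?thesis by (simp add: sum_distrib_right)
  qed
  have p: "regular_R ?p \<in> dual SR" by (rule regular_R_dual[OF pm pb])
  have pap: "regular_R ?p \<phi> = (\<Sum>n=1..N. ?a n * moment (n - 1) \<phi>)" if \<phi>: "\<phi> \<in> schwartz" for \<phi>
  proof -
    have "regular_R ?p \<phi> = (LINT t|lborel. (\<Sum>n=1..N. ?a n * (t ^ (n - 1) * \<phi> t)))"
      unfolding regular_R_apply[OF \<phi>] sum_distrib_right mult.assoc ..
    also have "\<dots> = (\<Sum>n=1..N. LINT t|lborel. ?a n * (t ^ (n - 1) * \<phi> t))"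
      by (intro Bochner_Integration.integral_sum integrable_mult_right moment_integrable \<phi>)
    finally show ?thesis unfolding moment_def integral_mult_right_zero .
  qed
  let ?f = "\<lambda>\<phi>\<in>schwartz. ?u \<phi> + regular_R ?p \<phi>"
  have f: "?f \<in> dual SR" by (rule SR.add_dual[OF f0 p])
  have Lf: "L ?f = restrict \<mu> schwartz"
  proof (rule SR.dual_eqI)
    show "L ?f \<in> extensional schwartz" by (rule SR.extensional_dual[OF L_dual[OF f]])
    fix \<phi> assume \<phi>: "\<phi> \<in> schwartz"
    let ?q = "B ((deriv ^^ N) \<phi>)"
    have q: "?q \<in> schwartz" by (intro lsi_mapD(1)[OF B] SR.iter_mem \<phi>)
    \<comment> \<open>\<open>B\<close> commutes with derivatives, so \<open>?q\<close> is an
      \<open>N\<close>-th derivative and the polynomial correction is invisible to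
      \<open>L\<close>.\<close>
    have "moment (n - 1) ?q = 0" if "n \<in> {1..N}" for n
      using that moment_deriv_iter[OF lsi_mapD(1)[OF B \<phi>], of "n - 1" N] lsi_map_iter[OF B \<phi>, of N] by auto
    then have "regular_R ?p ?q = 0" using pap[OF q] by simp
    moreover have "?u ?q = (-1) ^ N * restrict \<mu> schwartz \<phi>"
      using q v(2)[OF \<phi>] Binv_B[OF SR.iter_mem[OF \<phi>]] by simp
    ultimately show "L ?f \<phi> = restrict \<mu> schwartz \<phi>"
      using L_apply[OF f \<phi>] q by (simp flip: mult.assoc power_mult_distrib)
  qed simp
  have "?f (\<theta> n) = b n" if n: "n \<in> {1..N}" for n
  proof -
    have "(\<Sum>k=1..N. ?a k * moment (k - 1) (\<theta> n)) = (\<Sum>k=1..N. if k = n then ?a k else 0)"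
    proof (rule sum.cong[OF refl])
      fix k assume k: "k \<in> {1..N}"
      then have "k - 1 < N" "Suc (k - 1) = k" by auto
      then show "?a k * moment (k - 1) (\<theta> n) = (if k = n then ?a k else 0)" using moment_\<theta>[OF n, of "k - 1"] by auto
    qed
    also have "\<dots> = ?a n" using n by simp
    finally show ?thesis using pap[OF \<theta>_mem[OF n]] \<theta>_mem[OF n] by simp
  qed
  moreover have "?f \<in> native_R L" unfolding native_R_def using f Lf MR.restrict_measures_in[OF \<mu>] by simp
  moreover have "meas_R (L ?f) = \<mu>" unfolding Lf by (rule MR.measure_of_gfun_restrict[OF \<mu>])
  ultimately show ?thesis by (intro bexI[of _ ?f]) blast+
qed

end

subsection \<open>The seasonal measurement space\<close>

lemma YT_continuous: "h \<in> YT \<Longrightarrow> continuous_on S h"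
  by (auto intro: continuous_on_subset)

lemma XT_in_YT: "\<phi> \<in> XT \<Longrightarrow> \<phi> \<in> YT"
  by (auto intro: smooth_continuous)

lemma YT_integrable: "h \<in> YT \<Longrightarrow> g \<in> YT \<Longrightarrow> (\<lambda>t. h t * g t) integrable_on {a..b}"
  by (intro integrable_continuous_interval continuous_on_mult YT_continuous)

lemma regular_T_YT: "h \<in> YT \<Longrightarrow> regular_T h \<in> dual ST"
  by (intro regular_T_dual YT_continuous)

lemma regular_T_apply_YT: "h \<in> YT \<Longrightarrow> \<phi> \<in> XT \<Longrightarrow> regular_T h \<phi> = integral {0..1} (\<lambda>x. h x * \<phi> x)"
  by (rule regular_T_apply[OF YT_continuous]) auto

lemma YT_const: "(\<lambda>_. c) \<in> YT"
  by (simp add: periodic1_def)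

text \<open>The integral of \<open>g^2\<close> equals that of \<open>g * (g - \<psi>)\<close> for
  every test function \<open>\<psi>\<close>, and density makes the latter arbitrarily small.\<close>

lemma YT_pairing_zero:
  assumes g: "g \<in> YT" and z: "\<And>\<psi>. \<psi> \<in> XT \<Longrightarrow> integral {0..1} (\<lambda>t. g t * \<psi> t) = 0"
  shows "g = (\<lambda>_. 0)"
proof -
  obtain H where H: "\<And>t. \<bar>g t\<bar> \<le> H" using CT.bounded_mem[OF g] by blast
  have H0: "H \<ge> 0" using H[of 0] by linarith
  have "\<bar>integral {0..1} (\<lambda>t. g t * g t)\<bar> \<le> 0"
  proof (rule field_le_epsilon)
    fix e :: real assume e: "0 < e"
    define d where "d = e / (H + 1)"
    have d: "d > 0" using e H0 by (simp add: d_def)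
    obtain \<psi> where \<psi>: "\<psi> \<in> XT" "\<And>t. \<bar>g t - \<psi> t\<bar> \<le> d" using XT_dense[OF g d] by blast
    have \<psi>Y: "\<psi> \<in> YT" by (rule XT_in_YT[OF \<psi>(1)])
    have dY: "(\<lambda>t. g t - \<psi> t) \<in> YT" by (rule CT.diff_mem[OF g \<psi>Y])
    have "integral {0..1} (\<lambda>t. g t * (g t - \<psi> t)) = integral {0..1} (\<lambda>t. g t * g t) - integral {0..1} (\<lambda>t. g t * \<psi> t)"
      unfolding right_diff_distrib by (intro Henstock_Kurzweil_Integration.integral_diff YT_integrable g \<psi>Y)
    then have eq: "integral {0..1} (\<lambda>t. g t * g t) = integral {0..1} (\<lambda>t. g t * (g t - \<psi> t))" using z[OF \<psi>(1)] by simp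
    have "norm (integral {0..1} (\<lambda>t. g t * (g t - \<psi> t))) \<le> (H * d) * (1 - 0)"
    proof (rule integral_bound)
      show "continuous_on {0..1} (\<lambda>t. g t * (g t - \<psi> t))" by (intro continuous_on_mult YT_continuous[OF g] YT_continuous[OF dY])
      fix t show "norm (g t * (g t - \<psi> t)) \<le> H * d"
        unfolding real_norm_def abs_mult using H \<psi>(2) H0 by (intro mult_mono) auto
    qed simp
    also have "\<dots> \<le> (H + 1) * d" using d by (simp add: distrib_right)
    also have "\<dots> = e" using H0 by (simp add: d_def)
    finally show "\<bar>integral {0..1} (\<lambda>t. g t * g t)\<bar> \<le> 0 + e" unfolding eq by simp
  qed
  then have "integral {0..1} (\<lambda>t. g t * g t) = 0" by simp
  from continuous_square_integral_zero[OF YT_continuous[OF g] _ this]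
  have "g (frac t) = 0" for t using periodic1_frac_mem[of t] by simp
  then show ?thesis using periodic1_frac[of g] g by (auto simp: fun_eq_iff)
qed

lemma integral_deriv_XT:
  assumes "\<phi> \<in> XT" shows "integral {0..1} (deriv \<phi>) = 0"
proof -
  have sm: "smooth \<phi>" and "periodic1 \<phi>" using assms by auto
  from spec[OF this(2)[unfolded periodic1_def], of 0] have per: "\<phi> (0 + 1) = \<phi> 0" .
  have "(deriv \<phi> has_integral (\<phi> 1 - \<phi> 0)) {0..1}"
    by (rule fundamental_theorem_of_calculus)
      (auto simp flip: has_real_derivative_iff_has_vector_derivative
        intro!: has_field_derivative_at_within smooth_has_derivative sm)
  then show ?thesis using per by (simp add: integral_unique)
qed

locale seasonal_op = admissible_op ST XT "{0}" "{0..1}" N L B Binv for N L B Binv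
begin

text \<open>Shift invariance maps constants to constants; this is the factor by which the inverse
  transpose multiplies them, its frequency response at 0.\<close>

definition gain :: real where "gain = Binv (\<lambda>_. 1) 0"

lemma lsi_map_const: assumes "lsi_map G" "g = G (\<lambda>_. 1) 0" shows "G (\<lambda>_. c) = (\<lambda>_. c * g)"
proof
  fix x
  have "G (\<lambda>_. 1) x = G (\<lambda>_. 1) 0" using fun_cong[OF lsi_mapD(4)[OF assms(1) XT_const[of 1], of x], of 0] by simp
  then show "G (\<lambda>_. c) x = c * g" using lsi_mapD(3)[OF assms(1) XT_const[of 1], of c] assms(2) by simp
qed

lemma Binv_const: "Binv (\<lambda>_. c) = (\<lambda>_. c * gain)"
  by (rule lsi_map_const[OF Binv gain_def])

lemma iter_const: "N > 0 \<Longrightarrow> (deriv ^^ N) (\<lambda>_. c :: real) = (\<lambda>_. 0)"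
  by (cases N) (simp_all add: funpow_swap1 deriv_iter_zero)

lemma meas_elem_T_apply:
  assumes h: "h \<in> YT" and \<phi>: "\<phi> \<in> XT"
  shows "meas_elem_T L h \<alpha> \<phi> = integral {0..1} (\<lambda>t. h t * B' ((deriv ^^ N) \<phi>) t) + \<alpha> * integral {0..1} \<phi>"
proof -
  have B\<phi>: "B' ((deriv ^^ N) \<phi>) \<in> XT" by (intro lsi_mapD(1)[OF B'] ST.iter_mem \<phi>)
  show ?thesis
    using adjoint_apply[OF regular_T_YT[OF h] \<phi>] regular_T_apply_YT[OF h B\<phi>] regular_T_apply_YT[OF YT_const \<phi>, of \<alpha>] \<phi>
    by (simp add: meas_elem_T_def)
qed

lemma native_T_dual: "f \<in> native_T L \<Longrightarrow> f \<in> dual ST" "f \<in> native_T L \<Longrightarrow> meas_T (L f) \<in> dual CT"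
  by (auto simp: native_T_def intro: MT.measure_of_gfun_mem)

text \<open>Constants are the compatibility conditions between the seasonal coordinates. For
  \<open>N > 0\<close> the measure annihilates them and the mean is free; for \<open>N = 0\<close>
  the mean is determined by the measure.\<close>

lemma native_T_measure_one:
  assumes f: "f \<in> native_T L"
  shows "N > 0 \<Longrightarrow> meas_T (L f) (\<lambda>_. 1) = 0" and "N = 0 \<Longrightarrow> mean f = gain * meas_T (L f) (\<lambda>_. 1)"
proof -
  have fd: "f \<in> dual ST" "L f \<in> MT" using f by (auto simp: native_T_def)
  have eq: "meas_T (L f) (\<lambda>_. 1) = (-1) ^ N * f (B ((deriv ^^ N) (\<lambda>_. 1)))"
    using MT.measure_of_gfun_apply[OF fd(2) XT_const] L_apply[OF fd(1) XT_const] by simp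
  show "meas_T (L f) (\<lambda>_. 1) = 0" if "N > 0"
    using eq iter_const[OF that] lsi_map_zero[OF B] ST.dual_zero[OF fd(1)] by simp
  show "mean f = gain * meas_T (L f) (\<lambda>_. 1)" if "N = 0"
  proof -
    define b where "b = B (\<lambda>_. 1) 0"
    have Bc: "B (\<lambda>_. c) = (\<lambda>_. c * b)" for c by (rule lsi_map_const[OF B b_def])
    have "f (B (\<lambda>_. 1)) = b * mean f"
      using ST.dual_scale[OF fd(1) XT_const, of b 1] by (simp add: mean_def Bc)
    moreover have "gain * b = 1" using B_Binv[OF XT_const, of 1] by (simp add: Binv_const Bc fun_eq_iff)
    ultimately show ?thesis using eq that by (simp flip: mult.assoc)
  qed
qed

text \<open>A decomposition of zero need not be trivial: for \<open>N > 0\<close> any constant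
  \<open>h\<close> is allowed. Its contribution to the pairing vanishes because
  \<open>meas_T (L f)\<close> annihilates constants.\<close>

lemma meas_elem_T_zero:
  assumes h: "h \<in> YT" and \<alpha>: "N = 0 \<longrightarrow> \<alpha> = 0" and f: "f \<in> native_T L"
    and z: "\<And>\<phi>. \<phi> \<in> XT \<Longrightarrow> integral {0..1} (\<lambda>t. h t * B' ((deriv ^^ N) \<phi>) t) + \<alpha> * integral {0..1} \<phi> = 0"
  shows "meas_T (L f) h + \<alpha> * mean f = 0"
proof -
  have \<nu>: "meas_T (L f) \<in> dual CT" by (rule native_T_dual[OF f])
  have \<alpha>0: "\<alpha> = 0"
  proof (cases "N = 0")
    case False
    then show ?thesis using z[OF XT_const, of 1] iter_const[of 1] lsi_map_zero[OF B'] by simp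
  qed (use \<alpha> in simp)
  have D0: "integral {0..1} (\<lambda>t. h t * (deriv ^^ N) \<eta> t) = 0" if \<eta>: "\<eta> \<in> XT" for \<eta>
    using z[OF lsi_mapD(1)[OF B'inv \<eta>]] \<alpha>0 lsi_map_iter[OF B' lsi_mapD(1)[OF B'inv \<eta>], of N] B'_B'inv[OF \<eta>] by simp
  show ?thesis
  proof (cases "N = 0")
    case True
    then have "h = (\<lambda>_. 0)" using YT_pairing_zero[OF h] D0 by simp
    then show ?thesis using CT.dual_zero[OF \<nu>] \<alpha>0 by simp
  next
    case False
    let ?m = "integral {0..1} h"
    have mem: "(\<lambda>t. h t - ?m) \<in> YT" by (rule CT.diff_mem[OF h YT_const])
    \<comment> \<open>Mean-zero test functions are \<open>N\<close>-th derivatives, so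
      \<open>h\<close> is orthogonal to all of them; subtracting its mean makes it orthogonal to
      constants as well.\<close>
    have "(\<lambda>t. h t - ?m) = (\<lambda>_. 0)"
    proof (rule YT_pairing_zero[OF mem])
      fix \<psi> assume \<psi>: "\<psi> \<in> XT"
      let ?p = "integral {0..1} \<psi>"
      have i: "h integrable_on {0..1}" "\<psi> integrable_on {0..1}"
        using h \<psi> by (auto intro!: integrable_continuous_interval intro: continuous_on_subset smooth_continuous)
      have d\<psi>: "(\<lambda>t. \<psi> t - ?p) \<in> XT" by (rule ST.diff_mem[OF \<psi> XT_const])
      have "integral {0..1} (\<lambda>t. \<psi> t - ?p) = integral {0..1} \<psi> - integral {0..1} (\<lambda>t::real. ?p)"
        by (intro Henstock_Kurzweil_Integration.integral_diff i(2) integrable_continuous_interval continuous_on_const)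
      then have "integral {0..1} (\<lambda>t. \<psi> t - ?p) = 0" by simp
      from mean_zero_antideriv_T[OF d\<psi> this] obtain \<eta> where \<eta>: "\<eta> \<in> XT" "(deriv ^^ N) \<eta> = (\<lambda>t. \<psi> t - ?p)" by blast
      then have "integral {0..1} (\<lambda>t. h t * (\<psi> t - ?p)) = 0" using D0[OF \<eta>(1)] by simp
      moreover have "integral {0..1} (\<lambda>t. h t * (\<psi> t - ?p)) = integral {0..1} (\<lambda>t. h t * \<psi> t) - integral {0..1} (\<lambda>t. h t * ?p)"
        unfolding right_diff_distrib by (intro Henstock_Kurzweil_Integration.integral_diff YT_integrable h XT_in_YT \<psi> YT_const)
      moreover have "integral {0..1} (\<lambda>t. (h t - ?m) * \<psi> t) = integral {0..1} (\<lambda>t. h t * \<psi> t) - integral {0..1} (\<lambda>t. ?m * \<psi> t)"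
        unfolding left_diff_distrib by (intro Henstock_Kurzweil_Integration.integral_diff YT_integrable h XT_in_YT \<psi> YT_const)
      ultimately show "integral {0..1} (\<lambda>t. (h t - ?m) * \<psi> t) = 0" by simp
    qed
    then have "h = (\<lambda>_. ?m * 1)" by (simp add: fun_eq_iff)
    then have "meas_T (L f) h = ?m * meas_T (L f) (\<lambda>_. 1)" using CT.dual_scale[OF \<nu> YT_const, of ?m 1] by metis
    then show ?thesis using native_T_measure_one(1)[OF f] False \<alpha>0 by simp
  qed
qed

text \<open>Two decompositions differ by a decomposition of zero, whose pairing with elements of the
  native space is zero.\<close>

lemma pairing_T_eq:
  assumes h: "h \<in> YT" and \<alpha>: "N = 0 \<longrightarrow> \<alpha> = 0" and f: "f \<in> native_T L"
  shows "pairing_T N L f (meas_elem_T L h \<alpha>) = meas_T (L f) h + \<alpha> * mean f"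
  unfolding pairing_T_def topspace_CT
proof (rule the_equality)
  fix r assume "\<exists>h'\<in>YT. \<exists>\<alpha>'. (N = 0 \<longrightarrow> \<alpha>' = 0) \<and> meas_elem_T L h \<alpha> = meas_elem_T L h' \<alpha>' \<and> r = meas_T (L f) h' + \<alpha>' * mean f"
  then obtain h' \<alpha>' where h': "h' \<in> YT" "N = 0 \<longrightarrow> \<alpha>' = 0" "meas_elem_T L h \<alpha> = meas_elem_T L h' \<alpha>'"
      "r = meas_T (L f) h' + \<alpha>' * mean f" by blast
  have mem: "(\<lambda>t. h t - h' t) \<in> YT" by (rule CT.diff_mem[OF h h'(1)])
  have "meas_T (L f) (\<lambda>t. h t - h' t) + (\<alpha> - \<alpha>') * mean f = 0"
  proof (rule meas_elem_T_zero[OF mem _ f])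
    show "N = 0 \<longrightarrow> \<alpha> - \<alpha>' = 0" using \<alpha> h'(2) by simp
    fix \<phi> assume \<phi>: "\<phi> \<in> XT"
    have B\<phi>: "B' ((deriv ^^ N) \<phi>) \<in> YT" by (intro XT_in_YT lsi_mapD(1)[OF B'] ST.iter_mem \<phi>)
    have "integral {0..1} (\<lambda>t. (h t - h' t) * B' ((deriv ^^ N) \<phi>) t) =
       integral {0..1} (\<lambda>t. h t * B' ((deriv ^^ N) \<phi>) t) - integral {0..1} (\<lambda>t. h' t * B' ((deriv ^^ N) \<phi>) t)"
      unfolding left_diff_distrib by (intro Henstock_Kurzweil_Integration.integral_diff YT_integrable h h'(1) B\<phi>)
    then show "integral {0..1} (\<lambda>t. (h t - h' t) * B' ((deriv ^^ N) \<phi>) t) + (\<alpha> - \<alpha>') * integral {0..1} \<phi> = 0"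
      using meas_elem_T_apply[OF h \<phi>, of \<alpha>] meas_elem_T_apply[OF h'(1) \<phi>, of \<alpha>'] h'(3) by (simp add: left_diff_distrib)
  qed
  then show "r = meas_T (L f) h + \<alpha> * mean f"
    using h'(4) CT.dual_diff[OF native_T_dual(2)[OF f] h h'(1)] by (simp add: left_diff_distrib)
qed (use h \<alpha> in blast)

text \<open>Decides which decompositions belong to the mean-zero measurement space; the adjoint
  contributes a mean only if no derivative is present.\<close>

lemma mean_meas_elem_T:
  assumes h: "h \<in> YT"
  shows "mean (meas_elem_T L h \<alpha>) = (if N = 0 then B' (\<lambda>_. 1) 0 * integral {0..1} h else 0) + \<alpha>"
proof (cases "N = 0")
  case True
  define b where "b = B' (\<lambda>_. 1) 0"
  have "B' (\<lambda>_. 1) = (\<lambda>_. 1 * b)" by (rule lsi_map_const[OF B' b_def])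
  then show ?thesis
    unfolding mean_def meas_elem_T_apply[OF h XT_const] b_def[symmetric] using True by (simp add: mult.commute)
next
  case False
  then show ?thesis
    unfolding mean_def meas_elem_T_apply[OF h XT_const] using iter_const[of 1] lsi_map_zero[OF B'] by simp
qed

text \<open>The two conditions of \<open>native_T_measure_one\<close> are also sufficient: a
  primitive exists if the measure annihilates constants, and an additive constant adjusts the
  mean.\<close>

lemma native_T_realization:
  assumes \<nu>: "\<nu> \<in> dual CT" and "N > 0 \<Longrightarrow> \<nu> (\<lambda>_. 1) = 0" and "N = 0 \<Longrightarrow> m = gain * \<nu> (\<lambda>_. 1)"
  shows "\<exists>f\<in>native_T L. meas_T (L f) = \<nu> \<and> mean f = m"
proof -
  let ?r = "restrict \<nu> XT"
  have r: "?r \<in> dual ST" by (rule MT.restrict_dual[OF \<nu>])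
  have "\<exists>v\<in>dual ST. (N > 0 \<longrightarrow> v (\<lambda>_. 1) = 0) \<and> (\<forall>\<phi>\<in>XT. v ((deriv ^^ N) \<phi>) = (-1) ^ N * ?r \<phi>)"
  proof (cases "N = 0")
    case False
    then have "?r (\<lambda>_. 1) = 0" using assms(2) XT_const[of 1] by simp
    from dual_ST_iterated_antiderivative[OF r this] show ?thesis by blast
  next
    case True
    then show ?thesis using r by (intro bexI[of _ ?r]) auto
  qed
  then obtain v where v: "v \<in> dual ST" "N > 0 \<Longrightarrow> v (\<lambda>_. 1) = 0"
      "\<And>\<phi>. \<phi> \<in> XT \<Longrightarrow> v ((deriv ^^ N) \<phi>) = (-1) ^ N * ?r \<phi>" by blast
  let ?u = "\<lambda>\<phi>\<in>XT. v (Binv \<phi>)"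
  have u: "?u \<in> dual ST" by (rule lsi_mapD(6)[OF Binv v(1)])
  have um: "?u (\<lambda>_. 1) = gain * v (\<lambda>_. 1)"
    using XT_const[of 1] Binv_const[of 1] ST.dual_scale[OF v(1) XT_const, of gain 1] by simp
  \<comment> \<open>For \<open>N = 0\<close> the operator does not annihilate constants, but there
    the prescribed mean already agrees with that of \<open>?u\<close> and \<open>a\<close> is
    0.\<close>
  define a where "a = m - ?u (\<lambda>_. 1)"
  have a0: "N = 0 \<Longrightarrow> a = 0" using um v(3)[OF XT_const, of 1] assms(3) XT_const[of 1] by (simp add: a_def)
  have c: "regular_T (\<lambda>_. a) \<in> dual ST" by (rule regular_T_YT[OF YT_const])
  let ?f = "\<lambda>\<phi>\<in>XT. ?u \<phi> + regular_T (\<lambda>_. a) \<phi>"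
  have f: "?f \<in> dual ST" by (rule ST.add_dual[OF u c])
  have Lf: "L ?f = ?r"
  proof (rule ST.dual_eqI)
    show "L ?f \<in> extensional XT" by (rule ST.extensional_dual[OF L_dual[OF f]])
    fix \<phi> assume \<phi>: "\<phi> \<in> XT"
    let ?q = "B ((deriv ^^ N) \<phi>)"
    have q: "?q \<in> XT" by (intro lsi_mapD(1)[OF B] ST.iter_mem \<phi>)
    have "regular_T (\<lambda>_. a) ?q = 0"
    proof (cases N)
      case (Suc k)
      have "?q = deriv ((deriv ^^ k) (B \<phi>))" using lsi_map_iter[OF B \<phi>, of N] Suc by simp
      then have "integral {0..1} ?q = 0" using integral_deriv_XT[OF ST.iter_mem[OF lsi_mapD(1)[OF B \<phi>]]] by simp
      then show ?thesis using regular_T_apply_YT[OF YT_const q, of a] by simp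
    qed (use a0 regular_T_apply_YT[OF YT_const q, of a] in simp)
    moreover have "?u ?q = (-1) ^ N * ?r \<phi>" using q v(3)[OF \<phi>] Binv_B[OF ST.iter_mem[OF \<phi>], of N] by simp
    ultimately show "L ?f \<phi> = ?r \<phi>" using L_apply[OF f \<phi>] q by (simp flip: mult.assoc power_mult_distrib)
  qed simp
  have "mean ?f = m"
    using XT_const[of 1] regular_T_apply_YT[OF YT_const XT_const, of a 1] by (simp add: mean_def a_def)
  moreover have "?f \<in> native_T L" unfolding native_T_def using f Lf MT.restrict_measures_in[OF \<nu>] by simp
  moreover have "meas_T (L ?f) = \<nu>" unfolding Lf by (rule MT.measure_of_gfun_restrict[OF \<nu>])
  ultimately show ?thesis by (intro bexI[of _ ?f]) blast+
qed

text \<open>The reflected Green's function is the continuous function that represents the sampling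
  functional at \<open>0\<close>; shift invariance then gives all the others.\<close>

lemma value_T_eq:
  assumes w: "periodic_greens_function N L w" and g: "periodic1 g" "continuous_on UNIV g" "w = regular_T g"
    and f: "f \<in> native_T L"
  shows "value_T N L f t = meas_T (L f) (\<lambda>x. g (t - x)) + (if N = 0 then 0 else 1) * mean f"
proof -
  let ?\<alpha> = "if N = 0 then 0 else 1 :: real"
  let ?h = "\<lambda>x. g (t - x)"
  have h: "?h \<in> YT"
  proof -
    have "g (t - (x + 1)) = g (t - x)" for x using periodic1_int[OF g(1), of "t - x" "-1"] by (simp add: algebra_simps)
    moreover have "continuous_on UNIV ?h" by (intro continuous_on_compose2[OF g(2)] continuous_intros) auto
    ultimately show ?thesis by (simp add: periodic1_def)
  qed
  have gY: "g \<in> YT" using g by simp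
  have "dirac ST t = meas_elem_T L ?h ?\<alpha>"
  proof (rule ST.dual_eqI)
    fix \<phi> assume \<phi>: "\<phi> \<in> XT"
    have sm: "smooth \<phi>" using \<phi> by simp
    \<comment> \<open>This is \<open>x \<mapsto> \<phi> (t - x)\<close>. Evaluating
      \<open>L w\<close> on it gives \<open>\<phi> t\<close>, less the mean of \<open>\<phi>\<close>
      if \<open>N > 0\<close>; the transpose of \<open>L\<close> expresses the same number as an
      integral against \<open>g\<close>.\<close>
    let ?\<psi> = "reflect (\<lambda>x. \<phi> (x + t))"
    have s: "(\<lambda>x. \<phi> (x + t)) \<in> XT" by (rule ST.shift_mem[OF \<phi>])
    have \<psi>: "?\<psi> \<in> XT" by (rule ST.reflect_in[OF s])
    let ?q = "(-1) ^ N * w (B ((deriv ^^ N) ?\<psi>))"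
    have wd: "w \<in> dual ST" using w by (simp add: periodic_greens_function_def)
    have "L w ?\<psi> = ?q" by (rule L_apply[OF wd \<psi>])
    moreover have "L w ?\<psi> = \<phi> t - ?\<alpha> * integral {0..1} ?\<psi>"
      using w \<psi> regular_T_apply_YT[OF YT_const \<psi>, of 1] by (auto simp: periodic_greens_function_def reflect_eq)
    moreover have "integral {0..1} ?\<psi> = integral {0..1} \<phi>"
      using periodic1_reflect_integral[of \<phi> t] \<phi> smooth_continuous[OF sm] by (simp add: reflect_eq add.commute)
    ultimately have val: "\<phi> t = ?q + ?\<alpha> * integral {0..1} \<phi>" by simp
    let ?b = "B' ((deriv ^^ N) \<phi>)"
    have b: "?b \<in> XT" by (intro lsi_mapD(1)[OF B'] ST.iter_mem \<phi>)
    \<comment> \<open>Reflecting the argument of \<open>D^N\<close> produces a second sign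
      \<open>(-1) ^ N\<close>, which cancels the first and turns \<open>B\<close> into
      \<open>B'\<close>.\<close>
    have eqB: "(-1) ^ N * B ((deriv ^^ N) ?\<psi>) x = ?b (t - x)" for x
    proof -
      have m: "reflect ((deriv ^^ N) (\<lambda>x. \<phi> (x + t))) \<in> XT" by (intro ST.reflect_in ST.iter_mem s)
      have "B ((deriv ^^ N) ?\<psi>) = (\<lambda>y. (-1) ^ N * B (reflect ((deriv ^^ N) (\<lambda>x. \<phi> (x + t)))) y)"
        unfolding ST.deriv_iter_reflect_in[OF s] by (rule lsi_mapD(3)[OF B m])
      then have "(-1) ^ N * B ((deriv ^^ N) ?\<psi>) x = B' ((deriv ^^ N) (\<lambda>x. \<phi> (x + t))) (- x)"
        by (simp add: B'_def reflect_def flip: mult.assoc power_mult_distrib)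
      also have "B' ((deriv ^^ N) (\<lambda>x. \<phi> (x + t))) = (\<lambda>x. ?b (x + t))"
        unfolding deriv_iter_shift[OF sm] by (rule lsi_mapD(4)[OF B' ST.iter_mem[OF \<phi>]])
      finally show ?thesis by simp
    qed
    have q: "B ((deriv ^^ N) ?\<psi>) \<in> XT" by (intro lsi_mapD(1)[OF B] ST.iter_mem \<psi>)
    have "?q = integral {0..1} (\<lambda>x. (-1) ^ N * (g x * B ((deriv ^^ N) ?\<psi>) x))"
      using regular_T_apply_YT[OF gY q] g(3) by simp
    also have "(\<lambda>x. (-1) ^ N * (g x * B ((deriv ^^ N) ?\<psi>) x)) = (\<lambda>x. g x * ?b (t - x))"
      using eqB by (simp add: fun_eq_iff mult.left_commute)
    also have "integral {0..1} (\<lambda>x. g x * ?b (t - x)) = integral {0..1} (\<lambda>x. ?h x * ?b x)"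
    proof -
      have p: "periodic1 (\<lambda>x. ?h x * ?b x)" using h b by (simp add: periodic1_def)
      have c: "continuous_on UNIV (\<lambda>x. ?h x * ?b x)" using YT_continuous[OF h] YT_continuous[OF XT_in_YT[OF b]] by (intro continuous_on_mult)
      show ?thesis using periodic1_reflect_integral[OF p c, of t] by simp
    qed
    finally show "dirac ST t \<phi> = meas_elem_T L ?h ?\<alpha> \<phi>" using val meas_elem_T_apply[OF h \<phi>, of ?\<alpha>] \<phi> by simp
  qed (simp_all add: dirac_def meas_elem_T_def)
  then show ?thesis unfolding value_T_def using pairing_T_eq[OF h _ f, of ?\<alpha>] by simp
qed

end

subsection \<open>Uniform convergence along a filter\<close>

text \<open>The filter is arbitrary, as the same estimates are applied to weak* convergent sequences
  and to cluster filters.\<close>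

definition unif_lim :: "'i filter \<Rightarrow> ('i \<Rightarrow> real \<Rightarrow> real) \<Rightarrow> (real \<Rightarrow> real) \<Rightarrow> real set \<Rightarrow> bool" where
  "unif_lim G F f S \<longleftrightarrow> (\<forall>e>0. \<forall>\<^sub>F i in G. \<forall>t\<in>S. \<bar>F i t - f t\<bar> \<le> e)"

lemma unif_limD: "unif_lim G F f S \<Longrightarrow> e > 0 \<Longrightarrow> \<forall>\<^sub>F i in G. \<forall>t\<in>S. \<bar>F i t - f t\<bar> \<le> e"
  by (simp add: unif_lim_def)

lemma unif_lim_add:
  assumes "unif_lim G F f S" "unif_lim G H h S"
  shows "unif_lim G (\<lambda>i t. F i t + H i t) (\<lambda>t. f t + h t) S"
  unfolding unif_lim_def
proof (intro allI impI)
  fix e :: real assume "e > 0"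
  then have "\<forall>\<^sub>F i in G. \<forall>t\<in>S. \<bar>F i t - f t\<bar> \<le> e / 2" "\<forall>\<^sub>F i in G. \<forall>t\<in>S. \<bar>H i t - h t\<bar> \<le> e / 2"
    by (intro unif_limD[OF assms(1)] unif_limD[OF assms(2)]; simp)+
  then show "\<forall>\<^sub>F i in G. \<forall>t\<in>S. \<bar>F i t + H i t - (f t + h t)\<bar> \<le> e"
  proof eventually_elim
    case (elim i)
    show ?case
    proof
      fix t assume "t \<in> S"
      then show "\<bar>F i t + H i t - (f t + h t)\<bar> \<le> e" 
        unfolding add_diff_add using bspec[OF elim(1), of t] bspec[OF elim(2), of t] abs_triangle_ineq[of "F i t - f t" "H i t - h t"]
        by linarith
    qed
  qed
qed

lemma (in sup_space) unif_lim_translates: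
  assumes \<mu>: "\<And>i. \<mu> i \<in> dual C" and \<mu>0: "\<mu>0 \<in> dual C" and K: "\<And>i. dual_norm C (\<mu> i) \<le> K"
    and lim: "\<And>h. h \<in> Y \<Longrightarrow> ((\<lambda>i. \<mu> i h) \<longlongrightarrow> \<mu>0 h) G" and h: "h \<in> Y"
  shows "unif_lim G (\<lambda>i t. \<mu> i (\<lambda>x. h (x - t))) (\<lambda>t. \<mu>0 (\<lambda>x. h (x - t))) {a..b}"
  unfolding unif_lim_def
proof (intro allI impI)
  fix e :: real assume e: "e > 0"
  \<comment> \<open>A positive bound for the norms of all \<open>\<mu> i\<close> and of
    \<open>\<mu>0\<close>, so that one modulus of continuity serves both ends of the three-term
    estimate on a finite net.\<close>
  define Q where "Q = \<bar>K\<bar> + dual_norm C \<mu>0 + 1"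
  have Q: "Q > 0" "dual_norm C \<mu>0 \<le> Q" "K \<le> Q" using dual_norm_nonneg[OF \<mu>0] by (auto simp: Q_def)
  have e': "e / (3 * Q) > 0" using e Q by simp
  obtain d where d: "d > 0" "\<And>x x'. \<bar>x' - x\<bar> < d \<Longrightarrow> \<bar>h x' - h x\<bar> < e / (3 * Q)"
    using uniformly_continuous_mem[OF h, unfolded uniformly_continuous_on_def, rule_format, OF e'] by (auto simp: dist_real_def)
  obtain k where k: "finite k" "{a..b} \<subseteq> (\<Union>x\<in>k. ball x d)"
    using compact_Icc[of a b] d(1) unfolding compact_eq_totally_bounded by blast
  have mem: "(\<lambda>x. h (x - t)) \<in> Y" for t by (rule shift_mem[OF h])
  have near: "\<bar>v (\<lambda>x. h (x - t)) - v (\<lambda>x. h (x - s))\<bar> \<le> e / 3"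
    if v: "v \<in> dual C" "dual_norm C v \<le> Q" and ts: "\<bar>t - s\<bar> < d" for v s t
  proof -
    have "\<bar>h (x - t) - h (x - s)\<bar> \<le> e / (3 * Q)" for x using d(2)[of "x - t" "x - s"] ts by (simp add: abs_minus_commute less_imp_le)
    from dual_norm_upper[OF v(1) diff_mem[OF mem mem] this]
    have "\<bar>v (\<lambda>x. h (x - t)) - v (\<lambda>x. h (x - s))\<bar> \<le> dual_norm C v * (e / (3 * Q))" unfolding dual_diff[OF v(1) mem mem] .
    also have "\<dots> \<le> Q * (e / (3 * Q))" using v(2) e' by (intro mult_right_mono) auto
    finally show ?thesis using Q(1) by simp
  qed
  have "\<forall>\<^sub>F i in G. \<forall>s\<in>k. \<bar>\<mu> i (\<lambda>x. h (x - s)) - \<mu>0 (\<lambda>x. h (x - s))\<bar> \<le> e / 3"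
  proof (rule eventually_ball_finite[OF k(1)], rule ballI)
    fix s assume "s \<in> k"
    have "\<forall>\<^sub>F i in G. dist (\<mu> i (\<lambda>x. h (x - s))) (\<mu>0 (\<lambda>x. h (x - s))) < e / 3"
      using lim[OF mem] e by (intro tendstoD) auto
    then show "\<forall>\<^sub>F i in G. \<bar>\<mu> i (\<lambda>x. h (x - s)) - \<mu>0 (\<lambda>x. h (x - s))\<bar> \<le> e / 3"
      by (rule eventually_mono) (simp add: dist_real_def)
  qed
  then show "\<forall>\<^sub>F i in G. \<forall>t\<in>{a..b}. \<bar>\<mu> i (\<lambda>x. h (x - t)) - \<mu>0 (\<lambda>x. h (x - t))\<bar> \<le> e"
  proof (eventually_elim, intro ballI)
    fix i t assume ev: "\<forall>s\<in>k. \<bar>\<mu> i (\<lambda>x. h (x - s)) - \<mu>0 (\<lambda>x. h (x - s))\<bar> \<le> e / 3" and t: "t \<in> {a..b}"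
    obtain s where s: "s \<in> k" "\<bar>t - s\<bar> < d" using k(2) t by (auto simp: dist_real_def abs_minus_commute)
    show "\<bar>\<mu> i (\<lambda>x. h (x - t)) - \<mu>0 (\<lambda>x. h (x - t))\<bar> \<le> e"
      using bspec[OF ev s(1)] near[OF \<mu>[of i] order_trans[OF K Q(3)] s(2)] near[OF \<mu>0 Q(2) s(2)]
      unfolding abs_le_iff by linarith
  qed
qed

context trend_op
begin

lemma native_R_dual: "f \<in> native_R L \<Longrightarrow> f \<in> dual SR" "f \<in> native_R L \<Longrightarrow> meas_R (L f) \<in> dual C0R"
  by (auto simp: native_R_def intro: MR.measure_of_gfun_mem)

context
  fixes G :: "'i filter" and fs :: "'i \<Rightarrow> gfun" and f :: gfun and K :: real
  assumes fs: "\<And>i. fs i \<in> native_R L" and f: "f \<in> native_R L"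
    and K: "\<And>i. norm_MR (L (fs i)) \<le> K"
    and lim\<mu>: "\<And>h. h \<in> Y0 \<Longrightarrow> ((\<lambda>i. meas_R (L (fs i)) h) \<longlongrightarrow> meas_R (L f) h) G"
    and lim\<theta>: "\<And>n. n \<in> {1..N} \<Longrightarrow> ((\<lambda>i. fs i (\<theta> n)) \<longlongrightarrow> f (\<theta> n)) G"
begin

text \<open>The decomposition of a test function expresses its pairing by one value of the measure
  and the values at the \<open>\<theta> n\<close>.\<close>

lemma test_convergence:
  assumes \<phi>: "\<phi> \<in> schwartz" shows "((\<lambda>i. fs i \<phi>) \<longlongrightarrow> f \<phi>) G"
proof -
  obtain \<zeta> where \<zeta>: "\<zeta> \<in> schwartz"
      "\<phi> = (\<lambda>t. (-1) ^ N * B ((deriv ^^ N) \<zeta>) t + (\<Sum>n=1..N. moment (n - 1) \<phi> * \<theta> n t))"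
    using schwartz_decomposition[OF \<phi>] by blast
  have rep: "u \<phi> = meas_R (L u) \<zeta> + (\<Sum>n=1..N. moment (n - 1) \<phi> * u (\<theta> n))" if "u \<in> native_R L" for u
    using dual_decomposition[OF that \<zeta>(1), of "\<lambda>n. moment (n - 1) \<phi>"] \<zeta>(2) by simp
  show ?thesis
    unfolding rep[OF fs] rep[OF f] by (intro tendsto_add lim\<mu> schwartz_in_Y0 \<zeta>(1) tendsto_sum tendsto_mult_left lim\<theta>)
qed

lemma unif_lim_translates_R:
  "h \<in> Y0 \<Longrightarrow> unif_lim G (\<lambda>i t. meas_R (L (fs i)) (\<lambda>x. h (x - t))) (\<lambda>t. meas_R (L f) (\<lambda>x. h (x - t))) {a..b}"
  by (rule C0R.unif_lim_translates[where K = K]) (use fs f K lim\<mu> in \<open>auto simp: norm_MR_def native_R_dual\<close>)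

text \<open>Uniform convergence of the derivatives in \<open>t\<close> together with convergence at
  the single point 0 gives uniform convergence, by the mean value inequality on an interval around
  0.\<close>

lemma unif_lim_antiderivative:
  assumes \<psi>: "\<psi> \<in> schwartz" and D: "unif_lim G (\<lambda>i t. fs i (\<lambda>x. deriv \<psi> (x - t))) (\<lambda>t. f (\<lambda>x. deriv \<psi> (x - t))) {- r..r}"
  shows "unif_lim G (\<lambda>i t. fs i (\<lambda>x. \<psi> (x - t))) (\<lambda>t. f (\<lambda>x. \<psi> (x - t))) {- r..r}"
  unfolding unif_lim_def
proof (intro allI impI)
  fix e :: real assume e: "e > 0"
  define d where "d = e / (2 * (\<bar>r\<bar> + 1))"
  have d: "d > 0" using e by (simp add: d_def)
  have der: "((\<lambda>t. u (\<lambda>x. \<psi> (x - t))) has_real_derivative - u (\<lambda>x. deriv \<psi> (x - t))) (at t within S)"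
    if "u \<in> native_R L" for u t S
  proof -
    have "((\<lambda>t. u (\<lambda>x. \<psi> (x + t))) has_real_derivative u (\<lambda>x. deriv \<psi> (x + - t))) (at (- t))"
      by (rule SR.dual_shift_has_derivative[OF native_R_dual(1)[OF that] \<psi>])
    from DERIV_mirror[THEN iffD1, OF this]
    have "((\<lambda>t. u (\<lambda>x. \<psi> (x - t))) has_real_derivative - u (\<lambda>x. deriv \<psi> (x - t))) (at t)"
      by (simp only: add_uminus_conv_diff)
    then show ?thesis by (rule has_field_derivative_at_within)
  qed
  have "\<forall>\<^sub>F i in G. dist (fs i \<psi>) (f \<psi>) < e / 2" using test_convergence[OF \<psi>] e by (intro tendstoD) auto
  with unif_limD[OF D d]
  show "\<forall>\<^sub>F i in G. \<forall>t\<in>{- r..r}. \<bar>fs i (\<lambda>x. \<psi> (x - t)) - f (\<lambda>x. \<psi> (x - t))\<bar> \<le> e"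
  proof (eventually_elim, intro ballI)
    fix i t assume ev: "\<forall>t\<in>{- r..r}. \<bar>fs i (\<lambda>x. deriv \<psi> (x - t)) - f (\<lambda>x. deriv \<psi> (x - t))\<bar> \<le> d"
      and e2: "dist (fs i \<psi>) (f \<psi>) < e / 2" and t: "t \<in> {- r..r}"
    let ?g = "\<lambda>t. fs i (\<lambda>x. \<psi> (x - t)) - f (\<lambda>x. \<psi> (x - t))"
    have "norm (?g t - ?g 0) \<le> d * norm (t - 0)"
    proof (rule field_differentiable_bound[where S = "{- r..r}"])
      fix z assume z: "z \<in> {- r..r}"
      show "(?g has_real_derivative - fs i (\<lambda>x. deriv \<psi> (x - z)) - (- f (\<lambda>x. deriv \<psi> (x - z)))) (at z within {- r..r})"
        by (intro DERIV_diff der fs f)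
      show "norm (- fs i (\<lambda>x. deriv \<psi> (x - z)) - (- f (\<lambda>x. deriv \<psi> (x - z)))) \<le> d"
        using bspec[OF ev z] by (simp add: abs_minus_commute)
    qed (use t in auto)
    also have "\<dots> \<le> d * \<bar>r\<bar>" using t d by (intro mult_left_mono) auto
    also have "\<dots> \<le> d * (\<bar>r\<bar> + 1)" using d by (intro mult_left_mono) auto
    also have "\<dots> = e / 2" by (simp add: d_def field_simps)
    finally have "\<bar>?g t - ?g 0\<bar> \<le> e / 2" by simp
    moreover have "\<bar>?g 0\<bar> < e / 2" using e2 by (simp add: dist_real_def)
    ultimately show "\<bar>?g t\<bar> \<le> e" by linarith
  qed
qed

text \<open>An \<open>N\<close>-th derivative has no \<open>\<theta>\<close> component: its pairing
  is a value of the measure on a translate, which is already under control. The antiderivative lemma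
  then descends from order \<open>N\<close> to order 0.\<close>

lemma unif_lim_test:
  assumes \<phi>: "\<phi> \<in> schwartz"
  shows "unif_lim G (\<lambda>i t. fs i (\<lambda>x. \<phi> (x - t))) (\<lambda>t. f (\<lambda>x. \<phi> (x - t))) {- r..r}" (is "?U \<phi>")
proof -
  have base: "?U ((deriv ^^ N) \<phi>)" if \<phi>: "\<phi> \<in> schwartz" for \<phi>
  proof -
    let ?\<zeta> = "\<lambda>t. (-1) ^ N * Binv \<phi> t"
    have z: "Binv \<phi> \<in> schwartz" by (rule lsi_mapD(1)[OF Binv \<phi>])
    have \<zeta>: "?\<zeta> \<in> schwartz" by (rule SR.scale_mem[OF z])
    have A: "(-1) ^ N * B ((deriv ^^ N) ?\<zeta>) x = (deriv ^^ N) \<phi> x" for x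
    proof -
      have "B ((deriv ^^ N) ?\<zeta>) = (\<lambda>t. (-1) ^ N * B ((deriv ^^ N) (Binv \<phi>)) t)"
        unfolding deriv_iter_scale[OF schwartz_smooth[OF z]] by (rule lsi_mapD(3)[OF B SR.iter_mem[OF z]])
      then show ?thesis using lsi_map_iter[OF B z, of N] B_Binv[OF \<phi>] by (simp flip: mult.assoc power_mult_distrib)
    qed
    have "u (\<lambda>x. (deriv ^^ N) \<phi> (x - t)) = meas_R (L u) (\<lambda>x. ?\<zeta> (x - t))" if u: "u \<in> native_R L" for u t
    proof -
      have s: "(\<lambda>x. ?\<zeta> (x - t)) \<in> schwartz" by (rule SR.shift_mem'[OF \<zeta>])
      have "B ((deriv ^^ N) (\<lambda>x. ?\<zeta> (x - t))) = (\<lambda>x. B ((deriv ^^ N) ?\<zeta>) (x - t))"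
        using deriv_iter_shift[OF schwartz_smooth[OF \<zeta>], of N "- t"] lsi_mapD(4)[OF B SR.iter_mem[OF \<zeta>], of N "- t"] by simp
      then have "(\<lambda>x. (-1) ^ N * B ((deriv ^^ N) (\<lambda>x. ?\<zeta> (x - t))) x) = (\<lambda>x. (deriv ^^ N) \<phi> (x - t))" using A by simp
      then show ?thesis using dual_decomposition[OF u s, of "\<lambda>_. 0"] by simp
    qed
    then show ?thesis using unif_lim_translates_R[OF schwartz_in_Y0[OF \<zeta>]] fs f by simp
  qed
  have "(\<And>\<phi>. \<phi> \<in> schwartz \<Longrightarrow> ?U ((deriv ^^ k) \<phi>)) \<Longrightarrow> \<phi> \<in> schwartz \<Longrightarrow> ?U \<phi>" for k \<phi>
  proof (induction k arbitrary: \<phi>)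
    case (Suc k)
    show ?case
    proof (rule Suc.IH[OF _ Suc.prems(2)])
      fix \<phi> assume \<phi>: "\<phi> \<in> schwartz"
      have "?U (deriv ((deriv ^^ k) \<phi>))" using Suc.prems(1)[OF \<phi>] by simp
      then show "?U ((deriv ^^ k) \<phi>)" by (rule unif_lim_antiderivative[OF SR.iter_mem[OF \<phi>]])
    qed
  qed simp
  from this[OF base \<phi>] show ?thesis .
qed

lemma unif_lim_value_R:
  assumes d: "dirac SR 0 \<in> predual_R N \<theta> L"
  shows "unif_lim G (\<lambda>i. value_R N \<theta> L (fs i)) (value_R N \<theta> L f) {- r..r}"
proof -
  obtain h0 c0 where h0: "h0 \<in> Y0" "dirac SR 0 = meas_elem_R N \<theta> L h0 c0"
    using d unfolding predual_R_def topspace_C0R by blast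
  have "value_R N \<theta> L u = (\<lambda>t. meas_R (L u) (\<lambda>x. h0 (x - t)) + u (\<lambda>x. \<Sum>n=1..N. c0 n * \<theta> n (x - t)))" if "u \<in> native_R L" for u
    using value_R_eq[OF h0 that] by (simp add: fun_eq_iff)
  then show ?thesis
    using unif_lim_add[OF unif_lim_translates_R[OF h0(1)] unif_lim_test[OF \<theta>_sum_mem[of c0]]] fs f by simp
qed

end

end

context seasonal_op
begin

lemma unif_lim_value_T:
  fixes G :: "'i filter" and fs :: "'i \<Rightarrow> gfun"
  assumes fs: "\<And>i. fs i \<in> native_T L" and f: "f \<in> native_T L"
    and K: "\<And>i. norm_MT (L (fs i)) \<le> K"
    and lim\<nu>: "\<And>h. h \<in> YT \<Longrightarrow> ((\<lambda>i. meas_T (L (fs i)) h) \<longlongrightarrow> meas_T (L f) h) G"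
    and limm: "N > 0 \<Longrightarrow> ((\<lambda>i. mean (fs i)) \<longlongrightarrow> mean f) G"
    and w: "periodic_greens_function N L w" "lipschitz_periodic_gfun w"
  shows "unif_lim G (\<lambda>i. value_T N L (fs i)) (value_T N L f) UNIV"
proof -
  obtain g C where g: "periodic1 g" "C-lipschitz_on UNIV g" "w = regular_T g"
    using w(2) unfolding lipschitz_periodic_gfun_def by blast
  have gc: "continuous_on UNIV g" using g(2) by (rule lipschitz_on_continuous_on)
  let ?\<alpha> = "if N = 0 then 0 else 1 :: real"
  let ?h = "\<lambda>x. g (- x)"
  have val: "value_T N L u t = meas_T (L u) (\<lambda>x. ?h (x - t)) + ?\<alpha> * mean u" if "u \<in> native_T L" for u t
    using value_T_eq[OF w(1) g(1) gc g(3) that, of t] by simp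
  have h: "?h \<in> YT"
  proof -
    have "g (- (x + 1)) = g (- x)" for x using periodic1_int[OF g(1), of "- x" "-1"] by simp
    moreover have "continuous_on UNIV ?h" by (intro continuous_on_compose2[OF gc] continuous_intros) auto
    ultimately show ?thesis by (simp add: periodic1_def)
  qed
  \<comment> \<open>Periodicity reduces the supremum over the line to the compact interval
    \<open>{0..1}\<close>.\<close>
  have red: "value_T N L u t = value_T N L u (frac t)" if "u \<in> native_T L" for u t
  proof -
    have "?h (x - t) = ?h (x - frac t)" for x
      using periodic1_int[OF g(1), of "frac t - x" "\<lfloor>t\<rfloor>"] by (simp add: frac_def)
    then show ?thesis unfolding val[OF that] by presburger
  qed
  have U1: "unif_lim G (\<lambda>i t. meas_T (L (fs i)) (\<lambda>x. ?h (x - t))) (\<lambda>t. meas_T (L f) (\<lambda>x. ?h (x - t))) {0..1}"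
    by (rule CT.unif_lim_translates[where K = K and h = ?h]) (use fs f K lim\<nu> h in \<open>auto simp: norm_MT_def native_T_dual\<close>)
  have "((\<lambda>i. ?\<alpha> * mean (fs i)) \<longlongrightarrow> ?\<alpha> * mean f) G" using limm by (auto intro: tendsto_mult_left)
  then have U2: "unif_lim G (\<lambda>i t. ?\<alpha> * mean (fs i)) (\<lambda>t. ?\<alpha> * mean f) {0..1}"
    unfolding unif_lim_def by (auto dest!: tendstoD simp: dist_real_def elim!: eventually_mono)
  have U: "unif_lim G (\<lambda>i. value_T N L (fs i)) (value_T N L f) {0..1}"
    using unif_lim_add[OF U1 U2] val fs f by (simp add: unif_lim_def)
  show ?thesis
    unfolding unif_lim_def
  proof (intro allI impI)
    fix e :: real assume "e > 0"
    from unif_limD[OF U this] show "\<forall>\<^sub>F i in G. \<forall>t\<in>UNIV. \<bar>value_T N L (fs i) t - value_T N L f t\<bar> \<le> e"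
    proof (eventually_elim, intro ballI)
      fix i t assume "\<forall>t\<in>{0..1}. \<bar>value_T N L (fs i) t - value_T N L f t\<bar> \<le> e"
      from bspec[OF this periodic1_frac_mem[of t]] show "\<bar>value_T N L (fs i) t - value_T N L f t\<bar> \<le> e"
        using red[OF fs, of i t] red[OF f, of t] by simp
    qed
  qed
qed

end

subsection \<open>Cluster points and coercivity\<close>

text \<open>Tychonoff's theorem in place of a diagonal sequence: the index set may be uncountable,
  so the result is a finer filter.\<close>

lemma pointwise_bounded_cluster:
  fixes u :: "'n \<Rightarrow> 'i \<Rightarrow> real"
  assumes F: "F \<noteq> bot" and bd: "\<And>i. \<exists>B. \<forall>n. \<bar>u n i\<bar> \<le> B"
  shows "\<exists>G\<le>F. G \<noteq> bot \<and> (\<forall>i. \<exists>l. ((\<lambda>n. u n i) \<longlongrightarrow> l) G)"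
proof -
  obtain b where b: "\<And>n i. \<bar>u n i\<bar> \<le> b i" using bd by metis
  let ?K = "Pi\<^sub>E UNIV (\<lambda>i. {- b i..b i})"
  have "compactin (product_topology (\<lambda>_. euclidean) UNIV) ?K" by (subst compactin_PiE) auto
  then have K: "compact ?K" by (simp add: euclidean_product_topology)
  have "\<forall>\<^sub>F x in filtermap u F. x \<in> ?K"
    unfolding eventually_filtermap using b by (intro always_eventually) (auto simp: abs_le_iff minus_le_iff)
  moreover have "filtermap u F \<noteq> bot" using F by (simp add: filtermap_bot_iff)
  ultimately obtain x where x: "inf (nhds x) (filtermap u F) \<noteq> bot" using K unfolding compact_filter by blast
  \<comment> \<open>The indices are restricted to those whose points lie near the cluster point
    \<open>x\<close>; it is nontrivial exactly because \<open>x\<close> is a cluster point.\<close>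
  let ?G = "inf F (filtercomap u (nhds x))"
  have "?G \<noteq> bot"
  proof
    assume "?G = bot"
    then have "eventually (\<lambda>_. False) ?G" by simp
    then obtain P Q where PQ: "eventually P F" "eventually Q (filtercomap u (nhds x))" "\<And>n. P n \<Longrightarrow> Q n \<Longrightarrow> False"
      unfolding eventually_inf by blast
    obtain R where R: "eventually R (nhds x)" "\<And>n. R (u n) \<Longrightarrow> Q n" using PQ(2) unfolding eventually_filtercomap by blast
    have "eventually (\<lambda>y. \<not> R y) (filtermap u F)"
      unfolding eventually_filtermap using PQ(1) by (rule eventually_mono) (use PQ(3) R(2) in blast)
    with R(1) have "eventually (\<lambda>_. False) (inf (nhds x) (filtermap u F))" unfolding eventually_inf by blast
    then show False using x by (simp add: trivial_limit_def)
  qed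
  moreover have "((\<lambda>n. u n i) \<longlongrightarrow> x i) ?G" for i
  proof -
    have "(u \<longlongrightarrow> x) ?G" by (rule filterlim_mono[OF filterlim_filtercomap order_refl]) simp
    show ?thesis
    proof (rule topological_tendstoI)
      fix S :: "real set" assume S: "open S" "x i \<in> S"
      have "open ((\<lambda>y :: 'i \<Rightarrow> real. y i) -` S)"
        by (rule open_vimage[OF S(1)]) (rule continuous_on_product_coordinates)
      from topological_tendstoD[OF \<open>(u \<longlongrightarrow> x) ?G\<close> this] S(2) show "\<forall>\<^sub>F n in ?G. u n i \<in> S" by simp
    qed
  qed
  ultimately show ?thesis by (intro exI[of _ ?G]) auto
qed

text \<open>The filter form of the principle of subsequences: if \<open>P\<close> failed frequently,
  the filter restricted to the failures would be nontrivial, and no refinement of it could satisfy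
  \<open>P\<close>.\<close>

lemma eventually_subfilterI:
  assumes "\<And>F. F \<le> H \<Longrightarrow> F \<noteq> bot \<Longrightarrow> \<exists>G\<le>F. G \<noteq> bot \<and> eventually P G"
  shows "eventually P H"
proof (rule ccontr)
  assume np: "\<not> eventually P H"
  let ?F = "inf H (principal {n. \<not> P n})"
  have "?F \<noteq> bot"
  proof
    assume "?F = bot"
    then have "eventually (\<lambda>_. False) ?F" by simp
    then show False using np by (simp add: eventually_inf_principal)
  qed
  then obtain G where G: "G \<le> ?F" "G \<noteq> bot" "eventually P G" using assms[of ?F] by auto
  have "eventually (\<lambda>n. \<not> P n) ?F" by (simp add: eventually_inf_principal)
  then have "eventually (\<lambda>n. \<not> P n) G" using G(1) by (rule filter_leD[rotated])
  with G(3) have "eventually (\<lambda>_. False) G" by eventually_elim simp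
  then show False using G(2) by (simp add: trivial_limit_def)
qed

lemma injective_coefficients_bound:
  fixes c :: "'l \<Rightarrow> 'k \<Rightarrow> real"
  assumes "finite K" and "\<And>z. (\<And>l. (\<Sum>j\<in>K. c l j * z j) = 0) \<Longrightarrow> \<forall>j\<in>K. z j = 0"
  shows "\<exists>Q. \<forall>z. (\<forall>l. \<bar>\<Sum>j\<in>K. c l j * z j\<bar> \<le> R l) \<longrightarrow> (\<forall>j\<in>K. \<bar>z j\<bar> \<le> Q)"
  using assms
proof (induction K arbitrary: c R rule: finite_induct)
  case (insert k K)
  have "\<exists>l0. c l0 k \<noteq> 0"
  proof (rule ccontr)
    assume "\<nexists>l0. c l0 k \<noteq> 0"
    then have "(\<Sum>j\<in>insert k K. c l j * (if j = k then 1 else 0)) = 0" for l by (intro sum.neutral) auto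
    from insert.prems[OF this] show False by simp
  qed
  then obtain l0 where l0: "c l0 k \<noteq> 0" by blast
  define q where "q l = c l k / c l0 k" for l
  \<comment> \<open>Row \<open>l\<close> after elimination of the unknown \<open>k\<close> with the
    pivot row \<open>l0\<close>.\<close>
  define c' where "c' l j = c l j - q l * c l0 j" for l j
  have sum': "(\<Sum>j\<in>K. c' l j * z j) = (\<Sum>j\<in>insert k K. c l j * z j) - q l * (\<Sum>j\<in>insert k K. c l0 j * z j)" for l z
  proof -
    have "(\<Sum>j\<in>K. c' l j * z j) = (\<Sum>j\<in>K. c l j * z j) - q l * (\<Sum>j\<in>K. c l0 j * z j)"
      by (simp add: c'_def left_diff_distrib sum_subtractf sum_distrib_left mult.assoc)
    moreover have "q l * (c l0 k * z k) = c l k * z k" using l0 by (simp add: q_def)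
    moreover have "(\<Sum>j\<in>insert k K. c l j * z j) = c l k * z k + (\<Sum>j\<in>K. c l j * z j)"
      "(\<Sum>j\<in>insert k K. c l0 j * z j) = c l0 k * z k + (\<Sum>j\<in>K. c l0 j * z j)"
      using insert.hyps by simp_all
    ultimately show ?thesis by (simp only: distrib_left)
  qed
  have inj: "\<forall>j\<in>K. z j = 0" if z: "\<And>l. (\<Sum>j\<in>K. c' l j * z j) = 0" for z
  proof -
    \<comment> \<open>Back substitution: the eliminated unknown is chosen so that the pivot row is
      satisfied, which lifts a solution of the reduced system to the full one.\<close>
    define z' where "z' j = (if j = k then - (\<Sum>j\<in>K. c l0 j * z j) / c l0 k else z j)" for j
    have zK: "(\<Sum>j\<in>K. b j * z' j) = (\<Sum>j\<in>K. b j * z j)" for b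
      using insert.hyps(2) by (intro sum.cong) (auto simp: z'_def)
    have "(\<Sum>j\<in>insert k K. c l0 j * z' j) = 0" using insert.hyps l0 by (simp add: zK) (simp add: z'_def)
    then have "(\<Sum>j\<in>insert k K. c l j * z' j) = 0" for l using sum'[of l z'] z[of l] zK by simp
    from insert.prems[OF this] show ?thesis using insert.hyps(2) by (auto simp: z'_def split: if_splits)
  qed
  obtain Q where Q: "\<And>z. \<forall>l. \<bar>\<Sum>j\<in>K. c' l j * z j\<bar> \<le> R l + \<bar>q l\<bar> * R l0 \<Longrightarrow> \<forall>j\<in>K. \<bar>z j\<bar> \<le> Q"
    using insert.IH[of c' "\<lambda>l. R l + \<bar>q l\<bar> * R l0", OF inj] by blast
  let ?Q = "(R l0 + (\<Sum>j\<in>K. \<bar>c l0 j\<bar> * Q)) / \<bar>c l0 k\<bar>"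
  have "\<forall>j\<in>insert k K. \<bar>z j\<bar> \<le> max Q ?Q" if z: "\<forall>l. \<bar>\<Sum>j\<in>insert k K. c l j * z j\<bar> \<le> R l" for z
  proof -
    have "\<bar>\<Sum>j\<in>K. c' l j * z j\<bar> \<le> R l + \<bar>q l\<bar> * R l0" for l
    proof -
      have "\<bar>q l * (\<Sum>j\<in>insert k K. c l0 j * z j)\<bar> \<le> \<bar>q l\<bar> * R l0"
        unfolding abs_mult using z by (intro mult_left_mono) auto
      then show ?thesis using z[rule_format, of l] unfolding sum' by linarith
    qed
    then have zK: "\<forall>j\<in>K. \<bar>z j\<bar> \<le> Q" using Q by blast
    have "\<bar>\<Sum>j\<in>K. c l0 j * z j\<bar> \<le> (\<Sum>j\<in>K. \<bar>c l0 j\<bar> * Q)"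
      using zK by (intro order_trans[OF sum_abs] sum_mono) (simp add: abs_mult mult_left_mono)
    moreover have "\<bar>c l0 k * z k + (\<Sum>j\<in>K. c l0 j * z j)\<bar> \<le> R l0"
      using z[rule_format, of l0] insert.hyps by simp
    ultimately have "\<bar>c l0 k\<bar> * \<bar>z k\<bar> \<le> R l0 + (\<Sum>j\<in>K. \<bar>c l0 j\<bar> * Q)"
      unfolding abs_mult[symmetric] by linarith
    then have "\<bar>z k\<bar> \<le> ?Q" using l0 by (simp add: pos_le_divide_eq mult.commute)
    then show ?thesis using zK by auto
  qed
  then show ?case by blast
qed simp

subsection \<open>Discretization by piecewise linear interpolation\<close>

definition interp :: "real \<Rightarrow> (int \<Rightarrow> real) \<Rightarrow> real \<Rightarrow> real" where
  "interp h a x = (1 - frac (x / h)) * a \<lfloor>x / h\<rfloor> + frac (x / h) * a (\<lfloor>x / h\<rfloor> + 1)"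

definition tent :: "real \<Rightarrow> real" where "tent x = max 0 (1 - \<bar>x\<bar>)"

lemma tent_int: "tent (y - of_int k) = (if k = \<lfloor>y\<rfloor> then 1 - frac y else if k = \<lfloor>y\<rfloor> + 1 then frac y else 0)"
proof -
  have y: "y = of_int \<lfloor>y\<rfloor> + frac y" by (simp add: frac_def)
  have f: "0 \<le> frac y" "frac y < 1" by (simp_all add: frac_lt_1)
  have yk: "y - of_int k = of_int (\<lfloor>y\<rfloor> - k) + frac y" by (simp add: frac_def)
  consider "k = \<lfloor>y\<rfloor>" | "k = \<lfloor>y\<rfloor> + 1" | "k < \<lfloor>y\<rfloor>" | "\<lfloor>y\<rfloor> + 1 < k" by linarith
  then show ?thesis
  proof cases
    case 3
    then have "1 \<le> (of_int (\<lfloor>y\<rfloor> - k) :: real)" by linarith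
    then have "1 - \<bar>of_int (\<lfloor>y\<rfloor> - k) + frac y\<bar> \<le> 0" using f by linarith
    then show ?thesis using 3 unfolding tent_def yk by (simp add: max_def)
  next
    case 4
    then have "(of_int (\<lfloor>y\<rfloor> - k) :: real) \<le> - 2" by linarith
    then have "1 - \<bar>of_int (\<lfloor>y\<rfloor> - k) + frac y\<bar> \<le> 0" using f by linarith
    then show ?thesis using 4 unfolding tent_def yk by (simp add: max_def)
  qed (unfold tent_def yk, use f in simp_all)
qed

text \<open>All tents but two vanish at \<open>x\<close>, so any finite set containing the two
  active nodes may be used. This shows continuity and exhibits the coefficients of the discretized
  measure.\<close>

lemma interp_eq_sum:
  assumes "finite I" "\<lfloor>x / h\<rfloor> \<in> I" "\<lfloor>x / h\<rfloor> + 1 \<in> I"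
  shows "interp h a x = (\<Sum>k\<in>I. a k * tent (x / h - of_int k))"
proof -
  have "(\<Sum>k\<in>I. a k * tent (x / h - of_int k)) = (\<Sum>k\<in>{\<lfloor>x / h\<rfloor>, \<lfloor>x / h\<rfloor> + 1}. a k * tent (x / h - of_int k))"
    by (rule sum.mono_neutral_right) (use assms in \<open>auto simp: tent_int\<close>)
  also have "\<dots> = interp h a x" by (simp add: tent_int interp_def mult.commute)
  finally show ?thesis by simp
qed

lemma continuous_tent: "continuous_on S (\<lambda>x. tent (x / h - of_int k))"
  unfolding tent_def divide_inverse by (intro continuous_intros)

lemma continuous_interp: "continuous_on UNIV (interp h a)"
proof -
  have "isCont (interp h a) x" for x
  proof -
    \<comment> \<open>A fixed index set valid on a whole neighbourhood of \<open>x\<close>, on which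
      the floor changes by at most 1.\<close>
    define I where "I = {\<lfloor>x / h\<rfloor> - 3..\<lfloor>x / h\<rfloor> + 3}"
    define S where "S = {y. \<bar>y / h - x / h\<bar> < 1}"
    have "open S" unfolding S_def divide_inverse by (intro open_Collect_less continuous_intros)
    moreover have "x \<in> S" by (simp add: S_def)
    moreover have "continuous_on S (interp h a)"
    proof (rule continuous_on_cong[THEN iffD1, OF refl])
      show "continuous_on S (\<lambda>y. \<Sum>k\<in>I. a k * tent (y / h - of_int k))"
        by (intro continuous_on_sum continuous_on_mult continuous_on_const continuous_tent)
      fix y assume "y \<in> S"
      then have "\<bar>y / h - x / h\<bar> < 1" by (simp add: S_def)
      then have "x / h - 1 \<le> y / h \<and> y / h \<le> x / h + 1" by linarith
      then have "\<lfloor>x / h\<rfloor> - 1 \<le> \<lfloor>y / h\<rfloor>" "\<lfloor>y / h\<rfloor> \<le> \<lfloor>x / h\<rfloor> + 1"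
        using floor_mono[of "x / h - 1" "y / h"] floor_mono[of "y / h" "x / h + 1"] by auto
      then have "\<lfloor>y / h\<rfloor> \<in> I" "\<lfloor>y / h\<rfloor> + 1 \<in> I" unfolding I_def by auto
      then show "(\<Sum>k\<in>I. a k * tent (y / h - of_int k)) = interp h a y"
        by (intro interp_eq_sum[symmetric]) (auto simp: I_def)
    qed
    ultimately show ?thesis by (simp add: continuous_on_eq_continuous_at)
  qed
  then show ?thesis by (simp add: continuous_at_imp_continuous_on)
qed

text \<open>The value is a convex combination of the two neighbouring node values, so it stays in
  any interval that contains both.\<close>

lemma interp_close:
  assumes "\<bar>a \<lfloor>x / h\<rfloor> - v\<bar> \<le> B" "\<bar>a (\<lfloor>x / h\<rfloor> + 1) - v\<bar> \<le> B"
  shows "\<bar>interp h a x - v\<bar> \<le> B"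
proof -
  let ?s = "frac (x / h)"
  have s: "0 \<le> ?s" "?s \<le> 1" using periodic1_frac_mem[of "x / h"] by auto
  have "interp h a x - v = (1 - ?s) * (a \<lfloor>x / h\<rfloor> - v) + ?s * (a (\<lfloor>x / h\<rfloor> + 1) - v)"
    by (simp add: interp_def algebra_simps)
  also have "\<bar>\<dots>\<bar> \<le> \<bar>(1 - ?s) * (a \<lfloor>x / h\<rfloor> - v)\<bar> + \<bar>?s * (a (\<lfloor>x / h\<rfloor> + 1) - v)\<bar>" by (rule abs_triangle_ineq)
  also have "\<dots> \<le> (1 - ?s) * B + ?s * B"
    unfolding abs_mult using s assms by (intro add_mono) (simp_all add: mult_left_mono)
  also have "\<dots> = B" by (simp add: algebra_simps)
  finally show ?thesis .
qed

lemma scaled_half_less: "Q > 0 \<Longrightarrow> e > 0 \<Longrightarrow> Q * (e / (2 * Q)) < (e :: real)"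
  by simp

lemma interp_abs_le: "(\<And>k. \<bar>a k\<bar> \<le> B) \<Longrightarrow> \<bar>interp h a x\<bar> \<le> B"
  using interp_close[of a x h 0 B] by simp

lemma interp_add: "interp h (\<lambda>k. a k + b k) x = interp h a x + interp h b x"
  and interp_scale: "interp h (\<lambda>k. c * a k) x = c * interp h a x"
  and interp_const: "interp h (\<lambda>_. c) x = c"
  by (simp_all add: interp_def algebra_simps)

definition interpolant :: "real \<Rightarrow> (real \<Rightarrow> real) \<Rightarrow> real \<Rightarrow> real" where
  "interpolant h \<phi> = interp h (\<lambda>k. \<phi> (h * of_int k))"

lemma interpolant_near:
  fixes h x :: real
  assumes "h > 0"
  shows "\<bar>h * of_int \<lfloor>x / h\<rfloor> - x\<bar> \<le> h" "\<bar>h * of_int (\<lfloor>x / h\<rfloor> + 1) - x\<bar> \<le> h"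
proof -
  have x: "x = h * (x / h)" using assms by simp
  have scale: "\<bar>h * k - x\<bar> \<le> h" if "\<bar>k - x / h\<bar> \<le> 1" for k
  proof -
    have "h * k - x = h * (k - x / h)" using assms by (simp add: right_diff_distrib)
    then have "\<bar>h * k - x\<bar> = h * \<bar>k - x / h\<bar>" using assms by (simp add: abs_mult)
    then show ?thesis using mult_left_mono[OF that, of h] assms by simp
  qed
  show "\<bar>h * of_int \<lfloor>x / h\<rfloor> - x\<bar> \<le> h" by (rule scale) linarith
  have "\<bar>real_of_int (\<lfloor>x / h\<rfloor> + 1) - x / h\<bar> \<le> 1" by linarith
  then show "\<bar>h * of_int (\<lfloor>x / h\<rfloor> + 1) - x\<bar> \<le> h" by (rule scale)
qed

context sup_space
begin

definition discretize :: "real \<Rightarrow> gfun \<Rightarrow> gfun" where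
  "discretize h \<mu> = (\<lambda>\<phi>\<in>Y. \<mu> (interpolant h \<phi>))"

lemma
  assumes \<mu>: "\<mu> \<in> dual C" and I: "\<And>\<phi>. \<phi> \<in> Y \<Longrightarrow> interpolant h \<phi> \<in> Y"
  shows discretize_dual: "discretize h \<mu> \<in> dual C"
    and discretize_norm: "dual_norm C (discretize h \<mu>) \<le> dual_norm C \<mu>"
proof -
  have bound: "\<bar>discretize h \<mu> \<phi>\<bar> \<le> dual_norm C \<mu> * B" if \<phi>: "\<phi> \<in> Y" and B: "\<And>t. \<bar>\<phi> t\<bar> \<le> B" for \<phi> B
  proof -
    have "\<bar>interpolant h \<phi> t\<bar> \<le> B" for t unfolding interpolant_def by (rule interp_abs_le) (rule B)
    from dual_norm_upper[OF \<mu> I[OF \<phi>] this] show ?thesis using \<phi> by (simp add: discretize_def)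
  qed
  show "discretize h \<mu> \<in> dual C"
  proof (rule dualI[where K = "dual_norm C \<mu>"])
    fix f g assume fg: "f \<in> Y" "g \<in> Y"
    have "interpolant h (\<lambda>t. f t + g t) = (\<lambda>t. interpolant h f t + interpolant h g t)"
      unfolding interpolant_def interp_add ..
    then show "discretize h \<mu> (\<lambda>t. f t + g t) = discretize h \<mu> f + discretize h \<mu> g"
      using fg by (simp add: discretize_def add_mem dual_add[OF \<mu> I I])
  next
    fix c f assume f: "f \<in> Y"
    have "interpolant h (\<lambda>t. c * f t) = (\<lambda>t. c * interpolant h f t)" unfolding interpolant_def interp_scale ..
    then show "discretize h \<mu> (\<lambda>t. c * f t) = c * discretize h \<mu> f"
      using f by (simp add: discretize_def scale_mem dual_scale[OF \<mu> I])
  qed (use bound in \<open>auto simp: discretize_def\<close>)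
  show "dual_norm C (discretize h \<mu>) \<le> dual_norm C \<mu>"
    by (rule dual_norm_leI) (use bound[of _ 1] in simp)
qed

text \<open>Both nodes are within \<open>h\<close> of the point, so uniform continuity makes the
  interpolants converge in the sup norm.\<close>

lemma discretize_tendsto:
  assumes \<mu>: "\<mu> \<in> dual C" and I: "\<And>n \<phi>. \<phi> \<in> Y \<Longrightarrow> interpolant (h n) \<phi> \<in> Y"
    and h: "\<And>n. h n > 0" "h \<longlonglongrightarrow> 0" and \<phi>: "\<phi> \<in> Y"
  shows "(\<lambda>n. discretize (h n) \<mu> \<phi>) \<longlonglongrightarrow> \<mu> \<phi>"
proof (rule LIMSEQ_I)
  fix e :: real assume e: "e > 0"
  let ?Q = "dual_norm C \<mu> + 1"
  have Q: "?Q > 0" using dual_norm_nonneg[OF \<mu>] by simp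
  have e': "e / (2 * ?Q) > 0" using e Q by simp
  obtain d where d: "d > 0" "\<And>x x'. \<bar>x' - x\<bar> < d \<Longrightarrow> \<bar>\<phi> x' - \<phi> x\<bar> < e / (2 * ?Q)"
    using uniformly_continuous_mem[OF \<phi>, unfolded uniformly_continuous_on_def, rule_format, OF e'] by (auto simp: dist_real_def)
  obtain n0 where n0: "\<And>n. n0 \<le> n \<Longrightarrow> h n < d"
    using LIMSEQ_D[OF h(2) d(1)] h(1) by (auto simp: abs_of_pos)
  have "norm (discretize (h n) \<mu> \<phi> - \<mu> \<phi>) < e" if n: "n0 \<le> n" for n
  proof -
    have "\<bar>interpolant (h n) \<phi> t - \<phi> t\<bar> \<le> e / (2 * ?Q)" for t
      unfolding interpolant_def
      by (rule interp_close; rule less_imp_le, rule d(2), rule le_less_trans[OF interpolant_near(1)[OF h(1)] n0[OF n]]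
          le_less_trans[OF interpolant_near(2)[OF h(1)] n0[OF n]])
    from dual_norm_upper[OF \<mu> diff_mem[OF I[OF \<phi>] \<phi>] this]
    have "\<bar>\<mu> (interpolant (h n) \<phi>) - \<mu> \<phi>\<bar> \<le> dual_norm C \<mu> * (e / (2 * ?Q))"
      unfolding dual_diff[OF \<mu> I[OF \<phi>] \<phi>] .
    also have "\<dots> \<le> ?Q * (e / (2 * ?Q))" using e' by (intro mult_right_mono) auto
    also have "\<dots> < e" by (rule scaled_half_less[OF Q e])
    finally show ?thesis using \<phi> by (simp add: discretize_def)
  qed
  then show "\<exists>n0. \<forall>n\<ge>n0. norm (discretize (h n) \<mu> \<phi> - \<mu> \<phi>) < e" by blast
qed

text \<open>Lower semicontinuity of the norm: each inequality
  \<open>\<bar>\<mu> i f\<bar> \<le> dual_norm C (\<mu> i) * B\<close> passes to the limit, which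
  gives both membership in the dual and the bound \<open>a\<close>.\<close>

lemma limit_functional:
  assumes G: "G \<noteq> bot" and \<mu>: "\<And>i. \<mu> i \<in> dual C" and lim: "\<And>h. h \<in> Y \<Longrightarrow> \<exists>l. ((\<lambda>i. \<mu> i h) \<longlongrightarrow> l) G"
    and a: "((\<lambda>i. dual_norm C (\<mu> i)) \<longlongrightarrow> a) G"
  shows "\<exists>\<mu>0\<in>dual C. dual_norm C \<mu>0 \<le> a \<and> (\<forall>h\<in>Y. ((\<lambda>i. \<mu> i h) \<longlongrightarrow> \<mu>0 h) G)"
proof -
  obtain m where m: "\<And>h. h \<in> Y \<Longrightarrow> ((\<lambda>i. \<mu> i h) \<longlongrightarrow> m h) G" using lim by metis
  let ?m = "restrict m Y"
  have bound: "\<bar>m f\<bar> \<le> a * B" if f: "f \<in> Y" and B: "\<And>t. \<bar>f t\<bar> \<le> B" for f B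
    by (rule tendsto_le[OF G tendsto_mult_right[OF a] tendsto_rabs[OF m[OF f]]])
      (intro always_eventually allI dual_norm_upper \<mu> f B)
  have "?m \<in> dual C"
  proof (rule dualI[where K = a])
    fix f g assume fg: "f \<in> Y" "g \<in> Y"
    have "((\<lambda>i. \<mu> i (\<lambda>t. f t + g t)) \<longlongrightarrow> m f + m g) G"
      unfolding dual_add[OF \<mu> fg] by (intro tendsto_add m fg)
    from tendsto_unique[OF G m[OF add_mem[OF fg]] this] show "?m (\<lambda>t. f t + g t) = ?m f + ?m g"
      using fg add_mem[OF fg] by simp
  next
    fix c f assume f: "f \<in> Y"
    have "((\<lambda>i. \<mu> i (\<lambda>t. c * f t)) \<longlongrightarrow> c * m f) G"
      unfolding dual_scale[OF \<mu> f] by (intro tendsto_mult_left m f)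
    from tendsto_unique[OF G m[OF scale_mem[OF f]] this] show "?m (\<lambda>t. c * f t) = c * ?m f"
      using f scale_mem[OF f] by simp
  qed (use bound in auto)
  moreover have "dual_norm C ?m \<le> a" by (rule dual_norm_leI) (use bound[of _ 1] in simp)
  ultimately show ?thesis using m by (intro bexI[of _ ?m]) auto
qed

end

lemma interpolant_Y0:
  assumes h: "h > 0" and \<phi>: "\<phi> \<in> Y0"
  shows "interpolant h \<phi> \<in> Y0"
proof -
  have "(interpolant h \<phi> \<longlongrightarrow> 0) at_infinity"
  proof (rule tendstoI)
    fix e :: real assume e: "e > 0"
    have "\<forall>\<^sub>F x in at_infinity. dist (\<phi> x) 0 < e / 2" using \<phi> e by (intro tendstoD) auto
    then obtain R where R: "\<And>x. R \<le> norm x \<Longrightarrow> \<bar>\<phi> x\<bar> < e / 2" unfolding eventually_at_infinity by auto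
    have "dist (interpolant h \<phi> x) 0 < e" if x: "R + h \<le> norm x" for x
    proof -
      have "\<bar>interpolant h \<phi> x - 0\<bar> \<le> e / 2"
        unfolding interpolant_def
      proof (rule interp_close)
        show "\<bar>\<phi> (h * of_int \<lfloor>x / h\<rfloor>) - 0\<bar> \<le> e / 2"
          using R[of "h * of_int \<lfloor>x / h\<rfloor>"] interpolant_near(1)[OF h, of x] x unfolding real_norm_def by linarith
        show "\<bar>\<phi> (h * of_int (\<lfloor>x / h\<rfloor> + 1)) - 0\<bar> \<le> e / 2"
          using R[of "h * of_int (\<lfloor>x / h\<rfloor> + 1)"] interpolant_near(2)[OF h, of x] x unfolding real_norm_def by linarith
      qed
      then show ?thesis using e by simp
    qed
    then show "\<forall>\<^sub>F x in at_infinity. dist (interpolant h \<phi> x) 0 < e" unfolding eventually_at_infinity by blast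
  qed
  then show ?thesis using continuous_interp by (simp add: interpolant_def)
qed

text \<open>The coefficients are the values of \<open>\<mu>\<close> on the tents. What has to be
  proved is that they are absolutely summable and that the infinite sum represents the
  functional.\<close>

lemma discretize_grid_R:
  assumes \<mu>: "\<mu> \<in> dual C0R" and h: "h > 0"
  shows "restrict (C0R.discretize h \<mu>) schwartz \<in> grid_measures_R h"
proof -
  let ?T = "\<lambda>k x. tent (x / h - of_int k)"
  have vanish: "f \<in> Y0" if c: "continuous_on UNIV f" and z: "\<And>x. R \<le> \<bar>x\<bar> \<Longrightarrow> f x = 0" for f :: "real \<Rightarrow> real" and R
  proof -
    have "\<forall>\<^sub>F x in at_infinity. f x = 0" unfolding eventually_at_infinity using z by auto
    then show ?thesis using c by (auto intro: tendsto_eventually)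
  qed
  have T: "?T k \<in> Y0" for k
  proof (rule vanish[where R = "h * (1 + \<bar>of_int k\<bar>)"])
    fix x assume "h * (1 + \<bar>of_int k\<bar>) \<le> \<bar>x\<bar>"
    then have "1 + \<bar>of_int k\<bar> \<le> \<bar>x / h\<bar>" using h by (simp add: pos_le_divide_eq mult.commute)
    then have "1 \<le> \<bar>x / h - of_int k\<bar>" by linarith
    then show "?T k x = 0" by (simp add: tent_def)
  qed (rule continuous_tent)
  let ?a = "\<lambda>k. \<mu> (?T k)"
  have sum_T: "(\<lambda>x. \<Sum>k\<in>J. b k * ?T k x) \<in> Y0" "\<mu> (\<lambda>x. \<Sum>k\<in>J. b k * ?T k x) = (\<Sum>k\<in>J. b k * ?a k)" if "finite J" for J b
    using C0R.dual_sum[OF \<mu> that, of "\<lambda>k x. b k * ?T k x"] C0R.scale_mem[OF T] C0R.dual_scale[OF \<mu> T] by auto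
  have part: "(\<Sum>k\<in>J. b k * ?T k x) = interp h (\<lambda>k. if k \<in> J then b k else 0) x" if J: "finite J" for J b x
  proof -
    have "interp h (\<lambda>k. if k \<in> J then b k else 0) x =
       (\<Sum>k\<in>J \<union> {\<lfloor>x / h\<rfloor>, \<lfloor>x / h\<rfloor> + 1}. (if k \<in> J then b k else 0) * ?T k x)"
      using J by (intro interp_eq_sum) auto
    also have "\<dots> = (\<Sum>k\<in>J. (if k \<in> J then b k else 0) * ?T k x)"
      using J by (intro sum.mono_neutral_right) auto
    finally show ?thesis by simp
  qed
  have "(\<Sum>k\<in>J. \<bar>?a k\<bar>) \<le> dual_norm C0R \<mu>" if J: "finite J" for J
  proof -
    \<comment> \<open>A signed finite sum of tents interpolates node values in
      \<open>{-1, 0, 1}\<close>, hence has sup norm at most 1; testing \<open>\<mu>\<close> on it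
      sums the absolute coefficients.\<close>
    have "\<bar>\<Sum>k\<in>J. sgn (?a k) * ?T k x\<bar> \<le> 1" for x
      unfolding part[OF J] by (rule interp_abs_le) (simp add: abs_sgn_eq)
    from C0R.dual_norm_upper[OF \<mu> sum_T(1)[OF J] this] sum_T(2)[OF J, of "\<lambda>k. sgn (?a k)"]
    have "\<bar>\<Sum>k\<in>J. sgn (?a k) * ?a k\<bar> \<le> dual_norm C0R \<mu>" by simp
    moreover have "(\<Sum>k\<in>J. sgn (?a k) * ?a k) = (\<Sum>k\<in>J. \<bar>?a k\<bar>)"
      by (intro sum.cong refl) (simp add: abs_sgn mult.commute)
    ultimately show ?thesis by linarith
  qed
  then have summ: "(\<lambda>k. \<bar>?a k\<bar>) summable_on UNIV"
    by (intro nonneg_bdd_above_summable_on) (auto intro!: bdd_aboveI2)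
  have sum: "((\<lambda>k. ?a k * \<phi> (h * of_int k)) has_sum \<mu> (interpolant h \<phi>)) UNIV" if \<phi>: "\<phi> \<in> Y0" for \<phi>
    unfolding has_sum_def
  proof (rule tendstoI)
    fix e :: real assume e: "e > 0"
    let ?Q = "dual_norm C0R \<mu> + 1"
    have Q: "?Q > 0" using C0R.dual_norm_nonneg[OF \<mu>] by simp
    have e': "e / (2 * ?Q) > 0" using e Q by simp
    have "\<forall>\<^sub>F x in at_infinity. dist (\<phi> x) 0 < e / (2 * ?Q)" using \<phi> e' by (intro tendstoD) auto
    then obtain R where R: "\<And>x. R \<le> norm x \<Longrightarrow> \<bar>\<phi> x\<bar> < e / (2 * ?Q)" unfolding eventually_at_infinity by auto
    \<comment> \<open>Outside this window the nodes lie beyond \<open>R\<close>, where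
      \<open>\<phi>\<close> is small.\<close>
    let ?J0 = "{- \<lceil>\<bar>R\<bar> / h\<rceil>..\<lceil>\<bar>R\<bar> / h\<rceil>}"
    have small: "\<bar>\<phi> (h * of_int k)\<bar> \<le> e / (2 * ?Q)" if "k \<notin> ?J0" for k
    proof -
      have "\<bar>R\<bar> / h \<le> \<bar>of_int k\<bar>" using that unfolding atLeastAtMost_iff by linarith
      then have "\<bar>R\<bar> \<le> h * \<bar>of_int k\<bar>" using h by (simp add: pos_divide_le_eq mult.commute)
      then have "R \<le> norm (h * of_int k)" using h by (simp add: abs_mult)
      then show ?thesis using R by (intro less_imp_le) blast
    qed
    have "dist (\<Sum>k\<in>J. ?a k * \<phi> (h * of_int k)) (\<mu> (interpolant h \<phi>)) < e" if J: "finite J" "?J0 \<subseteq> J" for J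
    proof -
      let ?s = "\<lambda>x. \<Sum>k\<in>J. \<phi> (h * of_int k) * ?T k x"
      \<comment> \<open>The difference interpolates node values that are 0 on \<open>J\<close> and
        \<open>- \<phi>\<close> off \<open>J\<close>, so its sup norm is governed by the small
        tail.\<close>
      have "\<bar>?s x - interpolant h \<phi> x\<bar> \<le> e / (2 * ?Q)" for x
      proof -
        have "?s x - interpolant h \<phi> x = interp h (\<lambda>k. (if k \<in> J then \<phi> (h * of_int k) else 0) + (-1) * \<phi> (h * of_int k)) x"
          unfolding part[OF J(1)] interp_add interp_scale interpolant_def by simp
        also have "\<bar>\<dots>\<bar> \<le> e / (2 * ?Q)" 
        proof (rule interp_abs_le)
          fix k
          show "\<bar>(if k \<in> J then \<phi> (h * of_int k) else 0) + (-1) * \<phi> (h * of_int k)\<bar> \<le> e / (2 * ?Q)"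
          proof (cases "k \<in> J")
            case False
            then have "k \<notin> ?J0" using J(2) by blast
            then show ?thesis using small False by simp
          qed (use less_imp_le[OF e'] in simp)
        qed
        finally show ?thesis .
      qed
      from C0R.dual_norm_upper[OF \<mu> C0R.diff_mem[OF sum_T(1)[OF J(1)] interpolant_Y0[OF h \<phi>]] this]
      have "\<bar>\<mu> ?s - \<mu> (interpolant h \<phi>)\<bar> \<le> dual_norm C0R \<mu> * (e / (2 * ?Q))"
        unfolding C0R.dual_diff[OF \<mu> sum_T(1)[OF J(1)] interpolant_Y0[OF h \<phi>]] .
      also have "\<dots> \<le> ?Q * (e / (2 * ?Q))" using e' by (intro mult_right_mono) auto
      also have "\<dots> < e" by (rule scaled_half_less[OF Q e])
      finally show ?thesis using sum_T(2)[OF J(1), of "\<lambda>k. \<phi> (h * of_int k)"] by (simp add: dist_real_def mult.commute)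
    qed
    then show "\<forall>\<^sub>F J in finite_subsets_at_top UNIV. dist (\<Sum>k\<in>J. ?a k * \<phi> (h * of_int k)) (\<mu> (interpolant h \<phi>)) < e"
      unfolding eventually_finite_subsets_at_top by (intro exI[of _ ?J0]) auto
  qed
  have "restrict (C0R.discretize h \<mu>) schwartz = (\<lambda>\<phi>\<in>topspace SR. \<Sum>\<^sub>\<infinity>k::int. ?a k * dirac SR (h * of_int k) \<phi>)"
    unfolding topspace_SR
  proof (rule restrict_ext)
    fix \<phi> assume \<phi>: "\<phi> \<in> schwartz"
    show "C0R.discretize h \<mu> \<phi> = (\<Sum>\<^sub>\<infinity>k::int. ?a k * dirac SR (h * of_int k) \<phi>)"
      using infsumI[OF sum[OF schwartz_in_Y0[OF \<phi>]]] schwartz_in_Y0[OF \<phi>] \<phi> by (simp add: C0R.discretize_def)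
  qed
  then show ?thesis unfolding grid_measures_R_def mem_Collect_eq by (intro exI[of _ ?a] conjI summ)
qed

lemma grid_step:
  fixes h :: real
  assumes "h > 0" "1 / h \<in> \<nat>"
  obtains n :: nat where "n > 0" "h = 1 / real n" "nat \<lfloor>1 / h\<rfloor> = n"
proof -
  obtain n where n: "1 / h = real n" using assms(2) by (auto elim: Nats_cases)
  then have "n > 0" using assms(1) by (cases n) auto
  then show ?thesis using that[of n] n assms(1) by (simp add: field_simps)
qed

text \<open>An integral number \<open>n\<close> of steps per period makes a translation by 1 a
  translation of the nodes by \<open>n\<close>.\<close>

lemma interpolant_periodic:
  assumes n: "n > 0" "h = 1 / real n" and a: "\<And>k. a (k + int n) = a k"
  shows "interp h a \<in> YT"
proof -
  have "interp h a (x + 1) = interp h a x" for x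
  proof -
    have e: "(x + 1) / h = x / h + of_int (int n)" by (simp add: n(2) distrib_right)
    have "\<lfloor>(x + 1) / h\<rfloor> = \<lfloor>x / h\<rfloor> + int n" unfolding e by (rule floor_add_int[symmetric])
    moreover have "frac ((x + 1) / h) = frac (x / h)" unfolding frac_def calculation e by simp
    moreover have "a (\<lfloor>x / h\<rfloor> + int n + 1) = a (\<lfloor>x / h\<rfloor> + 1)" using a[of "\<lfloor>x / h\<rfloor> + 1"] by (simp add: ac_simps)
    ultimately show ?thesis by (simp add: interp_def a)
  qed
  then show ?thesis using continuous_interp by (simp add: periodic1_def)
qed

lemma interpolant_YT:
  assumes h: "h > 0" "1 / h \<in> \<nat>" and \<phi>: "\<phi> \<in> YT"
  shows "interpolant h \<phi> \<in> YT"
proof -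
  obtain n :: nat where n: "n > 0" "h = 1 / real n" using grid_step[OF h] by blast
  show ?thesis
    unfolding interpolant_def
  proof (rule interpolant_periodic[OF n])
    fix k
    have "h * of_int (k + int n) = h * of_int k + 1" using n by (simp add: field_simps)
    then show "\<phi> (h * of_int (k + int n)) = \<phi> (h * of_int k)" using \<phi> by (simp add: periodic1_def)
  qed
qed

text \<open>The tents are summed over residue classes modulo \<open>n\<close>, which gives
  \<open>n\<close> periodic hat functions; their images under \<open>\<nu>\<close> are the
  coefficients.\<close>

lemma discretize_grid_T:
  assumes \<nu>: "\<nu> \<in> dual CT" and h: "h > 0" "1 / h \<in> \<nat>"
  shows "restrict (CT.discretize h \<nu>) XT \<in> grid_measures_T h"
proof -
  obtain n :: nat where n: "n > 0" "h = 1 / real n" "nat \<lfloor>1 / h\<rfloor> = n" using grid_step[OF h] by blast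
  define T where "T k = interp h (\<lambda>i. if i mod int n = int k mod int n then 1 else 0)" for k :: nat
  have T: "T k \<in> YT" for k unfolding T_def by (rule interpolant_periodic[OF n(1,2)]) simp
  have rep: "interpolant h \<phi> = (\<lambda>x. \<Sum>k=1..n. \<phi> (h * of_nat k) * T k x)" if \<phi>: "\<phi> \<in> YT" for \<phi>
  proof
    fix x
    have val: "\<phi> (h * of_int i) = (\<Sum>k=1..n. \<phi> (h * of_nat k) * (if i mod int n = int k mod int n then 1 else 0))" for i
    proof -
      \<comment> \<open>The grid is indexed by \<open>{1..n}\<close>, so the residue class 0 is
        represented by \<open>n\<close>.\<close>
      define k0 where "k0 = (if i mod int n = 0 then n else nat (i mod int n))"
      have im: "0 \<le> i mod int n" "i mod int n < int n" using n(1) by auto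
      have "nat (i mod int n) < n" using im by (simp add: nat_less_iff)
      moreover have "1 \<le> nat (i mod int n)" if "i mod int n \<noteq> 0" using im(1) that by linarith
      ultimately have k0: "k0 \<in> {1..n}" using n(1) by (cases "i mod int n = 0") (auto simp: k0_def)
      have k0m: "int k0 mod int n = i mod int n" using im by (auto simp: k0_def)
      have uniq: "k = k0" if "k \<in> {1..n}" "i mod int n = int k mod int n" for k
      proof -
        have km: "int k mod int n = (if k = n then 0 else int k)" using that(1) by auto
        show ?thesis using that km n(1) by (auto simp: k0_def split: if_splits)
      qed
      have "(\<Sum>k=1..n. \<phi> (h * of_nat k) * (if i mod int n = int k mod int n then 1 else 0)) = (\<Sum>k=1..n. if k = k0 then \<phi> (h * of_nat k) else 0)"
      proof (rule sum.cong[OF refl])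
        fix k assume k: "k \<in> {1..n}"
        have "i mod int n = int k mod int n \<longleftrightarrow> k = k0" using uniq[OF k] k0m by metis
        then show "\<phi> (h * of_nat k) * (if i mod int n = int k mod int n then 1 else 0) = (if k = k0 then \<phi> (h * of_nat k) else 0)" by simp
      qed
      also have "\<dots> = \<phi> (h * of_nat k0)" using k0 by simp
      also have "\<dots> = \<phi> (h * of_int i)"
      proof -
        have "int n dvd i - int k0" using k0m by (intro mod_eq_dvd_iff[THEN iffD1]) simp
        then obtain q where "i - int k0 = int n * q" unfolding dvd_def by blast
        then have "of_int i = of_nat k0 + real n * of_int q" by (metis add.commute diff_add_cancel of_int_add of_int_mult of_int_of_nat_eq)
        then have "h * of_int i = h * of_nat k0 + of_int q" using n(1,2) by (simp add: field_simps)
        then show ?thesis using periodic1_int[of \<phi> "h * of_nat k0" q] \<phi> by simp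
      qed
      finally show ?thesis by simp
    qed
    have "interp h (\<lambda>i. \<Sum>k\<in>S. \<phi> (h * of_nat k) * (if i mod int n = int k mod int n then 1 else 0)) x =
        (\<Sum>k\<in>S. \<phi> (h * of_nat k) * T k x)" if "finite S" for S
      using that
    proof (induction S rule: finite_induct)
      case empty
      then show ?case by (simp add: interp_const)
    next
      case (insert k S)
      show ?case unfolding sum.insert[OF insert.hyps] interp_add interp_scale insert.IH T_def ..
    qed
    from this[of "{1..n}"] show "interpolant h \<phi> x = (\<Sum>k=1..n. \<phi> (h * of_nat k) * T k x)" unfolding interpolant_def val by simp
  qed
  have "restrict (CT.discretize h \<nu>) XT = (\<lambda>\<phi>\<in>topspace ST. \<Sum>k=1..nat \<lfloor>1 / h\<rfloor>. \<nu> (T k) * dirac ST (h * of_nat k) \<phi>)"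
    unfolding topspace_ST n(3)
  proof (rule restrict_ext)
    fix \<phi> assume \<phi>: "\<phi> \<in> XT"
    have "\<nu> (\<lambda>x. \<Sum>k=1..n. \<phi> (h * of_nat k) * T k x) = (\<Sum>k=1..n. \<phi> (h * of_nat k) * \<nu> (T k))"
      using CT.dual_sum(2)[OF \<nu>, of "{1..n}" "\<lambda>k x. \<phi> (h * of_nat k) * T k x"] CT.scale_mem[OF T] CT.dual_scale[OF \<nu> T] by simp
    then show "CT.discretize h \<nu> \<phi> = (\<Sum>k=1..n. \<nu> (T k) * dirac ST (h * of_nat k) \<phi>)"
      using rep[OF XT_in_YT[OF \<phi>]] XT_in_YT[OF \<phi>] \<phi> by (simp add: CT.discretize_def mult.commute)
  qed
  then show ?thesis unfolding grid_measures_T_def mem_Collect_eq by (intro exI[of _ "\<lambda>k. \<nu> (T k)"] conjI TrueI)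
qed

subsection \<open>The seasonal-trend problem in coordinates\<close>

lemma (in test_measure) restrict_measure_of_gfun:
  "w \<in> measures_in T C \<Longrightarrow> restrict (measure_of_gfun T C w) X = w"
  unfolding measures_in_def measure_of_gfun_def T.topspace_T by (rule f_inv_into_f[of w "\<lambda>u. restrict u X"])

lemma (in sup_space) zero_dual: "(\<lambda>_\<in>Y. 0) \<in> dual C"
  by (rule dualI[where K = 0]) (simp_all add: add_mem scale_mem)

lemma minimizers_iff: "x \<in> minimizers J A \<longleftrightarrow> x \<in> A \<and> (\<forall>z\<in>A. (J x :: real) \<le> J z)"
  by (auto simp: minimizers_def is_arg_min_linorder)

text \<open>In \<open>ennreal\<close> the supremum exists without a boundedness proof and is 0 over
  an empty interval.\<close>

lemma unif_lim_SUP: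
  fixes F :: "nat \<Rightarrow> real \<Rightarrow> real"
  assumes "unif_lim sequentially F f S" "S' \<subseteq> S"
  shows "(\<lambda>n. SUP t\<in>S'. ennreal \<bar>F n t - f t\<bar>) \<longlonglongrightarrow> 0"
proof (rule tendsto_zero_ennreal)
  fix r :: real assume r: "r > 0"
  from unif_limD[OF assms(1), of "r / 2"] r have "\<forall>\<^sub>F n in sequentially. \<forall>t\<in>S. \<bar>F n t - f t\<bar> \<le> r / 2" by simp
  then show "\<forall>\<^sub>F n in sequentially. (SUP t\<in>S'. ennreal \<bar>F n t - f t\<bar>) < ennreal r"
  proof (rule eventually_mono)
    fix n assume "\<forall>t\<in>S. \<bar>F n t - f t\<bar> \<le> r / 2"
    then have "(SUP t\<in>S'. ennreal \<bar>F n t - f t\<bar>) \<le> ennreal (r / 2)"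
      using assms(2) by (intro SUP_least ennreal_leI) auto
    also have "\<dots> < ennreal r" using r by (simp add: ennreal_less_iff)
    finally show "(SUP t\<in>S'. ennreal \<bar>F n t - f t\<bar>) < ennreal r" .
  qed
qed

text \<open>Indexing the coordinates by the real sequences themselves yields one filter along which
  every bounded sequence converges, so no list of the quantities needed has to be fixed
  beforehand.\<close>

lemma bounded_cluster:
  assumes "F \<noteq> bot"
  shows "\<exists>G\<le>F. G \<noteq> bot \<and> (\<forall>v :: 'n \<Rightarrow> real. (\<exists>B. \<forall>n. \<bar>v n\<bar> \<le> B) \<longrightarrow> (\<exists>l. (v \<longlongrightarrow> l) G))"
proof -
  \<comment> \<open>Unbounded sequences are replaced by 0 so that every coordinate is
    bounded.\<close>
  let ?u = "\<lambda>n v :: 'n \<Rightarrow> real. if \<exists>B. \<forall>n. \<bar>v n\<bar> \<le> B then v n else 0"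
  have "\<exists>B. \<forall>n. \<bar>?u n v\<bar> \<le> B" for v :: "'n \<Rightarrow> real"
  proof (cases "\<exists>B. \<forall>n. \<bar>v n\<bar> \<le> B")
    case False
    then show ?thesis by (intro exI[of _ 0]) (simp only: if_False abs_zero order_refl simp_thms)
  qed simp
  from pointwise_bounded_cluster[OF assms, of ?u, OF this]
  obtain G where G: "G \<le> F" "G \<noteq> bot" "\<And>v. \<exists>l. ((\<lambda>n. ?u n v) \<longlongrightarrow> l) G" by blast
  have "\<exists>l. (v \<longlongrightarrow> l) G" if "\<exists>B. \<forall>n. \<bar>v n\<bar> \<le> B" for v :: "'n \<Rightarrow> real"
    using G(3)[of v] that by simp
  then show ?thesis using G(1,2) by blast
qed

text \<open>One decomposition of each sensing functional and of its periodization is fixed; through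
  it the data term becomes an explicit function of the coordinates.\<close>

locale seasonal_trend =
  T: trend_op N1 L1 B1 B1i \<theta> + S: seasonal_op N2 L2 B2 B2i
  for N1 L1 B1 B1i \<theta> N2 L2 B2 B2i +
  fixes y :: "real ^ 'l::finite" and \<Phi> :: "'l \<Rightarrow> gfun" and lT lS :: real
    and h k :: "'l \<Rightarrow> real \<Rightarrow> real" and c :: "'l \<Rightarrow> nat \<Rightarrow> real" and \<alpha> :: "'l \<Rightarrow> real"
  assumes lT: "lT > 0" and lS: "lS > 0"
    and h: "\<And>l. h l \<in> Y0" and \<Phi>: "\<And>l. \<Phi> l = meas_elem_R N1 \<theta> L1 (h l) (c l)"
    and k: "\<And>l. k l \<in> YT" and per: "\<And>l. periodization (\<Phi> l) = meas_elem_T L2 (k l) (\<alpha> l)"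
    and \<alpha>: "\<And>l. N2 = 0 \<Longrightarrow> \<alpha> l = 0"
begin

abbreviation "NS \<equiv> native N1 L1 L2"
abbreviation mu :: "gfun \<times> gfun \<Rightarrow> gfun" where "mu f \<equiv> meas_R (L1 (fst f))"
abbreviation nu :: "gfun \<times> gfun \<Rightarrow> gfun" where "nu f \<equiv> meas_T (L2 (snd f))"
abbreviation mn :: "gfun \<times> gfun \<Rightarrow> real" where "mn f \<equiv> mean (snd f)"
abbreviation sns :: "gfun \<times> gfun \<Rightarrow> real ^ 'l" where "sns \<equiv> sense N1 \<theta> L1 N2 L2 \<Phi>"
abbreviation J :: "gfun \<times> gfun \<Rightarrow> real" where "J \<equiv> objective N1 \<theta> L1 N2 L2 y \<Phi> lT lS"
abbreviation "grid \<equiv> native_grid N1 L1 L2"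

lemma nativeD:
  assumes "f \<in> NS"
  shows "fst f \<in> native_R L1" "snd f \<in> native_T L2" "N1 > 0 \<Longrightarrow> mn f = 0"
  using assms by (auto simp: native_def native_T0_def split: if_splits)

lemma native_dual: "f \<in> NS \<Longrightarrow> mu f \<in> dual C0R" "f \<in> NS \<Longrightarrow> nu f \<in> dual CT"
  by (rule T.native_R_dual(2), erule nativeD(1)) (rule S.native_T_dual(2), erule nativeD(2))

lemma nu_one: "f \<in> NS \<Longrightarrow> N2 > 0 \<Longrightarrow> nu f (\<lambda>_. 1) = 0"
  and mn_eq: "f \<in> NS \<Longrightarrow> N2 = 0 \<Longrightarrow> mn f = S.gain * nu f (\<lambda>_. 1)"
  using S.native_T_measure_one[OF nativeD(2)] by auto

lemma objective_eq: "J f = (norm (y - sns f))\<^sup>2 + lT * dual_norm C0R (mu f) + lS * dual_norm CT (nu f)"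
  by (simp add: objective_def norm_MR_def norm_MT_def)

text \<open>The general linear measurement in coordinates. Sensing functionals and the weak*
  topology are both expressed by it, with different constraints on the weights.\<close>

definition coord :: "(real \<Rightarrow> real) \<Rightarrow> (nat \<Rightarrow> real) \<Rightarrow> (real \<Rightarrow> real) \<Rightarrow> real \<Rightarrow> gfun \<times> gfun \<Rightarrow> real" where
  "coord g b w a f = mu f g + (\<Sum>n=1..N1. b n * fst f (\<theta> n)) + (nu f w + a * mn f)"

lemma sense_eq: "f \<in> NS \<Longrightarrow> sns f $ l = coord (h l) (c l) (k l) (\<alpha> l) f"
  using T.pairing_R_eq[OF h] S.pairing_T_eq[OF k] \<alpha> nativeD by (simp add: sense_def coord_def \<Phi>[of l] per[of l, unfolded \<Phi>[of l]])

text \<open>The last three conditions are the compatibility conditions: a measure annihilating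
  constants, a mean tied to the measure, and a mean fixed to 0 when the trend absorbs
  constants.\<close>

lemma realization:
  assumes "\<mu> \<in> dual C0R" "\<nu> \<in> dual CT" "N2 > 0 \<Longrightarrow> \<nu> (\<lambda>_. 1) = 0" "N2 = 0 \<Longrightarrow> m = S.gain * \<nu> (\<lambda>_. 1)"
    and "N1 > 0 \<Longrightarrow> m = 0"
  shows "\<exists>f\<in>NS. mu f = \<mu> \<and> nu f = \<nu> \<and> mn f = m \<and> (\<forall>n\<in>{1..N1}. fst f (\<theta> n) = b n)"
proof -
  obtain u where u: "u \<in> native_R L1" "meas_R (L1 u) = \<mu>" "\<forall>n\<in>{1..N1}. u (\<theta> n) = b n"
    using T.native_R_realization[OF assms(1)] by blast
  obtain v where v: "v \<in> native_T L2" "meas_T (L2 v) = \<nu>" "mean v = m"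
    using S.native_T_realization[OF assms(2-4)] by blast
  show ?thesis using u v assms(5) by (intro bexI[of _ "(u, v)"]) (auto simp: native_def native_T0_def)
qed

lemma coord_tendsto:
  assumes "\<And>g. g \<in> Y0 \<Longrightarrow> ((\<lambda>i. mu (fs i) g) \<longlongrightarrow> mu f g) G" "\<And>w. w \<in> YT \<Longrightarrow> ((\<lambda>i. nu (fs i) w) \<longlongrightarrow> nu f w) G"
    and "\<And>n. n \<in> {1..N1} \<Longrightarrow> ((\<lambda>i. fst (fs i) (\<theta> n)) \<longlongrightarrow> fst f (\<theta> n)) G" "((\<lambda>i. mn (fs i)) \<longlongrightarrow> mn f) G"
    and "g \<in> Y0" "w \<in> YT"
  shows "((\<lambda>i. coord g b w a (fs i)) \<longlongrightarrow> coord g b w a f) G"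
  unfolding coord_def using assms by (intro tendsto_add tendsto_sum tendsto_mult_left) auto

lemma sense_tendsto:
  assumes fs: "\<And>i. fs i \<in> NS" and f: "f \<in> NS"
    and lim: "\<And>g. g \<in> Y0 \<Longrightarrow> ((\<lambda>i. mu (fs i) g) \<longlongrightarrow> mu f g) G" "\<And>w. w \<in> YT \<Longrightarrow> ((\<lambda>i. nu (fs i) w) \<longlongrightarrow> nu f w) G"
      "\<And>n. n \<in> {1..N1} \<Longrightarrow> ((\<lambda>i. fst (fs i) (\<theta> n)) \<longlongrightarrow> fst f (\<theta> n)) G" "((\<lambda>i. mn (fs i)) \<longlongrightarrow> mn f) G"
  shows "((\<lambda>i. (norm (y - sns (fs i)))\<^sup>2) \<longlongrightarrow> (norm (y - sns f))\<^sup>2) G"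
proof -
  have "((\<lambda>i. sns (fs i)) \<longlongrightarrow> sns f) G"
    by (rule vec_tendstoI, unfold sense_eq[OF fs] sense_eq[OF f], rule coord_tendsto[OF lim h k])
  then show ?thesis by (intro tendsto_intros)
qed

lemma unif_lim_native:
  assumes fs: "\<And>i. fs i \<in> NS" and f: "f \<in> NS"
    and K: "\<And>i. dual_norm C0R (mu (fs i)) \<le> K" "\<And>i. dual_norm CT (nu (fs i)) \<le> K'"
    and lim: "\<And>g. g \<in> Y0 \<Longrightarrow> ((\<lambda>i. mu (fs i) g) \<longlongrightarrow> mu f g) G" "\<And>w. w \<in> YT \<Longrightarrow> ((\<lambda>i. nu (fs i) w) \<longlongrightarrow> nu f w) G"
      "\<And>n. n \<in> {1..N1} \<Longrightarrow> ((\<lambda>i. fst (fs i) (\<theta> n)) \<longlongrightarrow> fst f (\<theta> n)) G" "((\<lambda>i. mn (fs i)) \<longlongrightarrow> mn f) G"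
    and d: "dirac SR 0 \<in> predual_R N1 \<theta> L1" and w: "periodic_greens_function N2 L2 w" "lipschitz_periodic_gfun w"
  shows "unif_lim G (\<lambda>i. value_R N1 \<theta> L1 (fst (fs i))) (value_R N1 \<theta> L1 (fst f)) {- r..r}"
    and "unif_lim G (\<lambda>i. value_T N2 L2 (snd (fs i))) (value_T N2 L2 (snd f)) UNIV"
proof -
  show "unif_lim G (\<lambda>i. value_R N1 \<theta> L1 (fst (fs i))) (value_R N1 \<theta> L1 (fst f)) {- r..r}"
    by (rule T.unif_lim_value_R[where K = K, OF nativeD(1)[OF fs] nativeD(1)[OF f] _ lim(1) lim(3) d]) (use K in \<open>simp_all add: norm_MR_def\<close>)
  show "unif_lim G (\<lambda>i. value_T N2 L2 (snd (fs i))) (value_T N2 L2 (snd f)) UNIV"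
    by (rule S.unif_lim_value_T[where K = K', OF nativeD(2)[OF fs] nativeD(2)[OF f] _ lim(2) lim(4) w]) (use K in \<open>simp_all add: norm_MT_def\<close>)
qed

text \<open>Only the measures are replaced. Interpolation reproduces constants, so the compatibility
  conditions on measure and mean survive with the mean unchanged.\<close>

lemma discretization:
  assumes f: "f \<in> NS" and hT: "hT > 0" and hS: "hS > 0" "1 / hS \<in> \<nat>"
  shows "\<exists>g\<in>grid hT hS. mu g = C0R.discretize hT (mu f) \<and> nu g = CT.discretize hS (nu f) \<and> mn g = mn f \<and>
    (\<forall>n\<in>{1..N1}. fst g (\<theta> n) = fst f (\<theta> n))"
proof -
  note d = native_dual[OF f]
  have one: "CT.discretize hS (nu f) (\<lambda>_. 1) = nu f (\<lambda>_. 1)"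
    unfolding CT.discretize_def restrict_apply'[OF YT_const] interpolant_def interp_const ..
  have dR: "C0R.discretize hT (mu f) \<in> dual C0R" by (rule C0R.discretize_dual[OF d(1) interpolant_Y0[OF hT]])
  have dT: "CT.discretize hS (nu f) \<in> dual CT" by (rule CT.discretize_dual[OF d(2) interpolant_YT[OF hS]])
  obtain g where g: "g \<in> NS" "mu g = C0R.discretize hT (mu f)" "nu g = CT.discretize hS (nu f)" "mn g = mn f"
      "\<forall>n\<in>{1..N1}. fst g (\<theta> n) = fst f (\<theta> n)"
    using realization[where m = "mn f" and b = "\<lambda>n. fst f (\<theta> n)",
        OF dR dT, unfolded one,
        OF nu_one[OF f] mn_eq[OF f] nativeD(3)[OF f]] by blast
  have "L1 (fst g) = restrict (mu g) schwartz" "L2 (snd g) = restrict (nu g) XT"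
    using nativeD(1,2)[OF g(1)] MR.restrict_measure_of_gfun MT.restrict_measure_of_gfun by (simp_all add: native_R_def native_T_def)
  then have "g \<in> grid hT hS"
    unfolding native_grid_def using g(1-3) discretize_grid_R[OF d(1) hT] discretize_grid_T[OF d(2) hS] by simp
  then show ?thesis using g by blast
qed

text \<open>The grid space contains an element with all coordinates zero, at which the objective is
  at most \<open>(norm y)^2\<close>; each nonnegative summand at a minimizer is then bounded by this
  number, uniformly in the grid.\<close>

lemma minimizer_bounds:
  assumes f: "f \<in> minimizers J (grid hT hS)" and hT: "hT > 0" and hS: "hS > 0" "1 / hS \<in> \<nat>"
  shows "f \<in> NS" "dual_norm C0R (mu f) \<le> (norm y)\<^sup>2 / lT" "dual_norm CT (nu f) \<le> (norm y)\<^sup>2 / lS" "norm (sns f) \<le> 2 * norm y"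
proof -
  show f': "f \<in> NS" using f by (simp add: minimizers_iff native_grid_def)
  let ?z = "\<lambda>_\<in>Y0. 0" and ?z' = "\<lambda>_\<in>YT. 0"
  have "\<exists>z\<in>NS. mu z = ?z \<and> nu z = ?z' \<and> mn z = 0 \<and> (\<forall>n\<in>{1..N1}. fst z (\<theta> n) = (\<lambda>_. 0) n)"
    by (rule realization[OF C0R.zero_dual CT.zero_dual]) (simp_all only: restrict_apply'[OF YT_const] mult_zero_right)
  then obtain z where z: "z \<in> NS" "mu z = ?z" "nu z = ?z'" "mn z = 0" "\<forall>n\<in>{1..N1}. fst z (\<theta> n) = 0" by blast
  \<comment> \<open>Membership in the grid space is obtained by discretizing the zero measures,
    whose discretizations are zero again.\<close>
  obtain g where g: "g \<in> grid hT hS" "mu g = C0R.discretize hT ?z" "nu g = CT.discretize hS ?z'" "mn g = 0" "\<forall>n\<in>{1..N1}. fst g (\<theta> n) = 0"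
    using discretization[OF z(1) hT hS] z by auto
  have gN: "g \<in> NS" using g(1) by (simp add: native_grid_def)
  have mu0: "mu g \<phi> = 0" if "\<phi> \<in> Y0" for \<phi> unfolding g(2) C0R.discretize_def using that interpolant_Y0[OF hT that] by simp
  have nu0: "nu g \<phi> = 0" if "\<phi> \<in> YT" for \<phi> unfolding g(3) CT.discretize_def using that interpolant_YT[OF hS that] by simp
  have "sns g = 0"
    unfolding vec_eq_iff sense_eq[OF gN] coord_def using g(4,5) mu0[OF h] nu0[OF k] by simp
  moreover have "dual_norm C0R (mu g) \<le> 0" by (rule C0R.dual_norm_leI) (simp only: mu0 abs_zero order_refl)
  moreover have "dual_norm CT (nu g) \<le> 0" by (rule CT.dual_norm_leI) (simp only: nu0 abs_zero order_refl)
  ultimately have "J g \<le> (norm y)\<^sup>2"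
    unfolding objective_eq using lT lS by (simp add: mult_nonneg_nonpos add_nonpos_nonpos)
  moreover have "J f \<le> J g" using f g(1) by (simp add: minimizers_iff)
  ultimately have Jf: "(norm (y - sns f))\<^sup>2 + lT * dual_norm C0R (mu f) + lS * dual_norm CT (nu f) \<le> (norm y)\<^sup>2"
    unfolding objective_eq by linarith
  have nn: "0 \<le> lT * dual_norm C0R (mu f)" "0 \<le> lS * dual_norm CT (nu f)" "0 \<le> (norm (y - sns f))\<^sup>2"
    using C0R.dual_norm_nonneg CT.dual_norm_nonneg native_dual[OF f'] lT lS by simp_all
  show "dual_norm C0R (mu f) \<le> (norm y)\<^sup>2 / lT" unfolding pos_le_divide_eq[OF lT] mult.commute[of _ lT] using Jf nn by linarith
  show "dual_norm CT (nu f) \<le> (norm y)\<^sup>2 / lS" unfolding pos_le_divide_eq[OF lS] mult.commute[of _ lS] using Jf nn by linarith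
  have "(norm (y - sns f))\<^sup>2 \<le> (norm y)\<^sup>2" using Jf nn by linarith
  then have "norm (y - sns f) \<le> norm y" by (rule power2_le_imp_le) simp
  moreover have "norm (sns f) \<le> norm y + norm (y - sns f)" using norm_triangle_ineq4[of y "y - sns f"] by simp
  ultimately show "norm (sns f) \<le> 2 * norm y" by linarith
qed

end

subsection \<open>Convergence of the discretized minimizers\<close>

lemma unique_minimizerD:
  assumes "minimizers J A = {f}"
  shows "f \<in> A" and "g \<in> A \<Longrightarrow> (J f :: real) \<le> J g" and "g \<in> A \<Longrightarrow> J g \<le> J f \<Longrightarrow> g = f"
proof -
  have f: "f \<in> minimizers J A" using assms by simp
  then show "f \<in> A" and le: "g \<in> A \<Longrightarrow> J f \<le> J g" for g by (simp_all add: minimizers_iff)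
  assume g: "g \<in> A" "J g \<le> J f"
  have "J g \<le> J z" if "z \<in> A" for z using g(2) le[OF that] by (rule order_trans)
  then have "g \<in> minimizers J A" using g(1) by (simp add: minimizers_iff)
  then show "g = f" using assms by simp
qed

context seasonal_op
begin

text \<open>Otherwise the invertible map \<open>Binv\<close> would annihilate the constant
  1.\<close>

lemma gain_nonzero: "gain \<noteq> 0"
proof
  assume "gain = 0"
  then have "Binv (\<lambda>_. 1) = (\<lambda>_. 0)" using Binv_const[of 1] by simp
  then have "B (\<lambda>_. 0) = (\<lambda>_. 1)" using B_Binv[of "\<lambda>_. 1"] by (simp add: periodic1_def smooth_const)
  then show False using lsi_map_zero[OF B] by (simp add: fun_eq_iff)
qed

end

context seasonal_trend
begin

text \<open>The conditions on \<open>w\<close> and \<open>a\<close> say precisely that the seasonal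
  part lies in the measurement space, which has mean zero when \<open>N1 > 0\<close>.\<close>

lemma weak_star_coord:
  assumes lim: "limitin (native_weak_star N1 \<theta> L1 N2 L2) fs f F" and fs: "\<And>i. fs i \<in> NS" and f: "f \<in> NS"
    and g: "g \<in> Y0" and w: "w \<in> YT" and a: "N2 = 0 \<Longrightarrow> a = 0"
    and m: "N1 > 0 \<Longrightarrow> mean (meas_elem_T L2 w a) = 0"
  shows "((\<lambda>i. coord g b w a (fs i)) \<longlongrightarrow> coord g b w a f) F"
proof (rule topological_tendstoI)
  fix U :: "real set" assume U: "open U" "coord g b w a f \<in> U"
  let ?p = "(meas_elem_R N1 \<theta> L1 g b, meas_elem_T L2 w a)"
  have eq: "pairing_R N1 \<theta> L1 (fst z) (fst ?p) + pairing_T N2 L2 (snd z) (snd ?p) = coord g b w a z" if "z \<in> NS" for z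
    unfolding fst_conv snd_conv coord_def T.pairing_R_eq[OF g] using S.pairing_T_eq[OF w _ nativeD(2)[OF that]] a by simp
  have "?p \<in> predual N1 \<theta> L1 N2 L2"
    unfolding predual_def predual_T0_def predual_T_def predual_R_def using g w a m by auto
  then have "openin (native_weak_star N1 \<theta> L1 N2 L2)
      {z \<in> NS. pairing_R N1 \<theta> L1 (fst z) (fst ?p) + pairing_T N2 L2 (snd z) (snd ?p) \<in> U}"
    unfolding native_weak_star_def using U(1) by (intro topology_generated_by_Basis) blast
  moreover have "f \<in> {z \<in> NS. pairing_R N1 \<theta> L1 (fst z) (fst ?p) + pairing_T N2 L2 (snd z) (snd ?p) \<in> U}"
    using f U(2) eq[OF f] by simp
  ultimately have "\<forall>\<^sub>F i in F. fs i \<in> {z \<in> NS. pairing_R N1 \<theta> L1 (fst z) (fst ?p) + pairing_T N2 L2 (snd z) (snd ?p) \<in> U}"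
    using lim unfolding limitin_def by blast
  then show "\<forall>\<^sub>F i in F. coord g b w a (fs i) \<in> U"
    by (rule eventually_mono) (use eq[OF fs] in auto)
qed

text \<open>Each coordinate is isolated by a measurement in which the other weights vanish. Only the
  seasonal measure for \<open>N1 > 0\<close> resists, as there just mean-zero measurements may be
  used.\<close>

lemma weak_star_limits:
  assumes lim: "limitin (native_weak_star N1 \<theta> L1 N2 L2) fs f F" and fs: "\<And>i. fs i \<in> NS" and f: "f \<in> NS"
  shows "g \<in> Y0 \<Longrightarrow> ((\<lambda>i. mu (fs i) g) \<longlongrightarrow> mu f g) F"
    and "w \<in> YT \<Longrightarrow> ((\<lambda>i. nu (fs i) w) \<longlongrightarrow> nu f w) F"
    and "n \<in> {1..N1} \<Longrightarrow> ((\<lambda>i. fst (fs i) (\<theta> n)) \<longlongrightarrow> fst f (\<theta> n)) F"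
    and "((\<lambda>i. mn (fs i)) \<longlongrightarrow> mn f) F"
proof -
  note coord = weak_star_coord[OF lim fs f]
  have z: "(\<lambda>_. 0) \<in> Y0" "(\<lambda>_. 0) \<in> YT" "mean (meas_elem_T L2 (\<lambda>_. 0) 0) = 0"
    using C0R.zero_mem CT.zero_mem S.mean_meas_elem_T[OF CT.zero_mem, of 0] by auto
  have mu0: "mu z (\<lambda>_. 0) = 0" and nu0: "nu z (\<lambda>_. 0) = 0" if "z \<in> NS" for z
    using C0R.dual_zero CT.dual_zero native_dual[OF that] by auto
  show "((\<lambda>i. mu (fs i) g) \<longlongrightarrow> mu f g) F" if "g \<in> Y0"
    using coord[OF that z(2) _ z(3), of "\<lambda>_. 0"] by (simp add: coord_def nu0[OF fs] nu0[OF f])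
  show "((\<lambda>i. fst (fs i) (\<theta> n)) \<longlongrightarrow> fst f (\<theta> n)) F" if n: "n \<in> {1..N1}"
    using coord[OF z(1,2) _ z(3), of "\<lambda>j. if j = n then 1 else 0"] n
    by (simp add: coord_def mu0[OF fs] mu0[OF f] nu0[OF fs] nu0[OF f] if_distrib[of "\<lambda>x. x * _"] sum.delta cong: if_cong)
  show nuT: "((\<lambda>i. nu (fs i) w) \<longlongrightarrow> nu f w) F" if w: "w \<in> YT" for w
  proof (cases "N1 = 0")
    case True
    then have "((\<lambda>i. coord (\<lambda>_. 0) (\<lambda>_. 0) w 0 (fs i)) \<longlongrightarrow> coord (\<lambda>_. 0) (\<lambda>_. 0) w 0 f) F"
      by (intro coord z(1) w) simp_all
    then show ?thesis by (simp add: coord_def mu0[OF fs] mu0[OF f])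
  next
    case False
    \<comment> \<open>Removing the mean of \<open>w\<close> makes the measurement admissible and
      leaves its value unchanged: for \<open>N1 > 0\<close> the seasonal mean is 0, so the seasonal
      measure annihilates constants, for \<open>N2 = 0\<close> because \<open>gain\<close> is
      nonzero.\<close>
    let ?w = "\<lambda>t. w t - integral {0..1} w * (1 :: real)"
    have c: "(\<lambda>_. 1) \<in> YT" "(\<lambda>t. integral {0..1} w * 1) \<in> YT" using YT_const by auto
    have w': "?w \<in> YT" by (rule CT.diff_mem[OF w c(2)])
    have "w integrable_on {0..1}" using YT_continuous[OF w] by (rule integrable_continuous_real)
    then have "integral {0..1} ?w = 0"
      by (subst Henstock_Kurzweil_Integration.integral_diff) (auto simp: integrable_on_const)
    then have "mean (meas_elem_T L2 ?w 0) = 0" using S.mean_meas_elem_T[OF w', of 0] by simp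
    moreover have "nu g ?w = nu g w" if g: "g \<in> NS" for g
    proof -
      have "nu g (\<lambda>_. 1) = 0"
        using nu_one[OF g] mn_eq[OF g] nativeD(3)[OF g] S.gain_nonzero False by (cases "N2 = 0") auto
      then show ?thesis
        using CT.dual_diff[OF native_dual(2)[OF g] w c(2)] CT.dual_scale[OF native_dual(2)[OF g] c(1), of "integral {0..1} w"] by simp
    qed
    ultimately show ?thesis
      using coord[OF z(1) w', of 0 "\<lambda>_. 0"] fs f by (simp only: coord_def mu0[OF fs] mu0[OF f]) simp
  qed
  show "((\<lambda>i. mn (fs i)) \<longlongrightarrow> mn f) F"
  proof (cases "N1 = 0")
    case N1: True
    show ?thesis
    proof (cases "N2 = 0")
      case True
      show ?thesis unfolding mn_eq[OF fs True] mn_eq[OF f True] by (intro tendsto_mult_left nuT YT_const)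
    next
      case False
      then have "((\<lambda>i. coord (\<lambda>_. 0) (\<lambda>_. 0) (\<lambda>_. 0) 1 (fs i)) \<longlongrightarrow> coord (\<lambda>_. 0) (\<lambda>_. 0) (\<lambda>_. 0) 1 f) F"
        using N1 by (intro coord z(1,2)) simp_all
      then show ?thesis by (simp add: coord_def mu0[OF fs] mu0[OF f] nu0[OF fs] nu0[OF f])
    qed
  next
    case False
    then show ?thesis using nativeD(3)[OF fs] nativeD(3)[OF f] by simp
  qed
qed

text \<open>The norms bound the part of each measurement that comes from the measures; what remains
  is a linear system in finitely many coordinates, and uniqueness of the minimizer makes it
  injective.\<close>

lemma unique_minimizer_bounded:
  assumes V: "minimizers J NS = {f}"
  shows "\<exists>Q. \<forall>g\<in>NS. dual_norm C0R (mu g) \<le> Ka \<longrightarrow> dual_norm CT (nu g) \<le> Kb \<longrightarrow> norm (sns g) \<le> Kc \<longrightarrow>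
    (\<forall>n\<in>{1..N1}. \<bar>fst g (\<theta> n)\<bar> \<le> Q) \<and> (N1 = 0 \<and> N2 > 0 \<longrightarrow> \<bar>mn g\<bar> \<le> Q)"
proof -
  have f: "f \<in> NS" by (rule unique_minimizerD(1)[OF V])
  \<comment> \<open>Index 0 stands for the seasonal mean, which is a free coordinate only if the
    trend does not absorb constants and the measure does not determine it.\<close>
  define K where "K = {1..N1} \<union> (if N1 = 0 \<and> N2 > 0 then {0} else {})"
  define C where "C l j = (if j = 0 then \<alpha> l else c l j)" for l and j :: nat
  define \<zeta> where "\<zeta> g j = (if j = 0 then mn g else fst g (\<theta> j))" for g and j :: nat
  have split: "sns g $ l = mu g (h l) + nu g (k l) + (\<Sum>j\<in>K. C l j * \<zeta> g j)" if g: "g \<in> NS" for g l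
  proof -
    have "(\<Sum>j\<in>K. C l j * \<zeta> g j) = (\<Sum>n=1..N1. C l n * \<zeta> g n) + (if N1 = 0 \<and> N2 > 0 then C l 0 * \<zeta> g 0 else 0)"
      unfolding K_def by (subst sum.union_disjoint) auto
    also have "(\<Sum>n=1..N1. C l n * \<zeta> g n) = (\<Sum>n=1..N1. c l n * fst g (\<theta> n))"
      by (intro sum.cong refl) (simp add: C_def \<zeta>_def)
    also have "(if N1 = 0 \<and> N2 > 0 then C l 0 * \<zeta> g 0 else 0) = \<alpha> l * mn g"
      using \<alpha>[of l] nativeD(3)[OF g] by (auto simp: C_def \<zeta>_def)
    finally show ?thesis unfolding sense_eq[OF g] coord_def by simp
  qed
  have inj: "\<forall>j\<in>K. z j = 0" if z: "\<And>l. (\<Sum>j\<in>K. C l j * z j) = 0" for z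
  proof -
    \<comment> \<open>The kernel vector \<open>z\<close> is added to the free coordinates of the
      minimizer. The measures, hence both norms, and the measurements stay the same, so the
      objective does too.\<close>
    define m where "m = (if N1 = 0 \<and> N2 > 0 then mn f + z 0 else mn f)"
    have "\<exists>g\<in>NS. mu g = mu f \<and> nu g = nu f \<and> mn g = m \<and> (\<forall>n\<in>{1..N1}. fst g (\<theta> n) = fst f (\<theta> n) + z n)"
      by (rule realization[OF native_dual[OF f]]) (use nu_one[OF f] mn_eq[OF f] nativeD(3)[OF f] in \<open>auto simp: m_def\<close>)
    then obtain g where g: "g \<in> NS" "mu g = mu f" "nu g = nu f" "mn g = m" "\<And>n. n \<in> {1..N1} \<Longrightarrow> fst g (\<theta> n) = fst f (\<theta> n) + z n"
      by blast
    have \<zeta>g: "\<zeta> g j = \<zeta> f j + z j" if "j \<in> K" for j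
      using that g(4,5) by (auto simp: \<zeta>_def K_def m_def split: if_splits)
    have "(\<Sum>j\<in>K. C l j * \<zeta> g j) = (\<Sum>j\<in>K. C l j * \<zeta> f j) + (\<Sum>j\<in>K. C l j * z j)" for l
      unfolding sum.distrib[symmetric] by (intro sum.cong refl) (simp add: \<zeta>g distrib_left)
    then have "sns g = sns f" unfolding vec_eq_iff split[OF g(1)] split[OF f] g(2,3) z by simp
    then have "J g \<le> J f" unfolding objective_eq g(2,3) by simp
    then have "g = f" by (rule unique_minimizerD(3)[OF V g(1)])
    then show ?thesis using \<zeta>g by auto
  qed
  obtain H where H: "\<And>l t. \<bar>h l t\<bar> \<le> H l" using C0R.bounded_mem[OF h] by metis
  obtain H' where H': "\<And>l t. \<bar>k l t\<bar> \<le> H' l" using CT.bounded_mem[OF k] by metis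
  have H0: "0 \<le> H l" "0 \<le> H' l" for l using order_trans[OF abs_ge_zero H] order_trans[OF abs_ge_zero H'] by simp_all
  have "finite K" by (simp add: K_def)
  \<comment> \<open>The right-hand side of row \<open>l\<close> is the measurement minus its two
    measure terms, bounded by \<open>Kc\<close>, \<open>Ka * H l\<close> and
    \<open>Kb * H' l\<close>.\<close>
  from injective_coefficients_bound[OF this inj, where R = "\<lambda>l. Kc + Ka * H l + Kb * H' l"]
  obtain Q where Q: "\<And>z. (\<And>l. \<bar>\<Sum>j\<in>K. C l j * z j\<bar> \<le> Kc + Ka * H l + Kb * H' l) \<Longrightarrow> \<forall>j\<in>K. \<bar>z j\<bar> \<le> Q" by blast
  show ?thesis
  proof (intro exI[of _ Q] ballI impI)
    fix g assume g: "g \<in> NS" and b: "dual_norm C0R (mu g) \<le> Ka" "dual_norm CT (nu g) \<le> Kb" "norm (sns g) \<le> Kc"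
    have "\<bar>\<Sum>j\<in>K. C l j * \<zeta> g j\<bar> \<le> Kc + Ka * H l + Kb * H' l" for l
    proof -
      have "\<bar>mu g (h l)\<bar> \<le> Ka * H l"
        using C0R.dual_norm_upper[OF native_dual(1)[OF g] h H] mult_right_mono[OF b(1) H0(1)] by (rule order_trans)
      moreover have "\<bar>nu g (k l)\<bar> \<le> Kb * H' l"
        using CT.dual_norm_upper[OF native_dual(2)[OF g] k H'] mult_right_mono[OF b(2) H0(2)] by (rule order_trans)
      moreover have "\<bar>sns g $ l\<bar> \<le> Kc" using component_le_norm_cart[of "sns g" l] b(3) by (rule order_trans)
      ultimately show ?thesis using split[OF g, of l] by linarith
    qed
    from Q[OF this] have \<zeta>: "\<bar>\<zeta> g j\<bar> \<le> Q" if "j \<in> K" for j using that by blast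
    show "(\<forall>n\<in>{1..N1}. \<bar>fst g (\<theta> n)\<bar> \<le> Q) \<and> (N1 = 0 \<and> N2 > 0 \<longrightarrow> \<bar>mn g\<bar> \<le> Q)"
    proof (intro conjI ballI impI)
      fix n assume "n \<in> {1..N1}"
      then show "\<bar>fst g (\<theta> n)\<bar> \<le> Q" using \<zeta>[of n] by (simp add: K_def \<zeta>_def)
    next
      assume "N1 = 0 \<and> N2 > 0"
      then show "\<bar>mn g\<bar> \<le> Q" using \<zeta>[of 0] by (simp add: K_def \<zeta>_def)
    qed
  qed
qed

context
  fixes hT hS :: "nat \<Rightarrow> real" and fs :: "nat \<Rightarrow> gfun \<times> gfun"
  assumes hT: "\<And>n. hT n > 0" "hT \<longlonglongrightarrow> 0" and hS: "\<And>n. hS n > 0" "hS \<longlonglongrightarrow> 0" "\<And>n. 1 / hS n \<in> \<nat>"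
    and fs: "\<And>n. fs n \<in> minimizers J (grid (hT n) (hS n))"
begin

lemmas bounds = minimizer_bounds[OF fs hT(1) hS(1,3)]

text \<open>Competitors on the grid are the discretizations of \<open>f\<close>. Their norms are
  only known not to exceed those of \<open>f\<close>, so the majorant \<open>u\<close> uses the
  norms of \<open>f\<close> itself and converges because the data term does.\<close>

lemma recovery:
  assumes f: "f \<in> NS" and G: "G \<le> sequentially"
  shows "\<exists>u. (u \<longlongrightarrow> J f) G \<and> (\<forall>n. J (fs n) \<le> u n)"
proof -
  note d = native_dual[OF f]
  have "\<exists>g. \<forall>n. g n \<in> grid (hT n) (hS n) \<and> mu (g n) = C0R.discretize (hT n) (mu f) \<and>
      nu (g n) = CT.discretize (hS n) (nu f) \<and> mn (g n) = mn f \<and> (\<forall>j\<in>{1..N1}. fst (g n) (\<theta> j) = fst f (\<theta> j))"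
    by (rule choice, rule allI) (use discretization[OF f hT(1) hS(1,3)] in blast)
  then obtain g where g: "\<And>n. g n \<in> grid (hT n) (hS n)" "\<And>n. mu (g n) = C0R.discretize (hT n) (mu f)"
      "\<And>n. nu (g n) = CT.discretize (hS n) (nu f)" "\<And>n. mn (g n) = mn f" "\<And>n j. j \<in> {1..N1} \<Longrightarrow> fst (g n) (\<theta> j) = fst f (\<theta> j)"
    by blast
  have gN: "g n \<in> NS" for n using g(1)[of n] by (simp add: native_grid_def)
  have "((\<lambda>n. (norm (y - sns (g n)))\<^sup>2) \<longlongrightarrow> (norm (y - sns f))\<^sup>2) sequentially"
  proof (rule sense_tendsto[OF gN f])
    show "((\<lambda>n. mu (g n) \<phi>) \<longlongrightarrow> mu f \<phi>) sequentially" if "\<phi> \<in> Y0" for \<phi>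
      unfolding g(2) by (rule C0R.discretize_tendsto[OF d(1) interpolant_Y0[OF hT(1)] hT that])
    show "((\<lambda>n. nu (g n) \<phi>) \<longlongrightarrow> nu f \<phi>) sequentially" if "\<phi> \<in> YT" for \<phi>
      unfolding g(3) by (rule CT.discretize_tendsto[OF d(2) interpolant_YT[OF hS(1,3)] hS(1,2) that])
    show "((\<lambda>n. fst (g n) (\<theta> j)) \<longlongrightarrow> fst f (\<theta> j)) sequentially" if "j \<in> {1..N1}" for j
      unfolding g(5)[OF that] by (rule tendsto_const)
    show "((\<lambda>n. mn (g n)) \<longlongrightarrow> mn f) sequentially" unfolding g(4) by (rule tendsto_const)
  qed
  then have "((\<lambda>n. (norm (y - sns (g n)))\<^sup>2 + lT * dual_norm C0R (mu f) + lS * dual_norm CT (nu f)) \<longlongrightarrow> J f) G"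
    unfolding objective_eq by (intro tendsto_add tendsto_const tendsto_mono[OF G])
  moreover have "J (fs n) \<le> (norm (y - sns (g n)))\<^sup>2 + lT * dual_norm C0R (mu f) + lS * dual_norm CT (nu f)" for n
  proof -
    have "J (fs n) \<le> J (g n)" using fs[of n] g(1)[of n] by (simp add: minimizers_iff)
    moreover have "lT * dual_norm C0R (mu (g n)) \<le> lT * dual_norm C0R (mu f)"
      unfolding g(2) using C0R.discretize_norm[OF d(1) interpolant_Y0[OF hT(1)]] lT by (intro mult_left_mono) auto
    moreover have "lS * dual_norm CT (nu (g n)) \<le> lS * dual_norm CT (nu f)"
      unfolding g(3) using CT.discretize_norm[OF d(2) interpolant_YT[OF hS(1,3)]] lS by (intro mult_left_mono) auto
    ultimately show ?thesis unfolding objective_eq[of "g n"] by linarith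
  qed
  ultimately show ?thesis by blast
qed

text \<open>Along a filter on which all bounded quantities converge, the limits satisfy the
  compatibility conditions and define some \<open>f0\<close> of the native space; \<open>f0\<close>
  is shown to be no worse than \<open>f\<close>, and so equals it.\<close>

lemma unique_limits:
  assumes V: "minimizers J NS = {f}" and F: "F \<le> sequentially" "F \<noteq> bot"
  shows "\<exists>G\<le>F. G \<noteq> bot \<and> (\<forall>g\<in>Y0. ((\<lambda>i. mu (fs i) g) \<longlongrightarrow> mu f g) G) \<and> (\<forall>w\<in>YT. ((\<lambda>i. nu (fs i) w) \<longlongrightarrow> nu f w) G)
    \<and> (\<forall>n\<in>{1..N1}. ((\<lambda>i. fst (fs i) (\<theta> n)) \<longlongrightarrow> fst f (\<theta> n)) G) \<and> ((\<lambda>i. mn (fs i)) \<longlongrightarrow> mn f) G"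
proof -
  have f: "f \<in> NS" by (rule unique_minimizerD(1)[OF V])
  let ?Ka = "(norm y)\<^sup>2 / lT" and ?Kb = "(norm y)\<^sup>2 / lS"
  note d = native_dual[OF bounds(1)]
  obtain Q where Q: "\<And>i n. n \<in> {1..N1} \<Longrightarrow> \<bar>fst (fs i) (\<theta> n)\<bar> \<le> Q" "\<And>i. N1 = 0 \<Longrightarrow> N2 > 0 \<Longrightarrow> \<bar>mn (fs i)\<bar> \<le> Q"
    using unique_minimizer_bounded[OF V, of ?Ka ?Kb "2 * norm y"] bounds by blast
  obtain G where G: "G \<le> F" "G \<noteq> bot" and cl: "\<And>v :: nat \<Rightarrow> real. \<exists>B. \<forall>n. \<bar>v n\<bar> \<le> B \<Longrightarrow> \<exists>l. (v \<longlongrightarrow> l) G"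
    using bounded_cluster[OF F(2)] by metis
  have "\<exists>l. ((\<lambda>i. dual_norm C0R (mu (fs i))) \<longlongrightarrow> l) G"
    by (rule cl, rule exI[of _ ?Ka]) (simp add: abs_of_nonneg[OF C0R.dual_norm_nonneg[OF d(1)]] bounds(2))
  then obtain a where a: "((\<lambda>i. dual_norm C0R (mu (fs i))) \<longlongrightarrow> a) G" by blast
  have "\<exists>l. ((\<lambda>i. dual_norm CT (nu (fs i))) \<longlongrightarrow> l) G"
    by (rule cl, rule exI[of _ ?Kb]) (simp add: abs_of_nonneg[OF CT.dual_norm_nonneg[OF d(2)]] bounds(3))
  then obtain a' where a': "((\<lambda>i. dual_norm CT (nu (fs i))) \<longlongrightarrow> a') G" by blast
  have "\<exists>l. ((\<lambda>i. mu (fs i) g) \<longlongrightarrow> l) G" if g: "g \<in> Y0" for g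
  proof -
    obtain B where B: "\<And>t. \<bar>g t\<bar> \<le> B" using C0R.bounded_mem[OF g] by blast
    have "0 \<le> B" using B[of 0] by linarith
    have "\<bar>mu (fs i) g\<bar> \<le> ?Ka * B" for i
      using C0R.dual_norm_upper[OF d(1) g B] mult_right_mono[OF bounds(2) \<open>0 \<le> B\<close>] by (rule order_trans)
    then show ?thesis by (intro cl exI allI)
  qed
  from C0R.limit_functional[OF G(2) d(1) this a]
  obtain \<mu> where \<mu>: "\<mu> \<in> dual C0R" "dual_norm C0R \<mu> \<le> a" "\<And>g. g \<in> Y0 \<Longrightarrow> ((\<lambda>i. mu (fs i) g) \<longlongrightarrow> \<mu> g) G" by blast
  have "\<exists>l. ((\<lambda>i. nu (fs i) w) \<longlongrightarrow> l) G" if w: "w \<in> YT" for w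
  proof -
    obtain B where B: "\<And>t. \<bar>w t\<bar> \<le> B" using CT.bounded_mem[OF w] by blast
    have "0 \<le> B" using B[of 0] by linarith
    have "\<bar>nu (fs i) w\<bar> \<le> ?Kb * B" for i
      using CT.dual_norm_upper[OF d(2) w B] mult_right_mono[OF bounds(3) \<open>0 \<le> B\<close>] by (rule order_trans)
    then show ?thesis by (intro cl exI allI)
  qed
  from CT.limit_functional[OF G(2) d(2) this a']
  obtain \<nu> where \<nu>: "\<nu> \<in> dual CT" "dual_norm CT \<nu> \<le> a'" "\<And>w. w \<in> YT \<Longrightarrow> ((\<lambda>i. nu (fs i) w) \<longlongrightarrow> \<nu> w) G" by blast
  have "\<exists>l. ((\<lambda>i. fst (fs i) (\<theta> n)) \<longlongrightarrow> l) G" if "n \<in> {1..N1}" for n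
    using Q(1)[OF that] by (intro cl exI allI)
  then obtain b where b: "\<And>n. n \<in> {1..N1} \<Longrightarrow> ((\<lambda>i. fst (fs i) (\<theta> n)) \<longlongrightarrow> b n) G" by metis
  note one = \<nu>(3)[OF YT_const[of 1]]
  have "\<exists>l. ((\<lambda>i. mn (fs i)) \<longlongrightarrow> l) G"
  proof -
    consider "N1 > 0" | "N1 = 0" "N2 > 0" | "N2 = 0" by blast
    then show ?thesis
    proof cases
      case 1
      then show ?thesis using nativeD(3)[OF bounds(1)] by auto
    next
      case 2
      then show ?thesis using Q(2) by (intro cl exI allI)
    next
      case 3
      show ?thesis unfolding mn_eq[OF bounds(1) 3] using tendsto_mult_left[OF one] by blast
    qed
  qed
  then obtain m where m: "((\<lambda>i. mn (fs i)) \<longlongrightarrow> m) G" by blast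
  \<comment> \<open>The compatibility conditions are closed under limits; this and the next two
    facts are what \<open>realization\<close> demands.\<close>
  have "\<nu> (\<lambda>_. 1) = 0" if N2: "N2 > 0"
    using tendsto_unique[OF G(2) one[unfolded nu_one[OF bounds(1) N2]] tendsto_const] .
  moreover have "m = S.gain * \<nu> (\<lambda>_. 1)" if N2: "N2 = 0"
    using tendsto_unique[OF G(2) m[unfolded mn_eq[OF bounds(1) N2]] tendsto_mult_left[OF one]] .
  moreover have "m = 0" if N1: "N1 > 0"
    using tendsto_unique[OF G(2) m[unfolded nativeD(3)[OF bounds(1) N1]] tendsto_const] .
  ultimately obtain f0 where f0: "f0 \<in> NS" "mu f0 = \<mu>" "nu f0 = \<nu>" "mn f0 = m" "\<forall>n\<in>{1..N1}. fst f0 (\<theta> n) = b n"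
    using realization[OF \<mu>(1) \<nu>(1), of m b] by blast
  have lim: "g \<in> Y0 \<Longrightarrow> ((\<lambda>i. mu (fs i) g) \<longlongrightarrow> mu f0 g) G" "w \<in> YT \<Longrightarrow> ((\<lambda>i. nu (fs i) w) \<longlongrightarrow> nu f0 w) G"
      "n \<in> {1..N1} \<Longrightarrow> ((\<lambda>i. fst (fs i) (\<theta> n)) \<longlongrightarrow> fst f0 (\<theta> n)) G" "((\<lambda>i. mn (fs i)) \<longlongrightarrow> mn f0) G" for g w n
    using \<mu>(3) \<nu>(3) b m f0 by auto
  \<comment> \<open>The data term is continuous, whereas the norms converge to \<open>a\<close> and
    \<open>a'\<close>, which only dominate the norms of the limit measures; that is the inequality
    wanted.\<close>
  have "((\<lambda>i. J (fs i)) \<longlongrightarrow> (norm (y - sns f0))\<^sup>2 + lT * a + lS * a') G"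
    unfolding objective_eq by (intro tendsto_add tendsto_mult_left a a' sense_tendsto[OF bounds(1) f0(1) lim])
  moreover obtain u where u: "(u \<longlongrightarrow> J f) G" "\<And>n. J (fs n) \<le> u n"
    using recovery[OF f order_trans[OF G(1) F(1)]] by blast
  ultimately have "(norm (y - sns f0))\<^sup>2 + lT * a + lS * a' \<le> J f"
    by (intro tendsto_le[OF G(2) u(1)] always_eventually allI u(2))
  moreover have "J f0 \<le> (norm (y - sns f0))\<^sup>2 + lT * a + lS * a'"
    unfolding objective_eq f0(2,3) using \<mu>(2) \<nu>(2) lT lS by (intro add_mono mult_left_mono order_refl) auto
  ultimately have "J f0 \<le> J f" by linarith
  then have "f0 = f" by (rule unique_minimizerD(3)[OF V f0(1)])
  then show ?thesis using lim G by blast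
qed

context
  fixes w :: gfun
  assumes d: "dirac SR 0 \<in> predual_R N1 \<theta> L1" and w: "periodic_greens_function N2 L2 w" "lipschitz_periodic_gfun w"
begin

lemma weak_star_unif_lim:
  assumes f: "f \<in> NS" and lim: "limitin (native_weak_star N1 \<theta> L1 N2 L2) (\<lambda>n. fs (\<psi> n)) f sequentially"
  shows "unif_lim sequentially (\<lambda>n. value_R N1 \<theta> L1 (fst (fs (\<psi> n)))) (value_R N1 \<theta> L1 (fst f)) {- r..r}"
    and "unif_lim sequentially (\<lambda>n. value_T N2 L2 (snd (fs (\<psi> n)))) (value_T N2 L2 (snd f)) UNIV"
  by (rule unif_lim_native[OF bounds(1) f bounds(2,3) weak_star_limits[OF lim bounds(1) f] d w], assumption+)+

text \<open>Every nontrivial filter finer than \<open>sequentially\<close> has a refinement along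
  which the coordinates, and hence the point values uniformly, converge to those of the one
  minimizer; so the whole sequence converges.\<close>

lemma unique_unif_lim:
  assumes V: "minimizers J NS = {f}"
  shows "unif_lim sequentially (\<lambda>n. value_R N1 \<theta> L1 (fst (fs n))) (value_R N1 \<theta> L1 (fst f)) {- r..r}"
    and "unif_lim sequentially (\<lambda>n. value_T N2 L2 (snd (fs n))) (value_T N2 L2 (snd f)) UNIV"
proof -
  have f: "f \<in> NS" by (rule unique_minimizerD(1)[OF V])
  have "\<exists>G\<le>F. G \<noteq> bot \<and> unif_lim G (\<lambda>n. value_R N1 \<theta> L1 (fst (fs n))) (value_R N1 \<theta> L1 (fst f)) {- r..r} \<and>
      unif_lim G (\<lambda>n. value_T N2 L2 (snd (fs n))) (value_T N2 L2 (snd f)) UNIV" if F: "F \<le> sequentially" "F \<noteq> bot" for F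
  proof -
    obtain G where G: "G \<le> F" "G \<noteq> bot" and lim: "\<And>g. g \<in> Y0 \<Longrightarrow> ((\<lambda>i. mu (fs i) g) \<longlongrightarrow> mu f g) G" "\<And>w. w \<in> YT \<Longrightarrow> ((\<lambda>i. nu (fs i) w) \<longlongrightarrow> nu f w) G"
      "\<And>n. n \<in> {1..N1} \<Longrightarrow> ((\<lambda>i. fst (fs i) (\<theta> n)) \<longlongrightarrow> fst f (\<theta> n)) G" "((\<lambda>i. mn (fs i)) \<longlongrightarrow> mn f) G"
      using unique_limits[OF V F] by blast
    show ?thesis using G unif_lim_native[OF bounds(1) f bounds(2,3) lim d w] by blast
  qed
  then show "unif_lim sequentially (\<lambda>n. value_R N1 \<theta> L1 (fst (fs n))) (value_R N1 \<theta> L1 (fst f)) {- r..r}"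
    and "unif_lim sequentially (\<lambda>n. value_T N2 L2 (snd (fs n))) (value_T N2 L2 (snd f)) UNIV"
    unfolding unif_lim_def by (intro allI impI eventually_subfilterI, blast)+
qed

end
end
end

theorem theorem3:
  fixes y :: "real ^ 'l::finite"
    and \<Phi> :: "'l \<Rightarrow> gfun"
    and L\<^sub>T L\<^sub>S :: "gfun \<Rightarrow> gfun"
    and N\<^sub>T N\<^sub>S :: nat
    and \<theta> :: "nat \<Rightarrow> real \<Rightarrow> real"
    and lam\<^sub>T lam\<^sub>S :: real
    and h\<^sub>T h\<^sub>S :: "nat \<Rightarrow> real"
    and f :: "nat \<Rightarrow> gfun \<times> gfun"
  defines "J \<equiv> objective N\<^sub>T \<theta> L\<^sub>T N\<^sub>S L\<^sub>S y \<Phi> lam\<^sub>T lam\<^sub>S"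
  defines "V \<equiv> minimizers J (native N\<^sub>T L\<^sub>T L\<^sub>S)"
  assumes "trend_admissible N\<^sub>T L\<^sub>T" and "seasonal_admissible N\<^sub>S L\<^sub>S"
    and "biorthogonal_moments N\<^sub>T \<theta>"
    and "lam\<^sub>T > 0" and "lam\<^sub>S > 0"
    and "\<And>l. sensing_admissible N\<^sub>T \<theta> L\<^sub>T N\<^sub>S L\<^sub>S (\<Phi> l)"
    and "\<And>p :: real poly. L\<^sub>T (regular_R (poly p)) = (\<lambda>\<phi>\<in>topspace SR. 0) \<Longrightarrow>
           sense N\<^sub>T \<theta> L\<^sub>T N\<^sub>S L\<^sub>S \<Phi> (regular_R (poly p), \<lambda>\<phi>\<in>topspace ST. 0) = 0 \<Longrightarrow> p = 0"
    and "sampling_admissible N\<^sub>T \<theta> L\<^sub>T N\<^sub>S L\<^sub>S"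
    and "\<exists>w. greens_function L\<^sub>T w \<and> locally_lipschitz_gfun w"
    and "\<exists>w. periodic_greens_function N\<^sub>S L\<^sub>S w \<and> lipschitz_periodic_gfun w"
    and "\<And>n. h\<^sub>T n > 0" and "\<And>n. h\<^sub>S n > 0" and "\<And>n. 1 / h\<^sub>S n \<in> \<nat>"
    and "(\<lambda>n. (h\<^sub>T n, h\<^sub>S n)) \<longlonglongrightarrow> (0, 0)"
    and "\<And>n. f n \<in> minimizers J (native_grid N\<^sub>T L\<^sub>T L\<^sub>S (h\<^sub>T n) (h\<^sub>S n))"
  shows "(\<forall>f\<^sub>T f\<^sub>S \<psi>. (f\<^sub>T, f\<^sub>S) \<in> V \<longrightarrow> strict_mono (\<psi> :: nat \<Rightarrow> nat) \<longrightarrow>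
            limitin (native_weak_star N\<^sub>T \<theta> L\<^sub>T N\<^sub>S L\<^sub>S) (\<lambda>n. f (\<psi> n)) (f\<^sub>T, f\<^sub>S) sequentially \<longrightarrow>
            (\<forall>a b. (\<lambda>n. SUP t\<in>{a..b}. ennreal \<bar>value_R N\<^sub>T \<theta> L\<^sub>T (fst (f (\<psi> n))) t - value_R N\<^sub>T \<theta> L\<^sub>T f\<^sub>T t\<bar>)
                     \<longlonglongrightarrow> 0) \<and>
            (\<lambda>n. SUP t. ennreal \<bar>value_T N\<^sub>S L\<^sub>S (snd (f (\<psi> n))) t - value_T N\<^sub>S L\<^sub>S f\<^sub>S t\<bar>) \<longlonglongrightarrow> 0) \<and>
         (\<forall>f\<^sub>T f\<^sub>S. V = {(f\<^sub>T, f\<^sub>S)} \<longrightarrow>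
            (\<forall>a b. (\<lambda>n. SUP t\<in>{a..b}. ennreal \<bar>value_R N\<^sub>T \<theta> L\<^sub>T (fst (f n)) t - value_R N\<^sub>T \<theta> L\<^sub>T f\<^sub>T t\<bar>)
                     \<longlonglongrightarrow> 0) \<and>
            (\<lambda>n. SUP t. ennreal \<bar>value_T N\<^sub>S L\<^sub>S (snd (f n)) t - value_T N\<^sub>S L\<^sub>S f\<^sub>S t\<bar>) \<longlonglongrightarrow> 0)"
proof -
  have adm: "trend_admissible N\<^sub>T L\<^sub>T" "seasonal_admissible N\<^sub>S L\<^sub>S" "biorthogonal_moments N\<^sub>T \<theta>" "lam\<^sub>T > 0" "lam\<^sub>S > 0"
    and sens: "\<And>l. sensing_admissible N\<^sub>T \<theta> L\<^sub>T N\<^sub>S L\<^sub>S (\<Phi> l)" and samp: "sampling_admissible N\<^sub>T \<theta> L\<^sub>T N\<^sub>S L\<^sub>S"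
    and h: "\<And>n. h\<^sub>T n > 0" "\<And>n. h\<^sub>S n > 0" "\<And>n. 1 / h\<^sub>S n \<in> \<nat>" "(\<lambda>n. (h\<^sub>T n, h\<^sub>S n)) \<longlonglongrightarrow> (0, 0)"
    and f: "\<And>n. f n \<in> minimizers J (native_grid N\<^sub>T L\<^sub>T L\<^sub>S (h\<^sub>T n) (h\<^sub>S n))"
    by fact+
  obtain w where w: "periodic_greens_function N\<^sub>S L\<^sub>S w" "lipschitz_periodic_gfun w"
    using \<open>\<exists>w. periodic_greens_function N\<^sub>S L\<^sub>S w \<and> lipschitz_periodic_gfun w\<close> by blast
  obtain B1 B1i where B1: "admissible_op SR schwartz UNIV UNIV N\<^sub>T L\<^sub>T B1 B1i"
    using SR.admissible_imp_admissible_op[OF adm(1)] by blast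
  obtain B2 B2i where B2: "admissible_op ST XT {0} {0..1} N\<^sub>S L\<^sub>S B2 B2i"
    using ST.admissible_imp_admissible_op[OF adm(2)] by blast
  have "\<exists>h c. h \<in> Y0 \<and> \<Phi> l = meas_elem_R N\<^sub>T \<theta> L\<^sub>T h c" for l
    using sens[of l] unfolding sensing_admissible_def predual_R_def by auto
  then obtain g c where g: "\<And>l. g l \<in> Y0" "\<And>l. \<Phi> l = meas_elem_R N\<^sub>T \<theta> L\<^sub>T (g l) (c l)" by metis
  have "\<exists>k \<alpha>. k \<in> YT \<and> periodization (\<Phi> l) = meas_elem_T L\<^sub>S k \<alpha> \<and> (N\<^sub>S = 0 \<longrightarrow> \<alpha> = 0)" for l
    using sens[of l] unfolding sensing_admissible_def predual_T_def by auto
  then obtain k \<alpha> where k: "\<And>l. k l \<in> YT" "\<And>l. periodization (\<Phi> l) = meas_elem_T L\<^sub>S (k l) (\<alpha> l)" "\<And>l. N\<^sub>S = 0 \<Longrightarrow> \<alpha> l = 0" by metis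
  interpret P: seasonal_trend N\<^sub>T L\<^sub>T B1 B1i \<theta> N\<^sub>S L\<^sub>S B2 B2i y \<Phi> lam\<^sub>T lam\<^sub>S g k c \<alpha>
    by (intro seasonal_trend.intro seasonal_trend_axioms.intro trend_op.intro trend_op_axioms.intro seasonal_op.intro B1 B2 adm(3-5) g k)
  have lims: "h\<^sub>T \<longlonglongrightarrow> 0" "h\<^sub>S \<longlonglongrightarrow> 0" using tendsto_fst[OF h(4)] tendsto_snd[OF h(4)] by simp_all
  have d: "dirac SR 0 \<in> predual_R N\<^sub>T \<theta> L\<^sub>T" using samp unfolding sampling_admissible_def sensing_admissible_def by blast
  note grid = h(1) lims(1) h(2) lims(2) h(3) f[unfolded J_def] d w
  \<comment> \<open>Trend values are controlled on intervals symmetric about 0, where the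
    antiderivative argument is anchored.\<close>
  have sub: "{a..b} \<subseteq> {- max \<bar>a\<bar> \<bar>b\<bar>..max \<bar>a\<bar> \<bar>b\<bar>}" for a b :: real by auto
  show ?thesis
    unfolding V_def J_def
  proof (intro conjI allI impI)
    fix f\<^sub>T f\<^sub>S and \<psi> :: "nat \<Rightarrow> nat"
    assume "(f\<^sub>T, f\<^sub>S) \<in> minimizers P.J P.NS"
      and lim: "limitin (native_weak_star N\<^sub>T \<theta> L\<^sub>T N\<^sub>S L\<^sub>S) (\<lambda>n. f (\<psi> n)) (f\<^sub>T, f\<^sub>S) sequentially"
    then have "(f\<^sub>T, f\<^sub>S) \<in> P.NS" by (simp add: minimizers_iff)
    note unif = P.weak_star_unif_lim[OF grid this lim, unfolded fst_conv snd_conv]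
    show "(\<lambda>n. SUP t\<in>{a..b}. ennreal \<bar>value_R N\<^sub>T \<theta> L\<^sub>T (fst (f (\<psi> n))) t - value_R N\<^sub>T \<theta> L\<^sub>T f\<^sub>T t\<bar>) \<longlonglongrightarrow> 0" for a b
      by (rule unif_lim_SUP[OF unif(1) sub])
    show "(\<lambda>n. SUP t. ennreal \<bar>value_T N\<^sub>S L\<^sub>S (snd (f (\<psi> n))) t - value_T N\<^sub>S L\<^sub>S f\<^sub>S t\<bar>) \<longlonglongrightarrow> 0"
      by (rule unif_lim_SUP[OF unif(2) order_refl])
  next
    fix f\<^sub>T f\<^sub>S
    assume "minimizers P.J P.NS = {(f\<^sub>T, f\<^sub>S)}"
    note unif = P.unique_unif_lim[OF grid this, unfolded fst_conv snd_conv]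
    show "(\<lambda>n. SUP t\<in>{a..b}. ennreal \<bar>value_R N\<^sub>T \<theta> L\<^sub>T (fst (f n)) t - value_R N\<^sub>T \<theta> L\<^sub>T f\<^sub>T t\<bar>) \<longlonglongrightarrow> 0" for a b
      by (rule unif_lim_SUP[OF unif(1) sub])
    show "(\<lambda>n. SUP t. ennreal \<bar>value_T N\<^sub>S L\<^sub>S (snd (f n)) t - value_T N\<^sub>S L\<^sub>S f\<^sub>S t\<bar>) \<longlonglongrightarrow> 0"
      by (rule unif_lim_SUP[OF unif(2) order_refl])
  qed
qed

end
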